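(* There exist two pairs of sequences of fundamental (invertible) matrix solutions, $(\mathbf\Psi_N(x),\underline{\mathbf\Phi}^{N-1}(x))$ of size $(d_2+1)\times(d_2+1)$ and $(\mathbf\Phi_N(y),\underline{\mathbf\Psi}^{N-1}(y))$ of size $(d_1+1)\times(d_1+1)$, of the difference–differential–deformation equations (i)–(iv) of the context, such that $$\underline{\mathbf\Phi}^{N-1}(x)\,\mathbb A^N\,\mathbf\Psi_N(x)\equiv\mathbf 1,\qquad \underline{\mathbf\Psi}^{N-1}(y)\,\mathbb B^N\,\mathbf\Phi_N(y)\equiv\mathbf 1$$ (identically in $N$, in $x$, resp. $y$, and in the deformation parameters $\{u_K,v_J\}$).
   Context: **Setting.** Fix integers $d_1,d_2\ge1$ and $V_1(x)=\sum_{K=1}^{d_1+1}\frac{u_K}{K}x^K$, $V_2(y)=\sum_{J=1}^{d_2+1}\frac{v_J}{J}y^J$ with $u_{d_1+1}\ne0$, $v_{d_2+1}\ne0$, and contours $\Gamma_x,\Gamma_y$ such that all integrals below converge and integrations by parts produce no boundary terms. Assume there are monic polynomials $\pi_n,\sigma_n$ of degree $n$ ($n\ge0$) with $\int_{\Gamma_x}\int_{\Gamma_y}\pi_n(x)\sigma_m(y)e^{-V_1(x)-V_2(y)+xy}\,dy\,dx=h_n\delta_{nm}$, $h_n\neq0$. The coefficients $u_K,v_J$ are regarded as smoothly varying deformation parameters. Put $\psi_n(x)=\pi_n(x)e^{-V_1(x)}/\sqrt{h_n}$. **Recursion coefficients.** There are unique numbers $\alpha_j(n)$ ($-1\le j\le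 d_2$), $\beta_j(n)$ ($-1\le j\le d_1$), with $\alpha_{-1}(n)=\beta_{-1}(n)=\gamma(n)=\sqrt{h_{n+1}/h_n}$ and $\alpha_j(n)=\beta_j(n)=0$ for $n<j$, such that (terms with negative index omitted) $x\psi_n=\sum_{j=-1}^{d_2}\alpha_j(n)\psi_{n-j}$ and $\partial_x\psi_n=-\sum_{j=-1}^{d_1}\beta_j(n+j)\psi_{n+j}$. Moreover $\alpha_{d_2}(n)\ne0$ ($n\ge d_2$) and $\beta_{d_1}(n)\neq0$ ($n\ge d_1$). Let $Q,P$ be the (finite band) semi-infinite matrices (indices $\ge0$) with $x\psi_n=\sum_mQ_{nm}\psi_m$, $\partial_x\psi_n=\sum_mP_{nm}\psi_m$. **Christoffel–Darboux matrices** (indices from $0$). $\mathbb A^N$ is $(d_2+1)\times(d_2+1)$ with $(\mathbb A^N)_{0,d_2}=-\gamma(N-1)$, $(\mathbb A^N)_{k+1,c}=\alpha_{d_2+k-c}(N+k)$ for $0\le k\le c\le d_2-1$, other entries $0$. $\mathbb B^N$ is $(d_1+1)\times(d_1+1)$ with $(\mathbb B^N)_{0,d_1}=-\gamma(N-1)$, $(\mathbb B^N)_{k+1,c}=\beta_{d_1+k-c}(N+k)$ for $0\le k\le c\le d_1-1$, other entries $0$. **Ladder matrices.** $\mathbf a_N(x)$ ($N\ge d_2$) is the $(d_2+1)\times(d_2+1)$ matrix with $1$'s on the first superdiagonal, last row $\frac1{\gamma(N)}(-\alpha_{d_2}(N),\dots,-\alpha_1(N),x-\alpha_0(N))$, other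 entries $0$; $\mathbf b_N(y)$ ($N\ge d_1$) is the $(d_1+1)\times(d_1+1)$ matrix with $1$'s on the first superdiagonal, last row $\frac1{\gamma(N)}(-\beta_{d_1}(N),\dots,-\beta_1(N),y-\beta_0(N))$, other entries $0$. Write $\mathbf a^N=\mathbf a_N^{-1}$, $\mathbf b^N=\mathbf b_N^{-1}$. $\underline{\mathbf a}^N(x)$ is the $(d_2+1)\times(d_2+1)$ matrix with $1$'s on the first superdiagonal, first column $\frac1{\gamma(N-1)}(x-\alpha_0(N),-\alpha_1(N+1),\dots,-\alpha_{d_2}(N+d_2))^t$, other entries $0$; $\underline{\mathbf b}^N(y)$ is the $(d_1+1)\times(d_1+1)$ matrix with $1$'s on the first superdiagonal, first column $\frac1{\gamma(N-1)}(y-\beta_0(N),-\beta_1(N+1),\dots,-\beta_{d_1}(N+d_1))^t$, other entries $0$. Write $\underline{\mathbf a}_N=(\underline{\mathbf a}^N)^{-1}$, $\underline{\mathbf b}_N=(\underline{\mathbf b}^N)^{-1}$. **Differential matrices.** For $j\ge-1$ put $\beta^N_j=\mathrm{diag}(\beta_j(N+j-d_2),\dots,\beta_j(N+j))$, $\alpha^N_j=\mathrm{diag}(\alpha_j(N+j-d_1),\dots,\alpha_j(N+j))$, $\underline\alpha^N_j=\mathrm{diag}(\alpha_j(N),\dots,\alpha_j(N+d_1))$, $\underline\beta^N_j=\mathrm{diag}(\beta_j(N),\dots,\beta_j(N+d_2))$. Then $D_1^N(x)=\beta^N_{-1}\mathbf a^{N-1}+\beta_0^N+\sum_{j=1}^{d_1}\beta_j^N\mathbf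 a_{N+j-1}\cdots\mathbf a_N$, $D_2^N(y)=\alpha^N_{-1}\mathbf b^{N-1}+\alpha_0^N+\sum_{j=1}^{d_2}\alpha_j^N\mathbf b_{N+j-1}\cdots\mathbf b_N$, $\underline D_2^N(y)=\underline{\mathbf b}_N\underline\alpha_{-1}^{N-1}+\underline\alpha_0^{N-1}+\sum_{j=1}^{d_2}\underline{\mathbf b}^{N-1}\cdots\underline{\mathbf b}^{N-j}\underline\alpha_j^{N-1}$, $\underline D_1^N(x)=\underline{\mathbf a}_N\underline\beta_{-1}^{N-1}+\underline\beta_0^{N-1}+\sum_{j=1}^{d_1}\underline{\mathbf a}^{N-1}\cdots\underline{\mathbf a}^{N-j}\underline\beta_j^{N-1}$. **Deformation matrices.** For $1\le K\le d_1+1$, $1\le J\le d_2+1$: $U^K:=-\frac1K\{(Q^K)_{>0}+\frac12(Q^K)_0\}$, $V^J:=-\frac1J\{((-P^t)^J)_{>0}+\frac12((-P^t)^J)_0\}$ ($>0$: strictly upper triangular part; $0$: diagonal part), $U^K_j(n)=(U^K)_{n,n+j}$, $V^J_j(n)=(V^J)_{n,n+j}$. Write $U^K_j[p;d]=\mathrm{diag}(U^K_j(p),\dots,U^K_j(p+d))$ and similarly $V^J_j[p;d]$. Empty products are $\mathbf 1$. Then $\mathbf U_K^{N,\Psi}=\sum_{j=0}^KU^K_j[N-d_2;d_2]\,\mathbf a_{N+j-1}\cdots\mathbf a_N$; $\mathbf V_J^{N,\Psi}=\sum_{j=0}^JV^J_j[N-d_2-j;d_2]\,\mathbf a^{N-j}\cdots\mathbf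 a^{N-1}$; $\underline{\mathbf U}_K^{N,\Psi}=\sum_{j=0}^K\underline{\mathbf b}_N\cdots\underline{\mathbf b}_{N+j-1}\,U^K_j[N-1;d_1]$; $\underline{\mathbf V}_J^{N,\Psi}=\sum_{j=0}^J\underline{\mathbf b}^{N-1}\cdots\underline{\mathbf b}^{N-j}\,V^J_j[N-1-j;d_1]$; $\mathbf U_K^{N,\Phi}=\sum_{j=0}^KU^K_j[N-j-d_1;d_1]\,\mathbf b^{N-j}\cdots\mathbf b^{N-1}$; $\mathbf V_J^{N,\Phi}=\sum_{j=0}^JV^J_j[N-d_1;d_1]\,\mathbf b_{N+j-1}\cdots\mathbf b_N$; $\underline{\mathbf U}_K^{N,\Phi}=\sum_{j=0}^K\underline{\mathbf a}^{N-1}\cdots\underline{\mathbf a}^{N-j}\,U^K_j[N-1-j;d_2]$; $\underline{\mathbf V}_J^{N,\Phi}=\sum_{j=0}^J\underline{\mathbf a}_N\cdots\underline{\mathbf a}_{N+j-1}\,V^J_j[N-1;d_2]$. **The equations** (for all $K,J$): (i) $\mathbf\Psi_{N+1}=\mathbf a_N\mathbf\Psi_N$, $\partial_x\mathbf\Psi_N=-D_1^N\mathbf\Psi_N$, $\partial_{u_K}\mathbf\Psi_N=\mathbf U_K^{N,\Psi}\mathbf\Psi_N$, $\partial_{v_J}\mathbf\Psi_N=-\mathbf V_J^{N,\Psi}\mathbf\Psi_N$, for $N\ge d_2+1$; (ii) $\mathbf\Phi_{N+1}=\mathbf b_N\mathbf\Phi_N$, $\partial_y\mathbf\Phi_N=-D_2^N\mathbf\Phi_N$,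 $\partial_{u_K}\mathbf\Phi_N=-\mathbf U_K^{N,\Phi}\mathbf\Phi_N$, $\partial_{v_J}\mathbf\Phi_N=\mathbf V_J^{N,\Phi}\mathbf\Phi_N$, for $N\ge d_1+1$; (iii) $\underline{\mathbf\Psi}^{N-1}=\underline{\mathbf\Psi}^N\underline{\mathbf b}^N$; $\partial_y\underline{\mathbf\Psi}^{N-1}=\underline{\mathbf\Psi}^{N-1}\underline D_2^N$ for $N\ge d_1+1$; $\partial_{u_K}\underline{\mathbf\Psi}^{N-1}=\underline{\mathbf\Psi}^{N-1}\underline{\mathbf U}_K^{N,\Psi}$ and $\partial_{v_J}\underline{\mathbf\Psi}^{N-1}=-\underline{\mathbf\Psi}^{N-1}\underline{\mathbf V}_J^{N,\Psi}$ for $N\ge1$; (iv) $\underline{\mathbf\Phi}^{N-1}=\underline{\mathbf\Phi}^N\underline{\mathbf a}^N$; $\partial_x\underline{\mathbf\Phi}^{N-1}=\underline{\mathbf\Phi}^{N-1}\underline D_1^N$ for $N\ge d_2+1$; $\partial_{u_K}\underline{\mathbf\Phi}^{N-1}=-\underline{\mathbf\Phi}^{N-1}\underline{\mathbf U}_K^{N,\Phi}$ and $\partial_{v_J}\underline{\mathbf\Phi}^{N-1}=\underline{\mathbf\Phi}^{N-1}\underline{\mathbf V}_J^{N,\Phi}$ for $N\ge1$.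
   Formalization: Equations hold only for N where all matrices exist: (i) v_J: N≥d2+J; (ii) u_K: N≥d1+K; (iii) y-derivative: N≥max(d1,d2)+1, v_J: N≥J+1; (iv) x-derivative: N≥max(d1,d2)+1, u_K: N≥K+1. The parameters range over an open simply connected set. *)

theory Defs
  imports "HOL-Analysis.Analysis" "HOL-Computational_Algebra.Polynomial"
    "Jordan_Normal_Form.Gauss_Jordan_Elimination"
begin

section \<open>Potentials, contours and the deformation parameters\<close>

text \<open>
  A point of parameter space is a pair \<open>(u, v)\<close> of coefficient families; only
  \<open>u 1, \<dots>, u (d1 + 1)\<close> and \<open>v 1, \<dots>, v (d2 + 1)\<close> are meaningful and all other values are
  pinned to \<open>0\<close>, so that \<open>param_space d1 d2\<close>, with the subspace topology of the product
  topology, is a copy of complex affine space of dimension \<open>d1 + d2 + 2\<close>.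
\<close>

type_synonym params = "(nat \<Rightarrow> complex) \<times> (nat \<Rightarrow> complex)"

definition param_space :: "nat \<Rightarrow> nat \<Rightarrow> params set" where
  "param_space d1 d2 =
     {(u, v). (\<forall>k. k \<notin> {1..d1+1} \<longrightarrow> u k = 0) \<and> (\<forall>k. k \<notin> {1..d2+1} \<longrightarrow> v k = 0)}"

definition potential :: "nat \<Rightarrow> (nat \<Rightarrow> complex) \<Rightarrow> complex \<Rightarrow> complex" where
  "potential d c z = (\<Sum>k=1..d+1. c k / of_nat k * z ^ k)"

definition weight :: "nat \<Rightarrow> nat \<Rightarrow> params \<Rightarrow> complex \<Rightarrow> complex \<Rightarrow> complex" where
  "weight d1 d2 t x y = exp (- potential d1 (fst t) x - potential d2 (snd t) y + x * y)"

text \<open>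
  A contour is a finite list of curves, each parametrised by the whole real line and piecewise
  continuously differentiable on compact intervals; integrals are added over the components.
\<close>

type_synonym contour = "(real \<Rightarrow> complex) list"

definition is_contour :: "contour \<Rightarrow> bool" where
  "is_contour G \<longleftrightarrow> (\<forall>g\<in>set G. \<forall>a b. g piecewise_C1_differentiable_on {a..b})"

definition pullback ::
  "(real \<Rightarrow> complex) \<Rightarrow> (real \<Rightarrow> complex) \<Rightarrow> (complex \<Rightarrow> complex \<Rightarrow> complex) \<Rightarrow> real \<times> real \<Rightarrow> complex"
  where "pullback g k F = (\<lambda>(a, b). F (g a) (k b) *
     vector_derivative g (at a) * vector_derivative k (at b))"

definition dbl_integrable :: "contour \<Rightarrow> contour \<Rightarrow> (complex \<Rightarrow> complex \<Rightarrow> complex) \<Rightarrow> bool" where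
  "dbl_integrable Gx Gy F \<longleftrightarrow> (\<forall>g\<in>set Gx. \<forall>k\<in>set Gy. integrable lborel (pullback g k F))"

definition dbl_integral :: "contour \<Rightarrow> contour \<Rightarrow> (complex \<Rightarrow> complex \<Rightarrow> complex) \<Rightarrow> complex" where
  "dbl_integral Gx Gy F = (\<Sum>g\<leftarrow>Gx. \<Sum>k\<leftarrow>Gy. integral\<^sup>L lborel (pullback g k F))"

definition integrals_converge :: "nat \<Rightarrow> nat \<Rightarrow> contour \<Rightarrow> contour \<Rightarrow> params \<Rightarrow> bool" where
  "integrals_converge d1 d2 Gx Gy t \<longleftrightarrow>
     (\<forall>p q :: complex poly. dbl_integrable Gx Gy (\<lambda>x y. poly p x * poly q y * weight d1 d2 t x y))"

text \<open>The boundary term of an integration by parts is the integral of a total derivative.\<close>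

definition no_boundary_terms :: "nat \<Rightarrow> nat \<Rightarrow> contour \<Rightarrow> contour \<Rightarrow> params \<Rightarrow> bool" where
  "no_boundary_terms d1 d2 Gx Gy t \<longleftrightarrow>
     (\<forall>p q :: complex poly.
        dbl_integral Gx Gy (\<lambda>x y. deriv (\<lambda>z. poly p z * poly q y * weight d1 d2 t z y) x) = 0 \<and>
        dbl_integral Gx Gy (\<lambda>x y. deriv (\<lambda>z. poly p x * poly q z * weight d1 d2 t x z) y) = 0)"


section \<open>Biorthogonal polynomials and recursion coefficients\<close>

definition biorthogonal ::
  "nat \<Rightarrow> nat \<Rightarrow> contour \<Rightarrow> contour \<Rightarrow> params \<Rightarrow>
   (nat \<Rightarrow> complex poly) \<Rightarrow> (nat \<Rightarrow> complex poly) \<Rightarrow> (nat \<Rightarrow> complex) \<Rightarrow> bool" where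
  "biorthogonal d1 d2 Gx Gy t \<pi> \<sigma> h \<longleftrightarrow>
     (\<forall>n. degree (\<pi> n) = n \<and> lead_coeff (\<pi> n) = 1 \<and> degree (\<sigma> n) = n \<and> lead_coeff (\<sigma> n) = 1) \<and>
     (\<forall>n m. dbl_integral Gx Gy (\<lambda>x y. poly (\<pi> n) x * poly (\<sigma> m) y * weight d1 d2 t x y) =
        (if n = m then h n else 0)) \<and>
     (\<forall>n. h n \<noteq> 0)"

text \<open>Here \<open>r n\<close> is the chosen square root of \<open>h n\<close>.\<close>

definition wave_fun ::
  "nat \<Rightarrow> params \<Rightarrow> (nat \<Rightarrow> complex poly) \<Rightarrow> (nat \<Rightarrow> complex) \<Rightarrow> nat \<Rightarrow> complex \<Rightarrow> complex" where
  "wave_fun d1 t \<pi> r n x = poly (\<pi> n) x * exp (- potential d1 (fst t) x) / r n"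

text \<open>The coefficient written \<open>\<alpha>\<^sub>j(n)\<close> in the literature is \<open>\<alpha> j n\<close>, with \<open>j \<ge> -1\<close> an integer.\<close>

type_synonym rec_coeffs = "int \<Rightarrow> nat \<Rightarrow> complex"

definition recursion_coeffs ::
  "nat \<Rightarrow> nat \<Rightarrow> (nat \<Rightarrow> complex \<Rightarrow> complex) \<Rightarrow> (nat \<Rightarrow> complex) \<Rightarrow>
   rec_coeffs \<Rightarrow> rec_coeffs \<Rightarrow> bool" where
  "recursion_coeffs d1 d2 \<psi> r \<alpha> \<beta> \<longleftrightarrow>
     (\<forall>n. \<alpha> (-1) n = r (n+1) / r n \<and> \<beta> (-1) n = r (n+1) / r n) \<and>
     (\<forall>j n. int n < j \<longrightarrow> \<alpha> j n = 0 \<and> \<beta> j n = 0) \<and>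
     (\<forall>n x. x * \<psi> n x =
        (\<Sum>j | j \<in> {-1..int d2} \<and> 0 \<le> int n - j. \<alpha> j n * \<psi> (nat (int n - j)) x)) \<and>
     (\<forall>n x. (\<psi> n has_field_derivative
        - (\<Sum>j | j \<in> {-1..int d1} \<and> 0 \<le> int n + j.
             \<beta> j (nat (int n + j)) * \<psi> (nat (int n + j)) x)) (at x))"


section \<open>Semi-infinite matrices\<close>

type_synonym inf_mat = "nat \<Rightarrow> nat \<Rightarrow> complex"

text \<open>The product is only used for row-finite \<open>A\<close>.\<close>

definition inf_mult :: "inf_mat \<Rightarrow> inf_mat \<Rightarrow> inf_mat" where
  "inf_mult A B n m = (\<Sum>l | A n l \<noteq> 0. A n l * B l m)"

primrec inf_power :: "inf_mat \<Rightarrow> nat \<Rightarrow> inf_mat" where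
  "inf_power A 0 = (\<lambda>n m. if n = m then 1 else 0)"
| "inf_power A (Suc k) = inf_mult A (inf_power A k)"

definition Q_mat :: "nat \<Rightarrow> rec_coeffs \<Rightarrow> inf_mat" where
  "Q_mat d2 \<alpha> n m = (if int n - int m \<in> {-1..int d2} then \<alpha> (int n - int m) n else 0)"

definition P_mat :: "nat \<Rightarrow> rec_coeffs \<Rightarrow> inf_mat" where
  "P_mat d1 \<beta> n m = (if int m - int n \<in> {-1..int d1} then - \<beta> (int m - int n) m else 0)"

text \<open>\<open>- 1/k\<close> times the strictly upper triangular part plus half the diagonal part of \<open>A\<^sup>k\<close>.\<close>

definition deform :: "inf_mat \<Rightarrow> nat \<Rightarrow> inf_mat" where
  "deform A k n m = - (1 / of_nat k) *
     (if n < m then inf_power A k n m else if n = m then inf_power A k n n / 2 else 0)"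

definition U_mat :: "nat \<Rightarrow> rec_coeffs \<Rightarrow> nat \<Rightarrow> inf_mat" where
  "U_mat d2 \<alpha> K = deform (Q_mat d2 \<alpha>) K"

definition V_mat :: "nat \<Rightarrow> rec_coeffs \<Rightarrow> nat \<Rightarrow> inf_mat" where
  "V_mat d1 \<beta> J = deform (\<lambda>n m. - P_mat d1 \<beta> m n) J"


section \<open>Finite windows\<close>

text \<open>
  The matrices come in two families interchanged by \<open>(d2, \<alpha>, x) \<leftrightarrow> (d1, \<beta>, y)\<close>; the definitions
  below are stated once, for a generic triple \<open>(d, c, z)\<close> and size \<open>d + 1\<close>. Since
  \<open>\<alpha>\<^sub>-\<^sub>1 = \<beta>\<^sub>-\<^sub>1 = \<gamma>\<close>, the coefficient \<open>\<gamma>(n)\<close> is \<open>c (-1) n\<close>. All subtractions of natural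
  numbers are exact in the ranges in which the matrices are used.
\<close>

definition christoffel_darboux :: "nat \<Rightarrow> rec_coeffs \<Rightarrow> nat \<Rightarrow> complex mat" where
  "christoffel_darboux d c N = mat (d+1) (d+1) (\<lambda>(i, k).
     if i = 0 then (if k = d then - c (-1) (N-1) else 0)
     else if i - 1 \<le> k \<and> k \<le> d - 1 then c (int d + int (i-1) - int k) (N + (i-1)) else 0)"

text \<open>\<open>ladder\<close> is \<open>a\<^sub>N\<close> (resp. \<open>b\<^sub>N\<close>) and \<open>dual_ladder\<close> its underlined counterpart with upper
  index \<open>N\<close>; the suffix \<open>_inv\<close> denotes the inverses.\<close>

definition ladder :: "nat \<Rightarrow> rec_coeffs \<Rightarrow> complex \<Rightarrow> nat \<Rightarrow> complex mat" where
  "ladder d c z N = mat (d+1) (d+1) (\<lambda>(i, k).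
     if i < d then (if k = i + 1 then 1 else 0)
     else if k < d then - c (int d - int k) N / c (-1) N else (z - c 0 N) / c (-1) N)"

definition ladder_inv :: "nat \<Rightarrow> rec_coeffs \<Rightarrow> complex \<Rightarrow> nat \<Rightarrow> complex mat" where
  "ladder_inv d c z N = the (mat_inverse (ladder d c z N))"

definition dual_ladder :: "nat \<Rightarrow> rec_coeffs \<Rightarrow> complex \<Rightarrow> nat \<Rightarrow> complex mat" where
  "dual_ladder d c z N = mat (d+1) (d+1) (\<lambda>(i, k).
     if k = 0 then (if i = 0 then (z - c 0 N) / c (-1) (N-1) else - c (int i) (N+i) / c (-1) (N-1))
     else if k = i + 1 then 1 else 0)"

definition dual_ladder_inv :: "nat \<Rightarrow> rec_coeffs \<Rightarrow> complex \<Rightarrow> nat \<Rightarrow> complex mat" where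
  "dual_ladder_inv d c z N = the (mat_inverse (dual_ladder d c z N))"

text \<open>\<open>lprod n F j = F (j-1) * \<dots> * F 0\<close> and \<open>rprod n F j = F 0 * \<dots> * F (j-1)\<close>.\<close>

primrec lprod :: "nat \<Rightarrow> (nat \<Rightarrow> complex mat) \<Rightarrow> nat \<Rightarrow> complex mat" where
  "lprod n F 0 = 1\<^sub>m n"
| "lprod n F (Suc j) = F j * lprod n F j"

primrec rprod :: "nat \<Rightarrow> (nat \<Rightarrow> complex mat) \<Rightarrow> nat \<Rightarrow> complex mat" where
  "rprod n F 0 = 1\<^sub>m n"
| "rprod n F (Suc j) = rprod n F j * F j"

definition mat_sum :: "nat \<Rightarrow> nat set \<Rightarrow> (nat \<Rightarrow> complex mat) \<Rightarrow> complex mat" where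
  "mat_sum n S F = mat n n (\<lambda>(i, k). \<Sum>j\<in>S. F j $$ (i, k))"

definition window :: "(nat \<Rightarrow> complex) \<Rightarrow> nat \<Rightarrow> nat \<Rightarrow> complex mat" where
  "window f p d = mat_diag (d+1) (\<lambda>i. f (p + i))"

text \<open>
  \<open>diff_mat d2 d1 \<alpha> \<beta> x N\<close> is \<open>D\<^sub>1\<^sup>N(x)\<close> and \<open>diff_mat d1 d2 \<beta> \<alpha> y N\<close> is \<open>D\<^sub>2\<^sup>N(y)\<close>; likewise
  \<open>dual_diff_mat d1 d2 \<beta> \<alpha> y N\<close> and \<open>dual_diff_mat d2 d1 \<alpha> \<beta> x N\<close> are the underlined
  \<open>D\<^sub>2\<^sup>N(y)\<close> and \<open>D\<^sub>1\<^sup>N(x)\<close>.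
\<close>

definition diff_mat ::
  "nat \<Rightarrow> nat \<Rightarrow> rec_coeffs \<Rightarrow> rec_coeffs \<Rightarrow> complex \<Rightarrow> nat \<Rightarrow> complex mat" where
  "diff_mat d e c b z N =
     window (b (-1)) (N-1-d) d * ladder_inv d c z (N-1) + window (b 0) (N-d) d +
     mat_sum (d+1) {1..e} (\<lambda>j. window (b (int j)) (N+j-d) d *
       lprod (d+1) (\<lambda>i. ladder d c z (N+i)) j)"

definition dual_diff_mat ::
  "nat \<Rightarrow> nat \<Rightarrow> rec_coeffs \<Rightarrow> rec_coeffs \<Rightarrow> complex \<Rightarrow> nat \<Rightarrow> complex mat" where
  "dual_diff_mat d e c b z N =
     dual_ladder_inv d c z N * window (b (-1)) (N-1) d + window (b 0) (N-1) d +
     mat_sum (d+1) {1..e} (\<lambda>j. rprod (d+1) (\<lambda>i. dual_ladder d c z (N-1-i)) j *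
       window (b (int j)) (N-1) d)"

text \<open>
  Deformation matrices obtained by folding a semi-infinite matrix \<open>W\<close> (one of \<open>U\<^sup>K\<close>, \<open>V\<^sup>J\<close>,
  with \<open>k\<close> the exponent) onto a window. \<open>fold_up\<close>: \<open>U\<^sub>K\<^sup>N\<^sup>,\<^sup>\<Psi>\<close> and \<open>V\<^sub>J\<^sup>N\<^sup>,\<^sup>\<Phi>\<close>;
  \<open>fold_down\<close>: \<open>V\<^sub>J\<^sup>N\<^sup>,\<^sup>\<Psi>\<close> and \<open>U\<^sub>K\<^sup>N\<^sup>,\<^sup>\<Phi>\<close>; \<open>dual_fold_up\<close>: underlined \<open>U\<^sub>K\<^sup>N\<^sup>,\<^sup>\<Psi>\<close> and
  \<open>V\<^sub>J\<^sup>N\<^sup>,\<^sup>\<Phi>\<close>; \<open>dual_fold_down\<close>: underlined \<open>V\<^sub>J\<^sup>N\<^sup>,\<^sup>\<Psi>\<close> and \<open>U\<^sub>K\<^sup>N\<^sup>,\<^sup>\<Phi>\<close>.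
\<close>

definition fold_up ::
  "nat \<Rightarrow> rec_coeffs \<Rightarrow> complex \<Rightarrow> inf_mat \<Rightarrow> nat \<Rightarrow> nat \<Rightarrow> complex mat" where
  "fold_up d c z W k N = mat_sum (d+1) {0..k} (\<lambda>j.
     window (\<lambda>n. W n (n+j)) (N-d) d * lprod (d+1) (\<lambda>i. ladder d c z (N+i)) j)"

definition fold_down ::
  "nat \<Rightarrow> rec_coeffs \<Rightarrow> complex \<Rightarrow> inf_mat \<Rightarrow> nat \<Rightarrow> nat \<Rightarrow> complex mat" where
  "fold_down d c z W k N = mat_sum (d+1) {0..k} (\<lambda>j.
     window (\<lambda>n. W n (n+j)) (N-d-j) d * lprod (d+1) (\<lambda>i. ladder_inv d c z (N-1-i)) j)"

definition dual_fold_up ::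
  "nat \<Rightarrow> rec_coeffs \<Rightarrow> complex \<Rightarrow> inf_mat \<Rightarrow> nat \<Rightarrow> nat \<Rightarrow> complex mat" where
  "dual_fold_up d c z W k N = mat_sum (d+1) {0..k} (\<lambda>j.
     rprod (d+1) (\<lambda>i. dual_ladder_inv d c z (N+i)) j * window (\<lambda>n. W n (n+j)) (N-1) d)"

definition dual_fold_down ::
  "nat \<Rightarrow> rec_coeffs \<Rightarrow> complex \<Rightarrow> inf_mat \<Rightarrow> nat \<Rightarrow> nat \<Rightarrow> complex mat" where
  "dual_fold_down d c z W k N = mat_sum (d+1) {0..k} (\<lambda>j.
     rprod (d+1) (\<lambda>i. dual_ladder d c z (N-1-i)) j * window (\<lambda>n. W n (n+j)) (N-1-j) d)"


section \<open>The difference-differential-deformation equations\<close>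

definition has_mat_deriv :: "nat \<Rightarrow> (complex \<Rightarrow> complex mat) \<Rightarrow> complex mat \<Rightarrow> complex \<Rightarrow> bool" where
  "has_mat_deriv n F D z \<longleftrightarrow> D \<in> carrier_mat n n \<and>
     (\<forall>i<n. \<forall>k<n. ((\<lambda>w. F w $$ (i, k)) has_field_derivative D $$ (i, k)) (at z))"

definition has_u_deriv ::
  "nat \<Rightarrow> (params \<Rightarrow> complex mat) \<Rightarrow> nat \<Rightarrow> complex mat \<Rightarrow> params \<Rightarrow> bool" where
  "has_u_deriv n F K D t \<longleftrightarrow> has_mat_deriv n (\<lambda>s. F ((fst t)(K := s), snd t)) D (fst t K)"

definition has_v_deriv ::
  "nat \<Rightarrow> (params \<Rightarrow> complex mat) \<Rightarrow> nat \<Rightarrow> complex mat \<Rightarrow> params \<Rightarrow> bool" where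
  "has_v_deriv n F J D t \<longleftrightarrow> has_mat_deriv n (\<lambda>s. F (fst t, (snd t)(J := s))) D (snd t J)"

text \<open>
  A sequence of fundamental solutions is a family \<open>F N z t\<close> of invertible matrices. The
  coefficients \<open>\<alpha>\<close>, \<open>\<beta>\<close> depend on the parameter point \<open>t\<close>.

  Each equation is imposed for those \<open>N\<close> for which all matrices in it exist. The ladder matrix
  of index \<open>M\<close> is invertible precisely for \<open>M \<ge> d\<close> (its corner entry vanishes for \<open>M < d\<close>), and
  the dual ladder matrix of index \<open>M\<close> contains \<open>1 / \<gamma>(M-1)\<close> and so exists only for \<open>M \<ge> 1\<close>.
  Hence an equation involving \<open>fold_down\<close> with exponent \<open>k\<close> needs \<open>N \<ge> d + k\<close>, one involving
  \<open>dual_fold_down\<close> needs \<open>N \<ge> k + 1\<close>, and one involving \<open>dual_diff_mat d e\<close> needs \<open>N \<ge> e + 1\<close>.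
\<close>

definition Psi_system ::
  "nat \<Rightarrow> nat \<Rightarrow> params set \<Rightarrow> (params \<Rightarrow> rec_coeffs) \<Rightarrow> (params \<Rightarrow> rec_coeffs) \<Rightarrow>
   (nat \<Rightarrow> complex \<Rightarrow> params \<Rightarrow> complex mat) \<Rightarrow> bool" where
  "Psi_system d1 d2 T \<alpha> \<beta> \<Psi> \<longleftrightarrow> (\<forall>t\<in>T. \<forall>x. \<forall>N\<ge>d2+1.
     \<Psi> N x t \<in> carrier_mat (d2+1) (d2+1) \<and> invertible_mat (\<Psi> N x t) \<and>
     \<Psi> (N+1) x t = ladder d2 (\<alpha> t) x N * \<Psi> N x t \<and>
     has_mat_deriv (d2+1) (\<lambda>z. \<Psi> N z t) (- (diff_mat d2 d1 (\<alpha> t) (\<beta> t) x N * \<Psi> N x t)) x \<and>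
     (\<forall>K\<in>{1..d1+1}. has_u_deriv (d2+1) (\<Psi> N x) K
        (fold_up d2 (\<alpha> t) x (U_mat d2 (\<alpha> t) K) K N * \<Psi> N x t) t) \<and>
     (\<forall>J\<in>{1..d2+1}. N \<ge> d2 + J \<longrightarrow> has_v_deriv (d2+1) (\<Psi> N x) J
        (- (fold_down d2 (\<alpha> t) x (V_mat d1 (\<beta> t) J) J N * \<Psi> N x t)) t))"

definition Phi_system ::
  "nat \<Rightarrow> nat \<Rightarrow> params set \<Rightarrow> (params \<Rightarrow> rec_coeffs) \<Rightarrow> (params \<Rightarrow> rec_coeffs) \<Rightarrow>
   (nat \<Rightarrow> complex \<Rightarrow> params \<Rightarrow> complex mat) \<Rightarrow> bool" where
  "Phi_system d1 d2 T \<alpha> \<beta> \<Phi> \<longleftrightarrow> (\<forall>t\<in>T. \<forall>y. \<forall>N\<ge>d1+1.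
     \<Phi> N y t \<in> carrier_mat (d1+1) (d1+1) \<and> invertible_mat (\<Phi> N y t) \<and>
     \<Phi> (N+1) y t = ladder d1 (\<beta> t) y N * \<Phi> N y t \<and>
     has_mat_deriv (d1+1) (\<lambda>z. \<Phi> N z t) (- (diff_mat d1 d2 (\<beta> t) (\<alpha> t) y N * \<Phi> N y t)) y \<and>
     (\<forall>K\<in>{1..d1+1}. N \<ge> d1 + K \<longrightarrow> has_u_deriv (d1+1) (\<Phi> N y) K
        (- (fold_down d1 (\<beta> t) y (U_mat d2 (\<alpha> t) K) K N * \<Phi> N y t)) t) \<and>
     (\<forall>J\<in>{1..d2+1}. has_v_deriv (d1+1) (\<Phi> N y) J
        (fold_up d1 (\<beta> t) y (V_mat d1 (\<beta> t) J) J N * \<Phi> N y t) t))"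

text \<open>In the dual systems the first argument of the solution is its upper index, \<open>N - 1\<close> below.\<close>

definition dual_Psi_system ::
  "nat \<Rightarrow> nat \<Rightarrow> params set \<Rightarrow> (params \<Rightarrow> rec_coeffs) \<Rightarrow> (params \<Rightarrow> rec_coeffs) \<Rightarrow>
   (nat \<Rightarrow> complex \<Rightarrow> params \<Rightarrow> complex mat) \<Rightarrow> bool" where
  "dual_Psi_system d1 d2 T \<alpha> \<beta> \<Psi>u \<longleftrightarrow> (\<forall>t\<in>T. \<forall>y. \<forall>N\<ge>1.
     \<Psi>u (N-1) y t \<in> carrier_mat (d1+1) (d1+1) \<and> invertible_mat (\<Psi>u (N-1) y t) \<and>
     \<Psi>u (N-1) y t = \<Psi>u N y t * dual_ladder d1 (\<beta> t) y N \<and>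
     (N \<ge> d1+1 \<and> N \<ge> d2+1 \<longrightarrow> has_mat_deriv (d1+1) (\<lambda>z. \<Psi>u (N-1) z t)
        (\<Psi>u (N-1) y t * dual_diff_mat d1 d2 (\<beta> t) (\<alpha> t) y N) y) \<and>
     (\<forall>K\<in>{1..d1+1}. has_u_deriv (d1+1) (\<Psi>u (N-1) y) K
        (\<Psi>u (N-1) y t * dual_fold_up d1 (\<beta> t) y (U_mat d2 (\<alpha> t) K) K N) t) \<and>
     (\<forall>J\<in>{1..d2+1}. N \<ge> J+1 \<longrightarrow> has_v_deriv (d1+1) (\<Psi>u (N-1) y) J
        (- (\<Psi>u (N-1) y t * dual_fold_down d1 (\<beta> t) y (V_mat d1 (\<beta> t) J) J N)) t))"

definition dual_Phi_system ::
  "nat \<Rightarrow> nat \<Rightarrow> params set \<Rightarrow> (params \<Rightarrow> rec_coeffs) \<Rightarrow> (params \<Rightarrow> rec_coeffs) \<Rightarrow>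
   (nat \<Rightarrow> complex \<Rightarrow> params \<Rightarrow> complex mat) \<Rightarrow> bool" where
  "dual_Phi_system d1 d2 T \<alpha> \<beta> \<Phi>u \<longleftrightarrow> (\<forall>t\<in>T. \<forall>x. \<forall>N\<ge>1.
     \<Phi>u (N-1) x t \<in> carrier_mat (d2+1) (d2+1) \<and> invertible_mat (\<Phi>u (N-1) x t) \<and>
     \<Phi>u (N-1) x t = \<Phi>u N x t * dual_ladder d2 (\<alpha> t) x N \<and>
     (N \<ge> d2+1 \<and> N \<ge> d1+1 \<longrightarrow> has_mat_deriv (d2+1) (\<lambda>z. \<Phi>u (N-1) z t)
        (\<Phi>u (N-1) x t * dual_diff_mat d2 d1 (\<alpha> t) (\<beta> t) x N) x) \<and>
     (\<forall>K\<in>{1..d1+1}. N \<ge> K+1 \<longrightarrow> has_u_deriv (d2+1) (\<Phi>u (N-1) x) K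
        (- (\<Phi>u (N-1) x t * dual_fold_down d2 (\<alpha> t) x (U_mat d2 (\<alpha> t) K) K N)) t) \<and>
     (\<forall>J\<in>{1..d2+1}. has_v_deriv (d2+1) (\<Phi>u (N-1) x) J
        (\<Phi>u (N-1) x t * dual_fold_up d2 (\<alpha> t) x (V_mat d1 (\<beta> t) J) J N) t))"

end

theory Submission
  imports Defs "HOL-Complex_Analysis.Complex_Analysis" "Jordan_Normal_Form.Determinant"
begin

text \<open>
  In the coordinates \<open>p = (x, u, v)\<close> let \<open>L = Q - x\<close> and let \<open>M\<^sub>i\<close> be the band matrix by which
  \<open>\<partial>\<^sub>i\<close> acts on the wave functions \<open>\<psi>\<^sub>n\<close>. Since the \<open>\<psi>\<^sub>n\<close> are linearly independent over functions
  of the parameters, \<open>\<partial>\<^sub>i L = [M\<^sub>i, L]\<close> and the \<open>\<partial>\<^sub>i - M\<^sub>i\<close> commute. The sequences with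
  \<open>(L f)\<^sub>n = 0\<close> for \<open>n \<ge> d\<^sub>2\<close> form a space of dimension \<open>d\<^sub>2 + 1\<close> which is preserved by these
  operators, so on it they are a flat connection over a simply connected domain, and a frame of
  flat sections is a fundamental solution \<open>\<Psi>\<close>. The bilinear concomitant
  \<open>\<Sum> g\<^sub>m L\<^sub>m\<^sub>l ([l < N] - [m < N]) f\<^sub>l\<close> of \<open>L\<close> and its transpose is the Christoffel-Darboux
  pairing: it is nondegenerate and, on solutions, independent of \<open>N\<close>; normalising it to be the
  identity determines the dual solution, and differentiating the normalisation gives the dual
  deformation equations. The second pair follows by exchanging \<open>x\<close> and \<open>y\<close>.
\<close>

text \<open>The obstacle is the edge of the semi-infinite matrices. With all rows of
  \<open>L\<close> kept, the kernel would be spanned by the wave functions alone, so the first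
  \<open>d2\<close> rows are dropped. That costs exact invariance: \<open>M i\<close> has up to
  \<open>lo i\<close> subdiagonals, and an equation valid on the rows from \<open>d2\<close> on
  survives only on the rows from \<open>d2 + lo i\<close> on. The repair is that a solution of a
  recurrence with non-vanishing extreme coefficients is determined by any \<open>d2 + 1\<close>
  consecutive entries: identities are verified on a window far from the edge and carried back to it.
  The rows on which the derivative of a solution is finally known match the ranges of
  \<open>N\<close> in the systems.

  Differentiability in the parameters is not given either. Moments are differentiated under the
  integral sign, the monic polynomials are holomorphic by Gram-Schmidt, \<open>h\<close> and its
  continuous root \<open>r\<close> follow, and the recursion coefficients are quotients of moments
  by products of values of \<open>r\<close>. Since parameter points lie in a function space,
  holomorphy is developed in finitely many coordinates, and continuation along paths uses
  subdivisions only.\<close>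

section \<open>Transport in locally trivial cocycles\<close>

text \<open>Simple connectivity is phrased with free homotopies of loops, so it also links the
  constant loops at two different points; the track of the loop parameter \<open>0\<close> under
  such a homotopy is the path.\<close>

lemma simply_connected_path_connected:
  fixes S :: "'a::topological_space set"
  assumes "simply_connected S"
  shows "path_connected S"
  unfolding path_connected_def
proof (intro ballI)
  fix x y assume xy: "x \<in> S" "y \<in> S"
  have const: "path (\<lambda>_. a) \<and> pathfinish (\<lambda>_. a) = pathstart (\<lambda>_. a) \<and> path_image (\<lambda>_. a) \<subseteq> S" if "a \<in> S" for a
    using that by (auto simp: path_def path_image_def pathfinish_def pathstart_def)
  have "homotopic_loops S (\<lambda>_. x) (\<lambda>_. y)"
    using assms const[OF xy(1)] const[OF xy(2)] unfolding simply_connected_def by blast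
  then obtain H where H: "continuous_on ({0..1::real} \<times> {0..1::real}) H"
    "H \<in> ({0..1} \<times> {0..1}) \<rightarrow> S" "H (0,0) = x" "H (1,0) = y"
    unfolding homotopic_loops by auto
  have "continuous_on {0..1} (\<lambda>t. H (t, 0))"
    by (rule continuous_on_compose2[OF H(1)]) (auto intro!: continuous_intros)
  then show "\<exists>g. path g \<and> path_image g \<subseteq> S \<and> pathstart g = x \<and> pathfinish g = y"
    using H(2-4) by (intro exI[of _ "\<lambda>t. H (t, 0)"])
      (auto simp: path_def path_image_def pathstart_def pathfinish_def)
qed

section \<open>Transport along subdivided paths and its homotopy invariance\<close>

primrec chain_transport :: "('p \<Rightarrow> 'p \<Rightarrow> 'm \<Rightarrow> 'm) \<Rightarrow> (nat \<Rightarrow> 'p) \<Rightarrow> nat \<Rightarrow> 'm \<Rightarrow> 'm" where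
  "chain_transport \<tau> c 0 w = w"
| "chain_transport \<tau> c (Suc n) w = \<tau> (c n) (c (Suc n)) (chain_transport \<tau> c n w)"

lemma chain_transport_add:
  "chain_transport \<tau> c (m + n) w = chain_transport \<tau> (\<lambda>i. c (m + i)) n (chain_transport \<tau> c m w)"
  by (induction n) auto

lemma chain_transport_cong:
  "(\<And>i. i \<le> n \<Longrightarrow> c i = c' i) \<Longrightarrow> chain_transport \<tau> c n w = chain_transport \<tau> c' n w"
  by (induction n) auto

text \<open>Abstract parallel transport: \<open>\<tau> p q w\<close> stands for the value at
  \<open>q\<close> of the local solution with value \<open>w\<close> at \<open>p\<close>.
  Composition is controlled only inside a single member of the cover; what remains to be excluded is
  monodromy.\<close>

locale local_cocycle =
  fixes \<Omega> :: "'p::topological_space set" and \<B> :: "'p set set" and \<tau> :: "'p \<Rightarrow> 'p \<Rightarrow> 'm \<Rightarrow> 'm"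
  assumes cover: "\<Omega> = \<Union>\<B>"
    and ope: "\<And>B. B \<in> \<B> \<Longrightarrow> openin (top_of_set \<Omega>) B"
    and pc: "\<And>B. B \<in> \<B> \<Longrightarrow> path_connected B"
    and cocycle: "\<And>B p q r w. B \<in> \<B> \<Longrightarrow> p \<in> B \<Longrightarrow> q \<in> B \<Longrightarrow> r \<in> B \<Longrightarrow> \<tau> q r (\<tau> p q w) = \<tau> p r w"
    and refl: "\<And>p w. p \<in> \<Omega> \<Longrightarrow> \<tau> p p w = w"
begin

text \<open>Equal subdivisions suffice: those into \<open>n\<close> and into \<open>m\<close> pieces
  have the one into \<open>n * m\<close> pieces as a common refinement, which makes
  \<open>tr\<close> independent of the subdivision.\<close>

definition ok :: "(real \<Rightarrow> 'p) \<Rightarrow> nat \<Rightarrow> bool" where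
  "ok \<gamma> n \<longleftrightarrow> n > 0 \<and> (\<forall>i<n. \<exists>B\<in>\<B>. \<gamma> ` {real i / real n..real (Suc i) / real n} \<subseteq> B)"

definition tr :: "(real \<Rightarrow> 'p) \<Rightarrow> nat \<Rightarrow> 'm \<Rightarrow> 'm" where
  "tr \<gamma> n = chain_transport \<tau> (\<lambda>i. \<gamma> (real i / real n)) n"

lemma inverse_step: "B \<in> \<B> \<Longrightarrow> p \<in> B \<Longrightarrow> q \<in> B \<Longrightarrow> \<tau> q p (\<tau> p q w) = w"
  using cocycle[of B p q p w] refl[of p w] cover by auto

lemma chain_in_one:
  assumes "B \<in> \<B>" "\<And>i. i \<le> n \<Longrightarrow> c i \<in> B"
  shows "chain_transport \<tau> c n w = \<tau> (c 0) (c n) w"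
  using assms
proof (induction n)
  case 0
  then have "c 0 \<in> \<Omega>" using cover by auto
  then show ?case using refl by simp
next
  case (Suc n)
  then show ?case using cocycle[of B "c 0" "c n" "c (Suc n)" w] by auto
qed

text \<open>The \<open>k\<close> small steps inside one coarse piece stay in one member of the
  cover, where the cocycle law telescopes them into the coarse step.\<close>

lemma ok_refine:
  assumes "ok \<gamma> n" "k > 0"
  shows "ok \<gamma> (n * k)" "tr \<gamma> (n * k) = tr \<gamma> n"
proof -
  have n: "n > 0" using assms by (simp add: ok_def)
  obtain B where B: "\<And>i. i < n \<Longrightarrow> B i \<in> \<B> \<and> \<gamma> ` {real i / real n..real (Suc i) / real n} \<subseteq> B i"
    using assms(1) unfolding ok_def by metis
  have sub: "{real j / real (n * k)..real (Suc j) / real (n * k)} \<subseteq> {real i / real n..real (Suc i) / real n}"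
    if "i * k \<le> j" "Suc j \<le> Suc i * k" for i j
  proof -
    have "real i / real n = real (i * k) / real (n * k)" using assms(2) by simp
    also have "\<dots> \<le> real j / real (n * k)" using that(1) n assms(2) by (intro divide_right_mono) (simp_all only: of_nat_le_iff of_nat_0_le_iff)
    finally have 1: "real i / real n \<le> real j / real (n * k)" .
    have "real (Suc j) / real (n * k) \<le> real (Suc i * k) / real (n * k)" using that(2) by (intro divide_right_mono) (simp_all only: of_nat_le_iff of_nat_0_le_iff)
    also have "\<dots> = real (Suc i) / real n" using assms(2) unfolding of_nat_mult by (intro mult_divide_mult_cancel_right) simp
    finally show ?thesis using 1 by auto
  qed
  show "ok \<gamma> (n * k)"
    unfolding ok_def
  proof (intro conjI allI impI)
    show "0 < n * k" using n assms by simp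
    fix j assume j: "j < n * k"
    then have "j div k < n" by (simp add: less_mult_imp_div_less)
    moreover have "j div k * k \<le> j" by simp
    moreover have "Suc j \<le> Suc (j div k) * k"
      using assms(2) by (metis Suc_leI add.commute dividend_less_div_times mult_Suc)
    ultimately show "\<exists>B\<in>\<B>. \<gamma> ` {real j / real (n * k)..real (Suc j) / real (n * k)} \<subseteq> B"
      using B[of "j div k"] sub[of "j div k" j] by (meson image_mono subset_trans)
  qed
  have "chain_transport \<tau> (\<lambda>i. \<gamma> (real i / real (n * k))) (m * k) w =
        chain_transport \<tau> (\<lambda>i. \<gamma> (real i / real n)) m w" if "m \<le> n" for m w
    using that
  proof (induction m)
    case (Suc m)
    have "chain_transport \<tau> (\<lambda>i. \<gamma> (real i / real (n * k))) (m * k + k) w =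
       chain_transport \<tau> (\<lambda>i. \<gamma> (real (m * k + i) / real (n * k))) k
         (chain_transport \<tau> (\<lambda>i. \<gamma> (real i / real n)) m w)"
      using Suc by (simp add: chain_transport_add)
    also have "\<dots> = \<tau> (\<gamma> (real (m * k + 0) / real (n * k))) (\<gamma> (real (m * k + k) / real (n * k)))
         (chain_transport \<tau> (\<lambda>i. \<gamma> (real i / real n)) m w)"
    proof (rule chain_in_one[of "B m"])
      show "B m \<in> \<B>" using B Suc by auto
      fix i assume i: "i \<le> k"
      have "real (m * k + i) / real (n * k) \<in> {real m / real n..real (Suc m) / real n}"
      proof (cases "i = k")
        case True
        have "real (m * k + i) / real (n * k) = real (Suc m * k) / real (n * k)" using True by simp
        also have "\<dots> = real (Suc m) / real n" using assms(2) unfolding of_nat_mult by (intro mult_divide_mult_cancel_right) simp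
        finally show ?thesis using n by (simp add: divide_right_mono)
      next
        case False
        then have "real (m * k + i) / real (n * k) \<in> {real (m * k + i) / real (n * k)..real (Suc (m * k + i)) / real (n * k)}"
          by (simp add: divide_right_mono)
        also have "\<dots> \<subseteq> {real m / real n..real (Suc m) / real n}"
          by (rule sub) (use False i in auto)
        finally show ?thesis .
      qed
      then show "\<gamma> (real (m * k + i) / real (n * k)) \<in> B m" using B[of m] Suc by auto
    qed
    also have "real (m * k + 0) / real (n * k) = real m / real n" using assms(2) by simp
    also have "real (m * k + k) / real (n * k) = real (Suc m) / real n"
    proof -
      have "real (m * k + k) = real (Suc m) * real k" by (simp add: algebra_simps)
      then show ?thesis using assms(2) by (simp del: of_nat_Suc)
    qed
    finally show ?case by (simp add: add.commute)
  qed auto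
  from this[of n] show "tr \<gamma> (n * k) = tr \<gamma> n" unfolding tr_def by auto
qed

lemma tr_indep: "ok \<gamma> n \<Longrightarrow> ok \<gamma> m \<Longrightarrow> tr \<gamma> n = tr \<gamma> m"
  using ok_refine[of \<gamma> n m] ok_refine[of \<gamma> m n] by (simp add: mult.commute ok_def)

text \<open>\<open>\<delta>\<close> is a Lebesgue number of the cover pulled back along
  \<open>H\<close>.\<close>

lemma grid_fine:
  fixes H :: "'z::metric_space \<Rightarrow> 'p"
  assumes "continuous_on S H" "compact S" "H ` S \<subseteq> \<Omega>" "S \<noteq> {}"
  obtains \<delta> where "\<delta> > 0" "\<And>x. x \<in> S \<Longrightarrow> \<exists>B\<in>\<B>. H ` (ball x \<delta> \<inter> S) \<subseteq> B"
proof -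
  have "\<exists>U. open U \<and> U \<inter> S = S \<inter> H -` B" if "B \<in> \<B>" for B
  proof -
    have "openin (top_of_set S) (S \<inter> H -` B)"
      using continuous_openin_preimage[OF assms(1) _ ope[OF that]] assms(3) by (auto simp: image_subset_iff_funcset)
    then show ?thesis unfolding openin_open by (metis Int_commute)
  qed
  then obtain U where U: "\<And>B. B \<in> \<B> \<Longrightarrow> open (U B) \<and> U B \<inter> S = S \<inter> H -` B" by metis
  have "S \<subseteq> \<Union>(U ` \<B>)"
  proof
    fix x assume "x \<in> S"
    then obtain B where "B \<in> \<B>" "H x \<in> B" using assms(3) cover by blast
    then show "x \<in> \<Union>(U ` \<B>)" using U[of B] \<open>x \<in> S\<close> by auto
  qed
  moreover have "open G" if "G \<in> U ` \<B>" for G using that U by auto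
  ultimately obtain \<delta> where d: "0 < \<delta>" "\<And>x. x \<in> S \<Longrightarrow> \<exists>G \<in> U ` \<B>. ball x \<delta> \<subseteq> G"
    using Heine_Borel_lemma[OF assms(2)] by metis
  show ?thesis
  proof (rule that[OF d(1)])
    fix x assume "x \<in> S"
    then obtain B where B: "B \<in> \<B>" "ball x \<delta> \<subseteq> U B" using d by blast
    then have "ball x \<delta> \<inter> S \<subseteq> S \<inter> H -` B" using U[OF B(1)] by auto
    then show "\<exists>B\<in>\<B>. H ` (ball x \<delta> \<inter> S) \<subseteq> B" using B(1) by blast
  qed
qed

lemma ok_exists:
  assumes "path \<gamma>" "path_image \<gamma> \<subseteq> \<Omega>"
  shows "\<exists>n. ok \<gamma> n"
proof -
  obtain \<delta> where d: "\<delta> > 0" "\<And>x. x \<in> {0..1::real} \<Longrightarrow> \<exists>B\<in>\<B>. \<gamma> ` (ball x \<delta> \<inter> {0..1}) \<subseteq> B"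
    using grid_fine[of "{0..1}" \<gamma>] assms unfolding path_def path_image_def by auto
  obtain n where n: "n > 0" "1 / real n < \<delta>"
    using d(1) by (metis real_arch_inverse inverse_eq_divide gr0I)
  have "ok \<gamma> n"
    unfolding ok_def
  proof (intro conjI allI impI n)
    fix i assume i: "i < n"
    have "real (Suc i) / real n \<le> 1" using i by (simp add: divide_le_eq_1)
    then have "real i / real n \<in> {0..1}" using i by auto
    then obtain B where B: "B \<in> \<B>" "\<gamma> ` (ball (real i / real n) \<delta> \<inter> {0..1}) \<subseteq> B" using d(2) by blast
    have "{real i / real n..real (Suc i) / real n} \<subseteq> ball (real i / real n) \<delta> \<inter> {0..1}"
    proof
      fix x assume x: "x \<in> {real i / real n..real (Suc i) / real n}"
      then have "x - real i / real n \<le> 1 / real n" by (simp add: add_divide_distrib)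
      moreover have "0 \<le> x" using x by (meson atLeastAtMost_iff divide_nonneg_nonneg of_nat_0_le_iff order_trans)
      ultimately show "x \<in> ball (real i / real n) \<delta> \<inter> {0..1}"
        using x n(2) \<open>real (Suc i) / real n \<le> 1\<close> by (auto simp: dist_real_def)
    qed
    then show "\<exists>B\<in>\<B>. \<gamma> ` {real i / real n..real (Suc i) / real n} \<subseteq> B" using B by blast
  qed
  then show ?thesis ..
qed

text \<open>Each step is undone by the step back within the same member of the cover. Injectivity
  serves below where one would otherwise transport along a reversed path.\<close>

lemma tr_inj:
  assumes "ok \<gamma> n" "tr \<gamma> n v = tr \<gamma> n w"
  shows "v = w"
proof -
  have "chain_transport \<tau> (\<lambda>i. \<gamma> (real i / real n)) m v = chain_transport \<tau> (\<lambda>i. \<gamma> (real i / real n)) m w \<Longrightarrow> v = w"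
    if "m \<le> n" for m
    using that
  proof (induction m)
    case (Suc m)
    obtain B where B: "B \<in> \<B>" "\<gamma> ` {real m / real n..real (Suc m) / real n} \<subseteq> B"
      using assms(1) Suc.prems unfolding ok_def by (meson Suc_le_lessD)
    have "real m / real n \<le> real (Suc m) / real n" by (simp add: divide_right_mono)
    then have "\<gamma> (real m / real n) \<in> B" "\<gamma> (real (Suc m) / real n) \<in> B" by (auto intro!: subsetD[OF B(2)] imageI simp del: of_nat_Suc)
    note inv = inverse_step[OF B(1) this]
    have "chain_transport \<tau> (\<lambda>i. \<gamma> (real i / real n)) m v = chain_transport \<tau> (\<lambda>i. \<gamma> (real i / real n)) m w"
      using arg_cong[OF Suc.prems(1), of "\<tau> (\<gamma> (real (Suc m) / real n)) (\<gamma> (real m / real n))"]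
      by (simp only: chain_transport.simps inv)
    then show ?case using Suc.IH Suc.prems(2) by auto
  qed auto
  from this[of n] assms(2) show ?thesis by (simp add: tr_def)
qed

text \<open>Discrete form of a homotopy: the four corners of a cell lie in one member of the cover,
  so both ways around the cell agree; cells are composed to rows and rows to the square.\<close>

lemma grid_commutes:
  assumes "\<And>i j. i < n \<Longrightarrow> j < m \<Longrightarrow> \<exists>B\<in>\<B>. {h j i, h j (Suc i), h (Suc j) i, h (Suc j) (Suc i)} \<subseteq> B" "n > 0"
  shows "chain_transport \<tau> (\<lambda>j. h j n) m (chain_transport \<tau> (h 0) n w) =
    chain_transport \<tau> (h m) n (chain_transport \<tau> (\<lambda>j. h j 0) m w)"
  using assms
proof (induction m arbitrary: w)
  case (Suc m)
  have step: "\<tau> (h m i) (h (Suc m) i) (chain_transport \<tau> (h m) i v) =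
       chain_transport \<tau> (h (Suc m)) i (\<tau> (h m 0) (h (Suc m) 0) v)" if "i \<le> n" for i v
    using that
  proof (induction i)
    case (Suc i)
    obtain B where B: "B \<in> \<B>" "{h m i, h m (Suc i), h (Suc m) i, h (Suc m) (Suc i)} \<subseteq> B"
      using Suc.prems \<open>\<And>i j. i < n \<Longrightarrow> j < Suc m \<Longrightarrow> _\<close> by (metis Suc_le_lessD lessI)
    have "\<tau> (h m (Suc i)) (h (Suc m) (Suc i)) (\<tau> (h m i) (h m (Suc i)) (chain_transport \<tau> (h m) i v)) =
      \<tau> (h (Suc m) i) (h (Suc m) (Suc i)) (\<tau> (h m i) (h (Suc m) i) (chain_transport \<tau> (h m) i v))"
      using B cocycle[OF B(1)] by auto
    then show ?case using Suc by simp
  qed simp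
  have "chain_transport \<tau> (\<lambda>j. h j n) (Suc m) (chain_transport \<tau> (h 0) n w) =
     \<tau> (h m n) (h (Suc m) n) (chain_transport \<tau> (h m) n (chain_transport \<tau> (\<lambda>j. h j 0) m w))"
    using Suc by simp
  also have "\<dots> = chain_transport \<tau> (h (Suc m)) n (chain_transport \<tau> (\<lambda>j. h j 0) (Suc m) w)"
    using step[of n] by simp
  finally show ?case .
qed simp

lemma tr_const: "p \<in> \<Omega> \<Longrightarrow> tr (\<lambda>_. p) n w = w"
proof -
  assume p: "p \<in> \<Omega>"
  have "chain_transport \<tau> (\<lambda>i. p) m w = w" for m by (induction m) (auto simp: refl p)
  then show ?thesis by (simp add: tr_def)
qed

text \<open>A free homotopy moves the base point, but along the same track on both lateral sides of
  the square, because \<open>H (t, 1) = H (t, 0)\<close>. As the far side is constant, the grid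
  identity says that \<open>tr \<gamma>\<close> followed by the track equals the track alone, and
  transport along the track is injective.\<close>

lemma tr_loop:
  assumes sc: "simply_connected \<Omega>" and \<gamma>: "path \<gamma>" "path_image \<gamma> \<subseteq> \<Omega>" "pathfinish \<gamma> = pathstart \<gamma>"
    and ok: "ok \<gamma> m"
  shows "tr \<gamma> m w = w"
proof -
  define a where "a = \<gamma> 0"
  have a: "a \<in> \<Omega>" using \<gamma>(2) by (auto simp: a_def path_image_def)
  have "path (\<lambda>_. a) \<and> pathfinish (\<lambda>_. a) = pathstart (\<lambda>_. a) \<and> path_image (\<lambda>_. a) \<subseteq> \<Omega>"
    using a by (auto simp: path_def path_image_def pathfinish_def pathstart_def)
  then have "homotopic_loops \<Omega> \<gamma> (\<lambda>_. a)"
    using sc \<gamma> unfolding simply_connected_def by blast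
  then obtain H where H: "continuous_on ({0..1::real} \<times> {0..1::real}) H"
    "H \<in> ({0..1} \<times> {0..1}) \<rightarrow> \<Omega>" "\<And>x. x \<in> {0..1} \<Longrightarrow> H (0,x) = \<gamma> x" "\<And>x. x \<in> {0..1} \<Longrightarrow> H (1,x) = a"
    "\<And>t. t \<in> {0..1} \<Longrightarrow> H (t, 1) = H (t, 0)"
    unfolding homotopic_loops by (auto simp: pathfinish_def pathstart_def)
  obtain \<delta> where d: "\<delta> > 0"
    "\<And>x. x \<in> {0..1::real} \<times> {0..1::real} \<Longrightarrow> \<exists>B\<in>\<B>. H ` (ball x \<delta> \<inter> {0..1} \<times> {0..1}) \<subseteq> B"
  proof (rule grid_fine[OF H(1)])
    show "compact ({0..1::real} \<times> {0..1::real})" by (intro compact_Times) auto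
  qed (use H(2) in auto)
  \<comment> \<open>Each coordinate varies by at most \<open>1 / n\<close> within a cell, so the
    distance from its corner stays below \<open>\<delta>\<close>.\<close>
  obtain n where n: "n > 0" "1 / real n < \<delta> / 2"
    using d(1) by (metis real_arch_inverse inverse_eq_divide gr0I half_gt_zero)
  have cell: "\<exists>B\<in>\<B>. H ` ({real j / real n..real (Suc j) / real n} \<times> {real i / real n..real (Suc i) / real n}) \<subseteq> B"
    if ij: "i < n" "j < n" for i j
  proof -
    have le: "real (Suc k) / real n \<le> 1" if "k < n" for k using that by (simp add: divide_le_eq_1)
    have mem: "real k / real n \<in> {0..1}" if "k < n" for k using that by auto
    obtain B where B: "B \<in> \<B>" "H ` (ball (real j / real n, real i / real n) \<delta> \<inter> {0..1} \<times> {0..1}) \<subseteq> B"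
      using d(2)[of "(real j / real n, real i / real n)"] mem ij by auto
    have "{real j / real n..real (Suc j) / real n} \<times> {real i / real n..real (Suc i) / real n}
       \<subseteq> ball (real j / real n, real i / real n) \<delta> \<inter> {0..1} \<times> {0..1}"
    proof
      fix z assume z: "z \<in> {real j / real n..real (Suc j) / real n} \<times> {real i / real n..real (Suc i) / real n}"
      obtain x y where xy: "z = (x, y)" by (cases z)
      have 1: "x - real j / real n \<le> 1 / real n" "y - real i / real n \<le> 1 / real n"
        "real j / real n \<le> x" "real i / real n \<le> y"
        using z xy by (auto simp: add_divide_distrib)
      have 2: "0 \<le> x" "0 \<le> y" using 1(3,4) by (meson divide_nonneg_nonneg of_nat_0_le_iff order_trans)+
      have 3: "x \<le> 1" "y \<le> 1" using z xy le[OF ij(1)] le[OF ij(2)] by auto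
      have "dist (real j / real n, real i / real n) (x, y) \<le> dist (real j / real n) x + dist (real i / real n) y"
        unfolding dist_prod_def by (simp add: sqrt_sum_squares_le_sum)
      also have "\<dots> \<le> 1 / real n + 1 / real n"
        using 1 by (intro add_mono) (auto simp: dist_real_def)
      also have "\<dots> < \<delta>" using n(2) by simp
      finally show "z \<in> ball (real j / real n, real i / real n) \<delta> \<inter> {0..1} \<times> {0..1}"
        using 2 3 xy by auto
    qed
    then show ?thesis using B by blast
  qed
  define h where "h j i = H (real j / real n, real i / real n)" for j i
  have nn: "real n / real n = 1" using n by simp
  have in1: "real i / real n \<in> {0..1}" if "i \<le> n" for i using that n(1) by (auto simp: divide_le_eq_1)
  have okn: "ok \<gamma> n"
    unfolding ok_def
  proof (intro conjI allI impI n(1))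
    fix i assume i: "i < n"
    obtain B where B: "B \<in> \<B>" "H ` ({real 0 / real n..real (Suc 0) / real n} \<times> {real i / real n..real (Suc i) / real n}) \<subseteq> B"
      using cell[OF i, of 0] n(1) by auto
    have "\<gamma> x \<in> B" if x: "x \<in> {real i / real n..real (Suc i) / real n}" for x
    proof -
      have "x \<in> {0..1}" using x in1[of i] in1[of "Suc i"] i unfolding atLeastAtMost_iff Suc_le_eq by (meson less_imp_le order_trans)
      moreover have "H (0, x) \<in> B" using B(2) x by auto
      ultimately show ?thesis using H(3) by simp
    qed
    then show "\<exists>B\<in>\<B>. \<gamma> ` {real i / real n..real (Suc i) / real n} \<subseteq> B" using B(1) by blast
  qed
  have corners: "\<exists>B\<in>\<B>. {h j i, h j (Suc i), h (Suc j) i, h (Suc j) (Suc i)} \<subseteq> B" if ij: "i < n" "j < n" for i j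
  proof -
    obtain B where B: "B \<in> \<B>" "H ` ({real j / real n..real (Suc j) / real n} \<times> {real i / real n..real (Suc i) / real n}) \<subseteq> B"
      using cell[OF ij] by auto
    have "real k / real n \<le> real (Suc k) / real n" for k by (simp add: divide_right_mono)
    then show ?thesis using B unfolding h_def by (intro bexI[OF _ B(1)]) (auto intro!: subsetD[OF B(2)] imageI)
  qed
  have eq: "chain_transport \<tau> (\<lambda>j. h j n) n (chain_transport \<tau> (h 0) n w) =
    chain_transport \<tau> (h n) n (chain_transport \<tau> (\<lambda>j. h j 0) n w)"
    using grid_commutes[of n n h w] corners n(1) by blast
  have "chain_transport \<tau> (\<lambda>j. h j n) n v = chain_transport \<tau> (\<lambda>j. h j 0) n v" for v
    by (rule chain_transport_cong) (use H(5) in1 nn in \<open>auto simp: h_def\<close>)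
  moreover have "chain_transport \<tau> (h 0) n w = tr \<gamma> n w"
    unfolding tr_def by (rule chain_transport_cong) (use H(3) in1 in \<open>auto simp: h_def\<close>)
  moreover have "chain_transport \<tau> (h n) n v = v" for v
  proof -
    have "chain_transport \<tau> (h n) n v = chain_transport \<tau> (\<lambda>i. a) n v"
      by (rule chain_transport_cong) (use H(4) in1 nn in \<open>auto simp: h_def\<close>)
    then show ?thesis using tr_const[OF a, of n v] by (simp add: tr_def)
  qed
  ultimately have side: "chain_transport \<tau> (\<lambda>j. h j 0) n (tr \<gamma> n w) = chain_transport \<tau> (\<lambda>j. h j 0) n w"
    using eq by simp
  have "ok (\<lambda>t. H (t, 0)) n"
    unfolding ok_def
  proof (intro conjI allI impI n(1))
    fix j assume j: "j < n"
    obtain B where B: "B \<in> \<B>" "H ` ({real j / real n..real (Suc j) / real n} \<times> {real 0 / real n..real (Suc 0) / real n}) \<subseteq> B"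
      using cell[OF _ j, of 0] n(1) by auto
    have "(\<lambda>t. H (t, 0)) ` {real j / real n..real (Suc j) / real n} \<subseteq> B"
      by (auto intro!: subsetD[OF B(2)] imageI simp del: of_nat_Suc)
    then show "\<exists>B\<in>\<B>. (\<lambda>t. H (t, 0)) ` {real j / real n..real (Suc j) / real n} \<subseteq> B" using B(1) by blast
  qed
  then have "tr \<gamma> n w = w" by (rule tr_inj) (use side in \<open>simp add: tr_def h_def[abs_def]\<close>)
  then show ?thesis using tr_indep[OF ok okn] by simp
qed

text \<open>Both paths are cut into the same number of pieces, so that the equal subdivision of the
  joined path into \<open>n + n\<close> pieces breaks at the joint.\<close>

lemma tr_join:
  assumes "ok \<gamma> n" "ok \<delta> n" "pathfinish \<gamma> = pathstart \<delta>"
  shows "ok (\<gamma> +++ \<delta>) (n + n)" "tr (\<gamma> +++ \<delta>) (n + n) w = tr \<delta> n (tr \<gamma> n w)"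
proof -
  have n: "n > 0" using assms by (simp add: ok_def)
  have g: "(\<gamma> +++ \<delta>) x = \<gamma> (2 * x)" if "x \<le> 1/2" for x using that by (simp add: joinpaths_def)
  have dl: "(\<gamma> +++ \<delta>) x = \<delta> (2 * x - 1)" if "x \<ge> 1/2" for x
  proof (cases "x = 1/2")
    case True then show ?thesis using assms(3) by (simp add: True joinpaths_def pathfinish_def pathstart_def)
  qed (use that in \<open>auto simp: joinpaths_def\<close>)
  show "ok (\<gamma> +++ \<delta>) (n + n)"
    unfolding ok_def
  proof (intro conjI allI impI)
    fix i assume i: "i < n + n"
    show "\<exists>B\<in>\<B>. (\<gamma> +++ \<delta>) ` {real i / real (n + n)..real (Suc i) / real (n + n)} \<subseteq> B"
    proof (cases "i < n")
      case True
      obtain B where B: "B \<in> \<B>" "\<gamma> ` {real i / real n..real (Suc i) / real n} \<subseteq> B"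
        using assms(1) True by (auto simp: ok_def)
      have "(\<gamma> +++ \<delta>) x \<in> B" if x: "x \<in> {real i / real (n + n)..real (Suc i) / real (n + n)}" for x
      proof -
        have e: "real k / real (n + n) = real k / real n / 2" for k by simp
        have le1: "real (Suc i) / real n \<le> 1" using True by (simp add: divide_le_eq_1)
        have x2: "2 * x \<in> {real i / real n..real (Suc i) / real n}" using x unfolding e by auto
        then have "x \<le> 1/2" using le1 by auto
        then show ?thesis using g[of x] x2 B(2) by auto
      qed
      then show ?thesis using B(1) by blast
    next
      case False
      define i' where "i' = i - n"
      have i': "i = n + i'" "i' < n" using i False by (auto simp: i'_def)
      obtain B where B: "B \<in> \<B>" "\<delta> ` {real i' / real n..real (Suc i') / real n} \<subseteq> B"
        using assms(2) i'(2) by (auto simp: ok_def)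
      have "(\<gamma> +++ \<delta>) x \<in> B" if x: "x \<in> {real i / real (n + n)..real (Suc i) / real (n + n)}" for x
      proof -
        have e: "real (n + k) / real (n + n) = (1 + real k / real n) / 2" for k using n by (simp add: field_simps)
        have "real (Suc i) / real (n + n) = (1 + real (Suc i') / real n) / 2" using e[of "Suc i'"] i'(1) by simp
        moreover have "real i / real (n + n) = (1 + real i' / real n) / 2" using e[of "i'"] i'(1) by simp
        ultimately have x2: "2 * x - 1 \<in> {real i' / real n..real (Suc i') / real n}" using x by (simp del: of_nat_Suc of_nat_add)
        moreover have "0 \<le> real i' / real n" by simp
        ultimately have "x \<ge> 1/2" by (smt (verit) atLeastAtMost_iff field_sum_of_halves)
        then show ?thesis using dl[of x] x2 B(2) by auto
      qed
      then show ?thesis using B(1) by blast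
    qed
  qed (use n in auto)
  have "chain_transport \<tau> (\<lambda>i. (\<gamma> +++ \<delta>) (real i / real (n + n))) n w = tr \<gamma> n w"
    unfolding tr_def
  proof (rule chain_transport_cong)
    fix i assume "i \<le> n"
    then have "real i / real (n + n) \<le> 1/2" using n by (simp add: field_simps)
    then show "(\<gamma> +++ \<delta>) (real i / real (n + n)) = \<gamma> (real i / real n)" using g by auto
  qed
  moreover have "chain_transport \<tau> (\<lambda>i. (\<gamma> +++ \<delta>) (real (n + i) / real (n + n))) n v = tr \<delta> n v" for v
    unfolding tr_def
  proof (rule chain_transport_cong)
    fix i assume "i \<le> n"
    have "real (n + i) / real (n + n) = (1 + real i / real n) / 2" using n by (simp add: field_simps)
    note v0 = this
    have v: "2 * ((1 + real i / real n) / 2) - 1 = real i / real n" by (simp del: distrib_left_numeral)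
    show "(\<gamma> +++ \<delta>) (real (n + i) / real (n + n)) = \<delta> (real i / real n)"
      using dl[of "(1 + real i / real n) / 2"] by (simp only: v v0) simp
  qed
  ultimately show "tr (\<gamma> +++ \<delta>) (n + n) w = tr \<delta> n (tr \<gamma> n w)"
    unfolding tr_def[of "\<gamma> +++ \<delta>"] by (simp add: chain_transport_add)
qed

definition transport :: "(real \<Rightarrow> 'p) \<Rightarrow> 'm \<Rightarrow> 'm" where
  "transport \<gamma> = tr \<gamma> (SOME n. ok \<gamma> n)"

lemma transport_eq: "ok \<gamma> n \<Longrightarrow> transport \<gamma> = tr \<gamma> n"
  unfolding transport_def by (metis someI tr_indep)

lemma transport_join:
  assumes "path \<gamma>" "path_image \<gamma> \<subseteq> \<Omega>" "path \<delta>" "path_image \<delta> \<subseteq> \<Omega>" "pathfinish \<gamma> = pathstart \<delta>"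
  shows "transport (\<gamma> +++ \<delta>) w = transport \<delta> (transport \<gamma> w)"
proof -
  obtain n m where "ok \<gamma> n" "ok \<delta> m" using ok_exists assms by metis
  then have ok: "ok \<gamma> (n * m)" "ok \<delta> (n * m)"
    using ok_refine(1)[of \<gamma> n m] ok_refine(1)[of \<delta> m n] by (auto simp: mult.commute ok_def)
  show ?thesis using tr_join[OF ok assms(5)] ok transport_eq by metis
qed

text \<open>\<open>G p\<close> is the transport of \<open>w0\<close> along a chosen path from
  \<open>p0\<close> to \<open>p\<close>. For \<open>p\<close> and \<open>q\<close> in one member of
  the cover, the path \<open>c q\<close>, and the path \<open>c p\<close> prolonged inside that
  member to \<open>q\<close>, are closed up by the same return path \<open>e q\<close>. Both loops
  act trivially and transport along \<open>e q\<close> is injective.\<close>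

theorem coboundary:
  assumes sc: "simply_connected \<Omega>" and p0: "p0 \<in> \<Omega>"
  shows "\<exists>G. G p0 = w0 \<and> (\<forall>B\<in>\<B>. \<forall>p\<in>B. \<forall>q\<in>B. G q = \<tau> p q (G p))"
proof -
  have "path_connected \<Omega>" by (rule simply_connected_path_connected[OF sc])
  then have "\<forall>p\<in>\<Omega>. \<exists>\<gamma>. path \<gamma> \<and> path_image \<gamma> \<subseteq> \<Omega> \<and> pathstart \<gamma> = p0 \<and> pathfinish \<gamma> = p"
    and "\<forall>p\<in>\<Omega>. \<exists>\<gamma>. path \<gamma> \<and> path_image \<gamma> \<subseteq> \<Omega> \<and> pathstart \<gamma> = p \<and> pathfinish \<gamma> = p0"
    using p0 by (auto simp: path_connected_def)
  then obtain c e where c: "\<And>p. p \<in> \<Omega> \<Longrightarrow> path (c p) \<and> path_image (c p) \<subseteq> \<Omega> \<and> pathstart (c p) = p0 \<and> pathfinish (c p) = p"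
    and e: "\<And>p. p \<in> \<Omega> \<Longrightarrow> path (e p) \<and> path_image (e p) \<subseteq> \<Omega> \<and> pathstart (e p) = p \<and> pathfinish (e p) = p0"
    by metis
  have loop: "transport \<gamma> w = w" if "path \<gamma>" "path_image \<gamma> \<subseteq> \<Omega>" "pathfinish \<gamma> = pathstart \<gamma>" for \<gamma> w
    using that tr_loop[OF sc that] ok_exists[OF that(1,2)] transport_eq by metis
  define G where "G p = transport (c p) w0" for p
  have "G p0 = w0" unfolding G_def using c[OF p0] loop[of "c p0"] by auto
  moreover have "G q = \<tau> p q (G p)" if B: "B \<in> \<B>" "p \<in> B" "q \<in> B" for B p q
  proof -
    have pq: "p \<in> \<Omega>" "q \<in> \<Omega>" using B cover by auto
    obtain \<delta> where \<delta>: "path \<delta>" "path_image \<delta> \<subseteq> B" "pathstart \<delta> = p" "pathfinish \<delta> = q"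
      using pc[OF B(1)] B unfolding path_connected_def by blast
    have \<delta>\<Omega>: "path_image \<delta> \<subseteq> \<Omega>" using \<delta>(2) B(1) cover by auto
    have "ok \<delta> 1" unfolding ok_def using \<delta>(2) B(1) by (auto simp: path_image_def)
    then have t\<delta>: "transport \<delta> v = \<tau> p q v" for v
      using transport_eq[of \<delta> 1] \<delta>(3,4) by (simp add: tr_def pathstart_def pathfinish_def)
    have 1: "transport (e q) (transport (c q) w0) = w0"
      using transport_join[of "c q" "e q" w0] loop[of "c q +++ e q" w0] c[OF pq(2)] e[OF pq(2)]
      by (auto simp: path_image_join)
    have 2: "transport (e q) (\<tau> p q (transport (c p) w0)) = w0"
      using transport_join[of "c p" \<delta> w0] transport_join[of "c p +++ \<delta>" "e q" w0]
        loop[of "(c p +++ \<delta>) +++ e q" w0] c[OF pq(1)] e[OF pq(2)] \<delta> \<delta>\<Omega> t\<delta>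
      by (auto simp: path_image_join)
    obtain n where "ok (e q) n" using ok_exists e[OF pq(2)] by blast
    then show ?thesis unfolding G_def using 1 2 tr_inj transport_eq by metis
  qed
  ultimately show ?thesis by blast
qed

end

section \<open>Holomorphic functions of finitely many coordinates\<close>

text \<open>
  Points have coordinates indexed by an arbitrary type, of which only those in the finite set
  \<open>I\<close> vary over the domain: this allows finitely many variables inside a function space.
\<close>

definition polybox :: "'i set \<Rightarrow> ('i \<Rightarrow> complex) \<Rightarrow> real \<Rightarrow> ('i \<Rightarrow> complex) set" where
  "polybox I a e = {p. (\<forall>k\<in>I. dist (p k) (a k) < e) \<and> (\<forall>k. k \<notin> I \<longrightarrow> p k = a k)}"

definition hdom :: "'i set \<Rightarrow> ('i \<Rightarrow> complex) set \<Rightarrow> bool" where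
  "hdom I \<Omega> \<longleftrightarrow> finite I \<and> (\<forall>a\<in>\<Omega>. \<exists>e>0. polybox I a e \<subseteq> \<Omega>) \<and>
     (\<forall>p\<in>\<Omega>. \<forall>q\<in>\<Omega>. \<forall>k. k \<notin> I \<longrightarrow> p k = q k)"

definition pd :: "'i \<Rightarrow> (('i \<Rightarrow> complex) \<Rightarrow> complex) \<Rightarrow> ('i \<Rightarrow> complex) \<Rightarrow> complex" where
  "pd i f p = deriv (\<lambda>s. f (p(i := s))) (p i)"

text \<open>Holomorphy in the sense of Osgood: separate differentiability together with joint
  continuity. The latter is what allows Cauchy integrals to be differentiated under the integral
  sign.\<close>

definition hol :: "'i set \<Rightarrow> ('i \<Rightarrow> complex) set \<Rightarrow> (('i \<Rightarrow> complex) \<Rightarrow> complex) \<Rightarrow> bool" where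
  "hol I \<Omega> f \<longleftrightarrow> continuous_on \<Omega> f \<and>
     (\<forall>p\<in>\<Omega>. \<forall>i\<in>I. (\<lambda>s. f (p(i := s))) field_differentiable at (p i))"

section \<open>Polydiscs and domains in finitely many coordinates\<close>

lemma polybox_upd: "p \<in> polybox I a e \<Longrightarrow> i \<in> I \<Longrightarrow> dist s (a i) < e \<Longrightarrow> p(i := s) \<in> polybox I a e"
  by (auto simp: polybox_def)

lemma polybox_center: "0 < e \<Longrightarrow> a \<in> polybox I a e"
  by (auto simp: polybox_def)

lemma polybox_mono: "d \<le> e \<Longrightarrow> polybox I a d \<subseteq> polybox I a e"
  by (force simp: polybox_def)

lemma polybox_trans: "p \<in> polybox I a d \<Longrightarrow> d + d' \<le> e \<Longrightarrow> polybox I p d' \<subseteq> polybox I a e"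
proof
  fix q assume p: "p \<in> polybox I a d" and le: "d + d' \<le> e" and q: "q \<in> polybox I p d'"
  have "dist (q k) (a k) < e" if "k \<in> I" for k
  proof -
    have "dist (q k) (a k) \<le> dist (q k) (p k) + dist (p k) (a k)" by (rule dist_triangle)
    moreover have "dist (q k) (p k) < d'" "dist (p k) (a k) < d" using p q that by (auto simp: polybox_def)
    ultimately show ?thesis using le by linarith
  qed
  then show "q \<in> polybox I a e" using p q by (auto simp: polybox_def)
qed

lemma polybox_inner:
  assumes "finite I" "p \<in> polybox I a e"
  shows "\<exists>d>0. polybox I p d \<subseteq> polybox I a e"
proof (cases "I = {}")
  case True
  then show ?thesis using assms by (intro exI[of _ 1]) (auto simp: polybox_def)
next
  case False
  define d where "d = Min ((\<lambda>k. e - dist (p k) (a k)) ` I)"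
  have d: "d > 0" unfolding d_def using assms False by (subst Min_gr_iff) (auto simp: polybox_def)
  have "dist (p k) (a k) + d \<le> e" if "k \<in> I" for k
  proof -
    have "d \<le> e - dist (p k) (a k)" unfolding d_def using assms that by (intro Min_le) auto
    then show ?thesis by simp
  qed
  then have "polybox I p d \<subseteq> polybox I a e"
  proof (intro subsetI)
    fix q assume q: "q \<in> polybox I p d"
    have "dist (q k) (a k) < e" if "k \<in> I" for k
    proof -
      have "dist (q k) (a k) \<le> dist (q k) (p k) + dist (p k) (a k)" by (rule dist_triangle)
      moreover have "dist (q k) (p k) < d" using q that by (auto simp: polybox_def)
      ultimately show ?thesis using \<open>\<And>k. k \<in> I \<Longrightarrow> dist (p k) (a k) + d \<le> e\<close>[OF that] by linarith
    qed
    then show "q \<in> polybox I a e" using assms(2) q by (auto simp: polybox_def)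
  qed
  then show ?thesis using d by blast
qed

lemma hdom_polybox:
  assumes "finite I"
  shows "hdom I (polybox I a e)"
  unfolding hdom_def
proof (intro conjI ballI allI impI)
  show "\<exists>d>0. polybox I p d \<subseteq> polybox I a e" if "p \<in> polybox I a e" for p
    by (rule polybox_inner[OF assms that])
qed (use assms in \<open>simp_all add: polybox_def\<close>)

text \<open>The radius condition concerns finitely many coordinates and is therefore open in the
  product topology; the remaining coordinates are constant on all of
  \<open>\<Omega>\<close>.\<close>

lemma openin_polybox:
  assumes "hdom I \<Omega>" "a \<in> \<Omega>" "polybox I a e \<subseteq> \<Omega>"
  shows "openin (top_of_set \<Omega>) (polybox I a e)"
proof -
  have fin: "finite I" using assms by (simp add: hdom_def)
  have "open {p. \<forall>k\<in>I. dist (p k) (a k) < e}"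
  proof -
    have "open {p::'a \<Rightarrow> complex. dist (p k) (a k) < e}" for k
      by (intro open_Collect_less continuous_intros continuous_on_product_coordinates)
    then have "open (\<Inter>k\<in>I. {p::'a \<Rightarrow> complex. dist (p k) (a k) < e})" using fin by (intro open_INT) auto
    also have "(\<Inter>k\<in>I. {p::'a \<Rightarrow> complex. dist (p k) (a k) < e}) = {p. \<forall>k\<in>I. dist (p k) (a k) < e}" by auto
    finally show ?thesis .
  qed
  moreover have "polybox I a e = \<Omega> \<inter> {p. \<forall>k\<in>I. dist (p k) (a k) < e}"
  proof (intro equalityI subsetI)
    fix p assume "p \<in> polybox I a e"
    then show "p \<in> \<Omega> \<inter> {p. \<forall>k\<in>I. dist (p k) (a k) < e}" using assms(3) by (auto simp: polybox_def)
  next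
    fix p assume p: "p \<in> \<Omega> \<inter> {p. \<forall>k\<in>I. dist (p k) (a k) < e}"
    have "\<forall>k. k \<notin> I \<longrightarrow> p k = a k" using assms(1,2) p unfolding hdom_def by blast
    then show "p \<in> polybox I a e" using p by (simp add: polybox_def)
  qed
  ultimately show ?thesis unfolding openin_open by blast
qed

lemma hdom_continuous_onI:
  assumes "hdom I \<Omega>" "\<And>a. a \<in> \<Omega> \<Longrightarrow> \<exists>e>0. polybox I a e \<subseteq> \<Omega> \<and> continuous_on (polybox I a e) f"
  shows "continuous_on \<Omega> f"
proof -
  obtain e where e: "\<And>a. a \<in> \<Omega> \<Longrightarrow> e a > 0 \<and> polybox I a (e a) \<subseteq> \<Omega> \<and> continuous_on (polybox I a (e a)) f"
    using assms(2) by metis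
  have "(f \<longlongrightarrow> f a) (at a within \<Omega>)" if a: "a \<in> \<Omega>" for a
  proof -
    obtain U where U: "open U" "polybox I a (e a) = \<Omega> \<inter> U"
      using openin_polybox[OF assms(1) a, of "e a"] e[OF a] unfolding openin_open by blast
    have aU: "a \<in> polybox I a (e a)" using e[OF a] polybox_center by auto
    have "at a within \<Omega> = at a within polybox I a (e a)"
      by (rule at_within_nhd[of a U]) (use U aU in auto)
    then show ?thesis using e[OF a] aU by (auto simp: continuous_on_def)
  qed
  then show ?thesis by (simp add: continuous_on_def)
qed

lemma hdom_upd:
  assumes "hdom I \<Omega>" "p \<in> \<Omega>" "i \<in> I"
  shows "\<exists>d>0. \<forall>s\<in>ball (p i) d. p(i := s) \<in> \<Omega>"
proof -
  obtain e where e: "e > 0" "polybox I p e \<subseteq> \<Omega>" using assms by (auto simp: hdom_def)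
  have "p(i := s) \<in> \<Omega>" if "s \<in> ball (p i) e" for s
    using polybox_upd[OF polybox_center[OF e(1)] assms(3), of s] that e(2) by (auto simp: dist_commute)
  then show ?thesis using e(1) by blast
qed

section \<open>Closure properties and differentiation rules\<close>

lemma hol_continuous: "hol I \<Omega> f \<Longrightarrow> continuous_on \<Omega> f"
  by (simp add: hol_def)

lemma hol_deriv:
  assumes "hol I \<Omega> f" "p \<in> \<Omega>" "i \<in> I"
  shows "((\<lambda>s. f (p(i := s))) has_field_derivative pd i f p) (at (p i))"
  using assms by (auto simp: hol_def pd_def DERIV_deriv_iff_field_differentiable)

lemma hol_deriv_at:
  assumes "hol I \<Omega> f" "p(i := s) \<in> \<Omega>" "i \<in> I"
  shows "((\<lambda>s. f (p(i := s))) has_field_derivative pd i f (p(i := s))) (at s)"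
  using hol_deriv[OF assms] by simp

lemma pd_eqI: "((\<lambda>s. f (p(i := s))) has_field_derivative D) (at (p i)) \<Longrightarrow> pd i f p = D"
  by (simp add: pd_def DERIV_imp_deriv)

lemma holI:
  assumes "continuous_on \<Omega> f"
    "\<And>p i. p \<in> \<Omega> \<Longrightarrow> i \<in> I \<Longrightarrow> ((\<lambda>s. f (p(i := s))) has_field_derivative D i p) (at (p i))"
  shows "hol I \<Omega> f"
  using assms by (auto simp: hol_def field_differentiable_def)

lemma continuous_on_fun_upd [continuous_intros]:
  fixes g :: "'x::topological_space \<Rightarrow> 'i \<Rightarrow> complex"
  assumes "continuous_on S g" "continuous_on S h"
  shows "continuous_on S (\<lambda>x. (g x)(i := h x))"
proof (rule continuous_on_coordinatewise_then_product)
  fix k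
  have "continuous_on S (\<lambda>x. g x k)"
    using continuous_on_product_then_coordinatewise[OF assms(1)] .
  then show "continuous_on S (\<lambda>x. ((g x)(i := h x)) k)" using assms(2) by (cases "k = i") auto
qed

lemma hol_subset: "hol I \<Omega> f \<Longrightarrow> \<Omega>' \<subseteq> \<Omega> \<Longrightarrow> hol I \<Omega>' f"
  by (auto simp: hol_def intro: continuous_on_subset)

lemma hol_eventually:
  assumes "hdom I \<Omega>" "p \<in> \<Omega>" "i \<in> I"
  shows "eventually (\<lambda>s. p(i := s) \<in> \<Omega>) (nhds (p i))"
  using hdom_upd[OF assms] by (auto simp: eventually_nhds_metric dist_commute)

lemma pd_cong:
  assumes "hdom I \<Omega>" "p \<in> \<Omega>" "i \<in> I" "\<And>q. q \<in> \<Omega> \<Longrightarrow> f q = g q"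
  shows "pd i f p = pd i g p"
  unfolding pd_def
  by (rule deriv_cong_ev) (use hol_eventually[OF assms(1-3)] assms(4) in \<open>auto elim: eventually_mono\<close>)

lemma hol_cong:
  assumes "hdom I \<Omega>" "\<And>q. q \<in> \<Omega> \<Longrightarrow> f q = g q" "hol I \<Omega> f"
  shows "hol I \<Omega> g"
proof (rule holI)
  show "continuous_on \<Omega> g" using assms(2,3) continuous_on_cong by (metis hol_continuous)
  fix p i assume p: "p \<in> \<Omega>" "i \<in> I"
  have "((\<lambda>s. f (p(i := s))) has_field_derivative pd i f p) (at (p i))" using hol_deriv[OF assms(3) p] .
  then show "((\<lambda>s. g (p(i := s))) has_field_derivative pd i f p) (at (p i))"
    by (rule DERIV_cong_ev[THEN iffD1, rotated -1])
       (use hol_eventually[OF assms(1) p] assms(2) in \<open>auto elim: eventually_mono\<close>)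
qed

lemma hol_const [intro, simp]: "hol I \<Omega> (\<lambda>p. c)"
  by (auto simp: hol_def)

lemma hol_coord: "hol I \<Omega> (\<lambda>p. p k)"
proof (rule holI[where D = "\<lambda>i p. if k = i then 1 else 0"])
  show "continuous_on \<Omega> (\<lambda>p. p k)"
    by (rule continuous_on_subset[OF continuous_on_product_coordinates]) simp
  fix p :: "'a \<Rightarrow> complex" and i
  show "((\<lambda>s. (p(i := s)) k) has_field_derivative (if k = i then 1 else 0)) (at (p i))"
    by auto
qed

lemma pd_coord: "pd i (\<lambda>p. p k) p = (if k = i then 1 else 0)"
  by (rule pd_eqI) auto

lemma pd_const [simp]: "pd i (\<lambda>p. c) p = 0"
  by (simp add: pd_def)

lemma hol_add:
  assumes f: "hol I \<Omega> f" and g: "hol I \<Omega> g"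
  shows "hol I \<Omega> (\<lambda>p. f p + g p)"
proof (rule holI[where D = "\<lambda>i p. pd i f p + pd i g p"])
  show "continuous_on \<Omega> (\<lambda>p. f p + g p)" by (rule continuous_on_add[OF hol_continuous[OF f] hol_continuous[OF g]])
  fix p i assume p: "p \<in> \<Omega>" "i \<in> I"
  show "((\<lambda>s. f (p(i := s)) + g (p(i := s))) has_field_derivative pd i f p + pd i g p) (at (p i))"
    using DERIV_add[OF hol_deriv[OF f p] hol_deriv[OF g p]] by simp
qed

lemma hol_diff:
  assumes f: "hol I \<Omega> f" and g: "hol I \<Omega> g"
  shows "hol I \<Omega> (\<lambda>p. f p - g p)"
proof (rule holI[where D = "\<lambda>i p. pd i f p - pd i g p"])
  show "continuous_on \<Omega> (\<lambda>p. f p - g p)" by (rule continuous_on_diff[OF hol_continuous[OF f] hol_continuous[OF g]])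
  fix p i assume p: "p \<in> \<Omega>" "i \<in> I"
  show "((\<lambda>s. f (p(i := s)) - g (p(i := s))) has_field_derivative pd i f p - pd i g p) (at (p i))"
    using DERIV_diff[OF hol_deriv[OF f p] hol_deriv[OF g p]] by simp
qed

lemma hol_mult:
  assumes f: "hol I \<Omega> f" and g: "hol I \<Omega> g"
  shows "hol I \<Omega> (\<lambda>p. f p * g p)"
proof (rule holI[where D = "\<lambda>i p. pd i f p * g p + pd i g p * f p"])
  show "continuous_on \<Omega> (\<lambda>p. f p * g p)" by (rule continuous_on_mult[OF hol_continuous[OF f] hol_continuous[OF g]])
  fix p i assume p: "p \<in> \<Omega>" "i \<in> I"
  show "((\<lambda>s. f (p(i := s)) * g (p(i := s))) has_field_derivative pd i f p * g p + pd i g p * f p) (at (p i))"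
    using DERIV_mult[OF hol_deriv[OF f p] hol_deriv[OF g p]] by simp
qed

lemma hol_minus: "hol I \<Omega> f \<Longrightarrow> hol I \<Omega> (\<lambda>p. - f p)"
  using hol_diff[of I \<Omega> "\<lambda>_. 0" f] by simp

lemma hol_power: "hol I \<Omega> f \<Longrightarrow> hol I \<Omega> (\<lambda>p. f p ^ n)"
  by (induction n) (simp_all add: hol_mult)

lemma hol_sum: "(\<And>x. x \<in> S \<Longrightarrow> hol I \<Omega> (f x)) \<Longrightarrow> hol I \<Omega> (\<lambda>p. \<Sum>x\<in>S. f x p)"
  by (induction S rule: infinite_finite_induct) (simp_all add: hol_add)

lemma hol_prod: "(\<And>x. x \<in> S \<Longrightarrow> hol I \<Omega> (f x)) \<Longrightarrow> hol I \<Omega> (\<lambda>p. \<Prod>x\<in>S. f x p)"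
  by (induction S rule: infinite_finite_induct) (simp_all add: hol_mult)

lemma hol_inverse:
  assumes f: "hol I \<Omega> f" and nz: "\<And>p. p \<in> \<Omega> \<Longrightarrow> f p \<noteq> 0"
  shows "hol I \<Omega> (\<lambda>p. inverse (f p))"
proof (rule holI[where D = "\<lambda>i p. - (inverse (f (p(i := p i))) * pd i f p * inverse (f (p(i := p i))))"])
  show "continuous_on \<Omega> (\<lambda>p. inverse (f p))"
    by (rule continuous_on_inverse[OF hol_continuous[OF f]]) (use nz in blast)
  fix p i assume p: "p \<in> \<Omega>" "i \<in> I"
  show "((\<lambda>s. inverse (f (p(i := s)))) has_field_derivative
      - (inverse (f (p(i := p i))) * pd i f p * inverse (f (p(i := p i))))) (at (p i))"
    by (rule DERIV_inverse'[OF hol_deriv[OF f p]]) (use nz p in simp)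
qed

lemma hol_divide:
  assumes "hol I \<Omega> f" "hol I \<Omega> g" "\<And>p. p \<in> \<Omega> \<Longrightarrow> g p \<noteq> 0"
  shows "hol I \<Omega> (\<lambda>p. f p / g p)"
  unfolding divide_inverse by (rule hol_mult[OF assms(1) hol_inverse[OF assms(2,3)]])

lemma pd_diff:
  assumes "hol I \<Omega> f" "hol I \<Omega> g" "p \<in> \<Omega>" "i \<in> I"
  shows "pd i (\<lambda>p. f p - g p) p = pd i f p - pd i g p"
  by (rule pd_eqI[OF DERIV_diff[OF hol_deriv[OF assms(1,3,4)] hol_deriv[OF assms(2,3,4)]]])

lemma pd_mult:
  assumes "hol I \<Omega> f" "hol I \<Omega> g" "p \<in> \<Omega>" "i \<in> I"
  shows "pd i (\<lambda>p. f p * g p) p = pd i f p * g p + f p * pd i g p"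
  using DERIV_mult[OF hol_deriv[OF assms(1,3,4)] hol_deriv[OF assms(2,3,4)]]
  by (intro pd_eqI) (simp add: algebra_simps)

lemma pd_sum:
  assumes "\<And>x. x \<in> S \<Longrightarrow> hol I \<Omega> (f x)" "p \<in> \<Omega>" "i \<in> I"
  shows "pd i (\<lambda>p. \<Sum>x\<in>S. f x p) p = (\<Sum>x\<in>S. pd i (f x) p)"
  by (rule pd_eqI[OF DERIV_sum[OF hol_deriv[OF assms(1) assms(2,3)]]])

section \<open>Cauchy's integral formula and mixed partial derivatives\<close>

lemma deriv_integral:
  fixes F :: "('i \<Rightarrow> complex) \<Rightarrow> real \<Rightarrow> complex"
  assumes dom: "hdom I \<Omega>" and i: "i \<in> I" and p: "p \<in> \<Omega>"
    and cF: "continuous_on (\<Omega> \<times> {0..1}) (\<lambda>(p, t). F p t)"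
    and dF: "\<And>p t. p \<in> \<Omega> \<Longrightarrow> t \<in> {0..1} \<Longrightarrow>
       ((\<lambda>s. F (p(i := s)) t) has_field_derivative F' p t) (at (p i))"
    and cF': "continuous_on (\<Omega> \<times> {0..1}) (\<lambda>(p, t). F' p t)"
  shows "((\<lambda>s. integral {0..1} (F (p(i := s)))) has_field_derivative integral {0..1} (F' p)) (at (p i))"
proof -
  obtain d where d: "d > 0" "\<And>s. s \<in> ball (p i) d \<Longrightarrow> p(i := s) \<in> \<Omega>" using hdom_upd[OF dom p i] by auto
  have cu: "continuous_on S (\<lambda>z. (p(i := g z)))" if "continuous_on S g" for S :: "'z::topological_space set" and g
    by (intro continuous_intros that)
  have "((\<lambda>s. integral (cbox 0 1) (F (p(i := s)))) has_field_derivative integral (cbox 0 1) (F' (p(i := p i))))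
     (at (p i) within ball (p i) d)"
  proof (rule leibniz_rule_field_derivative[where fx = "\<lambda>s t. F' (p(i := s)) t" and U = "ball (p i) d"])
    fix s and t :: real assume s: "s \<in> ball (p i) d" and t: "t \<in> cbox 0 1"
    show "((\<lambda>s. F (p(i := s)) t) has_field_derivative F' (p(i := s)) t) (at s within ball (p i) d)"
      using dF[OF d(2)[OF s], of t] t by (auto intro: has_field_derivative_at_within)
  next
    fix s assume s: "s \<in> ball (p i) d"
    have "continuous_on {0..1} (\<lambda>t. case (p(i := s), t) of (p, t) \<Rightarrow> F p t)"
      by (rule continuous_on_compose2[OF cF]) (use d(2)[OF s] in \<open>auto intro: continuous_on_Pair continuous_on_const continuous_on_id\<close>)
    then have "continuous_on (cbox 0 1) (F (p(i := s)))" by simp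
    then show "F (p(i := s)) integrable_on cbox 0 1" by (rule integrable_continuous)
  next
    have "continuous_on (ball (p i) d \<times> {0..1}) (\<lambda>z. case (p(i := fst z), snd z) of (p, t) \<Rightarrow> F' p t)"
    proof (rule continuous_on_compose2[OF cF'])
      show "continuous_on (ball (p i) d \<times> {0..1}) (\<lambda>z. (p(i := fst z), snd z))"
        by (intro continuous_on_Pair cu continuous_on_fst continuous_on_snd continuous_on_id)
    qed (use d(2) in auto)
    then show "continuous_on (ball (p i) d \<times> cbox 0 1) (\<lambda>(s, t). F' (p(i := s)) t)"
      by (simp add: case_prod_unfold)
  qed (use d(1) in auto)
  then show ?thesis using d(1) by (simp add: at_within_open[of _ "ball (p i) d"])
qed

text \<open>The kernel of Cauchy's formula for the first derivative, pulled back to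
  \<open>{0..1}\<close>; the factor \<open>2 * pi * \<i>\<close> from the parametrisation of the
  circle cancels the prefactor of the formula.\<close>

definition cauchy_kernel :: "complex \<Rightarrow> real \<Rightarrow> complex \<Rightarrow> real \<Rightarrow> complex" where
  "cauchy_kernel z r w t = (of_real r * exp (2 * of_real pi * \<i> * of_real t)) / (circlepath z r t - w)\<^sup>2"

text \<open>The circle is centred at the centre of the box and not at \<open>p\<close>. Thus one
  formula, whose kernel depends on \<open>p\<close> only through \<open>p j\<close>, serves the
  whole half box and can be differentiated in the other variables.\<close>

lemma pd_cauchy:
  assumes f: "hol I \<Omega> f" and e: "e > 0" "polybox I a e \<subseteq> \<Omega>" and p: "p \<in> polybox I a (e/2)" and j: "j \<in> I"
  shows "pd j f p = integral {0..1} (\<lambda>t. f (p(j := circlepath (a j) (e/2) t)) * cauchy_kernel (a j) (e/2) (p j) t)"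
proof -
  let ?g = "\<lambda>s. f (p(j := s))"
  let ?\<gamma> = "circlepath (a j) (e/2)"
  have pe: "p \<in> polybox I a e" using polybox_mono[of "e/2" e I a] p e by auto
  have der: "(?g has_field_derivative pd j f (p(j := s))) (at s)" if "s \<in> ball (a j) e" for s
    by (rule hol_deriv_at[OF f _ j]) (use polybox_upd[OF pe j, of s] that e in \<open>auto simp: dist_commute\<close>)
  have "?g holomorphic_on ball (a j) e" using der by (intro holomorphic_onI) (meson field_differentiable_at_within field_differentiable_def)
  then have "continuous_on (cball (a j) (e/2)) ?g" "?g holomorphic_on ball (a j) (e/2)"
    using e by (auto intro!: holomorphic_on_imp_continuous_on elim: holomorphic_on_subset)
  moreover have w: "p j \<in> ball (a j) (e/2)" using p j by (auto simp: polybox_def dist_commute)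
  ultimately have d: "(?g has_field_derivative (1 / (2 * of_real pi * \<i>) * contour_integral ?\<gamma> (\<lambda>u. ?g u / (u - p j)^2))) (at (p j))"
    by (rule Cauchy_derivative_integral_circlepath)
  have "contour_integral ?\<gamma> (\<lambda>u. ?g u / (u - p j)^2) =
     integral {0..1} (\<lambda>t. ?g (?\<gamma> t) / (?\<gamma> t - p j)^2 * vector_derivative ?\<gamma> (at t))"
    by (rule contour_integral_integral)
  also have "\<dots> = integral {0..1} (\<lambda>t. (2 * of_real pi * \<i>) * (f (p(j := ?\<gamma> t)) * cauchy_kernel (a j) (e/2) (p j) t))"
    by (rule integral_cong) (simp add: vector_derivative_circlepath cauchy_kernel_def)
  also have "\<dots> = (2 * of_real pi * \<i>) * integral {0..1} (\<lambda>t. f (p(j := ?\<gamma> t)) * cauchy_kernel (a j) (e/2) (p j) t)"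
    by simp
  finally show ?thesis using pd_eqI[OF d] by simp
qed

lemma cauchy_nonzero:
  assumes "p \<in> polybox I a (e/2)" "j \<in> I" "e > 0"
  shows "circlepath (a j) (e/2) t - p j \<noteq> 0"
proof
  assume "circlepath (a j) (e/2) t - p j = 0"
  then have "p j = circlepath (a j) (e/2) t" by simp
  then have "p j - a j = of_real (e/2) * exp (2 * of_real pi * \<i> * of_real t)"
    by (simp only: circlepath add_diff_cancel_left')
  then have "norm (p j - a j) = norm (of_real (e/2) * exp (2 * of_real pi * \<i> * of_real t))" by (simp only:)
  also have "\<dots> = e/2" using assms(3) by (simp add: norm_mult norm_exp_eq_Re)
  finally have "norm (p j - a j) = e/2" .
  then show False using assms by (auto simp: polybox_def dist_norm)
qed

lemma circlepath_polybox:
  assumes "p \<in> polybox I a (e/2)" "j \<in> I" "e > 0"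
  shows "p(j := circlepath (a j) (e/2) t) \<in> polybox I a e"
proof (rule polybox_upd)
  show "p \<in> polybox I a e" using assms polybox_mono[of "e/2" e I a] by auto
  have "dist (circlepath (a j) (e/2) t) (a j) = e/2"
    using assms by (simp add: circlepath dist_norm norm_mult norm_exp_eq_Re)
  then show "dist (circlepath (a j) (e/2) t) (a j) < e" using assms by simp
qed (use assms in auto)

lemma continuous_on_cauchy_integrand:
  fixes \<Omega> :: "('i \<Rightarrow> complex) set"
  assumes f: "continuous_on \<Omega> f" and e: "e > 0" "polybox I a e \<subseteq> \<Omega>" and j: "j \<in> I"
  shows "continuous_on (polybox I a (e/2) \<times> {0..1})
    (\<lambda>(p, t). f (p(j := circlepath (a j) (e/2) t)) * cauchy_kernel (a j) (e/2) (p j) t)"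
proof -
  have c: "continuous_on S (\<lambda>z. circlepath (a j) (e/2) (snd z))" for S :: "(('i \<Rightarrow> complex) \<times> real) set"
    unfolding circlepath by (intro continuous_intros)
  have cj: "continuous_on S (\<lambda>z. fst z j)" for S :: "(('i \<Rightarrow> complex) \<times> real) set"
    by (rule continuous_on_product_then_coordinatewise) (intro continuous_intros)
  have "continuous_on (polybox I a (e/2) \<times> {0..1})
    (\<lambda>z. f ((fst z)(j := circlepath (a j) (e/2) (snd z))) * cauchy_kernel (a j) (e/2) (fst z j) (snd z))"
    unfolding cauchy_kernel_def
  proof (intro continuous_on_mult continuous_on_divide)
    show "continuous_on (polybox I a (e/2) \<times> {0..1}) (\<lambda>z. f ((fst z)(j := circlepath (a j) (e/2) (snd z))))"
    proof (rule continuous_on_compose2[OF f])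
      show "continuous_on (polybox I a (e/2) \<times> {0..1}) (\<lambda>z. (fst z)(j := circlepath (a j) (e/2) (snd z)))"
        by (intro continuous_on_fun_upd c continuous_on_fst continuous_on_id)
    qed (use circlepath_polybox[OF _ j e(1)] e in auto)
    show "\<forall>z\<in>polybox I a (e/2) \<times> {0..1}. (circlepath (a j) (e/2) (snd z) - fst z j)\<^sup>2 \<noteq> 0"
      using cauchy_nonzero[OF _ j e(1)] by auto
  qed (intro continuous_intros c cj)+
  then show ?thesis by (simp add: case_prod_unfold)
qed

lemma hol_pd_aux:
  assumes dom: "hdom I \<Omega>" and f: "hol I \<Omega> f" and j: "j \<in> I"
  shows "continuous_on \<Omega> (pd j f)"
proof (rule hdom_continuous_onI[OF dom])
  fix a assume a: "a \<in> \<Omega>"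
  then obtain e where e: "e > 0" "polybox I a e \<subseteq> \<Omega>" using dom by (auto simp: hdom_def)
  have "continuous_on (polybox I a (e/2)) (\<lambda>p. integral (cbox 0 1) (\<lambda>t. f (p(j := circlepath (a j) (e/2) t)) * cauchy_kernel (a j) (e/2) (p j) t))"
    by (rule integral_continuous_on_param) (use continuous_on_cauchy_integrand[OF hol_continuous[OF f] e j] in simp)
  then have "continuous_on (polybox I a (e/2)) (pd j f)"
    by (rule continuous_on_eq) (use pd_cauchy[OF f e _ j] in auto)
  then show "\<exists>e>0. polybox I a e \<subseteq> \<Omega> \<and> continuous_on (polybox I a e) (pd j f)"
    using e polybox_mono[of "e/2" e I a] by (intro exI[of _ "e/2"]) auto
qed

text \<open>For \<open>i \<noteq> j\<close> the Cauchy kernel in the direction \<open>j\<close> does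
  not contain the coordinate \<open>i\<close>, so the derivative passes under the integral onto
  \<open>f\<close>.\<close>

lemma pd_pd:
  assumes dom: "hdom I \<Omega>" and f: "hol I \<Omega> f" and i: "i \<in> I" and j: "j \<in> I" and ij: "i \<noteq> j"
    and e: "e > 0" "polybox I a e \<subseteq> \<Omega>" and p: "p \<in> polybox I a (e/2)"
  shows "((\<lambda>s. pd j f (p(i := s))) has_field_derivative
      integral {0..1} (\<lambda>t. pd i f (p(j := circlepath (a j) (e/2) t)) * cauchy_kernel (a j) (e/2) (p j) t)) (at (p i))"
proof -
  have fin: "finite I" using dom by (simp add: hdom_def)
  let ?D = "polybox I a (e/2)"
  have D: "hdom I ?D" using fin by (rule hdom_polybox)
  let ?F = "\<lambda>p t. f (p(j := circlepath (a j) (e/2) t)) * cauchy_kernel (a j) (e/2) (p j) t"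
  let ?F' = "\<lambda>p t. pd i f (p(j := circlepath (a j) (e/2) t)) * cauchy_kernel (a j) (e/2) (p j) t"
  have "((\<lambda>s. integral {0..1} (?F (p(i := s)))) has_field_derivative integral {0..1} (?F' p)) (at (p i))"
  proof (rule deriv_integral[OF D i p])
    show "continuous_on (?D \<times> {0..1}) (\<lambda>(p, t). ?F p t)"
      by (rule continuous_on_cauchy_integrand[OF hol_continuous[OF f] e j])
    show "continuous_on (?D \<times> {0..1}) (\<lambda>(p, t). ?F' p t)"
      by (rule continuous_on_cauchy_integrand[OF hol_pd_aux[OF dom f i] e j])
    fix q and t :: real assume q: "q \<in> ?D"
    let ?q = "q(j := circlepath (a j) (e/2) t)"
    have "?q \<in> \<Omega>" using circlepath_polybox[OF q j e(1)] e(2) by blast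
    from hol_deriv[OF f this i] have "((\<lambda>s. f (?q(i := s)) * cauchy_kernel (a j) (e/2) (q j) t) has_field_derivative ?F' q t) (at (q i))"
      using ij by (intro DERIV_cmult_right) simp
    then show "((\<lambda>s. ?F (q(i := s)) t) has_field_derivative ?F' q t) (at (q i))"
      using ij by (simp add: fun_upd_twist)
  qed
  then show ?thesis
  proof (rule DERIV_cong_ev[THEN iffD1, rotated -1])
    show "eventually (\<lambda>s. integral {0..1} (?F (p(i := s))) = pd j f (p(i := s))) (nhds (p i))"
      using hol_eventually[OF D p i] by eventually_elim (use pd_cauchy[OF f e _ j] in auto)
  qed auto
qed

text \<open>Mixed directions are settled by \<open>pd_pd\<close>; in the direction \<open>j\<close>
  itself the derivative of a holomorphic function of one variable is again holomorphic.\<close>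

lemma hol_pd:
  assumes dom: "hdom I \<Omega>" and f: "hol I \<Omega> f" and j: "j \<in> I"
  shows "hol I \<Omega> (pd j f)"
  unfolding hol_def
proof (intro conjI ballI)
  show "continuous_on \<Omega> (pd j f)" by (rule hol_pd_aux[OF assms])
  fix p i assume p: "p \<in> \<Omega>" and i: "i \<in> I"
  show "(\<lambda>s. pd j f (p(i := s))) field_differentiable at (p i)"
  proof (cases "i = j")
    case False
    obtain e where e: "e > 0" "polybox I p e \<subseteq> \<Omega>" using dom p by (auto simp: hdom_def)
    then show ?thesis using pd_pd[OF dom f i j False e, of p] polybox_center[of "e/2" p I]
      by (auto simp: field_differentiable_def)
  next
    case True
    obtain d where d: "d > 0" "\<And>s. s \<in> ball (p i) d \<Longrightarrow> p(i := s) \<in> \<Omega>" using hdom_upd[OF dom p i] by auto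
    have "((\<lambda>s. f (p(i := s))) has_field_derivative pd i f (p(i := s))) (at s)" if "s \<in> ball (p i) d" for s
      using hol_deriv_at[OF f d(2)[OF that] i] .
    then have "(\<lambda>s. f (p(i := s))) holomorphic_on ball (p i) d"
      by (intro holomorphic_onI) (meson field_differentiable_at_within field_differentiable_def)
    then have "deriv (\<lambda>s. f (p(i := s))) holomorphic_on ball (p i) d" by (rule holomorphic_deriv) auto
    moreover have "deriv (\<lambda>s. f (p(i := s))) = (\<lambda>s. pd i f (p(i := s)))"
      by (simp add: pd_def fun_eq_iff)
    ultimately show ?thesis using d(1) True
      by (auto simp: holomorphic_on_open field_differentiable_def)
  qed
qed

text \<open>Both sides are the same Cauchy integral of \<open>pd i f\<close>: once as the derivative
  of the formula for \<open>pd j f\<close>, once as the formula applied to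
  \<open>pd i f\<close>.\<close>

lemma pd_comm:
  assumes dom: "hdom I \<Omega>" and f: "hol I \<Omega> f" and i: "i \<in> I" and j: "j \<in> I" and p: "p \<in> \<Omega>"
  shows "pd i (pd j f) p = pd j (pd i f) p"
proof (cases "i = j")
  case False
  obtain e where e: "e > 0" "polybox I p e \<subseteq> \<Omega>" using dom p by (auto simp: hdom_def)
  have c: "p \<in> polybox I p (e/2)" using e polybox_center[of "e/2"] by auto
  show ?thesis
    using pd_eqI[OF pd_pd[OF dom f i j False e c]] pd_cauchy[OF hol_pd[OF dom f i] e c j] by simp
qed simp

section \<open>Flat sections\<close>

text \<open>A basic open set may restrict coordinates outside \<open>I\<close> as well; there the
  points of the box agree with \<open>a\<close>, so only the finitely many radii in \<open>I\<close>
  matter.\<close>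

lemma polybox_nbhd:
  fixes a :: "'i \<Rightarrow> complex"
  assumes "open U" "a \<in> U" "finite I"
  shows "\<exists>e>0. polybox I a e \<subseteq> U"
proof -
  have "openin (product_topology (\<lambda>i. euclidean) UNIV) U" using assms(1) by (simp add: open_fun_def)
  from product_topology_open_contains_basis[OF this assms(2)]
  obtain X where X: "a \<in> Pi\<^sub>E UNIV X" "\<And>i. openin euclidean (X i)" "finite {i. X i \<noteq> topspace euclidean}" "Pi\<^sub>E UNIV X \<subseteq> U"
    by blast
  have "\<exists>e>0. ball (a k) e \<subseteq> X k" for k
    using X(1,2) by (metis PiE_mem UNIV_I open_contains_ball open_openin)
  then obtain e where e: "\<And>k. e k > 0 \<and> ball (a k) (e k) \<subseteq> X k" by metis
  define d where "d = Min (insert 1 (e ` I))"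
  have d: "d > 0" unfolding d_def using assms(3) e by (subst Min_gr_iff) auto
  have "polybox I a d \<subseteq> Pi\<^sub>E UNIV X"
  proof
    fix p assume p: "p \<in> polybox I a d"
    have "p k \<in> X k" for k
    proof (cases "k \<in> I")
      case True
      have "d \<le> e k" unfolding d_def using assms(3) True by (intro Min_le) auto
      then have "p k \<in> ball (a k) (e k)" using p True by (auto simp: polybox_def dist_commute)
      then show ?thesis using e by blast
    next
      case False
      then have "p k \<in> ball (a k) (e k)" using p e by (auto simp: polybox_def)
      then show ?thesis using e by blast
    qed
    then show "p \<in> Pi\<^sub>E UNIV X" by auto
  qed
  then show ?thesis using d X(4) by blast
qed

lemma continuous_polybox_bound:
  assumes dom: "hdom I \<Omega>" and f: "continuous_on \<Omega> f" and a: "a \<in> \<Omega>"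
  shows "\<exists>e>0. polybox I a e \<subseteq> \<Omega> \<and> (\<forall>p\<in>polybox I a e. norm (f p :: complex) \<le> norm (f a) + 1)"
proof -
  have fin: "finite I" using dom by (simp add: hdom_def)
  have "open (ball (f a) 1)" by simp
  then obtain U where U: "open U" "U \<inter> \<Omega> = f -` ball (f a) 1 \<inter> \<Omega>"
    using f unfolding continuous_on_open_invariant by blast
  then have "a \<in> U" using a by auto
  from polybox_nbhd[OF U(1) this fin] obtain e where e: "e > 0" "polybox I a e \<subseteq> U" by blast
  obtain d where d: "d > 0" "polybox I a d \<subseteq> \<Omega>" using dom a by (auto simp: hdom_def)
  have sub: "polybox I a (min d e) \<subseteq> U \<inter> \<Omega>" using e d polybox_mono[of "min d e" d I a] polybox_mono[of "min d e" e I a] by auto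
  have "norm (f p) \<le> norm (f a) + 1" if "p \<in> polybox I a (min d e)" for p
  proof -
    have "dist (f a) (f p) < 1" using sub that U(2) by auto
    then show ?thesis by (metis add.commute dist_norm less_eq_real_def norm_minus_commute norm_triangle_sub add_left_mono order_trans)
  qed
  then show ?thesis using sub e d by (intro exI[of _ "min d e"]) auto
qed

lemma hol_upd_const:
  assumes dom: "finite I" and f: "hol I (polybox I a e) f" and i: "i \<in> I" and c: "dist c (a i) < e"
  shows "hol I (polybox I a e) (\<lambda>p. f (p(i := c)))"
proof -
  have m: "p(i := c) \<in> polybox I a e" if "p \<in> polybox I a e" for p by (rule polybox_upd[OF that i c])
  show ?thesis
  proof (rule holI)
    show "continuous_on (polybox I a e) (\<lambda>p. f (p(i := c)))"
      by (rule continuous_on_compose2[OF hol_continuous[OF f]])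
        (use m in \<open>auto intro!: continuous_on_fun_upd continuous_on_id continuous_on_const\<close>)
    fix p j assume p: "p \<in> polybox I a e" and j: "j \<in> I"
    show "((\<lambda>s. f ((p(j := s))(i := c))) has_field_derivative (if j = i then 0 else pd j f (p(i := c)))) (at (p j))"
    proof (cases "j = i")
      case False
      have "((\<lambda>s. f ((p(i := c))(j := s))) has_field_derivative pd j f (p(i := c))) (at ((p(i := c)) j))"
        by (rule hol_deriv[OF f m[OF p] j])
      then show ?thesis using False by (simp add: fun_upd_twist)
    qed simp
  qed
qed

section \<open>Primitives in one coordinate, the others being parameters\<close>

definition seg :: "'i \<Rightarrow> ('i \<Rightarrow> complex) \<Rightarrow> ('i \<Rightarrow> complex) \<Rightarrow> real \<Rightarrow> ('i \<Rightarrow> complex)" where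
  "seg i a p t = p(i := a i + of_real t * (p i - a i))"

text \<open>The primitive in the coordinate \<open>i\<close> that vanishes on the slice
  \<open>p i = a i\<close>, written over the fixed interval \<open>{0..1}\<close> so that it depends
  on the point only through the integrand.\<close>

definition primitive :: "'i \<Rightarrow> ('i \<Rightarrow> complex) \<Rightarrow> (('i \<Rightarrow> complex) \<Rightarrow> complex) \<Rightarrow> ('i \<Rightarrow> complex) \<Rightarrow> complex" where
  "primitive i a h p = integral {0..1} (\<lambda>t. (p i - a i) * h (seg i a p t))"

lemma seg_in:
  assumes "p \<in> polybox I a e" "i \<in> I" "t \<in> {0..1}"
  shows "seg i a p t \<in> polybox I a e"
  unfolding seg_def
proof (rule polybox_upd[OF assms(1,2)])
  have "dist (a i + of_real t * (p i - a i)) (a i) = t * dist (p i) (a i)"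
    using assms(3) by (simp add: dist_norm norm_mult)
  also have "\<dots> \<le> dist (p i) (a i)" using assms(3) by (simp add: mult_left_le_one_le)
  also have "\<dots> < e" using assms by (simp add: polybox_def)
  finally show "dist (a i + of_real t * (p i - a i)) (a i) < e" .
qed

lemma continuous_on_seg:
  fixes f :: "('i \<Rightarrow> complex) \<Rightarrow> complex"
  assumes f: "continuous_on (polybox I a e) f" and i: "i \<in> I"
  shows "continuous_on (polybox I a e \<times> {0..1}) (\<lambda>z. f (seg i a (fst z) (snd z)))"
proof (rule continuous_on_compose2[OF f])
  have cj: "continuous_on S (\<lambda>z. fst z i)" for S :: "(('i \<Rightarrow> complex) \<times> real) set"
    by (rule continuous_on_product_then_coordinatewise) (intro continuous_on_fst continuous_on_id)
  show "continuous_on (polybox I a e \<times> {0..1}) (\<lambda>z. seg i a (fst z) (snd z))"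
    unfolding seg_def
    by (intro continuous_on_fun_upd continuous_on_fst continuous_on_id continuous_on_add continuous_on_const
        continuous_on_mult continuous_on_of_real continuous_on_snd continuous_on_diff cj)
qed (use seg_in[OF _ i] in auto)

lemma continuous_on_seg_slice:
  fixes f :: "('i \<Rightarrow> complex) \<Rightarrow> complex"
  assumes f: "continuous_on (polybox I a e) f" and i: "i \<in> I" and p: "p \<in> polybox I a e"
  shows "continuous_on {0..1} (\<lambda>t. f (seg i a p t))"
proof -
  have "continuous_on {0..1} (\<lambda>t. f (seg i a (fst (p, t)) (snd (p, t))))"
    by (rule continuous_on_compose2[OF continuous_on_seg[OF f i], where f = "\<lambda>t. (p, t)"])
      (use p in \<open>auto intro: continuous_on_Pair continuous_on_const continuous_on_id\<close>)
  then show ?thesis by simp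
qed

lemma primitive_zero: "p i = a i \<Longrightarrow> primitive i a h p = 0"
  by (simp add: primitive_def)

lemma primitive_bound:
  assumes h: "continuous_on (polybox I a e) h" and i: "i \<in> I" and p: "p \<in> polybox I a e"
    and B: "\<And>q. q \<in> polybox I a e \<Longrightarrow> norm (h q) \<le> B"
  shows "norm (primitive i a h p) \<le> e * B"
proof -
  have B0: "B \<ge> 0" using B[OF p] norm_ge_zero order_trans by blast
  have e0: "dist (p i) (a i) < e" using p i by (simp add: polybox_def)
  have c: "continuous_on (cbox 0 1) (\<lambda>t. (p i - a i) * h (seg i a p t))"
    using continuous_on_seg_slice[OF h i p] by (auto intro: continuous_on_mult continuous_on_const)
  have "norm (primitive i a h p) \<le> (e * B) * measure lborel (cbox 0 (1::real))"
    unfolding primitive_def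
  proof (rule has_integral_bound)
    show "((\<lambda>t. (p i - a i) * h (seg i a p t)) has_integral integral {0..1} (\<lambda>t. (p i - a i) * h (seg i a p t))) (cbox 0 1)"
      using integrable_integral[OF integrable_continuous[OF c]] by simp
    fix t :: real assume "t \<in> cbox 0 1"
    then have "norm (h (seg i a p t)) \<le> B" using B seg_in[OF p i] by auto
    moreover have "norm (p i - a i) \<le> e" using e0 by (simp add: dist_norm)
    moreover have "0 \<le> e" using order_le_less_trans[OF zero_le_dist e0] by simp
    ultimately show "norm ((p i - a i) * h (seg i a p t)) \<le> e * B"
      unfolding norm_mult by (intro mult_mono) auto
  qed (use B0 e0 in \<open>smt (verit) mult_nonneg_nonneg zero_le_dist\<close>)
  then show ?thesis by simp
qed

text \<open>On the disc of the coordinate \<open>i\<close> a one-variable primitive \<open>G\<close>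
  exists, and the integral along the straight segment is \<open>G s - G (a i)\<close>; the
  derivative is read off from \<open>G\<close>.\<close>

lemma primitive_deriv:
  assumes h: "hol I (polybox I a e) h" and i: "i \<in> I" and p: "p \<in> polybox I a e"
  shows "((\<lambda>s. primitive i a h (p(i := s))) has_field_derivative h p) (at (p i))"
proof -
  let ?g = "\<lambda>s. h (p(i := s))"
  let ?S = "ball (a i) e"
  have m: "p(i := s) \<in> polybox I a e" if "s \<in> ?S" for s using polybox_upd[OF p i, of s] that by (auto simp: dist_commute)
  have pS: "p i \<in> ?S" using p i by (auto simp: polybox_def dist_commute)
  then have e: "e > 0" by (metis ball_eq_empty empty_iff not_less)
  have der: "(?g has_field_derivative pd i h (p(i := s))) (at s)" if "s \<in> ?S" for s
    by (rule hol_deriv_at[OF h m[OF that] i])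
  have hg: "?g holomorphic_on ?S"
    using der by (intro holomorphic_onI) (meson field_differentiable_at_within field_differentiable_def)
  obtain G where G: "\<And>s. s \<in> ?S \<Longrightarrow> (G has_field_derivative ?g s) (at s within ?S)"
    using holomorphic_convex_primitive'[of ?S ?g] hg by auto
  have eq: "primitive i a h (p(i := s)) = G s - G (a i)" if s: "s \<in> ?S" for s
  proof -
    have sub: "closed_segment (a i) s \<subseteq> ?S" using s e by (intro closed_segment_subset) auto
    have "(?g has_contour_integral (G (pathfinish (linepath (a i) s)) - G (pathstart (linepath (a i) s)))) (linepath (a i) s)"
      by (rule contour_integral_primitive[of ?S]) (use G sub in \<open>auto intro: valid_path_linepath\<close>)
    then have "contour_integral (linepath (a i) s) ?g = G s - G (a i)" by (simp add: contour_integral_unique)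
    moreover have "contour_integral (linepath (a i) s) ?g = integral {0..1} (\<lambda>t. ?g (linepath (a i) s t) * (s - a i))"
      by (simp add: contour_integral_integral)
    moreover have "linepath (a i) s t = a i + of_real t * (s - a i)" for t
      by (simp add: linepath_def scaleR_conv_of_real algebra_simps)
    ultimately show ?thesis by (simp add: primitive_def seg_def mult.commute)
  qed
  have "(G has_field_derivative h p) (at (p i))" using G[OF pS] pS by (simp add: at_within_open[OF pS])
  then have "((\<lambda>s. G s - G (a i)) has_field_derivative h p) (at (p i))" by (auto intro!: derivative_eq_intros)
  then show ?thesis
  proof (rule DERIV_cong_ev[THEN iffD1, rotated -1])
    have "eventually (\<lambda>s. s \<in> ?S) (nhds (p i))" by (rule eventually_nhds_in_open[OF open_ball pS])
    then show "eventually (\<lambda>s. G s - G (a i) = primitive i a h (p(i := s))) (nhds (p i))"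
      by eventually_elim (use eq in auto)
  qed auto
qed

lemma pd_primitive:
  "hol I (polybox I a e) h \<Longrightarrow> i \<in> I \<Longrightarrow> p \<in> polybox I a e \<Longrightarrow> pd i (primitive i a h) p = h p"
  by (rule pd_eqI[OF primitive_deriv])

lemma hol_primitive:
  assumes fin: "finite I" and h: "hol I (polybox I a e) h" and i: "i \<in> I"
  shows "hol I (polybox I a e) (primitive i a h)"
proof (rule holI)
  let ?D = "polybox I a e"
  have D: "hdom I ?D" using fin by (rule hdom_polybox)
  have cj: "continuous_on S (\<lambda>z. fst z i)" for S :: "(('a \<Rightarrow> complex) \<times> real) set"
    by (rule continuous_on_product_then_coordinatewise) (intro continuous_on_fst continuous_on_id)
  have c: "continuous_on (?D \<times> {0..1}) (\<lambda>(p, t). (p i - a i) * k (seg i a p t))" if "continuous_on ?D k" for k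
    unfolding case_prod_unfold
    by (intro continuous_on_mult continuous_on_diff cj continuous_on_const continuous_on_seg[OF that i])
  have "continuous_on ?D (\<lambda>p. integral (cbox 0 1) (\<lambda>t. (p i - a i) * h (seg i a p t)))"
    by (rule integral_continuous_on_param) (use c[OF hol_continuous[OF h]] in simp)
  then show "continuous_on ?D (primitive i a h)" by (simp add: primitive_def[abs_def])
  fix p j assume p: "p \<in> ?D" and j: "j \<in> I"
  show "((\<lambda>s. primitive i a h (p(j := s))) has_field_derivative
     (if j = i then h p else integral {0..1} (\<lambda>t. (p i - a i) * pd j h (seg i a p t)))) (at (p j))"
  proof (cases "j = i")
    case True then show ?thesis using primitive_deriv[OF h i p] by simp
  next
    case False
    have "((\<lambda>s. integral {0..1} (\<lambda>t. ((p(j := s)) i - a i) * h (seg i a (p(j := s)) t))) has_field_derivative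
       integral {0..1} (\<lambda>t. (p i - a i) * pd j h (seg i a p t))) (at (p j))"
    proof (rule deriv_integral[OF D j p])
      show "continuous_on (?D \<times> {0..1}) (\<lambda>(p, t). (p i - a i) * h (seg i a p t))" by (rule c[OF hol_continuous[OF h]])
      show "continuous_on (?D \<times> {0..1}) (\<lambda>(p, t). (p i - a i) * pd j h (seg i a p t))" by (rule c[OF hol_pd_aux[OF D h j]])
      fix q and t :: real assume q: "q \<in> ?D" and t: "t \<in> {0..1}"
      have "((\<lambda>s. h ((seg i a q t)(j := s))) has_field_derivative pd j h (seg i a q t)) (at ((seg i a q t) j))"
        by (rule hol_deriv[OF h seg_in[OF q i t] j])
      then have "((\<lambda>s. (q i - a i) * h ((seg i a q t)(j := s))) has_field_derivative (q i - a i) * pd j h (seg i a q t)) (at ((seg i a q t) j))"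
        by (rule DERIV_cmult)
      then show "((\<lambda>s. ((q(j := s)) i - a i) * h (seg i a (q(j := s)) t)) has_field_derivative (q i - a i) * pd j h (seg i a q t)) (at (q j))"
        using False by (simp add: seg_def fun_upd_twist)
    qed
    then show ?thesis using False by (simp add: primitive_def[abs_def])
  qed
qed

section \<open>Uniform limits and Picard iteration with parameters\<close>

lemma hol_uniform_limit:
  assumes D: "hdom I D" and h: "\<And>N. hol I D (S N)" and u: "uniform_limit D S f sequentially"
  shows "hol I D f" and "\<And>p i. p \<in> D \<Longrightarrow> i \<in> I \<Longrightarrow> (\<lambda>N. pd i (S N) p) \<longlonglongrightarrow> pd i f p"
proof -
  have key: "\<exists>g'. ((\<lambda>s. f (p(i := s))) has_field_derivative g') (at (p i)) \<and> (\<lambda>N. pd i (S N) p) \<longlonglongrightarrow> g'"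
    if p: "p \<in> D" and i: "i \<in> I" for p i
  proof -
    obtain d where d: "d > 0" "\<And>s. s \<in> ball (p i) d \<Longrightarrow> p(i := s) \<in> D" using hdom_upd[OF D p i] by auto
    have "\<exists>g'. \<forall>x\<in>ball (p i) d. ((\<lambda>s. f (p(i := s))) has_field_derivative g' x) (at x) \<and> (\<lambda>n. pd i (S n) (p(i := x))) \<longlonglongrightarrow> g' x"
    proof (rule has_complex_derivative_uniform_sequence[where f = "\<lambda>n s. S n (p(i := s))"])
      fix n x assume "x \<in> ball (p i) d"
      then show "((\<lambda>s. S n (p(i := s))) has_field_derivative pd i (S n) (p(i := x))) (at x)"
        by (intro hol_deriv_at[OF h _ i] d(2))
    next
      fix x assume "x \<in> ball (p i) d"
      then obtain r where r: "r > 0" "cball x r \<subseteq> ball (p i) d" by (meson open_ball open_contains_cball)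
      have "uniform_limit (cball x r) (\<lambda>n s. S n (p(i := s))) (\<lambda>s. f (p(i := s))) sequentially"
        by (rule uniform_limit_compose'[OF u]) (use r d(2) in auto)
      then show "\<exists>r>0. cball x r \<subseteq> ball (p i) d \<and> uniform_limit (cball x r) (\<lambda>n s. S n (p(i := s))) (\<lambda>s. f (p(i := s))) sequentially"
        using r by blast
    qed auto
    then show ?thesis using d(1) by (metis centre_in_ball fun_upd_triv)
  qed
  have "continuous_on D f"
    by (rule uniform_limit_theorem[OF _ u]) (use hol_continuous[OF h] in auto)
  then show "hol I D f" using key by (auto simp: hol_def field_differentiable_def)
  show "\<And>p i. p \<in> D \<Longrightarrow> i \<in> I \<Longrightarrow> (\<lambda>N. pd i (S N) p) \<longlonglongrightarrow> pd i f p"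
    using key pd_eqI by metis
qed

text \<open>Linear Cauchy problem in the direction \<open>i\<close>, with initial values
  \<open>f0\<close> on the slice \<open>p i = a i\<close>, solved by the Picard series. One
  integration over a segment shorter than \<open>e\<close>, against \<open>n\<close> coefficients
  bounded by \<open>C\<close>, gains the factor \<open>n * C * e \<le> 1/2\<close>; the terms are
  bounded by \<open>M / 2^m\<close> and the sum by \<open>2 * M\<close>.\<close>

lemma picard:
  fixes A :: "nat \<Rightarrow> nat \<Rightarrow> ('i \<Rightarrow> complex) \<Rightarrow> complex"
  assumes fin: "finite I" and i: "i \<in> I" and e: "e > 0" and C: "0 \<le> C" "real n * C * e \<le> 1/2"
    and A: "\<And>b c. b < n \<Longrightarrow> c < n \<Longrightarrow> hol I (polybox I a e) (A b c)"
    and AC: "\<And>b c p. b < n \<Longrightarrow> c < n \<Longrightarrow> p \<in> polybox I a e \<Longrightarrow> norm (A b c p) \<le> C"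
    and f0: "\<And>b. b < n \<Longrightarrow> hol I (polybox I a e) (f0 b)"
    and fM: "\<And>b p. b < n \<Longrightarrow> p \<in> polybox I a e \<Longrightarrow> norm (f0 b p) \<le> M"
  shows "\<exists>f. \<forall>b<n. hol I (polybox I a e) (f b) \<and> (\<forall>p\<in>polybox I a e.
     norm (f b p) \<le> 2 * M \<and> (p i = a i \<longrightarrow> f b p = f0 b p) \<and>
     pd i (f b) p = (\<Sum>c<n. A b c p * f c p))"
proof (cases "n = 0")
  case False
  let ?D = "polybox I a e"
  have D: "hdom I ?D" using fin by (rule hdom_polybox)
  have aD: "a \<in> ?D" using e by (rule polybox_center)
  have M0: "M \<ge> 0" using fM[of 0 a] aD False norm_ge_zero order_trans by blast
  \<comment> \<open>\<open>k m\<close> is the increment of the iteration and not the iterate: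
    \<open>k 0\<close> is the initial value continued constantly in the direction \<open>i\<close>,
    and all later terms vanish on the slice.\<close>
  define k where "k = rec_nat (\<lambda>b p. f0 b (p(i := a i))) (\<lambda>m u b. primitive i a (\<lambda>q. \<Sum>c<n. A b c q * u c q))"
  have k0: "k 0 b p = f0 b (p(i := a i))" for b p by (simp add: k_def)
  have kS: "k (Suc m) b = primitive i a (\<lambda>q. \<Sum>c<n. A b c q * k m c q)" for m b by (simp add: k_def)
  have hk: "hol I ?D (k m b)" if "b < n" for m b
    using that
  proof (induction m arbitrary: b)
    case 0
    have "hol I ?D (\<lambda>p. f0 b (p(i := a i)))" by (rule hol_upd_const[OF fin f0[OF 0] i]) (use e in auto)
    then show ?case by (simp add: k0[abs_def])
  next
    case (Suc m)
    show ?case unfolding kS by (rule hol_primitive[OF fin _ i]) (intro hol_sum hol_mult A Suc; use Suc in simp)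
  qed
  have hs: "hol I ?D (\<lambda>q. \<Sum>c<n. A b c q * k m c q)" if "b < n" for b m
    by (intro hol_sum hol_mult A hk) (use that in auto)
  have bk: "norm (k m b p) \<le> M * (1/2)^m" if "b < n" "p \<in> ?D" for m b p
    using that
  proof (induction m arbitrary: b p)
    case 0
    have "p(i := a i) \<in> ?D" by (rule polybox_upd[OF 0(2) i]) (use e in simp)
    then show ?case using fM[OF 0(1)] by (simp add: k0)
  next
    case (Suc m)
    have "norm (k (Suc m) b p) \<le> e * (real n * (C * (M * (1/2)^m)))"
      unfolding kS
    proof (rule primitive_bound[OF hol_continuous[OF hs[OF Suc(2)]] i Suc(3)])
      fix q assume q: "q \<in> ?D"
      have "norm (\<Sum>c<n. A b c q * k m c q) \<le> (\<Sum>c<n. C * (M * (1/2)^m))"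
        unfolding norm_mult by (rule sum_norm_le) (use Suc q AC C M0 in \<open>auto simp: norm_mult intro!: mult_mono\<close>)
      then show "norm (\<Sum>c<n. A b c q * k m c q) \<le> real n * (C * (M * (1/2)^m))" by simp
    qed
    also have "\<dots> = (real n * C * e) * (M * (1/2)^m)" by (simp add: algebra_simps)
    also have "\<dots> \<le> (1/2) * (M * (1/2)^m)" by (rule mult_right_mono[OF C(2)]) (use M0 in simp)
    finally show ?case by simp
  qed
  have sm: "summable (\<lambda>m. M * (1/2::real)^m)" by (intro summable_mult summable_geometric) simp
  define f where "f b p = (\<Sum>m. k m b p)" for b p
  have ul: "uniform_limit ?D (\<lambda>N p. \<Sum>m<N. k m b p) (f b) sequentially" if "b < n" for b
    unfolding f_def by (rule Weierstrass_m_test[OF bk[OF that] sm])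
  have hS: "hol I ?D (\<lambda>p. \<Sum>m<N. k m b p)" if "b < n" for N b
    by (intro hol_sum hk that)
  have hf: "hol I ?D (f b)" if "b < n" for b
    by (rule hol_uniform_limit(1)[OF D hS[OF that] ul[OF that]])
  have lim: "(\<lambda>N. \<Sum>m<N. k m b p) \<longlonglongrightarrow> f b p" if "b < n" "p \<in> ?D" for b p
    using tendsto_uniform_limitI[OF ul[OF that(1)] that(2)] .
  have "norm (f b p) \<le> 2 * M \<and> (p i = a i \<longrightarrow> f b p = f0 b p) \<and> pd i (f b) p = (\<Sum>c<n. A b c p * f c p)"
    if b: "b < n" and p: "p \<in> ?D" for b p
  proof (intro conjI impI)
    have "norm (f b p) \<le> (\<Sum>m. M * (1/2::real)^m)"
      unfolding f_def by (rule norm_suminf_le[OF bk[OF b p] sm])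
    also have "\<dots> = 2 * M" by (subst suminf_mult) (auto simp: suminf_geometric)
    finally show "norm (f b p) \<le> 2 * M" .
  next
    assume pi: "p i = a i"
    have "k (Suc m) b p = 0" for m unfolding kS by (rule primitive_zero) (rule pi)
    then have "k m b p = 0" if "m \<notin> {0}" for m using that by (cases m) auto
    then have "f b p = sum (\<lambda>m. k m b p) {0}" unfolding f_def by (intro suminf_finite) auto
    also have "\<dots> = f0 b p" using pi by (simp add: k0 fun_upd_idem)
    finally show "f b p = f0 b p" .
  next
    have pk: "pd i (k (Suc m) b) p = (\<Sum>c<n. A b c p * k m c p)" for m
      unfolding kS by (rule pd_primitive[OF hs[OF b] i p])
    have pk0: "pd i (k 0 b) p = 0" unfolding k0[abs_def] pd_def by simp
    have "pd i (\<lambda>p. \<Sum>m<Suc N. k m b p) p = (\<Sum>c<n. A b c p * (\<Sum>m<N. k m c p))" for N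
    proof -
      have "pd i (\<lambda>p. \<Sum>m<Suc N. k m b p) p = (\<Sum>m<Suc N. pd i (k m b) p)" by (rule pd_sum[OF hk[OF b] p i])
      also have "\<dots> = (\<Sum>m<N. \<Sum>c<n. A b c p * k m c p)"
        unfolding sum.lessThan_Suc_shift pk0 pk by simp
      also have "\<dots> = (\<Sum>c<n. \<Sum>m<N. A b c p * k m c p)" by (rule sum.swap)
      finally show ?thesis by (simp add: sum_distrib_left)
    qed
    moreover have "(\<lambda>N. \<Sum>c<n. A b c p * (\<Sum>m<N. k m c p)) \<longlonglongrightarrow> (\<Sum>c<n. A b c p * f c p)"
      by (intro tendsto_intros lim p) auto
    moreover have "(\<lambda>N. pd i (\<lambda>p. \<Sum>m<Suc N. k m b p) p) \<longlonglongrightarrow> pd i (f b) p"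
      using hol_uniform_limit(2)[OF D hS[OF b] ul[OF b] p i] by (rule LIMSEQ_Suc)
    ultimately show "pd i (f b) p = (\<Sum>c<n. A b c p * f c p)"
      using LIMSEQ_unique by (metis (no_types, lifting) ext)
  qed
  then show ?thesis using hf by blast
qed simp

section \<open>Local existence and uniqueness of flat sections\<close>

definition flat_section ::
  "'i set \<Rightarrow> ('i \<Rightarrow> complex) set \<Rightarrow> nat \<Rightarrow> ('i \<Rightarrow> nat \<Rightarrow> nat \<Rightarrow> ('i \<Rightarrow> complex) \<Rightarrow> complex) \<Rightarrow>
   (nat \<Rightarrow> ('i \<Rightarrow> complex) \<Rightarrow> complex) \<Rightarrow> bool" where
  "flat_section I D n A f \<longleftrightarrow> (\<forall>b<n. hol I D (f b) \<and>
     (\<forall>p\<in>D. \<forall>i\<in>I. pd i (f b) p = (\<Sum>c<n. A i b c p * f c p)))"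

text \<open>Where the sum \<open>M\<close> of the norms is maximal on the segment, the mean value
  inequality bounds it by half of itself. One factor \<open>n\<close> in the smallness condition
  comes from the matrix product, the other from summing the components.\<close>

lemma zero_along_line:
  assumes hf: "\<And>b. b < n \<Longrightarrow> hol I D (f b)"
    and ode: "\<And>b q. b < n \<Longrightarrow> q \<in> D \<Longrightarrow> pd i (f b) q = (\<Sum>c<n. A b c q * f c q)"
    and i: "i \<in> I"
    and seg: "\<And>w. w \<in> closed_segment (p i) s \<Longrightarrow> p(i := w) \<in> D"
    and AC: "\<And>b c q. b < n \<Longrightarrow> c < n \<Longrightarrow> q \<in> D \<Longrightarrow> norm (A b c q) \<le> C"
    and C: "0 \<le> C" "norm (s - p i) * (real n * real n * C) \<le> 1/2"
    and z: "\<And>b. b < n \<Longrightarrow> f b p = 0" and b: "b < n"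
  shows "f b (p(i := s)) = 0"
proof -
  let ?S = "closed_segment (p i) s"
  define M where "M w = (\<Sum>b<n. norm (f b (p(i := w))))" for w
  have der: "((\<lambda>w. f b (p(i := w))) has_field_derivative pd i (f b) (p(i := w))) (at w)" if "b < n" "w \<in> ?S" for b w
    by (rule hol_deriv_at[OF hf[OF that(1)] seg[OF that(2)] i])
  have "continuous_on ?S M"
    unfolding M_def
    by (intro continuous_intros) (use der in \<open>meson DERIV_isCont continuous_at_imp_continuous_on lessThan_iff\<close>)
  then obtain w0 where w0: "w0 \<in> ?S" "\<And>w. w \<in> ?S \<Longrightarrow> M w \<le> M w0"
    using continuous_attains_sup[OF compact_segment(1)[of "p i" s], of M] by blast
  have fM: "norm (f c (p(i := w))) \<le> M w0" if "c < n" "w \<in> ?S" for c w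
  proof -
    have "norm (f c (p(i := w))) \<le> M w" unfolding M_def by (rule member_le_sum[of c "{..<n}" "\<lambda>b. norm (f b (p(i := w)))"]) (use that in auto)
    then show ?thesis using w0(2)[OF that(2)] by simp
  qed
  have M0: "M w0 \<ge> 0" by (auto simp: M_def intro: sum_nonneg)
  have step: "norm (f b (p(i := w0))) \<le> real n * C * M w0 * norm (w0 - p i)" if b: "b < n" for b
  proof -
    have "norm (f b (p(i := w0)) - f b (p(i := p i))) \<le> (real n * (C * M w0)) * norm (w0 - p i)"
    proof (rule field_differentiable_bound[of ?S])
      fix w assume w: "w \<in> ?S"
      show "((\<lambda>w. f b (p(i := w))) has_field_derivative pd i (f b) (p(i := w))) (at w within ?S)"
        using der[OF b w] by (rule has_field_derivative_at_within)
      have "norm (pd i (f b) (p(i := w))) \<le> (\<Sum>c<n. C * M w0)"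
        unfolding ode[OF b seg[OF w]]
        by (rule sum_norm_le) (use AC[OF b _ seg[OF w]] fM[OF _ w] C(1) in \<open>auto simp: norm_mult intro!: mult_mono\<close>)
      then show "norm (pd i (f b) (p(i := w))) \<le> real n * (C * M w0)" by simp
    qed (use w0(1) in auto)
    then show ?thesis using z[OF b] by (simp add: mult.assoc)
  qed
  have ns: "norm (w0 - p i) \<le> norm (s - p i)" using segment_bound(1)[OF w0(1)] .
  have "M w0 \<le> (\<Sum>b<n. real n * C * M w0 * norm (w0 - p i))"
    unfolding M_def[of w0] by (rule sum_mono) (use step in \<open>auto simp: M_def\<close>)
  also have "\<dots> = (norm (w0 - p i) * (real n * real n * C)) * M w0" by simp
  also have "\<dots> \<le> (norm (s - p i) * (real n * real n * C)) * M w0"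
    by (intro mult_right_mono ns M0) (use C(1) in simp)
  also have "\<dots> \<le> (1/2) * M w0" by (rule mult_right_mono[OF C(2) M0])
  finally have "M w0 = 0" using M0 by simp
  then show ?thesis using fM[OF b, of s] by simp
qed

lemma polybox_segment:
  assumes "p \<in> polybox I a e" "q \<in> polybox I a e" "i \<in> I" "w \<in> closed_segment (p i) (q i)"
  shows "dist w (a i) < e"
proof -
  have "closed_segment (p i) (q i) \<subseteq> ball (a i) e"
    by (rule closed_segment_subset) (use assms(1-3) in \<open>auto simp: polybox_def dist_commute\<close>)
  then show ?thesis using assms(4) by (auto simp: dist_commute)
qed

text \<open>The coordinates are moved from \<open>p\<close> to \<open>q\<close> one after the other,
  and an intersection of boxes is a product of convex sets, so all intermediate points stay inside.
  Two boxes occur because sections over neighbouring boxes are compared on the overlap. The constant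
  \<open>2 * e\<close> bounds the difference of two values of one coordinate in a box of radius
  \<open>e\<close>.\<close>

lemma zero_move:
  assumes fin: "finite I" and f: "flat_section I D n A f"
    and D: "D = polybox I a e \<inter> polybox I a' e'"
    and AC: "\<And>i b c q. i \<in> I \<Longrightarrow> b < n \<Longrightarrow> c < n \<Longrightarrow> q \<in> D \<Longrightarrow> norm (A i b c q) \<le> C"
    and C: "0 \<le> C" "2 * e * (real n * real n * C) \<le> 1/2"
    and p: "p \<in> D" and q: "q \<in> D" and z: "\<And>b. b < n \<Longrightarrow> f b p = 0" and b: "b < n"
  shows "f b q = 0"
proof -
  define m where "m J = (\<lambda>k. if k \<in> J then q k else p k)" for J
  have mD: "m J \<in> D" for J using p q unfolding D m_def polybox_def by auto
  have "\<forall>b<n. f b (m J) = 0" if "finite J" "J \<subseteq> I" for J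
    using that
  proof (induction J rule: finite_induct)
    case empty
    then show ?case using z by (simp add: m_def)
  next
    case (insert i J)
    have i: "i \<in> I" using insert by simp
    have upd: "m (insert i J) = (m J)(i := q i)" by (auto simp: m_def)
    have mi: "m J i = p i" using insert by (simp add: m_def)
    have seg: "(m J)(i := w) \<in> D" if w: "w \<in> closed_segment (m J i) (q i)" for w
    proof -
      have "dist w (a i) < e" "dist w (a' i) < e'"
        using polybox_segment[OF _ _ i] w p q unfolding D mi by blast+
      then show ?thesis using mD[of J] i unfolding D by (auto intro!: polybox_upd)
    qed
    have "dist (q i) (p i) \<le> dist (q i) (a i) + dist (p i) (a i)" by (rule dist_triangle2)
    moreover have "dist (p i) (a i) < e" "dist (q i) (a i) < e" using p q i by (auto simp: D polybox_def)
    ultimately have "norm (q i - m J i) \<le> 2 * e" unfolding mi dist_norm by linarith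
    then have "norm (q i - m J i) * (real n * real n * C) \<le> 2 * e * (real n * real n * C)"
      using C(1) by (intro mult_right_mono) auto
    then have n: "norm (q i - m J i) * (real n * real n * C) \<le> 1/2" using C(2) by simp
    have hf: "hol I D (f b)" and ode: "q \<in> D \<Longrightarrow> pd i (f b) q = (\<Sum>c<n. A i b c q * f c q)" if "b < n" for b q
      using f i that unfolding flat_section_def by blast+
    show ?case
    proof (intro allI impI)
      fix b assume bn: "b < n"
      show "f b (m (insert i J)) = 0"
        unfolding upd
      proof (rule zero_along_line[where f = f and A = "A i" and D = D and i = i, OF hf ode i seg AC[OF i] C(1) n])
        show "f b (m J) = 0" if "b < n" for b using insert that by simp
      qed (use bn in auto)
    qed
  qed
  from this[OF fin] have "f b (m I) = 0" using b by simp
  moreover have "m I = q" using p q unfolding D m_def polybox_def by auto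
  ultimately show ?thesis by simp
qed

text \<open>Frobenius integrability: the two sides are the coefficients of \<open>f c\<close> in the
  two mixed second derivatives of a solution of \<open>pd i f = A i f\<close>.\<close>

definition curvature_free ::
  "'i set \<Rightarrow> ('i \<Rightarrow> complex) set \<Rightarrow> nat \<Rightarrow> ('i \<Rightarrow> nat \<Rightarrow> nat \<Rightarrow> ('i \<Rightarrow> complex) \<Rightarrow> complex) \<Rightarrow> bool" where
  "curvature_free I D n A \<longleftrightarrow> (\<forall>i\<in>I. \<forall>j\<in>I. \<forall>b<n. \<forall>c<n. \<forall>p\<in>D.
     pd j (A i b c) p + (\<Sum>d<n. A i b d p * A j d c p) = pd i (A j b c) p + (\<Sum>d<n. A j b d p * A i d c p))"

text \<open>The directions are treated one at a time: for \<open>i\<close> in \<open>J\<close> the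
  equation holds on the slice where the coordinates outside \<open>J\<close> have the values of
  \<open>a\<close>. A new direction is solved by \<open>picard\<close> with the previous functions
  as initial values, which is why a bound \<open>M\<close> is carried along.\<close>

lemma local_flat_section:
  assumes fin: "finite I" and e: "e > 0"
    and hA: "\<And>i b c. i \<in> I \<Longrightarrow> b < n \<Longrightarrow> c < n \<Longrightarrow> hol I (polybox I a e) (A i b c)"
    and AC: "\<And>i b c q. i \<in> I \<Longrightarrow> b < n \<Longrightarrow> c < n \<Longrightarrow> q \<in> polybox I a e \<Longrightarrow> norm (A i b c q) \<le> C"
    and C: "0 \<le> C" "real n * C * e \<le> 1/2" "e * (real n * real n * C) \<le> 1/2"
    and cf: "curvature_free I (polybox I a e) n A"
  shows "\<exists>f. flat_section I (polybox I a e) n A f \<and> (\<forall>b<n. f b a = w b)"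
proof -
  let ?D = "polybox I a e"
  have D: "hdom I ?D" using fin by (rule hdom_polybox)
  have "\<exists>f M. (\<forall>b<n. hol I ?D (f b) \<and> f b a = w b \<and> (\<forall>p\<in>?D. norm (f b p) \<le> M) \<and>
     (\<forall>i\<in>J. \<forall>p\<in>?D. (\<forall>k\<in>I-J. p k = a k) \<longrightarrow> pd i (f b) p = (\<Sum>c<n. A i b c p * f c p)))" if "finite J" "J \<subseteq> I" for J
    using that
  proof (induction J rule: finite_induct)
    case empty
    have "norm (w b) \<le> (\<Sum>b<n. norm (w b))" if "b < n" for b
      by (rule member_le_sum[of b "{..<n}" "\<lambda>b. norm (w b)"]) (use that in auto)
    then show ?case by (intro exI[of _ "\<lambda>b p. w b"] exI[of _ "\<Sum>b<n. norm (w b)"]) auto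
  next
    case (insert j J)
    have j: "j \<in> I" and jJ: "j \<notin> J" and JI: "J \<subseteq> I" using insert by auto
    from insert.IH[OF JI] obtain f M where f': "\<forall>b<n. hol I ?D (f b) \<and> f b a = w b \<and> (\<forall>p\<in>?D. norm (f b p) \<le> M) \<and>
     (\<forall>i\<in>J. \<forall>p\<in>?D. (\<forall>k\<in>I-J. p k = a k) \<longrightarrow> pd i (f b) p = (\<Sum>c<n. A i b c p * f c p))" by blast
    have f: "b < n \<Longrightarrow> hol I ?D (f b)" "b < n \<Longrightarrow> f b a = w b"
      "b < n \<Longrightarrow> p \<in> ?D \<Longrightarrow> norm (f b p) \<le> M"
      "b < n \<Longrightarrow> i \<in> J \<Longrightarrow> p \<in> ?D \<Longrightarrow> \<forall>k\<in>I-J. p k = a k \<Longrightarrow> pd i (f b) p = (\<Sum>c<n. A i b c p * f c p)" for b i p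
      using f' by blast+
    obtain F where F: "\<forall>b<n. hol I ?D (F b) \<and> (\<forall>p\<in>?D. norm (F b p) \<le> 2 * M \<and> (p j = a j \<longrightarrow> F b p = f b p) \<and>
       pd j (F b) p = (\<Sum>c<n. A j b c p * F c p))"

      using picard[of I j e C n a "A j" f M, OF fin j e C(1,2) hA[OF j] AC[OF j] f(1,3)] by blast
    have hF: "hol I ?D (F b)" if "b < n" for b using F that by blast
    have pdF: "pd j (F b) p = (\<Sum>c<n. A j b c p * F c p)" if "b < n" "p \<in> ?D" for b p using F that by blast
    have "pd i (F b) p = (\<Sum>c<n. A i b c p * F c p)"
      if b: "b < n" and iJ: "i \<in> J" and p: "p \<in> ?D" and sl: "\<forall>k\<in>I - insert j J. p k = a k" for b i p
    proof -
      have i: "i \<in> I" using iJ JI by auto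
      \<comment> \<open>The defect of the new functions in an old direction \<open>i\<close>. By
        zero curvature it satisfies the linear equation in the direction \<open>j\<close>, and it
        vanishes where \<open>p j = a j\<close>; uniqueness along the line finishes.\<close>
      define G where "G b q = pd i (F b) q - (\<Sum>c<n. A i b c q * F c q)" for b q
      have hAi: "hol I ?D (A i b c)" "hol I ?D (A j b c)" if "b < n" "c < n" for b c using hA that i j by auto
      have hG: "hol I ?D (G b)" if "b < n" for b
        unfolding G_def by (intro hol_diff hol_pd[OF D] hol_sum hol_mult hF hAi) (use that i in auto)
      have "pd j (G b) q = (\<Sum>c<n. A j b c q * G c q)" if b: "b < n" and q: "q \<in> ?D" for b q
      proof -
        have "pd j (G b) q = pd j (pd i (F b)) q - pd j (\<lambda>q. \<Sum>c<n. A i b c q * F c q) q"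
          unfolding G_def by (rule pd_diff[OF _ _ q j]) (intro hol_pd[OF D] hol_sum hol_mult hF hAi; use b i in auto)+
        also have "pd j (pd i (F b)) q = pd i (pd j (F b)) q" by (rule pd_comm[OF D hF[OF b] j i q])
        also have "\<dots> = pd i (\<lambda>q. \<Sum>c<n. A j b c q * F c q) q" by (rule pd_cong[OF D q i]) (use pdF b in auto)
        also have "\<dots> = (\<Sum>c<n. pd i (\<lambda>q. A j b c q * F c q) q)"
          by (rule pd_sum[OF _ q i]) (intro hol_mult hF hAi; use b in auto)
        also have "\<dots> = (\<Sum>c<n. pd i (A j b c) q * F c q + A j b c q * pd i (F c) q)"
          by (intro sum.cong refl pd_mult[OF _ _ q i] hAi hF) (use b in auto)
        also have "\<dots> = (\<Sum>c<n. pd i (A j b c) q * F c q) + (\<Sum>c<n. A j b c q * G c q)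
            + (\<Sum>c<n. \<Sum>d<n. A j b d q * A i d c q * F c q)"
        proof -
          have "(\<Sum>c<n. A j b c q * pd i (F c) q) = (\<Sum>c<n. A j b c q * G c q) + (\<Sum>c<n. A j b c q * (\<Sum>d<n. A i c d q * F d q))"
            by (simp add: G_def sum.distrib[symmetric] algebra_simps)
          also have "(\<Sum>c<n. A j b c q * (\<Sum>d<n. A i c d q * F d q)) = (\<Sum>c<n. \<Sum>d<n. A j b d q * A i d c q * F c q)"
            by (subst sum.swap) (simp add: sum_distrib_left mult.assoc)
          finally show ?thesis by (simp add: sum.distrib)
        qed
        also have "pd j (\<lambda>q. \<Sum>c<n. A i b c q * F c q) q = (\<Sum>c<n. pd j (\<lambda>q. A i b c q * F c q) q)"
          by (rule pd_sum[OF _ q j]) (intro hol_mult hF hAi; use b in auto)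
        also have "\<dots> = (\<Sum>c<n. pd j (A i b c) q * F c q + A i b c q * pd j (F c) q)"
          by (intro sum.cong refl pd_mult[OF _ _ q j] hAi hF) (use b in auto)
        also have "\<dots> = (\<Sum>c<n. pd j (A i b c) q * F c q) + (\<Sum>c<n. \<Sum>d<n. A i b d q * A j d c q * F c q)"
        proof -
          have "(\<Sum>c<n. A i b c q * pd j (F c) q) = (\<Sum>c<n. A i b c q * (\<Sum>d<n. A j c d q * F d q))"
            by (intro sum.cong refl) (use pdF q in auto)
          also have "\<dots> = (\<Sum>c<n. \<Sum>d<n. A i b d q * A j d c q * F c q)"
            by (subst sum.swap) (simp add: sum_distrib_left mult.assoc)
          finally show ?thesis by (simp add: sum.distrib)
        qed
        finally have *: "pd j (G b) q = (\<Sum>c<n. A j b c q * G c q) +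
          ((\<Sum>c<n. pd i (A j b c) q * F c q) + (\<Sum>c<n. \<Sum>d<n. A j b d q * A i d c q * F c q) -
          ((\<Sum>c<n. pd j (A i b c) q * F c q) + (\<Sum>c<n. \<Sum>d<n. A i b d q * A j d c q * F c q)))" by simp
        have "(\<Sum>c<n. pd i (A j b c) q * F c q) + (\<Sum>c<n. \<Sum>d<n. A j b d q * A i d c q * F c q) =
           (\<Sum>c<n. (pd i (A j b c) q + (\<Sum>d<n. A j b d q * A i d c q)) * F c q)"
          by (simp add: sum.distrib distrib_right sum_distrib_right)
        also have "\<dots> = (\<Sum>c<n. (pd j (A i b c) q + (\<Sum>d<n. A i b d q * A j d c q)) * F c q)"
        proof (rule sum.cong[OF refl])
          fix c assume "c \<in> {..<n}"
          then have "pd j (A i b c) q + (\<Sum>d<n. A i b d q * A j d c q) = pd i (A j b c) q + (\<Sum>d<n. A j b d q * A i d c q)"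
            using cf i j b q unfolding curvature_free_def by auto
          then show "(pd i (A j b c) q + (\<Sum>d<n. A j b d q * A i d c q)) * F c q = (pd j (A i b c) q + (\<Sum>d<n. A i b d q * A j d c q)) * F c q"
            by simp
        qed
        also have "\<dots> = (\<Sum>c<n. pd j (A i b c) q * F c q) + (\<Sum>c<n. \<Sum>d<n. A i b d q * A j d c q * F c q)"
          by (simp add: sum.distrib distrib_right sum_distrib_right)
        finally show ?thesis using * by simp
      qed
      note Gode = this
      define p' where "p' = p(j := a j)"
      have p'D: "p' \<in> ?D" unfolding p'_def by (rule polybox_upd[OF p j]) (use e in simp)
      have p'j: "p' j = a j" by (simp add: p'_def)
      have G0: "G b p' = 0" if b: "b < n" for b
      proof -
        have "pd i (F b) p' = pd i (f b) p'"
        proof -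
          have "((\<lambda>s. f b (p'(i := s))) has_field_derivative pd i (f b) p') (at (p' i))" by (rule hol_deriv[OF f(1)[OF b] p'D i])
          then have "((\<lambda>s. F b (p'(i := s))) has_field_derivative pd i (f b) p') (at (p' i))"
          proof (rule DERIV_cong_ev[THEN iffD1, rotated -1])
            show "eventually (\<lambda>s. f b (p'(i := s)) = F b (p'(i := s))) (nhds (p' i))"
              using hol_eventually[OF D p'D i]
            proof eventually_elim
              fix s assume s: "p'(i := s) \<in> ?D"
              have "(p'(i := s)) j = a j" using p'j iJ jJ by auto
              then show "f b (p'(i := s)) = F b (p'(i := s))" using F s b by auto
            qed
          qed auto
          then show ?thesis by (rule pd_eqI)
        qed
        also have "\<dots> = (\<Sum>c<n. A i b c p' * f c p')"
          by (rule f(4)[OF b iJ p'D]) (use sl in \<open>auto simp: p'_def\<close>)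
        also have "\<dots> = (\<Sum>c<n. A i b c p' * F c p')"
          by (intro sum.cong refl) (use F p'D p'j in auto)
        finally show ?thesis by (simp add: G_def)
      qed
      have "G b (p'(j := p j)) = 0"
      proof (rule zero_along_line[where f = G and D = ?D and A = "A j" and C = C and p = p' and s = "p j" and i = j, OF hG Gode j _ AC[OF j] C(1) _ G0 b])
        fix w assume w: "w \<in> closed_segment (p' j) (p j)"
        show "p'(j := w) \<in> ?D" by (rule polybox_upd[OF p'D j polybox_segment[OF p'D p j w]])
      next
        have "norm (p j - p' j) \<le> e" using p j unfolding p'j polybox_def by (auto simp: dist_norm intro: less_imp_le)
        then have "norm (p j - p' j) * (real n * real n * C) \<le> e * (real n * real n * C)"
          using C(1) by (intro mult_right_mono) auto
        then show "norm (p j - p' j) * (real n * real n * C) \<le> 1/2" using C(3) by simp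
      qed auto
      then show ?thesis by (simp add: p'_def G_def)
    qed
    then have "\<forall>b<n. hol I ?D (F b) \<and> F b a = w b \<and> (\<forall>p\<in>?D. norm (F b p) \<le> 2 * M) \<and>
     (\<forall>i\<in>insert j J. \<forall>p\<in>?D. (\<forall>k\<in>I-insert j J. p k = a k) \<longrightarrow> pd i (F b) p = (\<Sum>c<n. A i b c p * F c p))"
      using F f(2) polybox_center[OF e, of a I] by auto
    then show ?case by blast
  qed
  from this[OF fin] show ?thesis unfolding flat_section_def by auto
qed

lemma path_connected_polybox: "path_connected (polybox I a e)"
  unfolding path_connected_def
proof (intro ballI)
  fix p q assume pq: "p \<in> polybox I a e" "q \<in> polybox I a e"
  define g where "g t = (\<lambda>k. linepath (p k) (q k) t)" for t
  have "path g"
    unfolding path_def g_def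
    by (rule continuous_on_coordinatewise_then_product) (intro continuous_on_linepath)
  moreover have "g t \<in> polybox I a e" if t: "t \<in> {0..1}" for t
  proof -
    have "dist (g t k) (a k) < e" if k: "k \<in> I" for k
      by (rule polybox_segment[OF pq k]) (use t in \<open>auto simp: g_def linepath_in_path\<close>)
    moreover have "g t k = a k" if "k \<notin> I" for k
      using that pq by (simp add: g_def polybox_def linepath_refl)
    ultimately show ?thesis by (auto simp: polybox_def)
  qed
  ultimately show "\<exists>g. path g \<and> path_image g \<subseteq> polybox I a e \<and> pathstart g = p \<and> pathfinish g = q"
    by (intro exI[of _ g]) (auto simp: path_image_def pathstart_def pathfinish_def g_def linepath_0' linepath_1')
qed

lemma finite_polybox:
  assumes "finite S" "\<And>s. s \<in> S \<Longrightarrow> \<exists>e>0. polybox I a e \<subseteq> P s"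
  shows "\<exists>e>0. \<forall>s\<in>S. polybox I a e \<subseteq> P s"
  using assms
proof (induction S rule: finite_induct)
  case empty then show ?case by (intro exI[of _ 1]) auto
next
  case (insert x S)
  obtain e1 where e1: "e1 > 0" "\<forall>s\<in>S. polybox I a e1 \<subseteq> P s" using insert by auto
  obtain e2 where e2: "e2 > 0" "polybox I a e2 \<subseteq> P x" using insert.prems[of x] by blast
  have m: "polybox I a (min e1 e2) \<subseteq> polybox I a e1" "polybox I a (min e1 e2) \<subseteq> polybox I a e2"
    by (intro polybox_mono; simp)+
  then show ?case using e1 e2 by (intro exI[of _ "min e1 e2"]) auto
qed

text \<open>The radius \<open>3 * e\<close> leaves room to prescribe a section at an arbitrary point
  of the box of radius \<open>e\<close>: the box of radius \<open>2 * e\<close> around that point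
  contains the small box and stays inside the large one.\<close>

lemma good_box:
  fixes A :: "'i \<Rightarrow> nat \<Rightarrow> nat \<Rightarrow> ('i \<Rightarrow> complex) \<Rightarrow> complex"
  assumes dom: "hdom I \<Omega>" and a: "a \<in> \<Omega>"
    and hA: "\<And>i b c. i \<in> I \<Longrightarrow> b < n \<Longrightarrow> c < n \<Longrightarrow> hol I \<Omega> (A i b c)"
  shows "\<exists>e C. e > 0 \<and> C \<ge> 0 \<and> polybox I a (3 * e) \<subseteq> \<Omega> \<and>
    (\<forall>i\<in>I. \<forall>b<n. \<forall>c<n. \<forall>q\<in>polybox I a (3 * e). norm (A i b c q) \<le> C) \<and>
    real n * C * (2 * e) \<le> 1/2 \<and> 2 * e * (real n * real n * C) \<le> 1/2"
proof -
  have fin: "finite I" using dom by (simp add: hdom_def)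
  define S where "S = I \<times> {..<n} \<times> {..<n}"
  have S: "finite S" using fin by (simp add: S_def)
  define C where "C = (\<Sum>(i, b, c)\<in>S. norm (A i b c a) + 1)"
  have C0: "C \<ge> 0" unfolding C_def by (intro sum_nonneg) auto
  have AC: "norm (A i b c a) + 1 \<le> C" if "(i, b, c) \<in> S" for i b c
    unfolding C_def using member_le_sum[OF that, of "\<lambda>(i, b, c). norm (A i b c a) + 1"] S by auto
  have "\<exists>e>0. \<forall>s\<in>S. polybox I a e \<subseteq> {q \<in> \<Omega>. norm (A (fst s) (fst (snd s)) (snd (snd s)) q) \<le> C}"
  proof (rule finite_polybox[OF S])
    fix s assume s: "s \<in> S"
    obtain i b c where ibc: "s = (i, b, c)" by (cases s)
    have "hol I \<Omega> (A i b c)" using s hA by (auto simp: ibc S_def)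
    from continuous_polybox_bound[OF dom hol_continuous[OF this] a]
    obtain e where e: "e > 0" "polybox I a e \<subseteq> \<Omega>" "\<forall>p\<in>polybox I a e. norm (A i b c p) \<le> norm (A i b c a) + 1" by blast
    then have "polybox I a e \<subseteq> {q \<in> \<Omega>. norm (A i b c q) \<le> C}" using AC[of i b c] s ibc by force
    then show "\<exists>e>0. polybox I a e \<subseteq> {q \<in> \<Omega>. norm (A (fst s) (fst (snd s)) (snd (snd s)) q) \<le> C}"
      using e(1) ibc by auto
  qed
  then obtain e1 where e1: "e1 > 0" "\<And>s. s \<in> S \<Longrightarrow> polybox I a e1 \<subseteq> {q \<in> \<Omega>. norm (A (fst s) (fst (snd s)) (snd (snd s)) q) \<le> C}"
    by blast
  obtain e2 where e2: "e2 > 0" "polybox I a e2 \<subseteq> \<Omega>" using dom a by (auto simp: hdom_def)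
  \<comment> \<open>A single bound for the constants in the existence and the uniqueness condition;
    \<open>e \<le> 1 / (4 * K)\<close> then serves both.\<close>
  define K where "K = real n * C + real n * real n * C + 1"
  have K: "K \<ge> 1" "real n * C \<le> K" "real n * real n * C \<le> K" using C0 by (auto simp: K_def)
  define e where "e = min (min e1 e2 / 3) (1 / (4 * K))"
  have e: "e > 0" using e1 e2 K by (auto simp: e_def)
  have e12: "3 * e \<le> e1" "3 * e \<le> e2" by (auto simp: e_def)
  have "e \<le> 1 / (4 * K)" by (simp add: e_def)
  then have "2 * e * K \<le> 1/2" using K by (simp add: field_simps)
  then have "2 * e * (real n * C) \<le> 1/2" "2 * e * (real n * real n * C) \<le> 1/2"
    using K e by (smt (verit) mult_left_mono)+
  moreover have "polybox I a (3 * e) \<subseteq> \<Omega>" using polybox_mono[OF e12(2)] e2 by blast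
  moreover have "norm (A i b c q) \<le> C" if "i \<in> I" "b < n" "c < n" "q \<in> polybox I a (3 * e)" for i b c q
    using e1(2)[of "(i, b, c)"] polybox_mono[OF e12(1)] that by (auto simp: S_def)
  ultimately show ?thesis using e C0 by (intro exI[of _ e] exI[of _ C]) (simp add: mult.commute)
qed

lemma flat_section_subset: "flat_section I D n A f \<Longrightarrow> D' \<subseteq> D \<Longrightarrow> flat_section I D' n A f"
  unfolding flat_section_def using hol_subset by blast

lemma flat_section_diff:
  assumes "flat_section I D n A f" "flat_section I D n A g"
  shows "flat_section I D n A (\<lambda>b p. f b p - g b p)"
  unfolding flat_section_def
proof (intro allI impI conjI ballI)
  fix b assume b: "b < n"
  have h: "hol I D (f b)" "hol I D (g b)" using assms b by (auto simp: flat_section_def)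
  then show "hol I D (\<lambda>p. f b p - g b p)" by (rule hol_diff)
  fix p i assume "p \<in> D" "i \<in> I"
  then show "pd i (\<lambda>p. f b p - g b p) p = (\<Sum>c<n. A i b c p * (f c p - g c p))"
    using pd_diff[OF h] assms b by (simp add: flat_section_def right_diff_distrib sum_subtractf)
qed

section \<open>Gluing local flat sections over a simply connected domain\<close>

locale flat_system =
  fixes I :: "'i set" and \<Omega> :: "('i \<Rightarrow> complex) set" and n :: nat
    and A :: "'i \<Rightarrow> nat \<Rightarrow> nat \<Rightarrow> ('i \<Rightarrow> complex) \<Rightarrow> complex"
  assumes dom: "hdom I \<Omega>" and sc: "simply_connected \<Omega>"
    and hA: "\<And>i b c. i \<in> I \<Longrightarrow> hol I \<Omega> (A i b c)"
    and cf: "curvature_free I \<Omega> n A"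
begin

lemma fin: "finite I" using dom by (simp add: hdom_def)

definition "good a e C \<longleftrightarrow> e > 0 \<and> C \<ge> 0 \<and> polybox I a (3 * e) \<subseteq> \<Omega> \<and>
    (\<forall>i\<in>I. \<forall>b<n. \<forall>c<n. \<forall>q\<in>polybox I a (3 * e). norm (A i b c q) \<le> C) \<and>
    real n * C * (2 * e) \<le> 1/2 \<and> 2 * e * (real n * real n * C) \<le> 1/2"

definition rad :: "('i \<Rightarrow> complex) \<Rightarrow> real" where "rad a = (SOME e. \<exists>C. good a e C)"

lemma rad: "a \<in> \<Omega> \<Longrightarrow> \<exists>C. good a (rad a) C"
  unfolding rad_def by (rule someI_ex) (use good_box[OF dom _ hA] in \<open>simp add: good_def\<close>)

definition nb :: "('i \<Rightarrow> complex) \<Rightarrow> ('i \<Rightarrow> complex) set" where "nb a = polybox I a (rad a)"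

lemma rad_pos: "a \<in> \<Omega> \<Longrightarrow> rad a > 0" using rad by (auto simp: good_def)
lemma nb_self: "a \<in> \<Omega> \<Longrightarrow> a \<in> nb a" unfolding nb_def by (rule polybox_center[OF rad_pos])
lemma nb_sub: "a \<in> \<Omega> \<Longrightarrow> nb a \<subseteq> \<Omega>"
  using rad[of a] polybox_mono[of "rad a" "3 * rad a" I a] by (auto simp: nb_def good_def)

lemma nb_exists:
  assumes a: "a \<in> \<Omega>" and p: "p \<in> nb a"
  shows "\<exists>f. flat_section I (nb a) n A f \<and> (\<forall>b<n. f b p = w b)"
proof -
  obtain C where C: "good a (rad a) C" using rad[OF a] by blast
  let ?e = "rad a"
  have sub: "polybox I p (2 * ?e) \<subseteq> polybox I a (3 * ?e)" using p unfolding nb_def by (rule polybox_trans) simp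
  have sub\<Omega>: "polybox I p (2 * ?e) \<subseteq> \<Omega>" using sub C by (auto simp: good_def)
  have "\<exists>f. flat_section I (polybox I p (2 * ?e)) n A f \<and> (\<forall>b<n. f b p = w b)"
  proof (rule local_flat_section[OF fin])
    show "hol I (polybox I p (2 * ?e)) (A i b c)" if "i \<in> I" for i b c using hol_subset[OF hA[OF that] sub\<Omega>] .
    show "curvature_free I (polybox I p (2 * ?e)) n A"
      using cf sub\<Omega> unfolding curvature_free_def by blast
    show "0 \<le> C" "real n * C * (2 * ?e) \<le> 1/2" "2 * ?e * (real n * real n * C) \<le> 1/2" "2 * ?e > 0" using C by (auto simp: good_def)
    show "norm (A i b c q) \<le> C" if "i \<in> I" "b < n" "c < n" "q \<in> polybox I p (2 * ?e)" for i b c q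
      using C sub that by (auto simp: good_def)
  qed
  moreover have "nb a \<subseteq> polybox I p (2 * ?e)"
  proof -
    have "a \<in> polybox I p ?e" using p by (auto simp: nb_def polybox_def dist_commute)
    then show ?thesis unfolding nb_def by (rule polybox_trans) simp
  qed
  ultimately show ?thesis using flat_section_subset by blast
qed

lemma nb_unique:
  assumes a: "a \<in> \<Omega>" and f: "flat_section I (nb a) n A f" and g: "flat_section I (nb a') n A g"
    and p: "p \<in> nb a" "p \<in> nb a'" and q: "q \<in> nb a" "q \<in> nb a'"
    and eq: "\<And>b. b < n \<Longrightarrow> f b p = g b p" and b: "b < n"
  shows "f b q = g b q"
proof -
  obtain C where C: "good a (rad a) C" using rad[OF a] by blast
  have "f b q - g b q = 0"
  proof (rule zero_move[where f = "\<lambda>b p. f b p - g b p" and D = "nb a \<inter> nb a'" and a = a and a' = a' and e = "rad a" and e' = "rad a'" and C = C, OF fin])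
    show "flat_section I (nb a \<inter> nb a') n A (\<lambda>b p. f b p - g b p)"
      by (rule flat_section_diff) (use f g flat_section_subset in blast)+
    show "nb a \<inter> nb a' = polybox I a (rad a) \<inter> polybox I a' (rad a')" by (simp add: nb_def)
    show "0 \<le> C" "2 * rad a * (real n * real n * C) \<le> 1/2" using C by (auto simp: good_def)
    show "norm (A i b c q) \<le> C" if "i \<in> I" "b < n" "c < n" "q \<in> nb a \<inter> nb a'" for i b c q
      using C that polybox_mono[of "rad a" "3 * rad a" I a] by (auto simp: good_def nb_def)
  qed (use p q eq b in auto)
  then show ?thesis by simp
qed

text \<open>The choice ranges over all boxes containing both points and all local sections with
  value \<open>w\<close> at \<open>p\<close>; by \<open>nb_unique\<close> the value is the same for
  all of them. Components from \<open>n\<close> on are passed through unchanged, so that the cocycle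
  laws hold as equations between functions.\<close>

definition \<tau> :: "('i \<Rightarrow> complex) \<Rightarrow> ('i \<Rightarrow> complex) \<Rightarrow> (nat \<Rightarrow> complex) \<Rightarrow> nat \<Rightarrow> complex" where
  "\<tau> p q w = (\<lambda>b. if b < n then (SOME v. \<exists>a\<in>\<Omega>. p \<in> nb a \<and> q \<in> nb a \<and>
     (\<exists>f. flat_section I (nb a) n A f \<and> (\<forall>c<n. f c p = w c) \<and> v = f b q)) else w b)"

lemma \<tau>_eq:
  assumes a: "a \<in> \<Omega>" "p \<in> nb a" "q \<in> nb a" and f: "flat_section I (nb a) n A f" "\<And>c. c < n \<Longrightarrow> f c p = w c" and b: "b < n"
  shows "\<tau> p q w b = f b q"
proof -
  have "(SOME v. \<exists>a\<in>\<Omega>. p \<in> nb a \<and> q \<in> nb a \<and>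
     (\<exists>f. flat_section I (nb a) n A f \<and> (\<forall>c<n. f c p = w c) \<and> v = f b q)) = f b q"
  proof (rule some_equality)
    show "\<exists>a\<in>\<Omega>. p \<in> nb a \<and> q \<in> nb a \<and> (\<exists>f'. flat_section I (nb a) n A f' \<and> (\<forall>c<n. f' c p = w c) \<and> f b q = f' b q)"
      using a f by blast
    fix v assume "\<exists>a\<in>\<Omega>. p \<in> nb a \<and> q \<in> nb a \<and> (\<exists>f. flat_section I (nb a) n A f \<and> (\<forall>c<n. f c p = w c) \<and> v = f b q)"
    then obtain a' g where g: "a' \<in> \<Omega>" "p \<in> nb a'" "q \<in> nb a'" "flat_section I (nb a') n A g" "\<forall>c<n. g c p = w c" "v = g b q" by blast
    show "v = f b q" unfolding g(6)
      by (rule nb_unique[OF g(1,4) f(1) g(2) a(2) g(3) a(3) _ b]) (use g(5) f(2) in auto)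
  qed
  then show ?thesis using b by (simp add: \<tau>_def)
qed

sublocale local_cocycle \<Omega> "nb ` \<Omega>" \<tau>
proof unfold_locales
  show "\<Omega> = \<Union> (nb ` \<Omega>)" using nb_self nb_sub by blast
  fix B assume "B \<in> nb ` \<Omega>"
  then obtain a where a: "a \<in> \<Omega>" "B = nb a" by blast
  show "openin (top_of_set \<Omega>) B" using openin_polybox[OF dom a(1)] nb_sub[OF a(1)] a(2) by (simp add: nb_def)
  show "path_connected B" unfolding a(2) nb_def by (rule path_connected_polybox)
  fix p q r w assume pqr: "p \<in> B" "q \<in> B" "r \<in> B"
  obtain f where f: "flat_section I (nb a) n A f" "\<And>b. b < n \<Longrightarrow> f b p = w b" using nb_exists[OF a(1), of p w] pqr a by auto
  show "\<tau> q r (\<tau> p q w) = \<tau> p r w"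
  proof
    fix b show "\<tau> q r (\<tau> p q w) b = \<tau> p r w b"
    proof (cases "b < n")
      case True
      have "\<tau> p q w c = f c q" if "c < n" for c using \<tau>_eq[OF a(1) _ _ f that] pqr a by auto
      then have "\<tau> q r (\<tau> p q w) b = f b r" using \<tau>_eq[OF a(1) _ _ f(1) _ True] pqr a by auto
      then show ?thesis using \<tau>_eq[OF a(1) _ _ f True] pqr a by auto
    qed (simp add: \<tau>_def)
  qed
next
  fix p w assume p: "p \<in> \<Omega>"
  obtain f where f: "flat_section I (nb p) n A f" "\<And>b. b < n \<Longrightarrow> f b p = w b" using nb_exists[OF p nb_self[OF p], of w] by auto
  show "\<tau> p p w = w"
  proof
    fix b show "\<tau> p p w b = w b"
      using \<tau>_eq[OF p nb_self[OF p] nb_self[OF p] f, of b] f(2)[of b] by (cases "b < n") (auto simp: \<tau>_def)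
  qed
qed

text \<open>On every \<open>nb a\<close> the function \<open>G\<close> supplied by
  \<open>coboundary\<close> coincides with the local section through \<open>G a\<close>; holomorphy
  and the equations are local and are inherited from there.\<close>

lemma global_section:
  assumes p0: "p0 \<in> \<Omega>"
  shows "\<exists>f. flat_section I \<Omega> n A f \<and> (\<forall>b<n. f b p0 = w b)"
proof -
  obtain G where G: "G p0 = w" "\<And>a p q. a \<in> \<Omega> \<Longrightarrow> p \<in> nb a \<Longrightarrow> q \<in> nb a \<Longrightarrow> G q = \<tau> p q (G p)"
    using coboundary[OF sc p0, of w] by blast
  define f where "f b p = G p b" for b p
  have loc: "\<exists>F. flat_section I (nb a) n A F \<and> (\<forall>b<n. \<forall>q\<in>nb a. F b q = f b q)" if a: "a \<in> \<Omega>" for a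
  proof -
    obtain F where F: "flat_section I (nb a) n A F" "\<And>b. b < n \<Longrightarrow> F b a = G a b"
      using nb_exists[OF a nb_self[OF a], of "G a"] by auto
    have "F b q = f b q" if "b < n" "q \<in> nb a" for b q
      using \<tau>_eq[OF a nb_self[OF a] that(2) F that(1)] G(2)[OF a nb_self[OF a] that(2)] by (simp add: f_def)
    then show ?thesis using F(1) by blast
  qed
  have nbd: "hdom I (nb a)" for a unfolding nb_def by (rule hdom_polybox[OF fin])
  have lf: "flat_section I (nb a) n A f" if a: "a \<in> \<Omega>" for a
  proof -
    obtain F where F: "flat_section I (nb a) n A F" "\<And>b q. b < n \<Longrightarrow> q \<in> nb a \<Longrightarrow> F b q = f b q" using loc[OF a] by blast
    show ?thesis unfolding flat_section_def
    proof (intro allI impI conjI ballI)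
      fix b assume b: "b < n"
      show "hol I (nb a) (f b)" by (rule hol_cong[OF nbd F(2)[OF b]]) (use F(1) b in \<open>auto simp: flat_section_def\<close>)
      fix p i assume p: "p \<in> nb a" and i: "i \<in> I"
      have "pd i (f b) p = pd i (F b) p" by (rule pd_cong[OF nbd p i]) (use F(2)[OF b] in simp)
      also have "\<dots> = (\<Sum>c<n. A i b c p * F c p)" using F(1) b p i by (auto simp: flat_section_def)
      also have "\<dots> = (\<Sum>c<n. A i b c p * f c p)" by (intro sum.cong refl) (use F(2) p in auto)
      finally show "pd i (f b) p = (\<Sum>c<n. A i b c p * f c p)" .
    qed
  qed
  have "flat_section I \<Omega> n A f"
    unfolding flat_section_def
  proof (intro allI impI conjI ballI)
    fix b assume b: "b < n"
    have "continuous_on \<Omega> (f b)"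
    proof (rule hdom_continuous_onI[OF dom])
      fix a assume a: "a \<in> \<Omega>"
      show "\<exists>e>0. polybox I a e \<subseteq> \<Omega> \<and> continuous_on (polybox I a e) (f b)"
        using rad_pos[OF a] nb_sub[OF a] lf[OF a] b hol_continuous unfolding nb_def flat_section_def by blast
    qed
    moreover have "(\<lambda>s. f b (p(i := s))) field_differentiable at (p i)" if "p \<in> \<Omega>" "i \<in> I" for p i
      using lf[OF that(1)] nb_self[OF that(1)] b that(2) unfolding flat_section_def hol_def by blast
    ultimately show "hol I \<Omega> (f b)" by (simp add: hol_def)
    fix p i assume "p \<in> \<Omega>" "i \<in> I"
    then show "pd i (f b) p = (\<Sum>c<n. A i b c p * f c p)"
      using lf[of p] nb_self[of p] b unfolding flat_section_def by blast
  qed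
  then show ?thesis using G(1) by (intro exI[of _ f]) (simp add: f_def)
qed

text \<open>On each \<open>nb x\<close> a section vanishing at one point vanishes everywhere. Hence
  its zero set and the complement are both relatively open in the connected
  \<open>\<Omega>\<close>.\<close>

lemma section_zero:
  assumes f: "flat_section I \<Omega> n A f" and z: "\<And>b. b < n \<Longrightarrow> f b p = 0" and p: "p \<in> \<Omega>" and q: "q \<in> \<Omega>" and b: "b < n"
  shows "f b q = 0"
proof -
  have move: "\<forall>b<n. f b y = 0" if a: "a \<in> \<Omega>" and xy: "x \<in> nb a" "y \<in> nb a" and zx: "\<forall>b<n. f b x = 0" for a x y
  proof -
    have "flat_section I (nb a) n A (\<lambda>b p. 0)" by (simp add: flat_section_def)
    then show ?thesis
      using nb_unique[OF a flat_section_subset[OF f nb_sub[OF a]] _ xy(1) xy(1) xy(2) xy(2)] zx by auto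
  qed
  define Z where "Z = {x \<in> \<Omega>. \<forall>b<n. f b x = 0}"
  have conn: "connected \<Omega>" using simply_connected_path_connected[OF sc] by (rule path_connected_imp_connected)
  have ope: "openin (top_of_set \<Omega>) (nb a)" if "a \<in> \<Omega>" for a using ope that by blast
  have "openin (top_of_set \<Omega>) Z"
  proof (subst openin_subopen, intro ballI)
    fix x assume "x \<in> Z"
    then show "\<exists>T. openin (top_of_set \<Omega>) T \<and> x \<in> T \<and> T \<subseteq> Z"
      using ope[of x] nb_self[of x] nb_sub[of x] move[of x x] unfolding Z_def by blast
  qed
  moreover have "openin (top_of_set \<Omega>) (\<Omega> - Z)"
  proof (subst openin_subopen, intro ballI)
    fix x assume "x \<in> \<Omega> - Z"
    then show "\<exists>T. openin (top_of_set \<Omega>) T \<and> x \<in> T \<and> T \<subseteq> \<Omega> - Z"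
      using ope[of x] nb_self[of x] nb_sub[of x] move[of x _ x] unfolding Z_def by blast
  qed
  ultimately have "Z = {} \<or> Z = \<Omega>"
    using conn unfolding connected_clopen by (auto simp: closedin_def Z_def)
  then show ?thesis using p q b z unfolding Z_def by blast
qed

end

lemma global_flat_section:
  assumes "hdom I \<Omega>" "simply_connected \<Omega>" "p0 \<in> \<Omega>" "\<And>i b c. i \<in> I \<Longrightarrow> hol I \<Omega> (A i b c)" "curvature_free I \<Omega> n A"
  shows "\<exists>f. flat_section I \<Omega> n A f \<and> (\<forall>b<n. f b p0 = w b)"
proof -
  interpret flat_system I \<Omega> n A by unfold_locales (use assms in auto)
  show ?thesis by (rule global_section[OF assms(3)])
qed

lemma flat_section_zero:
  assumes "hdom I \<Omega>" "simply_connected \<Omega>" "p \<in> \<Omega>" "\<And>i b c. i \<in> I \<Longrightarrow> hol I \<Omega> (A i b c)" "curvature_free I \<Omega> n A"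
    "flat_section I \<Omega> n A f" "\<And>b. b < n \<Longrightarrow> f b p = 0" "q \<in> \<Omega>" "b < n"
  shows "f b q = 0"
proof -
  interpret flat_system I \<Omega> n A by unfold_locales (use assms in auto)
  show ?thesis by (rule section_zero[OF assms(6,7,3,8,9)])
qed

section \<open>Band recurrences with a zero curvature condition\<close>

locale hol_recurrence =
  fixes I :: "'i set" and \<Omega> :: "('i \<Rightarrow> complex) set" and d :: nat
    and a :: "nat \<Rightarrow> nat \<Rightarrow> ('i \<Rightarrow> complex) \<Rightarrow> complex"
  assumes ha: "\<And>n j. j \<le> Suc d \<Longrightarrow> hol I \<Omega> (a n j)"
    and low: "\<And>n p. p \<in> \<Omega> \<Longrightarrow> a n 0 p \<noteq> 0"
    and high: "\<And>n p. p \<in> \<Omega> \<Longrightarrow> a n (Suc d) p \<noteq> 0"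
begin

definition solves :: "nat \<Rightarrow> (nat \<Rightarrow> complex) \<Rightarrow> ('i \<Rightarrow> complex) \<Rightarrow> bool" where
  "solves r e p \<longleftrightarrow> (\<forall>n\<ge>r. (\<Sum>j\<le>Suc d. a n j p * e (n + j)) = 0)"

text \<open>The highest coefficient continues the zeros of a window upwards, the lowest one
  downwards, as far as rows are imposed.\<close>

lemma solves_zero:
  assumes p: "p \<in> \<Omega>" and s: "solves r e p" and N: "N \<ge> r" and w: "\<And>l. l \<le> d \<Longrightarrow> e (N + l) = 0" and m: "m \<ge> r"
  shows "e m = 0"
proof -
  have fwd: "\<forall>l\<le>d. e (n + l) = 0" if "n \<ge> N" for n
    using that
  proof (induction n rule: dec_induct)
    case base then show ?case using w by simp
  next
    case (step n)
    have "(\<Sum>j\<le>Suc d. a n j p * e (n + j)) = 0" using s step(1) N unfolding solves_def by auto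
    then have "a n (Suc d) p * e (n + Suc d) = 0" using step(3) by simp
    then have "e (n + Suc d) = 0" using high[OF p] by simp
    show ?case
    proof (intro allI impI)
      fix l assume "l \<le> d"
      show "e (Suc n + l) = 0"
      proof (cases "l = d")
        case True then show ?thesis using \<open>e (n + Suc d) = 0\<close> by simp
      next
        case False then show ?thesis using step(3)[rule_format, of "Suc l"] \<open>l \<le> d\<close> by simp
      qed
    qed
  qed
  have bwd: "\<forall>l\<le>d. e (n + l) = 0" if "n \<le> N" "r \<le> n" for n
    using that
  proof (induction n rule: inc_induct)
    case base then show ?case using w by simp
  next
    case (step n)
    have "(\<Sum>j\<le>Suc d. a n j p * e (n + j)) = 0" using s step unfolding solves_def by auto
    moreover have "(\<Sum>j\<le>Suc d. a n j p * e (n + j)) = a n 0 p * e n + (\<Sum>j\<le>d. a n (Suc j) p * e (n + Suc j))"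
      by (subst sum.atMost_Suc_shift) simp
    moreover have "(\<Sum>j\<le>d. a n (Suc j) p * e (n + Suc j)) = 0"
      by (rule sum.neutral) (use step in auto)
    ultimately have "e n = 0" using low[OF p] by simp
    show ?case
    proof (intro allI impI)
      fix l assume "l \<le> d"
      then show "e (n + l) = 0" using \<open>e n = 0\<close> step by (cases l) auto
    qed
  qed
  show ?thesis using fwd[of m] bwd[of m] m by (cases "N \<le> m") force+
qed

lemma solution_exists0:
  assumes hx: "\<And>l. l \<le> d \<Longrightarrow> hol I \<Omega> (x l)"
  shows "\<exists>u. (\<forall>n. hol I \<Omega> (u n)) \<and> (\<forall>l\<le>d. u l = x l) \<and> (\<forall>p\<in>\<Omega>. solves 0 (\<lambda>n. u n p) p)"
proof -
  \<comment> \<open>\<open>F j\<close> has its final values up to index \<open>d + j\<close>; each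
    row determines one further entry, and the diagonal \<open>F n n\<close> collects them.\<close>
  define F where "F = rec_nat (\<lambda>n. if n \<le> d then x n else (\<lambda>_. 0))
    (\<lambda>j (u :: nat \<Rightarrow> ('i \<Rightarrow> complex) \<Rightarrow> complex). u(Suc d + j := (\<lambda>p. - (\<Sum>m\<le>d. a j m p * u (j + m) p) / a j (Suc d) p)))"
  have F0: "F 0 = (\<lambda>n. if n \<le> d then x n else (\<lambda>_. 0))"
    and FS: "F (Suc j) = (F j)(Suc d + j := (\<lambda>p. - (\<Sum>m\<le>d. a j m p * F j (j + m) p) / a j (Suc d) p))" for j
    by (simp_all add: F_def)
  have hF: "hol I \<Omega> (F j n)" for j n
  proof (induction j arbitrary: n)
    case 0 then show ?case using hx by (auto simp: F0)
  next
    case (Suc j)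
    have "hol I \<Omega> (\<lambda>p. - (\<Sum>m\<le>d. a j m p * F j (j + m) p) / a j (Suc d) p)"
      by (intro hol_divide hol_minus hol_sum hol_mult ha Suc high) auto
    then show ?case using Suc by (auto simp: FS)
  qed
  have st: "F (j + k) n = F j n" if "n \<le> d + j" for j k n
    using that by (induction k) (auto simp: FS)
  define u where "u n = F n n" for n
  have uF: "u n = F j n" if "n \<le> d + j" for n j
  proof (cases "n \<le> j")
    case True
    then obtain k where "j = n + k" using le_Suc_ex by blast
    then show ?thesis using st[of n n k] by (simp add: u_def)
  next
    case False
    then obtain k where "n = j + k" by (metis le_add_diff_inverse nat_le_linear)
    then show ?thesis using st[of n j k] that by (simp add: u_def)
  qed
  have "solves 0 (\<lambda>n. u n p) p" if p: "p \<in> \<Omega>" for p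
    unfolding solves_def
  proof (intro allI impI)
    fix n
    have "u (n + Suc d) p = F (Suc n) (Suc d + n) p" using uF[of "n + Suc d" "Suc n"] by (simp add: add.commute)
    also have "\<dots> = - (\<Sum>m\<le>d. a n m p * F n (n + m) p) / a n (Suc d) p" by (simp add: FS)
    also have "(\<Sum>m\<le>d. a n m p * F n (n + m) p) = (\<Sum>m\<le>d. a n m p * u (n + m) p)"
    proof (intro sum.cong refl)
      fix m assume "m \<in> {..d}"
      then show "a n m p * F n (n + m) p = a n m p * u (n + m) p" using uF[of "n + m" n] by simp
    qed
    finally show "(\<Sum>j\<le>Suc d. a n j p * u (n + j) p) = 0" using high[OF p] by simp
  qed
  moreover have "\<forall>l\<le>d. u l = x l" using uF[of _ 0] by (auto simp: F0)
  moreover have "\<forall>n. hol I \<Omega> (u n)" using hF by (simp add: u_def)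
  ultimately show ?thesis by blast
qed

text \<open>Induction on the position of the window: row \<open>N\<close>, solved for its lowest
  entry, turns a window prescribed at \<open>N + 1\<close> into one at \<open>N\<close>. The same
  row then gives back the prescribed topmost entry, because its highest coefficient does not
  vanish.\<close>

lemma solution_exists:
  assumes hx: "\<And>l. l \<le> d \<Longrightarrow> hol I \<Omega> (x l)"
  shows "\<exists>u. (\<forall>n. hol I \<Omega> (u n)) \<and> (\<forall>l\<le>d. \<forall>p\<in>\<Omega>. u (N + l) p = x l p) \<and> (\<forall>p\<in>\<Omega>. solves 0 (\<lambda>n. u n p) p)"
  using hx
proof (induction N arbitrary: x)
  case 0
  from solution_exists0[of x, OF 0] obtain u where u: "\<forall>n. hol I \<Omega> (u n)" "\<forall>l\<le>d. u l = x l" "\<forall>p\<in>\<Omega>. solves 0 (\<lambda>n. u n p) p"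
    by blast
  then show ?case by (intro exI[of _ u]) auto
next
  case (Suc N)
  define y where "y l = (case l of 0 \<Rightarrow> (\<lambda>p. - (\<Sum>j\<le>d. a N (Suc j) p * x j p) / a N 0 p) | Suc l \<Rightarrow> x l)" for l
  have "hol I \<Omega> (y l)" if "l \<le> d" for l
  proof (cases l)
    case 0
    show ?thesis unfolding 0 y_def by (simp del: sum.atMost_Suc) (intro hol_divide hol_minus hol_sum hol_mult ha Suc low; simp)
  next
    case (Suc l') then show ?thesis using Suc.prems that by (auto simp: y_def)
  qed
  from Suc.IH[of y, OF this] obtain u where u: "\<forall>n. hol I \<Omega> (u n)" "\<forall>l\<le>d. \<forall>p\<in>\<Omega>. u (N + l) p = y l p" "\<forall>p\<in>\<Omega>. solves 0 (\<lambda>n. u n p) p"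
    by blast
  have "u (Suc N + l) p = x l p" if l: "l \<le> d" and p: "p \<in> \<Omega>" for l p
  proof (cases "l = d")
    case False
    then have "u (N + Suc l) p = y (Suc l) p" using u(2) l p by (metis Suc_leI le_neq_implies_less)
    then show ?thesis by (simp add: y_def)
  next
    case True
    have ux: "u (N + Suc j) p = x j p" if "j < d" for j
      using u(2)[rule_format, of "Suc j" p] that p by (simp add: y_def)
    have "(\<Sum>j\<le>Suc d. a N j p * u (N + j) p) = 0" using u(3) p unfolding solves_def by auto
    moreover have "(\<Sum>j\<le>Suc d. a N j p * u (N + j) p) = a N 0 p * u N p + (\<Sum>j\<le>d. a N (Suc j) p * u (N + Suc j) p)"
      by (subst sum.atMost_Suc_shift) simp
    moreover have "a N 0 p * u N p = - (\<Sum>j\<le>d. a N (Suc j) p * x j p)"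
    proof -
      have "u N p = y 0 p" using u(2) p by (metis add_0_right le0)
      then show ?thesis using low[OF p] by (simp add: y_def)
    qed
    ultimately have e: "(\<Sum>j\<le>d. a N (Suc j) p * u (N + Suc j) p) = (\<Sum>j\<le>d. a N (Suc j) p * x j p)" by simp
    have split: "(\<Sum>j\<le>d. g j) = (\<Sum>j<d. g j) + g d" for g :: "nat \<Rightarrow> complex"
      by (simp add: lessThan_Suc_atMost[symmetric])
    have "(\<Sum>j<d. a N (Suc j) p * u (N + Suc j) p) = (\<Sum>j<d. a N (Suc j) p * x j p)"
      by (intro sum.cong refl) (use ux in auto)
    then have "a N (Suc d) p * u (N + Suc d) p = a N (Suc d) p * x d p" using e unfolding split by simp
    then show ?thesis using high[OF p] True by simp
  qed
  then show ?case using u by blast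
qed

end

text \<open>\<open>b\<close> bounds all bandwidths of the \<open>M i\<close>. A sum up to
  \<open>n + b + 2\<close> contains all of row \<open>n\<close> of every matrix, so the finite sums
  in \<open>compat\<close> and \<open>curv\<close> are entries of genuine products of band
  matrices.\<close>

locale lax =
  fixes I :: "'i set" and \<Omega> :: "('i \<Rightarrow> complex) set" and d b :: nat
    and L :: "nat \<Rightarrow> nat \<Rightarrow> ('i \<Rightarrow> complex) \<Rightarrow> complex"
    and M :: "'i \<Rightarrow> nat \<Rightarrow> nat \<Rightarrow> ('i \<Rightarrow> complex) \<Rightarrow> complex"
    and lo hi :: "'i \<Rightarrow> nat"
  assumes dom: "hdom I \<Omega>" and sc: "simply_connected \<Omega>" and ne: "\<Omega> \<noteq> {}" and b1: "1 \<le> b" and d1: "1 \<le> d"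
    and L_band: "\<And>n m p. m > n + 1 \<or> n > m + d \<Longrightarrow> L n m p = 0"
    and M_band: "\<And>i n m p. i \<in> I \<Longrightarrow> m > n + hi i \<or> n > m + lo i \<Longrightarrow> M i n m p = 0"
    and lo_b: "\<And>i. i \<in> I \<Longrightarrow> lo i \<le> b" and hi_b: "\<And>i. i \<in> I \<Longrightarrow> hi i \<le> b"
    and hL: "\<And>n m. hol I \<Omega> (L n m)" and hM: "\<And>i n m. i \<in> I \<Longrightarrow> hol I \<Omega> (M i n m)"
    and L_up: "\<And>n p. p \<in> \<Omega> \<Longrightarrow> L n (Suc n) p \<noteq> 0"
    and L_low: "\<And>n p. p \<in> \<Omega> \<Longrightarrow> L (n + d) n p \<noteq> 0"
    and compat: "\<And>i n m p. i \<in> I \<Longrightarrow> p \<in> \<Omega> \<Longrightarrow>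
       pd i (L n m) p = (\<Sum>l<n+b+2. M i n l p * L l m p) - (\<Sum>l<n+b+2. L n l p * M i l m p)"
    and curv: "\<And>i j n m p. i \<in> I \<Longrightarrow> j \<in> I \<Longrightarrow> p \<in> \<Omega> \<Longrightarrow>
       pd j (M i n m) p + (\<Sum>l<n+b+2. M i n l p * M j l m p) =
       pd i (M j n m) p + (\<Sum>l<n+b+2. M j n l p * M i l m p)"
begin

section \<open>The kernel of \<open>L\<close> and the connection induced on it\<close>

definition app :: "(nat \<Rightarrow> nat \<Rightarrow> ('i \<Rightarrow> complex) \<Rightarrow> complex) \<Rightarrow> (nat \<Rightarrow> ('i \<Rightarrow> complex) \<Rightarrow> complex) \<Rightarrow> nat \<Rightarrow> ('i \<Rightarrow> complex) \<Rightarrow> complex" where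
  "app K f n p = (\<Sum>m<n+b+2. K n m p * f m p)"

lemma fin: "finite I" using dom by (simp add: hdom_def)

text \<open>The range of a row sum depends on the row; before double sums are exchanged, all ranges
  are enlarged to a common bound.\<close>

lemma sum_ext:
  assumes "\<And>m. m \<ge> n + b + 2 \<Longrightarrow> g m = 0" "R \<ge> n + b + 2"
  shows "(\<Sum>m<n+b+2. g m) = (\<Sum>m<R. (g m :: complex))"
  by (rule sum.mono_neutral_left) (use assms in auto)

lemma L_zero: "m \<ge> n + b + 2 \<Longrightarrow> L n m p = 0" using L_band b1 by auto
lemma M_zero: "i \<in> I \<Longrightarrow> m \<ge> n + b + 2 \<Longrightarrow> M i n m p = 0" using M_band[of i n m p] hi_b[of i] by auto

lemma app_L: "R \<ge> n + b + 2 \<Longrightarrow> app L f n p = (\<Sum>m<R. L n m p * f m p)"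
  unfolding app_def by (rule sum_ext) (auto simp: L_zero)
lemma app_M: "i \<in> I \<Longrightarrow> R \<ge> n + b + 2 \<Longrightarrow> app (M i) f n p = (\<Sum>m<R. M i n m p * f m p)"
  unfolding app_def by (rule sum_ext) (auto simp: M_zero)
lemma compat_ext: "i \<in> I \<Longrightarrow> p \<in> \<Omega> \<Longrightarrow> R \<ge> n + b + 2 \<Longrightarrow>
   pd i (L n m) p = (\<Sum>l<R. M i n l p * L l m p) - (\<Sum>l<R. L n l p * M i l m p)"
  unfolding compat by (subst (1 2) sum_ext[of n _ R]) (auto simp: L_zero M_zero)
lemma curv_ext: "i \<in> I \<Longrightarrow> j \<in> I \<Longrightarrow> p \<in> \<Omega> \<Longrightarrow> R \<ge> n + b + 2 \<Longrightarrow>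
   pd j (M i n m) p + (\<Sum>l<R. M i n l p * M j l m p) =
   pd i (M j n m) p + (\<Sum>l<R. M j n l p * M i l m p)"
  using curv[of i j p n m] by (subst (asm) (1 2) sum_ext[of n _ R]) (auto simp: M_zero)

lemma hol_app: "(\<And>m. hol I \<Omega> (f m)) \<Longrightarrow> (\<And>m. hol I \<Omega> (K n m)) \<Longrightarrow> hol I \<Omega> (app K f n)"
  unfolding app_def by (intro hol_sum hol_mult)

text \<open>Row \<open>n + d\<close> of \<open>L\<close> relates the entries \<open>n\<close> to
  \<open>n + d + 1\<close>. With this shift \<open>solves 0\<close> means that all rows from
  \<open>d\<close> on annihilate the sequence.\<close>

sublocale rec: hol_recurrence I \<Omega> d "\<lambda>n j. L (n + d) (n + j)"
  by unfold_locales (use hL L_up L_low in \<open>auto simp: add.commute\<close>)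

text \<open>Column \<open>Suc n\<close> of \<open>L\<close> relates the same entries, with the
  extreme coefficients exchanged; here \<open>solves 0\<close> covers all columns except column
  \<open>0\<close>.\<close>

sublocale drec: hol_recurrence I \<Omega> d "\<lambda>n j. L (n + j) (Suc n)"
proof unfold_locales
  fix n p assume p: "p \<in> \<Omega>"
  show "L (n + 0) (Suc n) p \<noteq> 0" using L_up[OF p] by simp
  show "L (n + Suc d) (Suc n) p \<noteq> 0" using L_low[OF p, of "Suc n"] by simp
qed (use hL in auto)

lemma app_L_window: "app L f (n + d) p = (\<Sum>j\<le>Suc d. L (n + d) (n + j) p * f (n + j) p)"
proof -
  have "app L f (n + d) p = (\<Sum>m<n+d+b+2. L (n + d) m p * f m p)" by (simp add: app_def)
  also have "\<dots> = (\<Sum>m\<in>(+) n ` {..Suc d}. L (n + d) m p * f m p)"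
  proof (rule sum.mono_neutral_right)
    show "(+) n ` {..Suc d} \<subseteq> {..<n + d + b + 2}" by auto
    show "\<forall>m\<in>{..<n + d + b + 2} - (+) n ` {..Suc d}. L (n + d) m p * f m p = 0"
    proof
      fix m assume m: "m \<in> {..<n + d + b + 2} - (+) n ` {..Suc d}"
      have "m < n \<or> m > n + Suc d"
      proof (rule ccontr)
        assume "\<not> ?thesis"
        then have "m = n + (m - n)" "m - n \<in> {..Suc d}" by auto
        then show False using m by blast
      qed
      then show "L (n + d) m p * f m p = 0" using L_band[of "n + d" m p] by auto
    qed
  qed auto
  also have "\<dots> = (\<Sum>j\<le>Suc d. L (n + d) (n + j) p * f (n + j) p)"
    by (subst sum.reindex) auto
  finally show ?thesis .
qed

lemma solves_iff: "rec.solves r (\<lambda>n. f n p) p \<longleftrightarrow> (\<forall>n\<ge>r + d. app L f n p = 0)"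
  unfolding rec.solves_def app_L_window[symmetric]
  by (metis add.commute add_le_cancel_right le_add_diff_inverse2 le_trans le_add2)

text \<open>Differentiating \<open>L f = 0\<close> and inserting \<open>compat\<close> gives
  \<open>L (pd i f - M f) = - M (L f)\<close>. Row \<open>n\<close> of \<open>M i\<close> begins at
  \<open>n - lo i\<close>, so \<open>L f\<close> has to vanish from there on.\<close>

lemma ker_step:
  assumes hf: "\<And>n. hol I \<Omega> (f n)" and ker: "\<And>p n. p \<in> \<Omega> \<Longrightarrow> n \<ge> r + d \<Longrightarrow> app L f n p = 0"
    and i: "i \<in> I" and p: "p \<in> \<Omega>" and n: "n \<ge> r + lo i + d"
  shows "app L (\<lambda>n p. pd i (f n) p - app (M i) f n p) n p = 0"
proof -
  define R where "R = n + 2 * b + 4"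
  have "pd i (app L f n) p = pd i (\<lambda>p. 0) p"
    by (rule pd_cong[OF dom p i]) (use ker n in auto)
  then have "0 = pd i (\<lambda>p. \<Sum>m<n+b+2. L n m p * f m p) p" by (simp add: app_def[abs_def])
  also have "\<dots> = (\<Sum>m<n+b+2. pd i (L n m) p * f m p + L n m p * pd i (f m) p)"
    by (subst pd_sum[OF hol_mult[OF hL hf] p i]) (intro sum.cong refl pd_mult[OF hL hf p i])
  also have "\<dots> = (\<Sum>m<n+b+2. pd i (L n m) p * f m p) + (\<Sum>m<n+b+2. L n m p * pd i (f m) p)" by (rule sum.distrib)
  also have "(\<Sum>m<n+b+2. pd i (L n m) p * f m p) = (\<Sum>m<R. pd i (L n m) p * f m p)"
  proof (rule sum_ext)
    fix m assume "m \<ge> n + b + 2"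
    then have "L n m = (\<lambda>p. 0)" using L_zero by auto
    then show "pd i (L n m) p * f m p = 0" by simp
  qed (simp add: R_def)
  also have "\<dots> = (\<Sum>m<R. ((\<Sum>l<n+b+2. M i n l p * L l m p) - (\<Sum>l<n+b+2. L n l p * M i l m p)) * f m p)"
    by (simp add: compat[OF i p])
  also have "\<dots> = (\<Sum>m<R. \<Sum>l<n+b+2. M i n l p * L l m p * f m p) - (\<Sum>m<R. \<Sum>l<n+b+2. L n l p * M i l m p * f m p)"
    by (simp add: left_diff_distrib sum_subtractf sum_distrib_right del: sum.lessThan_Suc add_2_eq_Suc')
  also have "(\<Sum>m<R. \<Sum>l<n+b+2. M i n l p * L l m p * f m p) = (\<Sum>l<n+b+2. M i n l p * app L f l p)"
  proof (subst sum.swap, rule sum.cong[OF refl])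
    fix l assume "l \<in> {..<n+b+2}"
    then have "app L f l p = (\<Sum>m<R. L l m p * f m p)" by (intro app_L) (auto simp: R_def)
    then show "(\<Sum>m<R. M i n l p * L l m p * f m p) = M i n l p * app L f l p" by (simp add: sum_distrib_left mult.assoc)
  qed
  also have "(\<Sum>l<n+b+2. M i n l p * app L f l p) = 0"
  proof (rule sum.neutral, intro ballI)
    fix l assume "l \<in> {..<n+b+2}"
    show "M i n l p * app L f l p = 0"
      using M_band[OF i, of n l p] ker[OF p, of l] n by (cases "n > l + lo i") auto
  qed
  also have "(\<Sum>m<R. \<Sum>l<n+b+2. L n l p * M i l m p * f m p) = (\<Sum>l<n+b+2. L n l p * app (M i) f l p)"
  proof (subst sum.swap, rule sum.cong[OF refl])
    fix l assume "l \<in> {..<n+b+2}"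
    then have "app (M i) f l p = (\<Sum>m<R. M i l m p * f m p)" by (intro app_M i) (auto simp: R_def)
    then show "(\<Sum>m<R. L n l p * M i l m p * f m p) = L n l p * app (M i) f l p" by (simp add: sum_distrib_left mult.assoc)
  qed
  finally have e: "0 = 0 - (\<Sum>l<n+b+2. L n l p * app (M i) f l p) + (\<Sum>m<n+b+2. L n m p * pd i (f m) p)" .
  have "app L (\<lambda>n p. pd i (f n) p - app (M i) f n p) n p =
     (\<Sum>m<n+b+2. L n m p * pd i (f m) p) - (\<Sum>l<n+b+2. L n l p * app (M i) f l p)"
    by (simp only: app_def[of L] right_diff_distrib sum_subtractf)
  also have "\<dots> = 0 - (\<Sum>l<n+b+2. L n l p * app (M i) f l p) + (\<Sum>m<n+b+2. L n m p * pd i (f m) p)"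
    by (simp only: diff_conv_add_uminus add_0_left add.commute)
  finally show ?thesis using e by (simp only:)
qed

lemma app_cong: "(\<And>m. K n m p \<noteq> 0 \<Longrightarrow> f m p = g m p) \<Longrightarrow> app K f n p = app K g n p"
  unfolding app_def by (intro sum.cong refl) (metis mult_zero_left)

lemma app_lin: "app K (\<lambda>m p. \<Sum>l\<in>S. c l p * u l m p) n p = (\<Sum>l\<in>S. c l p * app K (u l) n p)"
  unfolding app_def sum_distrib_left by (subst sum.swap) (simp add: mult.left_commute)

lemma app_minus: "app K (\<lambda>m p. - f m p) n p = - app K f n p"
  unfolding app_def by (simp add: sum_negf)

lemma app_diff: "app K (\<lambda>m p. f m p - g m p) n p = app K f n p - app K g n p"
  unfolding app_def by (simp add: right_diff_distrib sum_subtractf)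

text \<open>Rows \<open>n < lo i\<close> of \<open>M i\<close> are not controlled; the frame is normalised at \<open>N0\<close>, beyond two
  consecutive applications of the \<open>M i\<close>, so that those rows never enter.\<close>

definition N0 :: nat where "N0 = 2 * b"

definition basis :: "nat \<Rightarrow> nat \<Rightarrow> ('i \<Rightarrow> complex) \<Rightarrow> complex" where
  "basis k = (SOME u. (\<forall>n. hol I \<Omega> (u n)) \<and> (\<forall>l\<le>d. \<forall>p\<in>\<Omega>. u (N0 + l) p = (if l = k then 1 else 0)) \<and> (\<forall>p\<in>\<Omega>. rec.solves 0 (\<lambda>n. u n p) p))"

lemma basis: "hol I \<Omega> (basis k n)" "l \<le> d \<Longrightarrow> p \<in> \<Omega> \<Longrightarrow> basis k (N0 + l) p = (if l = k then 1 else 0)"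
  "p \<in> \<Omega> \<Longrightarrow> rec.solves 0 (\<lambda>n. basis k n p) p"
proof -
  have "\<exists>u. (\<forall>n. hol I \<Omega> (u n)) \<and> (\<forall>l\<le>d. \<forall>p\<in>\<Omega>. u (N0 + l) p = (if l = k then 1 else 0)) \<and> (\<forall>p\<in>\<Omega>. rec.solves 0 (\<lambda>n. u n p) p)"
    by (rule rec.solution_exists[where x = "\<lambda>l p. if l = k then 1 else 0"]) auto
  from someI_ex[OF this, folded basis_def]
  show "hol I \<Omega> (basis k n)" "l \<le> d \<Longrightarrow> p \<in> \<Omega> \<Longrightarrow> basis k (N0 + l) p = (if l = k then 1 else 0)"
    "p \<in> \<Omega> \<Longrightarrow> rec.solves 0 (\<lambda>n. basis k n p) p" by auto
qed

lemma basis_ker: "p \<in> \<Omega> \<Longrightarrow> n \<ge> d \<Longrightarrow> app L (basis k) n p = 0"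
  using basis(3)[of p k] solves_iff[of 0 "basis k" p] by auto

text \<open>Both sides solve the recurrence and agree on the window at \<open>N0\<close>. The
  coefficients are frozen at the point \<open>p\<close>, as the identity is pointwise while
  \<open>app\<close> acts on functions of the point.\<close>

lemma basis_expand:
  assumes p: "p \<in> \<Omega>" and ker: "\<And>n. n \<ge> r + d \<Longrightarrow> app L h n p = 0" and r: "r \<le> N0" and m: "m \<ge> r"
  shows "h m p = (\<Sum>l\<le>d. h (N0 + l) p * basis l m p)"
proof -
  define e where "e m p' = h m p' - (\<Sum>l\<le>d. h (N0 + l) p * basis l m p')" for m p'
  have "e m p = 0"
  proof (rule rec.solves_zero[where e = "\<lambda>n. e n p", OF p _ r _ m])
    show "rec.solves r (\<lambda>n. e n p) p"
      unfolding solves_iff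
    proof (intro allI impI)
      fix n assume n: "n \<ge> r + d"
      have "app L e n p = app L h n p - app L (\<lambda>m p'. \<Sum>l\<le>d. h (N0 + l) p * basis l m p') n p"
        unfolding e_def by (rule app_diff)
      also have "app L (\<lambda>m p'. \<Sum>l\<le>d. h (N0 + l) p * basis l m p') n p = (\<Sum>l\<le>d. h (N0 + l) p * app L (basis l) n p)"
        by (rule app_lin[where c = "\<lambda>l _. h (N0 + l) p"])
      finally show "app L e n p = 0" using ker[OF n] basis_ker[OF p] n by simp
    qed
    fix k assume k: "k \<le> d"
    have "(\<Sum>l\<le>d. h (N0 + l) p * basis l (N0 + k) p) = (\<Sum>l\<le>d. if l = k then h (N0 + l) p else 0)"
      by (intro sum.cong refl) (use basis(2)[OF k p] in auto)
    then show "e (N0 + k) p = 0" using k by (simp add: e_def)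
  qed
  then show ?thesis by (simp add: e_def)
qed

text \<open>Minus the matrix of the operators \<open>pd i - M i\<close> in the frame
  \<open>basis\<close>. On the window at \<open>N0\<close> the frame is constant, so only the term
  with \<open>M i\<close> is left; a combination of \<open>basis\<close> with coefficients
  \<open>F\<close> is horizontal when \<open>pd i F = A i F\<close>.\<close>

definition A :: "'i \<Rightarrow> nat \<Rightarrow> nat \<Rightarrow> ('i \<Rightarrow> complex) \<Rightarrow> complex" where
  "A i l k = app (M i) (basis k) (N0 + l)"

lemma hA: "i \<in> I \<Longrightarrow> hol I \<Omega> (A i l k)"
  unfolding A_def by (intro hol_app basis hM)

lemma pd_basis_window: "l \<le> d \<Longrightarrow> p \<in> \<Omega> \<Longrightarrow> i \<in> I \<Longrightarrow> pd i (basis k (N0 + l)) p = 0"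
  using pd_cong[OF dom, of p i "basis k (N0 + l)" "\<lambda>_. if l = k then 1 else 0"] basis(2) by simp

lemma nabla_basis:
  assumes i: "i \<in> I" and p: "p \<in> \<Omega>" and m: "m \<ge> lo i"
  shows "pd i (basis k m) p - app (M i) (basis k) m p = - (\<Sum>l\<le>d. A i l k p * basis l m p)"
proof -
  let ?h = "\<lambda>n p. pd i (basis k n) p - app (M i) (basis k) n p"
  have "?h m p = (\<Sum>l\<le>d. ?h (N0 + l) p * basis l m p)"
  proof (rule basis_expand[OF p _ _ m])
    fix n assume "n \<ge> lo i + d"
    then show "app L ?h n p = 0" by (intro ker_step[where r = 0] basis basis_ker i p) auto
  qed (use lo_b[OF i] in \<open>simp add: N0_def\<close>)
  also have "\<dots> = (\<Sum>l\<le>d. - (A i l k p * basis l m p))"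
    by (intro sum.cong refl) (use pd_basis_window[OF _ p i] in \<open>auto simp: A_def\<close>)
  finally show ?thesis by (simp add: sum_negf)
qed

text \<open>The entry at \<open>N0 + l\<close> of \<open>pd j - M j\<close> applied to
  \<open>pd i - M i\<close> applied to \<open>basis k\<close> is computed twice: in the frame, which
  produces \<open>A\<close> and its derivative (\<open>X1\<close>), and entrywise, where
  \<open>curv\<close> and the symmetry of second derivatives make it symmetric in \<open>i\<close>
  and \<open>j\<close> (\<open>X2\<close>).\<close>

lemma curvature_A: "curvature_free I \<Omega> (Suc d) A"
  unfolding curvature_free_def
proof (intro ballI allI impI)
  fix i j l k p assume i: "i \<in> I" and j: "j \<in> I" and "l < Suc d" "k < Suc d" and p: "p \<in> \<Omega>"
  then have l: "l \<le> d" and k: "k \<le> d" by auto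
  define n where "n = N0 + l"
  define X where "X i j = pd j (\<lambda>p. pd i (basis k n) p - app (M i) (basis k) n p) p
     - app (M j) (\<lambda>m p. pd i (basis k m) p - app (M i) (basis k) m p) n p" for i j
  have X1: "X i j = - pd j (A i l k) p + (\<Sum>c<Suc d. A j l c p * A i c k p)" if i: "i \<in> I" and j: "j \<in> I" for i j
  proof -
    have ln: "n \<ge> lo i" using lo_b[OF i] by (simp add: n_def N0_def)
    have "pd j (\<lambda>p. pd i (basis k n) p - app (M i) (basis k) n p) p = pd j (\<lambda>p. - A i l k p) p"
      by (rule pd_cong[OF dom p j]) (use pd_basis_window[OF l _ i] in \<open>simp add: n_def A_def\<close>)
    also have "\<dots> = pd j (\<lambda>p. 0 - A i l k p) p" by simp
    also have "\<dots> = - pd j (A i l k) p" by (subst pd_diff[OF hol_const hA[OF i] p j]) simp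
    finally have 1: "pd j (\<lambda>p. pd i (basis k n) p - app (M i) (basis k) n p) p = - pd j (A i l k) p" .
    have "app (M j) (\<lambda>m p. pd i (basis k m) p - app (M i) (basis k) m p) n p
       = app (M j) (\<lambda>m p. - (\<Sum>l\<le>d. A i l k p * basis l m p)) n p"
    proof (rule app_cong)
      fix m assume "M j n m p \<noteq> 0"
      then have "n \<le> m + lo j" using M_band[OF j, of n m p] by (meson not_le)
      then have "m \<ge> lo i" using lo_b[OF i] lo_b[OF j] by (simp add: n_def N0_def)
      then show "pd i (basis k m) p - app (M i) (basis k) m p = - (\<Sum>l\<le>d. A i l k p * basis l m p)"
        by (rule nabla_basis[OF i p])
    qed
    also have "\<dots> = - (\<Sum>c\<le>d. A i c k p * app (M j) (basis c) n p)"
      unfolding app_minus app_lin ..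
    also have "\<dots> = - (\<Sum>c<Suc d. A j l c p * A i c k p)"
      by (simp add: A_def[of j] n_def lessThan_Suc_atMost mult.commute)
    finally show ?thesis unfolding X_def 1 by simp
  qed
  define R where "R = n + 2 * b + 4"
  have X2: "X i j = pd j (pd i (basis k n)) p - (\<Sum>m<R. pd j (M i n m) p * basis k m p)
      - (\<Sum>m<R. M i n m p * pd j (basis k m) p) - (\<Sum>m<R. M j n m p * pd i (basis k m) p)
      + (\<Sum>m<R. (\<Sum>l<R. M j n l p * M i l m p) * basis k m p)" if i: "i \<in> I" and j: "j \<in> I" for i j
  proof -
    have "pd j (\<lambda>p. pd i (basis k n) p - app (M i) (basis k) n p) p
        = pd j (pd i (basis k n)) p - pd j (app (M i) (basis k) n) p"
      by (rule pd_diff[OF _ _ p j]) (intro hol_pd[OF dom] hol_app basis hM i)+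
    also have "pd j (app (M i) (basis k) n) p = (\<Sum>m<n+b+2. pd j (\<lambda>p. M i n m p * basis k m p) p)"
      unfolding app_def[abs_def] by (rule pd_sum[OF hol_mult[OF hM[OF i] basis(1)] p j])
    also have "\<dots> = (\<Sum>m<n+b+2. pd j (M i n m) p * basis k m p + M i n m p * pd j (basis k m) p)"
      by (intro sum.cong refl pd_mult[OF hM[OF i] basis(1) p j])
    also have "\<dots> = (\<Sum>m<R. pd j (M i n m) p * basis k m p + M i n m p * pd j (basis k m) p)"
    proof (rule sum_ext)
      fix m assume "m \<ge> n + b + 2"
      then have "M i n m = (\<lambda>p. 0)" using M_zero[OF i] by auto
      then show "pd j (M i n m) p * basis k m p + M i n m p * pd j (basis k m) p = 0" by simp
    qed (simp add: R_def)
    finally have 1: "pd j (\<lambda>p. pd i (basis k n) p - app (M i) (basis k) n p) p = pd j (pd i (basis k n)) p -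
      ((\<Sum>m<R. pd j (M i n m) p * basis k m p) + (\<Sum>m<R. M i n m p * pd j (basis k m) p))" by (simp add: sum.distrib)
    have "app (M j) (\<lambda>m p. app (M i) (basis k) m p) n p = (\<Sum>l<n+b+2. M j n l p * (\<Sum>m<R. M i l m p * basis k m p))"
      unfolding app_def[of "M j"]
      by (intro sum.cong refl arg_cong2[where f = "(*)"] app_M i) (auto simp: R_def)
    also have "\<dots> = (\<Sum>l<R. M j n l p * (\<Sum>m<R. M i l m p * basis k m p))"
      by (rule sum_ext) (auto simp: R_def M_zero[OF j])
    also have "\<dots> = (\<Sum>m<R. (\<Sum>l<R. M j n l p * M i l m p) * basis k m p)"
      by (simp add: sum_distrib_left sum_distrib_right mult.assoc) (rule sum.swap)
    finally have 2: "app (M j) (\<lambda>m p. app (M i) (basis k) m p) n p = (\<Sum>m<R. (\<Sum>l<R. M j n l p * M i l m p) * basis k m p)" .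
    have 3: "app (M j) (\<lambda>m p. pd i (basis k m) p) n p = (\<Sum>m<R. M j n m p * pd i (basis k m) p)"
      by (rule app_M[OF j]) (simp add: R_def)
    show ?thesis unfolding X_def app_diff 1 2 3 by simp
  qed
  have "X i j = X j i"
  proof -
    have "(\<Sum>m<R. pd j (M i n m) p * basis k m p) - (\<Sum>m<R. (\<Sum>l<R. M j n l p * M i l m p) * basis k m p)
       = (\<Sum>m<R. (pd j (M i n m) p - (\<Sum>l<R. M j n l p * M i l m p)) * basis k m p)"
      by (simp add: left_diff_distrib sum_subtractf)
    also have "\<dots> = (\<Sum>m<R. (pd i (M j n m) p - (\<Sum>l<R. M i n l p * M j l m p)) * basis k m p)"
    proof (rule sum.cong[OF refl])
      fix m
      have "pd j (M i n m) p - (\<Sum>l<R. M j n l p * M i l m p) = pd i (M j n m) p - (\<Sum>l<R. M i n l p * M j l m p)"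
        using curv_ext[OF i j p, of n R m] by (simp add: R_def algebra_simps)
      then show "(pd j (M i n m) p - (\<Sum>l<R. M j n l p * M i l m p)) * basis k m p = (pd i (M j n m) p - (\<Sum>l<R. M i n l p * M j l m p)) * basis k m p"
        by simp
    qed
    also have "\<dots> = (\<Sum>m<R. pd i (M j n m) p * basis k m p) - (\<Sum>m<R. (\<Sum>l<R. M i n l p * M j l m p) * basis k m p)"
      by (simp add: left_diff_distrib sum_subtractf)
    finally have e: "(\<Sum>m<R. pd j (M i n m) p * basis k m p) - (\<Sum>m<R. (\<Sum>l<R. M j n l p * M i l m p) * basis k m p) =
       (\<Sum>m<R. pd i (M j n m) p * basis k m p) - (\<Sum>m<R. (\<Sum>l<R. M i n l p * M j l m p) * basis k m p)" .
    have lin: "x - a - y - z + b = x - c - z - y + d'" if "a - b = c - d'" for x a y z b c d' :: complex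
    proof -
      have "x - a - y - z + b = x - y - z - (a - b)" by simp
      also have "\<dots> = x - y - z - (c - d')" by (simp only: that)
      finally show ?thesis by simp
    qed
    show ?thesis unfolding X2[OF i j] X2[OF j i] pd_comm[OF dom basis(1) i j p, of k n] by (rule lin[OF e])
  qed
  then show "pd j (A i l k) p + (\<Sum>c<Suc d. A i l c p * A j c k p) = pd i (A j l k) p + (\<Sum>c<Suc d. A j l c p * A i c k p)"
    unfolding X1[OF i j] X1[OF j i] by (simp add: algebra_simps)
qed

text \<open>With a flat section of \<open>A\<close> as coefficients, \<open>pd i f - M i f\<close>
  vanishes on the window at \<open>N0\<close> and therefore on all rows from \<open>lo i\<close> on.
  For independence, a combination vanishing on one window is the zero sequence; its coefficients
  form a flat section that is zero at \<open>p\<close>, hence at \<open>p0\<close>, where the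
  sections are the unit vectors.\<close>

theorem solution:
  shows "\<exists>f. (\<forall>k n. hol I \<Omega> (f k n)) \<and> (\<forall>p\<in>\<Omega>.
     (\<forall>k. \<forall>n\<ge>d. app L (f k) n p = 0) \<and>
     (\<forall>i\<in>I. \<forall>k. \<forall>n\<ge>lo i. pd i (f k n) p = app (M i) (f k) n p) \<and>
     (\<forall>N c. (\<forall>l\<le>d. (\<Sum>k\<le>d. c k * f k (N + l) p) = 0) \<longrightarrow> (\<forall>k\<le>d. c k = 0)))"
proof -
  obtain p0 where p0: "p0 \<in> \<Omega>" using ne by blast
  have "\<exists>F. flat_section I \<Omega> (Suc d) A F \<and> (\<forall>b<Suc d. F b p0 = (if b = k then 1 else 0))" for k
    by (rule global_flat_section[OF dom sc p0 hA curvature_A])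
  then obtain F where F: "\<And>k. flat_section I \<Omega> (Suc d) A (F k)" "\<And>k b. b < Suc d \<Longrightarrow> F k b p0 = (if b = k then 1 else 0)"
    by metis
  have hF: "hol I \<Omega> (F k l)" if "l \<le> d" for k l using F(1)[of k] that by (auto simp: flat_section_def)
  define f where "f k n p = (\<Sum>l\<le>d. F k l p * basis l n p)" for k n p
  have hf: "hol I \<Omega> (f k n)" for k n
    unfolding f_def by (intro hol_sum hol_mult hF basis) auto
  have ker: "app L (f k) n p = 0" if "p \<in> \<Omega>" "n \<ge> d" for k n p
    unfolding f_def[abs_def] app_lin using basis_ker[OF that] by simp
  have fw: "f k (N0 + l) p = F k l p" if "l \<le> d" "p \<in> \<Omega>" for k l p
  proof -
    have "f k (N0 + l) p = (\<Sum>m\<le>d. if m = l then F k m p else 0)"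
      unfolding f_def by (intro sum.cong refl) (use basis(2)[OF that] in auto)
    then show ?thesis using that by simp
  qed
  have der: "pd i (f k n) p = app (M i) (f k) n p" if i: "i \<in> I" and p: "p \<in> \<Omega>" and n: "n \<ge> lo i" for i k n p
  proof -
    let ?h = "\<lambda>n p. pd i (f k n) p - app (M i) (f k) n p"
    have "?h n p = (\<Sum>l\<le>d. ?h (N0 + l) p * basis l n p)"
    proof (rule basis_expand[OF p _ _ n])
      fix n assume "n \<ge> lo i + d"
      then show "app L ?h n p = 0" by (intro ker_step[where r = 0] hf ker i p) auto
    qed (use lo_b[OF i] in \<open>simp add: N0_def\<close>)
    also have "\<dots> = 0"
    proof (rule sum.neutral, intro ballI)
      fix l assume "l \<in> {..d}"
      then have l: "l \<le> d" by simp
      have "pd i (f k (N0 + l)) p = pd i (F k l) p" by (rule pd_cong[OF dom p i]) (use fw l in auto)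
      also have "\<dots> = (\<Sum>c<Suc d. A i l c p * F k c p)" using F(1)[of k] l p i unfolding flat_section_def by auto
      also have "\<dots> = app (M i) (f k) (N0 + l) p"
        unfolding f_def[abs_def] app_lin by (simp add: A_def lessThan_Suc_atMost mult.commute)
      finally show "?h (N0 + l) p * basis l n p = 0" by simp
    qed
    finally show ?thesis by simp
  qed
  have ns: "\<forall>k\<le>d. c k = 0" if p: "p \<in> \<Omega>" and z: "\<forall>l\<le>d. (\<Sum>k\<le>d. c k * f k (N + l) p) = 0" for p N c
  proof -
    have "(\<Sum>k\<le>d. c k * f k m p) = 0" for m
    proof (rule rec.solves_zero[where e = "\<lambda>m. \<Sum>k\<le>d. c k * f k m p" and r = 0 and N = N, OF p])
      have "app L (\<lambda>m p. \<Sum>k\<le>d. c k * f k m p) n p = 0" if "n \<ge> d" for n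
        using app_lin[of L "\<lambda>k _. c k" f "{..d}" n p] ker[OF p that] by simp
      then show "rec.solves 0 (\<lambda>m. \<Sum>k\<le>d. c k * f k m p) p"
        using solves_iff[of 0 "\<lambda>m p. \<Sum>k\<le>d. c k * f k m p" p] by simp
    qed (use z in auto)
    then have z: "(\<Sum>k\<le>d. c k * F k l p) = 0" if "l < Suc d" for l
      using fw[OF _ p] that by (metis (no_types, lifting) less_Suc_eq_le sum.cong)
    have "flat_section I \<Omega> (Suc d) A (\<lambda>l p. \<Sum>k\<le>d. c k * F k l p)"
      unfolding flat_section_def
    proof (intro allI impI conjI ballI)
      fix l assume l: "l < Suc d"
      show "hol I \<Omega> (\<lambda>p. \<Sum>k\<le>d. c k * F k l p)" by (intro hol_sum hol_mult hol_const hF) (use l in auto)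
      fix q i assume q: "q \<in> \<Omega>" and i: "i \<in> I"
      have "pd i (\<lambda>p. \<Sum>k\<le>d. c k * F k l p) q = (\<Sum>k\<le>d. pd i (\<lambda>p. c k * F k l p) q)"
        by (rule pd_sum[OF _ q i]) (intro hol_mult hol_const hF, use l in auto)
      also have "\<dots> = (\<Sum>k\<le>d. c k * (\<Sum>m<Suc d. A i l m q * F k m q))"
      proof (rule sum.cong[OF refl])
        fix k
        have "pd i (\<lambda>p. c k * F k l p) q = c k * pd i (F k l) q"
          using pd_mult[OF hol_const hF q i, of l "c k" k] l by simp
        then show "pd i (\<lambda>p. c k * F k l p) q = c k * (\<Sum>m<Suc d. A i l m q * F k m q)"
          using F(1)[of k] l q i unfolding flat_section_def by simp
      qed
      also have "\<dots> = (\<Sum>m<Suc d. A i l m q * (\<Sum>k\<le>d. c k * F k m q))"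
        unfolding sum_distrib_left by (subst sum.swap) (simp add: mult.left_commute del: sum.lessThan_Suc)
      finally show "pd i (\<lambda>p. \<Sum>k\<le>d. c k * F k l p) q = (\<Sum>m<Suc d. A i l m q * (\<Sum>k\<le>d. c k * F k m q))" .
    qed
    from flat_section_zero[OF dom sc p hA curvature_A this z p0]
    have "(\<Sum>k\<le>d. c k * F k l p0) = 0" if "l < Suc d" for l using that by blast
    moreover have "(\<Sum>k\<le>d. c k * F k l p0) = (\<Sum>k\<le>d. if k = l then c k else 0)" if "l < Suc d" for l
      by (intro sum.cong refl) (use F(2)[OF that] in auto)
    ultimately have "(\<Sum>k\<le>d. if k = l then c k else 0) = 0" if "l < Suc d" for l
      using that by metis
    then show ?thesis by (simp add: less_Suc_eq_le)
  qed
  show ?thesis using hf ker der ns by (intro exI[of _ f]) blast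
qed

end

section \<open>The dual recurrence and the bilinear concomitant\<close>

lemma hol_det:
  assumes "\<And>i j. i < n \<Longrightarrow> j < n \<Longrightarrow> hol I \<Omega> (C i j)"
  shows "hol I \<Omega> (\<lambda>p. Determinant.det (Matrix.mat n n (\<lambda>(i, j). C i j p)))"
proof -
  have perm: "q i < n" if "q permutes {0..<n}" "i < n" for q i
    using permutes_in_image[OF that(1), of i] that(2) by auto
  have "Determinant.det (Matrix.mat n n (\<lambda>(i, j). C i j p)) =
     (\<Sum>q | q permutes {0..<n}. signof q * (\<Prod>i = 0..<n. C i (q i) p))" for p
    by (subst det_def'[of _ n]) (auto intro!: sum.cong prod.cong simp: perm)
  moreover have "hol I \<Omega> (\<lambda>p. \<Sum>q | q permutes {0..<n}. signof q * (\<Prod>i = 0..<n. C i (q i) p))"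
  proof (intro hol_sum hol_mult hol_const hol_prod)
    fix q i assume "q \<in> {q. q permutes {0..<n}}" "i \<in> {0..<n}"
    then have "i < n" "q i < n" by (auto simp: perm)
    then show "hol I \<Omega> (C i (q i))" by (rule assms)
  qed
  ultimately show ?thesis by simp
qed

text \<open>Cramer's rule: the entries of the inverse are cofactors divided by the determinant, all
  of them polynomials in the entries of \<open>C\<close>.\<close>

lemma hol_inverse_matrix:
  fixes C :: "nat \<Rightarrow> nat \<Rightarrow> ('i \<Rightarrow> complex) \<Rightarrow> complex"
  assumes hC: "\<And>i j. i < n \<Longrightarrow> j < n \<Longrightarrow> hol I \<Omega> (C i j)"
    and ns: "\<And>p v. p \<in> \<Omega> \<Longrightarrow> (\<And>i. i < n \<Longrightarrow> (\<Sum>j<n. C i j p * v j) = 0) \<Longrightarrow> (\<And>j. j < n \<Longrightarrow> v j = 0)"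
  shows "\<exists>G. (\<forall>i<n. \<forall>j<n. hol I \<Omega> (G i j)) \<and> (\<forall>p\<in>\<Omega>. \<forall>i<n. \<forall>j<n.
     (\<Sum>l<n. G i l p * C l j p) = (if i = j then 1 else 0) \<and>
     (\<Sum>l<n. C i l p * G l j p) = (if i = j then 1 else 0))"
proof -
  define A where "A p = Matrix.mat n n (\<lambda>(i, j). C i j p)" for p
  have A: "A p \<in> carrier_mat n n" for p by (simp add: A_def)
  have hdet: "hol I \<Omega> (\<lambda>p. Determinant.det (A p))" unfolding A_def by (rule hol_det[OF hC])
  have nz: "Determinant.det (A p) \<noteq> 0" if p: "p \<in> \<Omega>" for p
  proof
    assume "Determinant.det (A p) = 0"
    then obtain v where v: "v \<in> carrier_vec n" "v \<noteq> 0\<^sub>v n" "A p *\<^sub>v v = 0\<^sub>v n"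
      using det_0_iff_vec_prod_zero_field[OF A] by blast
    have "v $ j = 0" if "j < n" for j
    proof (rule ns[OF p _ that, of "\<lambda>j. v $ j"])
      fix i assume i: "i < n"
      have "(A p *\<^sub>v v) $ i = (\<Sum>j<n. C i j p * v $ j)"
        using i v(1) by (simp add: A_def mult_mat_vec_def scalar_prod_def atLeast0LessThan)
      then show "(\<Sum>j<n. C i j p * v $ j) = 0" using v(3) i by simp
    qed
    then have "v = 0\<^sub>v n" using v(1) by (intro eq_vecI) auto
    then show False using v(2) by simp
  qed
  define G where "G i j p = cofactor (A p) j i / Determinant.det (A p)" for i j p
  have h1: "hol I \<Omega> (G i j)" if ij: "i < n" "j < n" for i j
  proof -
    have "cofactor (A p) j i = (-1)^(j+i) * Determinant.det (Matrix.mat (n-1) (n-1)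
       (\<lambda>(i', j'). C (if i' < j then i' else Suc i') (if j' < i then j' else Suc j') p))" for p
      unfolding cofactor_def mat_delete_def A_def
      by (rule arg_cong2[where f = "(*)"], rule refl, rule arg_cong[where f = Determinant.det], rule eq_matI)
        (use ij in auto)
    moreover have "hol I \<Omega> (\<lambda>p. (-1)^(j+i) * Determinant.det (Matrix.mat (n-1) (n-1)
       (\<lambda>(i', j'). C (if i' < j then i' else Suc i') (if j' < i then j' else Suc j') p)))"
      by (intro hol_mult hol_const hol_det hC) auto
    ultimately show ?thesis unfolding G_def by (intro hol_divide hdet nz) auto
  qed
  have h2: "(\<Sum>l<n. G i l p * C l j p) = (if i = j then 1 else 0)" if p: "p \<in> \<Omega>" and ij: "i < n" "j < n" for p i j
  proof -
    have a: "(adj_mat (A p) * A p) $$ (i, j) = (\<Sum>l<n. cofactor (A p) l i * C l j p)"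
      using ij by (simp add: adj_mat_def A_def scalar_prod_def atLeast0LessThan)
    have b: "(adj_mat (A p) * A p) $$ (i, j) = Determinant.det (A p) * (if i = j then 1 else 0)"
      unfolding adj_mat(3)[OF A] using ij by simp
    have c: "(\<Sum>l<n. G i l p * C l j p) = (\<Sum>l<n. cofactor (A p) l i * C l j p) / Determinant.det (A p)"
      by (simp add: G_def sum_divide_distrib)
    show ?thesis unfolding c a[symmetric] b using nz[OF p] by simp
  qed
  have h3: "(\<Sum>l<n. C i l p * G l j p) = (if i = j then 1 else 0)" if p: "p \<in> \<Omega>" and ij: "i < n" "j < n" for p i j
  proof -
    have a: "(A p * adj_mat (A p)) $$ (i, j) = (\<Sum>l<n. C i l p * cofactor (A p) j l)"
      using ij by (simp add: adj_mat_def A_def scalar_prod_def atLeast0LessThan)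
    have b: "(A p * adj_mat (A p)) $$ (i, j) = Determinant.det (A p) * (if i = j then 1 else 0)"
      unfolding adj_mat(2)[OF A] using ij by simp
    have c: "(\<Sum>l<n. C i l p * G l j p) = (\<Sum>l<n. C i l p * cofactor (A p) j l) / Determinant.det (A p)"
      by (simp add: G_def sum_divide_distrib)
    show ?thesis unfolding c a[symmetric] b using nz[OF p] by simp
  qed
  show ?thesis
    by (intro exI[of _ G] conjI allI impI ballI h1 h2 h3)
qed

section \<open>The transposed recurrence, its pairing with the original one, and dual
  solutions\<close>

context lax begin

text \<open>Multiplication of a row vector from the right. Column \<open>n\<close> of
  \<open>L\<close> ends at row \<open>n + d\<close>, that of \<open>M i\<close> at row
  \<open>n + lo i\<close>; the range covers both.\<close>

definition dapp :: "(nat \<Rightarrow> nat \<Rightarrow> ('i \<Rightarrow> complex) \<Rightarrow> complex) \<Rightarrow> (nat \<Rightarrow> ('i \<Rightarrow> complex) \<Rightarrow> complex) \<Rightarrow> nat \<Rightarrow> ('i \<Rightarrow> complex) \<Rightarrow> complex" where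
  "dapp K g n p = (\<Sum>m<n+b+d+2. g m p * K m n p)"

lemma dsum_ext:
  assumes "\<And>m. m \<ge> n + b + d + 2 \<Longrightarrow> g m = 0" "R \<ge> n + b + d + 2"
  shows "(\<Sum>m<n+b+d+2. g m) = (\<Sum>m<R. (g m :: complex))"
  by (rule sum.mono_neutral_left) (use assms in auto)

lemma L_zero': "m \<ge> n + b + d + 2 \<Longrightarrow> L m n p = 0" using L_band by auto
lemma M_zero': "i \<in> I \<Longrightarrow> m \<ge> n + b + d + 2 \<Longrightarrow> M i m n p = 0" using M_band[of i m n p] lo_b[of i] by auto

lemma dapp_L: "R \<ge> n + b + d + 2 \<Longrightarrow> dapp L g n p = (\<Sum>m<R. g m p * L m n p)"
  unfolding dapp_def by (rule dsum_ext) (auto simp: L_zero')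
lemma dapp_M: "i \<in> I \<Longrightarrow> R \<ge> n + b + d + 2 \<Longrightarrow> dapp (M i) g n p = (\<Sum>m<R. g m p * M i m n p)"
  unfolding dapp_def by (rule dsum_ext) (auto simp: M_zero')

lemma dapp_L_window: "dapp L g (Suc n) p = (\<Sum>j\<le>Suc d. L (n + j) (Suc n) p * g (n + j) p)"
proof -
  have "dapp L g (Suc n) p = (\<Sum>m<Suc n+b+d+2. g m p * L m (Suc n) p)" by (simp add: dapp_def)
  also have "\<dots> = (\<Sum>m\<in>(+) n ` {..Suc d}. g m p * L m (Suc n) p)"
  proof (rule sum.mono_neutral_right)
    show "(+) n ` {..Suc d} \<subseteq> {..<Suc n + b + d + 2}" by auto
    show "\<forall>m\<in>{..<Suc n + b + d + 2} - (+) n ` {..Suc d}. g m p * L m (Suc n) p = 0"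
    proof
      fix m assume m: "m \<in> {..<Suc n + b + d + 2} - (+) n ` {..Suc d}"
      have "m < n \<or> m > n + Suc d"
      proof (rule ccontr)
        assume "\<not> ?thesis"
        then have "m = n + (m - n)" "m - n \<in> {..Suc d}" by auto
        then show False using m by blast
      qed
      then show "g m p * L m (Suc n) p = 0" using L_band[of m "Suc n" p] by auto
    qed
  qed auto
  also have "\<dots> = (\<Sum>j\<le>Suc d. L (n + j) (Suc n) p * g (n + j) p)"
    by (subst sum.reindex) (auto simp: mult.commute intro: sum.cong)
  finally show ?thesis .
qed

lemma dsolves_iff: "drec.solves r (\<lambda>n. g n p) p \<longleftrightarrow> (\<forall>n\<ge>Suc r. dapp L g n p = 0)"
  unfolding drec.solves_def dapp_L_window[symmetric] by (metis Suc_le_D Suc_le_mono)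

lemma dapp_lin: "dapp K (\<lambda>m p. \<Sum>l\<in>S. c l p * u l m p) n p = (\<Sum>l\<in>S. c l p * dapp K (u l) n p)"
  unfolding dapp_def sum_distrib_left sum_distrib_right by (subst sum.swap) (simp add: mult.assoc)

lemma dapp_diff: "dapp K (\<lambda>m p. f m p - g m p) n p = dapp K f n p - dapp K g n p"
  unfolding dapp_def by (simp only: left_diff_distrib sum_subtractf)

text \<open>Acting from the right changes the sign:
  \<open>(pd i g + g M) L = pd i (g L) + (g L) M\<close>. Column \<open>n\<close> of
  \<open>M i\<close> begins at row \<open>n - hi i\<close>, where \<open>g L\<close> must already
  vanish.\<close>

lemma dker_step:
  assumes hg: "\<And>n. hol I \<Omega> (g n)" and ker: "\<And>p n. p \<in> \<Omega> \<Longrightarrow> n \<ge> r + 1 \<Longrightarrow> dapp L g n p = 0"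
    and i: "i \<in> I" and p: "p \<in> \<Omega>" and n: "n \<ge> r + hi i + 1"
  shows "dapp L (\<lambda>n p. pd i (g n) p + dapp (M i) g n p) n p = 0"
proof -
  define R where "R = n + b + d + 2"
  \<comment> \<open>\<open>R\<close> exhausts column \<open>n\<close> of \<open>L\<close>;
    \<open>S\<close> also exhausts the columns with index below \<open>R\<close>, which appear in
    the products.\<close>
  define S where "S = n + 3 * (b + d + 2)"
  have "pd i (dapp L g n) p = pd i (\<lambda>p. 0) p"
    by (rule pd_cong[OF dom p i]) (use ker n in auto)
  then have "0 = pd i (\<lambda>p. \<Sum>m<R. g m p * L m n p) p" by (simp add: dapp_def[abs_def] R_def)
  also have "\<dots> = (\<Sum>m<R. pd i (g m) p * L m n p + g m p * pd i (L m n) p)"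
    by (subst pd_sum[OF hol_mult[OF hg hL] p i]) (intro sum.cong refl pd_mult[OF hg hL p i])
  also have "\<dots> = (\<Sum>m<R. pd i (g m) p * L m n p) + (\<Sum>m<R. g m p * pd i (L m n) p)" by (rule sum.distrib)
  also have "(\<Sum>m<R. g m p * pd i (L m n) p) = (\<Sum>m<R. g m p * ((\<Sum>l<S. M i m l p * L l n p) - (\<Sum>l<S. L m l p * M i l n p)))"
  proof (rule sum.cong[OF refl])
    fix m assume "m \<in> {..<R}"
    then show "g m p * pd i (L m n) p = g m p * ((\<Sum>l<S. M i m l p * L l n p) - (\<Sum>l<S. L m l p * M i l n p))"
      by (subst compat_ext[OF i p, of m S]) (auto simp: R_def S_def)
  qed
  also have "\<dots> = (\<Sum>m<S. g m p * ((\<Sum>l<S. M i m l p * L l n p) - (\<Sum>l<S. L m l p * M i l n p)))"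
  proof (rule sum.mono_neutral_left)
    show "\<forall>m\<in>{..<S} - {..<R}. g m p * ((\<Sum>l<S. M i m l p * L l n p) - (\<Sum>l<S. L m l p * M i l n p)) = 0"
    proof
      fix m assume m: "m \<in> {..<S} - {..<R}"
      have "M i m l p * L l n p = 0 \<and> L m l p * M i l n p = 0" for l
        using m L_band[of l n p] M_band[OF i, of m l p] M_band[OF i, of l n p] L_band[of m l p] lo_b[OF i] unfolding R_def by fastforce
      then have "(\<Sum>l<S. M i m l p * L l n p) = 0" "(\<Sum>l<S. L m l p * M i l n p) = 0"
        by (intro sum.neutral ballI; blast)+
      then show "g m p * ((\<Sum>l<S. M i m l p * L l n p) - (\<Sum>l<S. L m l p * M i l n p)) = 0" by simp
    qed
  qed (auto simp: R_def S_def)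
  also have "\<dots> = (\<Sum>m<S. \<Sum>l<S. g m p * M i m l p * L l n p) - (\<Sum>m<S. \<Sum>l<S. g m p * L m l p * M i l n p)"
    by (simp only: right_diff_distrib sum_subtractf sum_distrib_left mult.assoc)
  also have "(\<Sum>m<S. \<Sum>l<S. g m p * M i m l p * L l n p) = (\<Sum>l<R. dapp (M i) g l p * L l n p)"
  proof -
    have "(\<Sum>m<S. \<Sum>l<S. g m p * M i m l p * L l n p) = (\<Sum>l<S. (\<Sum>m<S. g m p * M i m l p) * L l n p)"
      by (subst sum.swap) (simp only: sum_distrib_right)
    also have "\<dots> = (\<Sum>l<R. (\<Sum>m<S. g m p * M i m l p) * L l n p)"
      by (rule sum.mono_neutral_right) (auto simp: R_def S_def L_zero')
    also have "\<dots> = (\<Sum>l<R. dapp (M i) g l p * L l n p)"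
      by (intro sum.cong refl arg_cong2[where f = "(*)"] dapp_M[symmetric] i) (auto simp: R_def S_def)
    finally show ?thesis .
  qed
  also have "(\<Sum>m<S. \<Sum>l<S. g m p * L m l p * M i l n p) = (\<Sum>l<S. (\<Sum>m<S. g m p * L m l p) * M i l n p)"
    by (subst sum.swap) (simp only: sum_distrib_right)
  also have "\<dots> = 0"
  proof (rule sum.neutral, intro ballI)
    fix l assume "l \<in> {..<S}"
    show "(\<Sum>m<S. g m p * L m l p) * M i l n p = 0"
    proof (cases "M i l n p = 0")
      case False
      then have "n \<le> l + hi i" "l \<le> n + lo i" using M_band[OF i, of l n p] by (meson not_le)+
      then have "r + 1 \<le> l" "l + b + d + 2 \<le> S" using n lo_b[OF i] by (auto simp: S_def)
      then show ?thesis using ker[OF p, of l] dapp_L[of l S g p] by simp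
    qed simp
  qed
  finally show ?thesis
    unfolding dapp_def[of L] R_def by (simp only: distrib_right sum.distrib diff_zero)
qed

text \<open>The concomitant at \<open>Suc N1\<close> involves \<open>g\<close> exactly on the
  indices from \<open>N1\<close> to \<open>N1 + d\<close>, where \<open>dbasis\<close> is
  normalised, and \<open>f\<close> from index \<open>b + 1\<close> on, clear of the rows on which
  its derivative is not controlled.\<close>

definition N1 :: nat where "N1 = b + d"

definition dbasis :: "nat \<Rightarrow> nat \<Rightarrow> ('i \<Rightarrow> complex) \<Rightarrow> complex" where
  "dbasis k = (SOME u. (\<forall>n. hol I \<Omega> (u n)) \<and> (\<forall>l\<le>d. \<forall>p\<in>\<Omega>. u (N1 + l) p = (if l = k then 1 else 0)) \<and> (\<forall>p\<in>\<Omega>. drec.solves 0 (\<lambda>n. u n p) p))"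

lemma dbasis: "hol I \<Omega> (dbasis k n)" "l \<le> d \<Longrightarrow> p \<in> \<Omega> \<Longrightarrow> dbasis k (N1 + l) p = (if l = k then 1 else 0)"
  "p \<in> \<Omega> \<Longrightarrow> drec.solves 0 (\<lambda>n. dbasis k n p) p"
proof -
  have "\<exists>u. (\<forall>n. hol I \<Omega> (u n)) \<and> (\<forall>l\<le>d. \<forall>p\<in>\<Omega>. u (N1 + l) p = (if l = k then 1 else 0)) \<and> (\<forall>p\<in>\<Omega>. drec.solves 0 (\<lambda>n. u n p) p)"
    by (rule drec.solution_exists[where x = "\<lambda>l p. if l = k then 1 else 0"]) auto
  from someI_ex[OF this, folded dbasis_def]
  show "hol I \<Omega> (dbasis k n)" "l \<le> d \<Longrightarrow> p \<in> \<Omega> \<Longrightarrow> dbasis k (N1 + l) p = (if l = k then 1 else 0)"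
    "p \<in> \<Omega> \<Longrightarrow> drec.solves 0 (\<lambda>n. dbasis k n p) p" by auto
qed

lemma dbasis_ker: "p \<in> \<Omega> \<Longrightarrow> n \<ge> 1 \<Longrightarrow> dapp L (dbasis k) n p = 0"
  using dbasis(3)[of p k] dsolves_iff[of 0 "dbasis k" p] by auto

lemma dbasis_expand:
  assumes p: "p \<in> \<Omega>" and ker: "\<And>n. n \<ge> r + 1 \<Longrightarrow> dapp L h n p = 0" and r: "r \<le> N1" and m: "m \<ge> r"
  shows "h m p = (\<Sum>l\<le>d. h (N1 + l) p * dbasis l m p)"
proof -
  define e where "e m p' = h m p' - (\<Sum>l\<le>d. h (N1 + l) p * dbasis l m p')" for m p'
  have "e m p = 0"
  proof (rule drec.solves_zero[where e = "\<lambda>n. e n p", OF p _ r _ m])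
    show "drec.solves r (\<lambda>n. e n p) p"
      unfolding dsolves_iff
    proof (intro allI impI)
      fix n assume n: "n \<ge> Suc r"
      have "dapp L e n p = dapp L h n p - dapp L (\<lambda>m p'. \<Sum>l\<le>d. h (N1 + l) p * dbasis l m p') n p"
        unfolding e_def by (rule dapp_diff)
      also have "dapp L (\<lambda>m p'. \<Sum>l\<le>d. h (N1 + l) p * dbasis l m p') n p = (\<Sum>l\<le>d. h (N1 + l) p * dapp L (dbasis l) n p)"
        by (rule dapp_lin[where c = "\<lambda>l _. h (N1 + l) p"])
      finally show "dapp L e n p = 0" using ker[of n] dbasis_ker[OF p] n by simp
    qed
    fix k assume k: "k \<le> d"
    have "(\<Sum>l\<le>d. h (N1 + l) p * dbasis l (N1 + k) p) = (\<Sum>l\<le>d. if l = k then h (N1 + l) p else 0)"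
      by (intro sum.cong refl) (use dbasis(2)[OF k p] in auto)
    then show "e (N1 + k) p = 0" using k by (simp add: e_def)
  qed
  then show ?thesis by (simp add: e_def)
qed

definition pair :: "nat \<Rightarrow> (nat \<Rightarrow> ('i \<Rightarrow> complex) \<Rightarrow> complex) \<Rightarrow> (nat \<Rightarrow> ('i \<Rightarrow> complex) \<Rightarrow> complex) \<Rightarrow> ('i \<Rightarrow> complex) \<Rightarrow> complex" where
  "pair N g f p = (\<Sum>m<N+d+1. \<Sum>l<N+d+1. g m p * L m l p * (of_bool (l < N) - of_bool (m < N)) * f l p)"

text \<open>The product is an entry of the commutator of \<open>L\<close> with the projection onto
  the indices below \<open>N\<close>. Only entries with exactly one index below \<open>N\<close>
  survive: \<open>(N - 1, N)\<close> above the diagonal and \<open>l < N \<le> m \<le> l + d\<close>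
  below it.\<close>

lemma cut_zero:
  assumes "m \<ge> N + d \<or> l \<ge> N + d + 1 \<or> m + 1 < N \<or> l + d < N \<or> l > N"
  shows "L m l p * (of_bool (l < N) - of_bool (m < N)) = 0"
  using L_band[of l m p] L_band[of m l p] assms d1 by (auto simp: of_bool_def)

lemma sum2_extend:
  fixes A R :: nat
  assumes "\<And>m l. m \<ge> A \<or> l \<ge> A \<Longrightarrow> h m l = (0::complex)" "A \<le> R"
  shows "(\<Sum>m<A. \<Sum>l<A. h m l) = (\<Sum>m<R. \<Sum>l<R. h m l)"
proof -
  have "(\<Sum>m<A. \<Sum>l<A. h m l) = (\<Sum>m<A. \<Sum>l<R. h m l)"
    by (rule sum.cong[OF refl], rule sum.mono_neutral_left) (use assms in auto)
  also have "\<dots> = (\<Sum>m<R. \<Sum>l<R. h m l)"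
    by (rule sum.mono_neutral_left) (use assms in \<open>auto intro!: sum.neutral\<close>)
  finally show ?thesis .
qed

lemma pair_ext:
  assumes "R \<ge> N + d + 1"
  shows "pair N g f p = (\<Sum>m<R. \<Sum>l<R. g m p * L m l p * (of_bool (l < N) - of_bool (m < N)) * f l p)"
  unfolding pair_def
proof (rule sum2_extend)
  fix m l assume "N + d + 1 \<le> m \<or> N + d + 1 \<le> l"
  then have "L m l p * (of_bool (l < N) - of_bool (m < N)) = 0" by (intro cut_zero) auto
  then show "g m p * L m l p * (of_bool (l < N) - of_bool (m < N)) * f l p = 0" by (simp only: mult.assoc[of "g m p"]) simp
qed (rule assms)

lemma pair_lin1: "pair N (\<lambda>m p. \<Sum>k\<in>S. c k p * u k m p) f p = (\<Sum>k\<in>S. c k p * pair N (u k) f p)"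
proof -
  have "pair N (\<lambda>m p. \<Sum>k\<in>S. c k p * u k m p) f p =
    (\<Sum>m<N+d+1. \<Sum>l<N+d+1. \<Sum>k\<in>S. c k p * (u k m p * L m l p * (of_bool (l < N) - of_bool (m < N)) * f l p))"
    unfolding pair_def by (simp only: sum_distrib_right mult.assoc)
  also have "\<dots> = (\<Sum>m<N+d+1. \<Sum>k\<in>S. \<Sum>l<N+d+1. c k p * (u k m p * L m l p * (of_bool (l < N) - of_bool (m < N)) * f l p))"
    by (intro sum.cong refl sum.swap)
  also have "\<dots> = (\<Sum>k\<in>S. \<Sum>m<N+d+1. \<Sum>l<N+d+1. c k p * (u k m p * L m l p * (of_bool (l < N) - of_bool (m < N)) * f l p))"
    by (rule sum.swap)
  finally show ?thesis by (simp only: pair_def sum_distrib_left)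
qed

lemma pair_lin2: "pair N g (\<lambda>m p. \<Sum>k\<in>S. c k p * u k m p) p = (\<Sum>k\<in>S. c k p * pair N g (u k) p)"
proof -
  have "pair N g (\<lambda>m p. \<Sum>k\<in>S. c k p * u k m p) p =
    (\<Sum>m<N+d+1. \<Sum>l<N+d+1. \<Sum>k\<in>S. c k p * (g m p * L m l p * (of_bool (l < N) - of_bool (m < N)) * u k l p))"
    unfolding pair_def by (simp only: sum_distrib_left mult.left_commute[of _ "c _ p"])
  also have "\<dots> = (\<Sum>m<N+d+1. \<Sum>k\<in>S. \<Sum>l<N+d+1. c k p * (g m p * L m l p * (of_bool (l < N) - of_bool (m < N)) * u k l p))"
    by (intro sum.cong refl sum.swap)
  also have "\<dots> = (\<Sum>k\<in>S. \<Sum>m<N+d+1. \<Sum>l<N+d+1. c k p * (g m p * L m l p * (of_bool (l < N) - of_bool (m < N)) * u k l p))"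
    by (rule sum.swap)
  finally show ?thesis by (simp only: pair_def sum_distrib_left)
qed

text \<open>Passing from \<open>N\<close> to \<open>Suc N\<close> adds the commutator with the
  projection onto the single index \<open>N\<close>; paired with \<open>g\<close> and
  \<open>f\<close> it is entry \<open>N\<close> of \<open>g L\<close> times \<open>f N\<close> minus
  \<open>g N\<close> times entry \<open>N\<close> of \<open>L f\<close>.\<close>

lemma pair_step:
  assumes g: "dapp L g N p = 0" and f: "app L f N p = 0"
  shows "pair (Suc N) g f p = pair N g f p"
proof -
  define R where "R = N + b + d + 4"
  have R: "R \<ge> Suc N + d + 1" "R \<ge> N + d + 1" by (auto simp: R_def)
  have "pair (Suc N) g f p - pair N g f p = (\<Sum>m<R. \<Sum>l<R. g m p * L m l p * (of_bool (l = N) - of_bool (m = N)) * f l p)"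
    unfolding pair_ext[OF R(1)] pair_ext[OF R(2)] sum_subtractf[symmetric] left_diff_distrib[symmetric] right_diff_distrib[symmetric]
    by (intro sum.cong refl) (auto simp: of_bool_def less_Suc_eq)
  also have "\<dots> = (\<Sum>m<R. \<Sum>l<R. if l = N then g m p * L m l p * f l p else 0) - (\<Sum>m<R. \<Sum>l<R. if m = N then g m p * L m l p * f l p else 0)"
    unfolding sum_subtractf[symmetric] by (intro sum.cong refl) auto
  also have "(\<Sum>m<R. \<Sum>l<R. if l = N then g m p * L m l p * f l p else 0) = (\<Sum>m<R. g m p * L m N p) * f N p"
    by (simp add: R_def sum_distrib_right)
  also have "(\<Sum>m<R. \<Sum>l<R. if m = N then g m p * L m l p * f l p else 0) = g N p * (\<Sum>l<R. L N l p * f l p)"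
    by (subst sum.swap) (simp add: R_def sum_distrib_left mult.assoc)
  also have "(\<Sum>m<R. g m p * L m N p) = dapp L g N p" by (rule dapp_L[symmetric]) (simp add: R_def)
  also have "(\<Sum>l<R. L N l p * f l p) = app L f N p" by (rule app_L[symmetric]) (simp add: R_def)
  finally show ?thesis using g f by simp
qed

text \<open>\<open>\<rho>\<close> is the vector that \<open>g\<close> is paired with, and the unit
  windows \<open>dbasis k\<close> show that each of its entries vanishes. Its first entry contains
  \<open>f (Suc N1)\<close> alone, through the superdiagonal of \<open>L\<close>; the others, read
  from the last one backwards, contain one new value \<open>f N1\<close>, \<open>f (N1 - 1)\<close>
  and so on, through the lowest diagonal of \<open>L\<close>.\<close>

lemma pair_nondeg:
  assumes p: "p \<in> \<Omega>" and z: "\<And>k. k \<le> d \<Longrightarrow> pair (Suc N1) (dbasis k) f p = 0" and j: "j \<le> d"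
  shows "f (b + 1 + j) p = 0"
proof -
  define N where "N = Suc N1"
  define \<rho> where "\<rho> m = (\<Sum>l<N+d+1. L m l p * (of_bool (l < N) - of_bool (m < N)) * f l p)" for m
  have \<rho>0: "\<rho> m = 0" if "m < N1 \<or> m > N1 + d" for m
    unfolding \<rho>_def
  proof (rule sum.neutral, intro ballI)
    fix l
    have "L m l p * (of_bool (l < N) - of_bool (m < N)) = 0"
      by (rule cut_zero) (use that in \<open>auto simp: N_def\<close>)
    then show "L m l p * (of_bool (l < N) - of_bool (m < N)) * f l p = 0" by (simp only: mult_zero_left)
  qed
  have pair: "pair N g f p = (\<Sum>j\<le>d. g (N1 + j) p * \<rho> (N1 + j))" for g
  proof -
    have "pair N g f p = (\<Sum>m<N+d+1. g m p * \<rho> m)"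
      unfolding pair_def \<rho>_def by (simp only: sum_distrib_left mult.assoc)
    also have "\<dots> = (\<Sum>m\<in>(+) N1 ` {..d}. g m p * \<rho> m)"
    proof (rule sum.mono_neutral_right)
      show "\<forall>m\<in>{..<N + d + 1} - (+) N1 ` {..d}. g m p * \<rho> m = 0"
      proof
        fix m assume m: "m \<in> {..<N + d + 1} - (+) N1 ` {..d}"
        have "m < N1 \<or> m > N1 + d"
        proof (rule ccontr)
          assume "\<not> ?thesis"
          then have "m = N1 + (m - N1)" "m - N1 \<in> {..d}" by auto
          then show False using m by blast
        qed
        then show "g m p * \<rho> m = 0" using \<rho>0 by simp
      qed
    qed (auto simp: N_def)
    also have "\<dots> = (\<Sum>j\<le>d. g (N1 + j) p * \<rho> (N1 + j))" by (subst sum.reindex) auto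
    finally show ?thesis .
  qed
  have \<rho>z: "\<rho> (N1 + k) = 0" if k: "k \<le> d" for k
  proof -
    have "pair N (dbasis k) f p = (\<Sum>j\<le>d. if j = k then \<rho> (N1 + j) else 0)"
      unfolding pair by (intro sum.cong refl) (use dbasis(2)[OF _ p] in auto)
    then show ?thesis using z[OF k] k by (simp add: N_def)
  qed
  have fN: "f N p = 0"
  proof -
    have "\<rho> N1 = (\<Sum>l<N+d+1. if l = N then - L N1 N p * f N p else 0)"
      unfolding \<rho>_def
    proof (rule sum.cong[OF refl])
      fix l
      show "L N1 l p * (of_bool (l < N) - of_bool (N1 < N)) * f l p = (if l = N then - L N1 N p * f N p else 0)"
        using cut_zero[of N N1 l p] by (cases "l < N"; cases "l = N") (auto simp: N_def)
    qed
    then have "\<rho> N1 = - L N1 N p * f N p" by simp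
    then show ?thesis using \<rho>z[of 0] L_up[OF p, of N1] by (simp add: N_def)
  qed
  have below: "f (N1 - i) p = 0" if "i < d" for i
    using that
  proof (induction i rule: less_induct)
    case (less i)
    define l where "l = N1 - i"
    have li: "l = N1 - i" "l + i = N1" "l < N" using less.prems by (auto simp: l_def N1_def N_def)
    have "\<rho> (l + d) = (\<Sum>l'<N+d+1. if l' = l then L (l + d) l p * f l p else 0)"
      unfolding \<rho>_def
    proof (rule sum.cong[OF refl])
      fix l'
      have nlt: "\<not> l + d < N" using li less.prems by (simp add: N_def)
      show "L (l + d) l' p * (of_bool (l' < N) - of_bool (l + d < N)) * f l' p = (if l' = l then L (l + d) l p * f l p else 0)"
      proof (cases "l' < N")
        case True
        consider "l' < l" | "l' = l" | "l < l'" by linarith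
        then show ?thesis
        proof cases
          case 1 then show ?thesis using L_band[of "l + d" l' p] by simp
        next
          case 2 then show ?thesis using nlt True by simp
        next
          case 3
          then have "l' = N1 - (N1 - l')" "N1 - l' < i" using True li by (auto simp: N_def)
          then have "f l' p = 0" using less.IH[of "N1 - l'"] less.prems by simp
          then show ?thesis using 3 by simp
        qed
      qed (use nlt li in auto)
    qed
    then have "\<rho> (l + d) = L (l + d) l p * f l p" using li by simp
    moreover have "l + d = N1 + (d - i)" using li less.prems by simp
    ultimately show ?case using \<rho>z[of "d - i"] L_low[OF p, of l] by (simp add: l_def)
  qed
  show ?thesis
  proof (cases "j = d")
    case True then show ?thesis using fN by (simp add: N_def N1_def add.commute add.left_commute)
  next
    case False
    then have "b + 1 + j = N1 - (d - 1 - j)" "d - 1 - j < d" using j d1 by (auto simp: N1_def)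
    then show ?thesis using below[of "d - 1 - j"] by simp
  qed
qed

text \<open>The sums in an entry of the commutator are finite by its row as well as by its column.
  In \<open>pair_deriv\<close> only one of the two indices is known to be small.\<close>

lemma compat_R:
  assumes i: "i \<in> I" and p: "p \<in> \<Omega>" and R: "m + b + 2 \<le> R \<or> l + b + d + 2 \<le> R"
  shows "pd i (L m l) p = (\<Sum>s<R. M i m s p * L s l p) - (\<Sum>s<R. L m s p * M i s l p)"
proof (cases "m + b + 2 \<le> R")
  case True then show ?thesis by (rule compat_ext[OF i p])
next
  case False
  then have lR: "l + b + d + 2 \<le> R" using R by simp
  have "pd i (L m l) p = (\<Sum>s<m+b+2. M i m s p * L s l p) - (\<Sum>s<m+b+2. L m s p * M i s l p)" by (rule compat[OF i p])
  also have "(\<Sum>s<m+b+2. M i m s p * L s l p) = (\<Sum>s<R. M i m s p * L s l p)"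
    by (rule sum.mono_neutral_right) (use False lR in \<open>auto simp: L_zero'\<close>)
  also have "(\<Sum>s<m+b+2. L m s p * M i s l p) = (\<Sum>s<R. L m s p * M i s l p)"
    by (rule sum.mono_neutral_right) (use False lR in \<open>auto simp: M_zero'[OF i]\<close>)
  finally show ?thesis .
qed

text \<open>Write \<open>\<Pi>\<close> for the projection behind \<open>\<kappa>\<close>. The Jacobi
  identity turns \<open>[[M, L], \<Pi>]\<close> into
  \<open>[M, [L, \<Pi>]] - [L, [M, \<Pi>]]\<close>. Between \<open>g\<close> and \<open>f\<close>
  the second commutator drops out, since \<open>g L\<close> and \<open>L f\<close> vanish where
  \<open>[M, \<Pi>]\<close> lives; the part of the first one with \<open>M\<close> next to
  \<open>f\<close> cancels the derivative of \<open>f\<close>. Equations \<open>3\<close> and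
  \<open>4\<close> are the two vanishing statements, and the bound on \<open>N\<close> keeps them
  away from the edge.\<close>

lemma pair_deriv:
  assumes hg: "\<And>m. hol I \<Omega> (g m)" and hf: "\<And>m. hol I \<Omega> (f m)" and i: "i \<in> I" and p: "p \<in> \<Omega>"
    and kg: "\<And>n. n \<ge> 1 \<Longrightarrow> dapp L g n p = 0" and kf: "\<And>n. n \<ge> d \<Longrightarrow> app L f n p = 0"
    and df: "\<And>n. n \<ge> lo i \<Longrightarrow> pd i (f n) p = app (M i) f n p"
    and N: "N \<ge> b + d + 1"
  shows "pd i (pair N g f) p = pair N (\<lambda>m p. pd i (g m) p + dapp (M i) g m p) f p"
proof -
  define R where "R = N + 2 * b + 2 * d + 4"
  define \<kappa> where "\<kappa> m l = (of_bool (l < N) - of_bool (m < N) :: complex)" for m l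
  have cut: "L m l p * \<kappa> m l = 0" if "m \<ge> N + d + 1 \<or> l \<ge> N + d + 1 \<or> m + 1 < N \<or> l + d < N \<or> l > N" for m l p
    unfolding \<kappa>_def by (rule cut_zero) (use that in auto)
  have R: "R \<ge> N + d + 1" by (simp add: R_def)
  have "pd i (pair N g f) p = pd i (\<lambda>p. \<Sum>m<R. \<Sum>l<R. g m p * L m l p * \<kappa> m l * f l p) p"
    unfolding pair_ext[OF R, abs_def] \<kappa>_def ..
  also have "\<dots> = (\<Sum>m<R. \<Sum>l<R. pd i (\<lambda>p. g m p * L m l p * \<kappa> m l * f l p) p)"
    by (subst pd_sum[OF _ p i], intro hol_sum hol_mult hg hL hf hol_const)
      (intro sum.cong refl pd_sum[OF _ p i] hol_mult hg hL hf hol_const)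
  also have "\<dots> = (\<Sum>m<R. \<Sum>l<R. pd i (g m) p * L m l p * \<kappa> m l * f l p + g m p * pd i (L m l) p * \<kappa> m l * f l p + g m p * L m l p * \<kappa> m l * pd i (f l) p)"
  proof (intro sum.cong refl)
    fix m l
    have "pd i (\<lambda>p. g m p * L m l p * \<kappa> m l * f l p) p
      = (pd i (g m) p * L m l p + g m p * pd i (L m l) p) * \<kappa> m l * f l p + g m p * L m l p * \<kappa> m l * pd i (f l) p"
      using pd_mult[OF hol_mult[OF hol_mult[OF hg hL] hol_const] hf p i, of m m l "\<kappa> m l" l]
        pd_mult[OF hol_mult[OF hg hL] hol_const p i, of m m l "\<kappa> m l"] pd_mult[OF hg hL p i, of m m l]
      by simp
    then show "pd i (\<lambda>p. g m p * L m l p * \<kappa> m l * f l p) p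
      = pd i (g m) p * L m l p * \<kappa> m l * f l p + g m p * pd i (L m l) p * \<kappa> m l * f l p + g m p * L m l p * \<kappa> m l * pd i (f l) p"
      by (simp add: distrib_right)
  qed
  also have "\<dots> = (\<Sum>m<R. \<Sum>l<R. pd i (g m) p * L m l p * \<kappa> m l * f l p)
     + (\<Sum>m<R. \<Sum>l<R. g m p * pd i (L m l) p * \<kappa> m l * f l p)
     + (\<Sum>m<R. \<Sum>l<R. g m p * L m l p * \<kappa> m l * pd i (f l) p)"
    by (simp only: sum.distrib)
  also have "(\<Sum>m<R. \<Sum>l<R. g m p * pd i (L m l) p * \<kappa> m l * f l p)
    = (\<Sum>m<R. \<Sum>l<R. \<Sum>s<R. g m p * M i m s p * L s l p * \<kappa> m l * f l p) - (\<Sum>m<R. \<Sum>l<R. \<Sum>s<R. g m p * L m s p * M i s l p * \<kappa> m l * f l p)"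
  proof -
    have "g m p * pd i (L m l) p * \<kappa> m l * f l p = (\<Sum>s<R. g m p * M i m s p * L s l p * \<kappa> m l * f l p) - (\<Sum>s<R. g m p * L m s p * M i s l p * \<kappa> m l * f l p)" for m l
    proof (cases "\<kappa> m l = 0")
      case False
      then have ml: "m < N \<or> l < N" unfolding \<kappa>_def by (auto simp: of_bool_def split: if_splits)
      have "pd i (L m l) p = (\<Sum>s<R. M i m s p * L s l p) - (\<Sum>s<R. L m s p * M i s l p)"
        by (rule compat_R[OF i p]) (use ml in \<open>auto simp: R_def\<close>)
      then show ?thesis by (simp only: left_diff_distrib right_diff_distrib sum_distrib_left sum_distrib_right mult.assoc)
    qed simp
    then show ?thesis by (simp only: sum_subtractf)
  qed
  also have "(\<Sum>m<R. \<Sum>l<R. g m p * L m l p * \<kappa> m l * pd i (f l) p) = (\<Sum>m<R. \<Sum>l<R. \<Sum>s<R. g m p * L m s p * \<kappa> m s * M i s l p * f l p)"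
  proof (rule sum.cong[OF refl])
    fix m
    have "g m p * L m s p * \<kappa> m s * pd i (f s) p = (\<Sum>l<R. g m p * L m s p * \<kappa> m s * M i s l p * f l p)" for s
    proof (cases "L m s p * \<kappa> m s = 0")
      case False
      then have "s \<le> N" "N \<le> s + d" using cut[of m s p] by (meson not_le)+
      then have "pd i (f s) p = (\<Sum>l<R. M i s l p * f l p)"
        using df[of s] app_M[OF i, of s R f p] lo_b[OF i] N by (simp add: R_def)
      then show ?thesis by (simp only: sum_distrib_left mult.assoc)
    next
      case True
      have "g m p * L m s p * \<kappa> m s = 0" by (simp only: mult.assoc True mult_zero_right)
      then show ?thesis by (simp only: mult_zero_left sum.neutral_const)
    qed
    then have "(\<Sum>s<R. g m p * L m s p * \<kappa> m s * pd i (f s) p) = (\<Sum>s<R. \<Sum>l<R. g m p * L m s p * \<kappa> m s * M i s l p * f l p)"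
      by (simp only:)
    also have "\<dots> = (\<Sum>l<R. \<Sum>s<R. g m p * L m s p * \<kappa> m s * M i s l p * f l p)" by (rule sum.swap)
    finally show "(\<Sum>l<R. g m p * L m l p * \<kappa> m l * pd i (f l) p) = (\<Sum>l<R. \<Sum>s<R. g m p * L m s p * \<kappa> m s * M i s l p * f l p)" .
  qed
  finally have 1: "pd i (pair N g f) p = (\<Sum>m<R. \<Sum>l<R. pd i (g m) p * L m l p * \<kappa> m l * f l p) +
     ((\<Sum>m<R. \<Sum>l<R. \<Sum>s<R. g m p * M i m s p * L s l p * \<kappa> m l * f l p) - (\<Sum>m<R. \<Sum>l<R. \<Sum>s<R. g m p * L m s p * M i s l p * \<kappa> m l * f l p))
     + (\<Sum>m<R. \<Sum>l<R. \<Sum>s<R. g m p * L m s p * \<kappa> m s * M i s l p * f l p)" .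
  have 2: "pair N (\<lambda>m p. pd i (g m) p + dapp (M i) g m p) f p = (\<Sum>m<R. \<Sum>l<R. pd i (g m) p * L m l p * \<kappa> m l * f l p)
     + (\<Sum>m<R. \<Sum>l<R. \<Sum>s<R. g m p * M i m s p * L s l p * \<kappa> s l * f l p)"
  proof -
    have "(pd i (g m) p + dapp (M i) g m p) * L m l p * \<kappa> m l * f l p =
       pd i (g m) p * L m l p * \<kappa> m l * f l p + (\<Sum>s<R. g s p * M i s m p * L m l p * \<kappa> m l * f l p)" for m l
    proof (cases "L m l p * \<kappa> m l = 0")
      case False
      then have "m < N + d + 1" using cut[of m l p] by (meson not_le)
      then have "dapp (M i) g m p = (\<Sum>s<R. g s p * M i s m p)" by (intro dapp_M i) (simp add: R_def)
      then show ?thesis by (simp only: distrib_right sum_distrib_right)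
    next
      case True
      have "x * L m l p * \<kappa> m l = 0" for x by (simp only: mult.assoc True mult_zero_right)
      then show ?thesis by (simp only: mult_zero_left sum.neutral_const add_0)
    qed
    then have "pair N (\<lambda>m p. pd i (g m) p + dapp (M i) g m p) f p = (\<Sum>m<R. \<Sum>l<R. pd i (g m) p * L m l p * \<kappa> m l * f l p)
       + (\<Sum>m<R. \<Sum>l<R. \<Sum>s<R. g s p * M i s m p * L m l p * \<kappa> m l * f l p)"
      unfolding pair_ext[OF R] \<kappa>_def[symmetric] by (simp only: sum.distrib)
    also have "(\<Sum>m<R. \<Sum>l<R. \<Sum>s<R. g s p * M i s m p * L m l p * \<kappa> m l * f l p) = (\<Sum>m<R. \<Sum>s<R. \<Sum>l<R. g s p * M i s m p * L m l p * \<kappa> m l * f l p)"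
      by (intro sum.cong refl sum.swap)
    also have "\<dots> = (\<Sum>s<R. \<Sum>m<R. \<Sum>l<R. g s p * M i s m p * L m l p * \<kappa> m l * f l p)" by (rule sum.swap)
    also have "\<dots> = (\<Sum>s<R. \<Sum>l<R. \<Sum>m<R. g s p * M i s m p * L m l p * \<kappa> m l * f l p)" by (rule sum.cong[OF refl], rule sum.swap)
    finally show ?thesis .
  qed
  have 3: "(\<Sum>m<R. \<Sum>l<R. \<Sum>s<R. g m p * M i m s p * L s l p * \<kappa> m l * f l p) = (\<Sum>m<R. \<Sum>l<R. \<Sum>s<R. g m p * M i m s p * L s l p * \<kappa> s l * f l p)"
  proof -
    have "(\<Sum>m<R. \<Sum>l<R. \<Sum>s<R. g m p * M i m s p * L s l p * \<kappa> m l * f l p) - (\<Sum>m<R. \<Sum>l<R. \<Sum>s<R. g m p * M i m s p * L s l p * \<kappa> s l * f l p)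
      = (\<Sum>m<R. \<Sum>l<R. \<Sum>s<R. g m p * M i m s p * \<kappa> m s * (L s l p * f l p))"
      unfolding sum_subtractf[symmetric] by (intro sum.cong refl) (simp add: \<kappa>_def algebra_simps)
    also have "\<dots> = (\<Sum>m<R. \<Sum>s<R. \<Sum>l<R. g m p * M i m s p * \<kappa> m s * (L s l p * f l p))"
      by (rule sum.cong[OF refl], rule sum.swap)
    also have "\<dots> = (\<Sum>m<R. \<Sum>s<R. g m p * M i m s p * \<kappa> m s * (\<Sum>l<R. L s l p * f l p))"
      by (simp only: sum_distrib_left)
    also have "\<dots> = 0"
    proof (rule sum.neutral, rule ballI, rule sum.neutral, rule ballI)
      fix m s
      show "g m p * M i m s p * \<kappa> m s * (\<Sum>l<R. L s l p * f l p) = 0"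
      proof (cases "M i m s p = 0 \<or> \<kappa> m s = 0")
        case False
        then have "s \<le> m + hi i" "m \<le> s + lo i" using M_band[OF i, of m s p] by (meson not_le)+
        moreover have "(m < N) \<noteq> (s < N)" using False by (auto simp: \<kappa>_def)
        ultimately have "s \<ge> d" "s \<le> N + b" using lo_b[OF i] hi_b[OF i] N by linarith+
        then have "(\<Sum>l<R. L s l p * f l p) = 0" using kf[of s] app_L[of s R f p] by (simp add: R_def)
        then show ?thesis by simp
      qed auto
    qed
    finally show ?thesis by simp
  qed
  have 4: "(\<Sum>m<R. \<Sum>l<R. \<Sum>s<R. g m p * L m s p * M i s l p * \<kappa> m l * f l p) = (\<Sum>m<R. \<Sum>l<R. \<Sum>s<R. g m p * L m s p * \<kappa> m s * M i s l p * f l p)"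
  proof -
    have "(\<Sum>m<R. \<Sum>l<R. \<Sum>s<R. g m p * L m s p * M i s l p * \<kappa> m l * f l p) - (\<Sum>m<R. \<Sum>l<R. \<Sum>s<R. g m p * L m s p * \<kappa> m s * M i s l p * f l p)
      = (\<Sum>m<R. \<Sum>l<R. \<Sum>s<R. g m p * L m s p * (M i s l p * \<kappa> s l * f l p))"
      unfolding sum_subtractf[symmetric] by (intro sum.cong refl) (simp add: \<kappa>_def algebra_simps)
    also have "\<dots> = (\<Sum>l<R. \<Sum>m<R. \<Sum>s<R. g m p * L m s p * (M i s l p * \<kappa> s l * f l p))" by (rule sum.swap)
    also have "\<dots> = (\<Sum>l<R. \<Sum>s<R. \<Sum>m<R. g m p * L m s p * (M i s l p * \<kappa> s l * f l p))"
      by (rule sum.cong[OF refl], rule sum.swap)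
    also have "\<dots> = (\<Sum>l<R. \<Sum>s<R. (\<Sum>m<R. g m p * L m s p) * (M i s l p * \<kappa> s l * f l p))"
      by (simp only: sum_distrib_right)
    also have "\<dots> = 0"
    proof (rule sum.neutral, rule ballI, rule sum.neutral, rule ballI)
      fix l s
      show "(\<Sum>m<R. g m p * L m s p) * (M i s l p * \<kappa> s l * f l p) = 0"
      proof (cases "M i s l p = 0 \<or> \<kappa> s l = 0")
        case False
        then have "l \<le> s + hi i" "s \<le> l + lo i" using M_band[OF i, of s l p] by (meson not_le)+
        moreover have "(s < N) \<noteq> (l < N)" using False by (auto simp: \<kappa>_def)
        ultimately have "s \<ge> 1" "s \<le> N + b" using lo_b[OF i] hi_b[OF i] N by linarith+
        then have "(\<Sum>m<R. g m p * L m s p) = 0" using kg[of s] dapp_L[of s R g p] by (simp add: R_def)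
        then show ?thesis by simp
      qed auto
    qed
    finally show ?thesis by simp
  qed
  show ?thesis unfolding 1 2 3 4 by simp
qed

text \<open>\<open>C\<close> is the matrix of pairings of \<open>dbasis\<close> with the given
  solutions. It is invertible because \<open>pair_nondeg\<close> reduces a null vector to a
  vanishing window of a combination of the \<open>f k\<close>; the dual solutions are
  \<open>dbasis\<close> multiplied by the inverse of \<open>C\<close>.\<close>

theorem dual_solution:
  assumes hf: "\<And>k n. hol I \<Omega> (f k n)"
    and kf: "\<And>p k n. p \<in> \<Omega> \<Longrightarrow> n \<ge> d \<Longrightarrow> app L (f k) n p = 0"
    and df: "\<And>p i k n. p \<in> \<Omega> \<Longrightarrow> i \<in> I \<Longrightarrow> n \<ge> lo i \<Longrightarrow> pd i (f k n) p = app (M i) (f k) n p"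
    and ns: "\<And>p N c k. p \<in> \<Omega> \<Longrightarrow> (\<And>l. l \<le> d \<Longrightarrow> (\<Sum>k\<le>d. c k * f k (N + l) p) = 0) \<Longrightarrow> k \<le> d \<Longrightarrow> c k = 0"
  shows "\<exists>g. (\<forall>k\<le>d. \<forall>n. hol I \<Omega> (g k n)) \<and> (\<forall>p\<in>\<Omega>.
     (\<forall>k\<le>d. \<forall>n\<ge>1. dapp L (g k) n p = 0) \<and>
     (\<forall>i\<in>I. \<forall>k\<le>d. \<forall>n\<ge>hi i. pd i (g k n) p = - dapp (M i) (g k) n p) \<and>
     (\<forall>N\<ge>d. \<forall>k\<le>d. \<forall>k'\<le>d. pair N (g k) (f k') p = (if k = k' then 1 else 0)) \<and>
     (\<forall>N c. (\<forall>l\<le>d. (\<Sum>k\<le>d. c k * g k (N + l) p) = 0) \<longrightarrow> (\<forall>k\<le>d. c k = 0)))"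
proof -
  define N where "N = Suc N1"
  define C where "C l k = pair N (dbasis l) (f k)" for l k
  have hC: "hol I \<Omega> (C l k)" for l k
    unfolding C_def pair_def[abs_def] by (intro hol_sum hol_mult dbasis hL hf hol_const)
  have "\<exists>G. (\<forall>i<Suc d. \<forall>j<Suc d. hol I \<Omega> (G i j)) \<and> (\<forall>p\<in>\<Omega>. \<forall>i<Suc d. \<forall>j<Suc d.
     (\<Sum>l<Suc d. G i l p * C l j p) = (if i = j then 1 else 0) \<and>
     (\<Sum>l<Suc d. C i l p * G l j p) = (if i = j then 1 else 0))"
  proof (rule hol_inverse_matrix[OF hC])
    fix p v j assume p: "p \<in> \<Omega>" and z: "\<And>i. i < Suc d \<Longrightarrow> (\<Sum>j<Suc d. C i j p * v j) = 0" and j: "j < Suc d"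
    have "pair N (dbasis l) (\<lambda>m p. \<Sum>k\<le>d. v k * f k m p) p = 0" if "l \<le> d" for l
      using z[of l] that pair_lin2[of N "dbasis l" "\<lambda>k _. v k" f "{..d}" p]
      by (simp add: C_def mult.commute lessThan_Suc_atMost del: sum.lessThan_Suc)
    then have "(\<Sum>k\<le>d. v k * f k (b + 1 + l) p) = 0" if "l \<le> d" for l
      using pair_nondeg[OF p, of "\<lambda>m p. \<Sum>k\<le>d. v k * f k m p" l] that by (simp add: N_def)
    then show "v j = 0" by (rule ns[OF p]) (use j in auto)
  qed
  then obtain G where hG: "\<And>i j. i \<le> d \<Longrightarrow> j \<le> d \<Longrightarrow> hol I \<Omega> (G i j)"
    and G: "\<And>p i j. p \<in> \<Omega> \<Longrightarrow> i \<le> d \<Longrightarrow> j \<le> d \<Longrightarrow> (\<Sum>l\<le>d. G i l p * C l j p) = (if i = j then 1 else 0)"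
    and G': "\<And>p i j. p \<in> \<Omega> \<Longrightarrow> i \<le> d \<Longrightarrow> j \<le> d \<Longrightarrow> (\<Sum>l\<le>d. C i l p * G l j p) = (if i = j then 1 else 0)"
    unfolding lessThan_Suc_atMost less_Suc_eq_le by blast
  define g where "g k n p = (\<Sum>l\<le>d. G k l p * dbasis l n p)" for k n p
  have hg: "hol I \<Omega> (g k n)" if "k \<le> d" for k n
    unfolding g_def by (intro hol_sum hol_mult hG dbasis) (use that in auto)
  have kg: "dapp L (g k) n p = 0" if "p \<in> \<Omega>" "n \<ge> 1" for k n p
    unfolding g_def[abs_def] dapp_lin using dbasis_ker[OF that] by simp
  have pN: "pair N (g k) (f k') p = (if k = k' then 1 else 0)" if "p \<in> \<Omega>" "k \<le> d" "k' \<le> d" for p k k'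
    unfolding g_def[abs_def] pair_lin1 using G[OF that] by (simp add: C_def)
  \<comment> \<open>Passing index \<open>n\<close> by \<open>pair_step\<close> requires
    \<open>n \<ge> 1\<close> and \<open>n \<ge> d\<close>, so constancy begins at
    \<open>d\<close>.\<close>
  have pall: "pair N' (g k) (f k') p = (if k = k' then 1 else 0)" if N': "N' \<ge> d" and p: "p \<in> \<Omega>" and k: "k \<le> d" "k' \<le> d" for p k k' N'
  proof -
    have const: "pair N' (g k) (f k') p = pair d (g k) (f k') p" if "N' \<ge> d" for N'
      using that
    proof (induction N' rule: dec_induct)
      case (step n)
      then show ?case using pair_step[OF kg[OF p, of n k] kf[OF p, of n k']] d1 by simp
    qed simp
    show ?thesis using const[OF N'] const[of N] pN[OF p k] by (simp add: N_def N1_def)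
  qed
  have dg: "pd i (g k n) p = - dapp (M i) (g k) n p" if i: "i \<in> I" and k: "k \<le> d" and p: "p \<in> \<Omega>" and n: "n \<ge> hi i" for i k n p
  proof -
    let ?h = "\<lambda>n p. pd i (g k n) p + dapp (M i) (g k) n p"
    have exp: "?h m p = (\<Sum>l\<le>d. ?h (N1 + l) p * dbasis l m p)" if m: "m \<ge> hi i" for m
    proof (rule dbasis_expand[OF p _ _ m])
      fix n assume "n \<ge> hi i + 1"
      then show "dapp L ?h n p = 0" by (intro dker_step[where r = 0] hg kg i p k) auto
    qed (use hi_b[OF i] in \<open>simp add: N1_def\<close>)
    \<comment> \<open>The pairing is constant, so by \<open>pair_deriv\<close> the row of
      coefficients of \<open>pd i g + g M\<close> in \<open>dbasis\<close> is annihilated by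
      \<open>C\<close>; multiplying by \<open>G\<close> shows that this row is zero.\<close>
    have z: "(\<Sum>l\<le>d. ?h (N1 + l) p * C l k' p) = 0" if k': "k' \<le> d" for k'
    proof -
      have "pd i (pair N (g k) (f k')) p = pd i (\<lambda>p. if k = k' then 1 else 0) p"
        by (rule pd_cong[OF dom p i]) (use pN[OF _ k k'] in auto)
      then have "0 = pd i (pair N (g k) (f k')) p" by simp
      also have "\<dots> = pair N ?h (f k') p"
        by (rule pair_deriv[OF hg[OF k] hf i p kg[OF p] kf[OF p] df[OF p i]]) (auto simp: N_def N1_def)
      also have "\<dots> = pair N (\<lambda>m p'. \<Sum>l\<le>d. ?h (N1 + l) p * dbasis l m p') (f k') p"
        unfolding pair_def
      proof (intro sum.cong refl)
        fix m l
        show "?h m p * L m l p * (of_bool (l < N) - of_bool (m < N)) * f k' l p =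
          (\<Sum>l\<le>d. ?h (N1 + l) p * dbasis l m p) * L m l p * (of_bool (l < N) - of_bool (m < N)) * f k' l p"
        proof (cases "m \<ge> hi i")
          case True then show ?thesis by (simp only: exp[symmetric])
        next
          case False
          then have "m + 1 < N" using hi_b[OF i] d1 by (simp add: N_def N1_def)
          then have "L m l p * (of_bool (l < N) - of_bool (m < N)) = 0" by (intro cut_zero) auto
          then show ?thesis by (simp only: mult.assoc[of _ "L m l p"]) simp
        qed
      qed
      also have "\<dots> = (\<Sum>l\<le>d. ?h (N1 + l) p * C l k' p)"
        using pair_lin1[of N "\<lambda>l _. ?h (N1 + l) p" dbasis "{..d}" "f k'" p] by (simp add: C_def)
      finally show ?thesis by simp
    qed
    have "?h (N1 + j) p = 0" if j: "j \<le> d" for j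
    proof -
      have "?h (N1 + j) p = (\<Sum>l\<le>d. if l = j then ?h (N1 + l) p else 0)" using j by simp
      also have "\<dots> = (\<Sum>l\<le>d. ?h (N1 + l) p * (\<Sum>k'\<le>d. C l k' p * G k' j p))"
        by (intro sum.cong refl) (use G'[OF p _ j] in auto)
      also have "\<dots> = (\<Sum>l\<le>d. \<Sum>k'\<le>d. ?h (N1 + l) p * C l k' p * G k' j p)"
        by (simp only: sum_distrib_left mult.assoc)
      also have "\<dots> = (\<Sum>k'\<le>d. \<Sum>l\<le>d. ?h (N1 + l) p * C l k' p * G k' j p)" by (rule sum.swap)
      also have "\<dots> = (\<Sum>k'\<le>d. (\<Sum>l\<le>d. ?h (N1 + l) p * C l k' p) * G k' j p)"
        by (simp only: sum_distrib_right)
      also have "\<dots> = 0" using z by simp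
      finally show ?thesis .
    qed
    then have "?h n p = 0" unfolding exp[OF n] by simp
    then show ?thesis by (simp add: eq_neg_iff_add_eq_0)
  qed
  have nsg: "\<forall>k\<le>d. c k = 0" if p: "p \<in> \<Omega>" and z: "\<forall>l\<le>d. (\<Sum>k\<le>d. c k * g k (N' + l) p) = 0" for p N' c
  proof -
    have "(\<Sum>k\<le>d. c k * g k m p) = 0" for m
    proof (rule drec.solves_zero[where e = "\<lambda>m. \<Sum>k\<le>d. c k * g k m p" and r = 0 and N = N', OF p])
      have "dapp L (\<lambda>m p. \<Sum>k\<le>d. c k * g k m p) n p = 0" if "n \<ge> 1" for n
        using dapp_lin[of L "\<lambda>k _. c k" g "{..d}" n p] kg[OF p that] by simp
      then show "drec.solves 0 (\<lambda>m. \<Sum>k\<le>d. c k * g k m p) p"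
        using dsolves_iff[of 0 "\<lambda>m p. \<Sum>k\<le>d. c k * g k m p" p] by simp
    qed (use z in auto)
    then have z: "pair N (\<lambda>m p. \<Sum>k\<le>d. c k * g k m p) (f k') p = 0" for k' by (simp add: pair_def)
    show ?thesis
    proof (intro allI impI)
      fix k' assume k': "k' \<le> d"
      have "0 = (\<Sum>k\<le>d. c k * pair N (g k) (f k') p)" using z[of k'] pair_lin1[of N "\<lambda>k _. c k" g "{..d}" "f k'" p] by simp
      also have "\<dots> = (\<Sum>k\<le>d. if k = k' then c k else 0)"
        by (intro sum.cong refl) (use pN[OF p _ k'] in auto)
      finally show "c k' = 0" using k' by simp
    qed
  qed
  show ?thesis using hg kg dg pall nsg by (intro exI[of _ g]) blast
qed

end

section \<open>Biorthogonal polynomials\<close>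

text \<open>One index type for the spectral variable and all parameters: the spectral equation and
  the deformation equations become components of a single connection.\<close>

datatype coord = X | U nat | V nat

definition par :: "(coord \<Rightarrow> complex) \<Rightarrow> params" where
  "par p = (\<lambda>k. p (U k), \<lambda>k. p (V k))"

definition pt :: "complex \<Rightarrow> params \<Rightarrow> coord \<Rightarrow> complex" where
  "pt x t c = (case c of X \<Rightarrow> x | U k \<Rightarrow> fst t k | V k \<Rightarrow> snd t k)"

lemma par_pt [simp]: "par (pt x t) = t" by (simp add: par_def pt_def)
lemma pt_X [simp]: "pt x t X = x" by (simp add: pt_def)
lemma pt_U [simp]: "pt x t (U k) = fst t k" by (simp add: pt_def)
lemma pt_V [simp]: "pt x t (V k) = snd t k" by (simp add: pt_def)
lemma pt_par: "pt (p X) (par p) = p" by (rule ext) (auto simp: pt_def par_def split: coord.splits)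
lemma par_upd_X [simp]: "par (p(X := s)) = par p" by (simp add: par_def)
lemma par_upd_U [simp]: "par (p(U k := s)) = ((fst (par p))(k := s), snd (par p))" by (auto simp: par_def)
lemma par_upd_V [simp]: "par (p(V k := s)) = (fst (par p), (snd (par p))(k := s))" by (auto simp: par_def)
lemma pt_upd_X: "(pt x t)(X := s) = pt s t" by (rule ext) (simp add: pt_def split: coord.splits)
lemma pt_upd_U: "(pt x t)(U k := s) = pt x ((fst t)(k := s), snd t)" by (rule ext) (simp add: pt_def split: coord.splits)
lemma pt_upd_V: "(pt x t)(V k := s) = pt x (fst t, (snd t)(k := s))" by (rule ext) (simp add: pt_def split: coord.splits)

definition coords :: "nat \<Rightarrow> nat \<Rightarrow> coord set" where
  "coords d1 d2 = insert X (U ` {1..d1+1} \<union> V ` {1..d2+1})"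

definition dom_of :: "params set \<Rightarrow> (coord \<Rightarrow> complex) set" where "dom_of T = {p. par p \<in> T}"

lemma finite_coords: "finite (coords d1 d2)" by (simp add: coords_def)

lemma continuous_par: "continuous_on UNIV par"
  unfolding par_def
  by (intro continuous_on_Pair continuous_on_coordinatewise_then_product continuous_on_product_coordinates)

text \<open>\<open>param_space\<close> pins all further parameters to \<open>0\<close>; this is the
  constancy outside the finitely many coordinates that \<open>hdom\<close> asks for.\<close>

lemma hdom_dom_of:
  assumes "openin (top_of_set (param_space d1 d2)) T"
  shows "hdom (coords d1 d2) (dom_of T)"
  unfolding hdom_def
proof (intro conjI ballI allI impI finite_coords)
  obtain W where W: "open W" "T = param_space d1 d2 \<inter> W" using assms by (auto simp: openin_open)
  have zero: "p k = 0" if "p \<in> dom_of T" "k \<notin> coords d1 d2" for p k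
  proof -
    have "par p \<in> param_space d1 d2" using that W by (auto simp: dom_of_def)
    then show ?thesis using that(2) by (cases k) (auto simp: par_def param_space_def coords_def image_iff)
  qed
  fix p assume p: "p \<in> dom_of T"
  show "p k = q k" if "q \<in> dom_of T" "k \<notin> coords d1 d2" for q k using zero[OF p that(2)] zero[OF that] by simp
  have "open (par -` W)" using continuous_par W(1) by (simp add: continuous_on_open_vimage[OF open_UNIV])
  moreover have "p \<in> par -` W" using p W by (auto simp: dom_of_def)
  ultimately obtain e where e: "e > 0" "polybox (coords d1 d2) p e \<subseteq> par -` W" using polybox_nbhd finite_coords by metis
  have "par q \<in> T" if q: "q \<in> polybox (coords d1 d2) p e" for q
  proof -
    have z: "q k = 0" if "k \<notin> coords d1 d2" for k using q zero[OF p that] that by (simp add: polybox_def)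
    have "q (U k) = 0" if "k \<notin> {1..d1+1}" for k by (rule z) (use that in \<open>auto simp: coords_def\<close>)
    moreover have "q (V k) = 0" if "k \<notin> {1..d2+1}" for k by (rule z) (use that in \<open>auto simp: coords_def\<close>)
    ultimately have "par q \<in> param_space d1 d2" by (auto simp: param_space_def par_def)
    then show ?thesis using e(2) q W(2) by auto
  qed
  then show "\<exists>e>0. polybox (coords d1 d2) p e \<subseteq> dom_of T" using e(1) by (auto simp: dom_of_def)
qed

lemma continuous_pt:
  assumes "continuous_on S f" "continuous_on S g"
  shows "continuous_on S (\<lambda>z. pt (f z) (g z))"
proof (rule continuous_on_coordinatewise_then_product)
  fix c
  have "continuous_on S (\<lambda>z. fst (g z))" "continuous_on S (\<lambda>z. snd (g z))" using assms(2) by (auto intro: continuous_on_fst continuous_on_snd)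
  then have "continuous_on S (\<lambda>z. fst (g z) k)" "continuous_on S (\<lambda>z. snd (g z) k)" for k
    by (auto intro: continuous_on_product_then_coordinatewise)
  then show "continuous_on S (\<lambda>z. pt (f z) (g z) c)" using assms(1) by (cases c) auto
qed

text \<open>\<open>dom_of T\<close> is the product of \<open>T\<close> with the complex plane: the
  parameters follow the homotopy in \<open>T\<close> while the coordinate \<open>X\<close> is
  interpolated linearly.\<close>

lemma simply_connected_dom_of:
  assumes "simply_connected T"
  shows "simply_connected (dom_of T)"
  unfolding simply_connected_def
proof (intro allI impI, elim conjE)
  fix p q assume p: "path p" "pathfinish p = pathstart p" "path_image p \<subseteq> dom_of T"
    and q: "path q" "pathfinish q = pathstart q" "path_image q \<subseteq> dom_of T"
  have parc: "continuous_on {0..1} (\<lambda>s. par (g s))" if "path g" for g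
    using that continuous_on_compose2[OF continuous_par] unfolding path_def by blast
  have "homotopic_loops T (\<lambda>s. par (p s)) (\<lambda>s. par (q s))"
  proof -
    have "path (\<lambda>s. par (g s)) \<and> pathfinish (\<lambda>s. par (g s)) = pathstart (\<lambda>s. par (g s)) \<and> path_image (\<lambda>s. par (g s)) \<subseteq> T"
      if "path g" "pathfinish g = pathstart g" "path_image g \<subseteq> dom_of T" for g
      using parc[OF that(1)] that(2,3) by (auto simp: path_def path_image_def pathfinish_def pathstart_def dom_of_def)
    from this[OF p] this[OF q] show ?thesis using assms unfolding simply_connected_def by blast
  qed
  then obtain H where H: "continuous_on ({0..1::real} \<times> {0..1::real}) H" "H \<in> {0..1} \<times> {0..1} \<rightarrow> T"
    "\<forall>x\<in>{0..1}. H (0, x) = par (p x)" "\<forall>x\<in>{0..1}. H (1, x) = par (q x)" "\<forall>t\<in>{0..1}. H (t, 1) = H (t, 0)"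
    unfolding homotopic_loops by (auto simp: pathfinish_def pathstart_def)
  have Xc: "continuous_on ({0..1} \<times> {0..1}) (\<lambda>z :: real \<times> real. g (snd z) X)" if "path g" for g :: "real \<Rightarrow> coord \<Rightarrow> complex"
    by (rule continuous_on_product_then_coordinatewise, rule continuous_on_compose2[OF that[unfolded path_def]])
      (auto intro: continuous_on_snd continuous_on_id)
  define K where "K z = pt (of_real (1 - fst z) * p (snd z) X + of_real (fst z) * q (snd z) X) (H z)" for z
  have "continuous_on ({0..1} \<times> {0..1}) K"
    unfolding K_def
    by (intro continuous_pt H(1) continuous_on_add continuous_on_mult Xc p(1) q(1) continuous_on_of_real continuous_on_diff continuous_on_const continuous_on_fst continuous_on_id)
  moreover have "K \<in> {0..1} \<times> {0..1} \<rightarrow> dom_of T" using H(2) by (auto simp: K_def dom_of_def)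
  moreover have "\<forall>x\<in>{0..1}. K (0, x) = p x" "\<forall>x\<in>{0..1}. K (1, x) = q x" using H(3,4) by (auto simp: K_def pt_par)
  moreover have "\<forall>t\<in>{0..1}. K (t, 1) = K (t, 0)"
    using H(5) p(2) q(2) by (auto simp: K_def pathfinish_def pathstart_def)
  ultimately show "homotopic_loops (dom_of T) p q"
    unfolding homotopic_loops by (intro exI[of _ K]) (auto simp: pathfinish_def pathstart_def)
qed

text \<open>The difference quotient of \<open>r\<close> is that of \<open>h\<close> divided by
  \<open>r (p(i := s)) + r p\<close>. Continuity keeps \<open>r\<close> on one branch, so this
  divisor tends to \<open>2 * r p\<close>, which is non-zero.\<close>

lemma hol_sqrt:
  assumes dom: "hdom I \<Omega>" and h: "hol I \<Omega> h" and c: "continuous_on \<Omega> r"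
    and sq: "\<And>p. p \<in> \<Omega> \<Longrightarrow> (r p)\<^sup>2 = h p" and nz: "\<And>p. p \<in> \<Omega> \<Longrightarrow> h p \<noteq> 0"
  shows "hol I \<Omega> r" and "\<And>p i. p \<in> \<Omega> \<Longrightarrow> i \<in> I \<Longrightarrow> 2 * r p * pd i r p = pd i h p"
proof -
  have key: "((\<lambda>s. r (p(i := s))) has_field_derivative pd i h p / (2 * r p)) (at (p i))" if p: "p \<in> \<Omega>" and i: "i \<in> I" for p i
  proof -
    obtain d where d: "d > 0" "\<And>s. s \<in> ball (p i) d \<Longrightarrow> p(i := s) \<in> \<Omega>" using hdom_upd[OF dom p i] by auto
    have r0: "r p \<noteq> 0" using sq[OF p] nz[OF p] by auto
    have "continuous_on (ball (p i) d) (\<lambda>s. r (p(i := s)))"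
      by (rule continuous_on_compose2[OF c])
        (use d(2) in \<open>auto intro!: continuous_on_fun_upd continuous_on_const continuous_on_id\<close>)
    then have "isCont (\<lambda>s. r (p(i := s))) (p i)" using d(1) by (simp add: continuous_on_eq_continuous_at)
    then have rl: "((\<lambda>s. r (p(i := s))) \<longlongrightarrow> r p) (at (p i))" by (simp add: isCont_def)
    then have sl: "((\<lambda>s. r (p(i := s)) + r p) \<longlongrightarrow> r p + r p) (at (p i))" by (intro tendsto_intros)
    have ne: "r p + r p \<noteq> 0" using r0 by simp
    have "((\<lambda>s. (h (p(i := s)) - h p) / (s - p i)) \<longlongrightarrow> pd i h p) (at (p i))"
      using hol_deriv[OF h p i] by (simp add: has_field_derivative_iff)
    from tendsto_divide[OF this sl ne]
    have lim: "((\<lambda>s. (h (p(i := s)) - h p) / (s - p i) / (r (p(i := s)) + r p)) \<longlongrightarrow> pd i h p / (2 * r p)) (at (p i))"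
      unfolding mult_2 .
    have "eventually (\<lambda>s. r (p(i := s)) + r p \<noteq> 0) (at (p i))"
      using tendsto_imp_eventually_ne[OF sl ne] .
    moreover have "eventually (\<lambda>s. p(i := s) \<in> \<Omega>) (at (p i))"
      using hol_eventually[OF dom p i] by (auto simp: eventually_at_filter elim: eventually_mono)
    ultimately have "eventually (\<lambda>s. (h (p(i := s)) - h p) / (s - p i) / (r (p(i := s)) + r p) = (r (p(i := s)) - r p) / (s - p i)) (at (p i))"
    proof eventually_elim
      fix s assume s: "r (p(i := s)) + r p \<noteq> 0" "p(i := s) \<in> \<Omega>"
      have "h (p(i := s)) - h p = (r (p(i := s)) - r p) * (r (p(i := s)) + r p)"
        using sq[OF p] sq[OF s(2)] by (simp add: power2_eq_square algebra_simps)
      then show "(h (p(i := s)) - h p) / (s - p i) / (r (p(i := s)) + r p) = (r (p(i := s)) - r p) / (s - p i)"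
        using s(1) by simp
    qed
    from Lim_transform_eventually[OF lim this] show ?thesis by (simp add: has_field_derivative_iff)
  qed
  show "hol I \<Omega> r" by (rule holI[OF c key])
  fix p i assume pi: "p \<in> \<Omega>" "i \<in> I"
  have "r p \<noteq> 0" using sq[OF pi(1)] nz[OF pi(1)] by auto
  then show "2 * r p * pd i r p = pd i h p" using pd_eqI[OF key[OF pi]] by simp
qed

lemma hol_exp:
  assumes f: "hol I \<Omega> f"
  shows "hol I \<Omega> (\<lambda>p. exp (f p))"
proof (rule holI[where D = "\<lambda>i p. exp (f p) * pd i f p"])
  show "continuous_on \<Omega> (\<lambda>p. exp (f p))" using hol_continuous[OF f] by (rule continuous_on_exp)
  fix p i assume p: "p \<in> \<Omega>" "i \<in> I"
  show "((\<lambda>s. exp (f (p(i := s)))) has_field_derivative exp (f p) * pd i f p) (at (p i))"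
    using DERIV_fun_exp[OF hol_deriv[OF f p]] by simp
qed

lemma pd_exp:
  assumes f: "hol I \<Omega> f" and p: "p \<in> \<Omega>" "i \<in> I"
  shows "pd i (\<lambda>p. exp (f p)) p = exp (f p) * pd i f p"
  using DERIV_fun_exp[OF hol_deriv[OF f p]] by (intro pd_eqI) simp

lemma monic_basis_expand:
  fixes b :: "nat \<Rightarrow> complex poly"
  assumes b: "\<And>n. degree (b n) = n" "\<And>n. lead_coeff (b n) = 1" and P: "\<And>k. k \<ge> n \<Longrightarrow> coeff P k = 0"
  shows "\<exists>c. P = (\<Sum>m<n. Polynomial.smult (c m) (b m))"
  using P
proof (induction n arbitrary: P)
  case 0
  then have "P = 0" by (intro poly_eqI) auto
  then show ?case by simp
next
  case (Suc n)
  define P' where "P' = P - Polynomial.smult (coeff P n) (b n)"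
  have bn: "coeff (b n) n = 1" using b[of n] by simp
  have "coeff P' k = 0" if "k \<ge> n" for k
  proof (cases "k = n")
    case True then show ?thesis using bn by (simp add: P'_def)
  next
    case False
    then have "coeff (b n) k = 0" using b(1)[of n] that by (intro coeff_eq_0) simp
    then show ?thesis using Suc.prems[of k] that False by (simp add: P'_def)
  qed
  from Suc.IH[OF this] obtain c where "P' = (\<Sum>m<n. Polynomial.smult (c m) (b m))" by blast
  then have "P = (\<Sum>m<n. Polynomial.smult (c m) (b m)) + Polynomial.smult (coeff P n) (b n)" by (simp add: P'_def algebra_simps)
  then show ?case by (intro exI[of _ "c(n := coeff P n)"]) simp
qed

definition dpot :: "nat \<Rightarrow> (nat \<Rightarrow> complex) \<Rightarrow> complex poly" where
  "dpot d c = (\<Sum>k=1..d+1. monom (c k) (k - 1))"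

lemma coeff_dpot: "coeff (dpot d c) j = (if j \<le> d then c (Suc j) else 0)"
proof -
  have "coeff (dpot d c) j = (\<Sum>k=1..d+1. if k = Suc j then c k else 0)"
    unfolding dpot_def coeff_sum by (intro sum.cong refl) auto
  then show ?thesis by simp
qed

lemma poly_dpot: "((\<lambda>z. potential d c z) has_field_derivative poly (dpot d c) z) (at z)"
proof -
  have "((\<lambda>z. \<Sum>k=1..d+1. c k / of_nat k * z ^ k) has_field_derivative (\<Sum>k=1..d+1. c k / of_nat k * (of_nat k * z ^ (k - 1)))) (at z)"
    by (intro DERIV_sum DERIV_cmult) (auto intro!: derivative_eq_intros)
  moreover have "(\<Sum>k=1..d+1. c k / of_nat k * (of_nat k * z ^ (k - 1))) = poly (dpot d c) z"
    unfolding dpot_def poly_sum by (intro sum.cong refl) (auto simp: poly_monom)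
  ultimately show ?thesis by (simp add: potential_def[abs_def])
qed

text \<open>The interface between analysis and algebra: of the double integral only bilinearity, the
  two integrations by parts, continuity and the parameter derivatives are kept. It is symmetric
  under exchange of the two variables except for \<open>rec_co\<close>, which speaks of the wave
  functions in \<open>x\<close>.\<close>

locale bimoment =
  fixes d1 d2 :: nat and T :: "params set" and B :: "params \<Rightarrow> complex poly \<Rightarrow> complex poly \<Rightarrow> complex"
    and \<pi> \<sigma> :: "params \<Rightarrow> nat \<Rightarrow> complex poly" and h r :: "params \<Rightarrow> nat \<Rightarrow> complex"
    and \<alpha> \<beta> :: "params \<Rightarrow> rec_coeffs"
  assumes d1: "d1 \<ge> 1" and d2: "d2 \<ge> 1"
    and opT: "openin (top_of_set (param_space d1 d2)) T" and scT: "simply_connected T" and neT: "T \<noteq> {}"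
    and lead: "\<And>t. t \<in> T \<Longrightarrow> fst t (d1+1) \<noteq> 0 \<and> snd t (d2+1) \<noteq> 0"
    and B_add1: "\<And>t P P' R. t \<in> T \<Longrightarrow> B t (P + P') R = B t P R + B t P' R"
    and B_add2: "\<And>t P R R'. t \<in> T \<Longrightarrow> B t P (R + R') = B t P R + B t P R'"
    and B_smult1: "\<And>t c P R. t \<in> T \<Longrightarrow> B t (Polynomial.smult c P) R = c * B t P R"
    and B_smult2: "\<And>t c P R. t \<in> T \<Longrightarrow> B t P (Polynomial.smult c R) = c * B t P R"
    and parts1: "\<And>t P R. t \<in> T \<Longrightarrow> B t (pderiv P - dpot d1 (fst t) * P) R + B t P (monom 1 1 * R) = 0"
    and parts2: "\<And>t P R. t \<in> T \<Longrightarrow> B t (monom 1 1 * P) R + B t P (pderiv R - dpot d2 (snd t) * R) = 0"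
    and B_cont: "\<And>P R. continuous_on T (\<lambda>t. B t P R)"
    and B_deriv_u: "\<And>t K P R. t \<in> T \<Longrightarrow> K \<in> {1..d1+1} \<Longrightarrow>
       ((\<lambda>s. B ((fst t)(K := s), snd t) P R) has_field_derivative - (1 / of_nat K) * B t (monom 1 K * P) R) (at (fst t K))"
    and B_deriv_v: "\<And>t J P R. t \<in> T \<Longrightarrow> J \<in> {1..d2+1} \<Longrightarrow>
       ((\<lambda>s. B (fst t, (snd t)(J := s)) P R) has_field_derivative - (1 / of_nat J) * B t P (monom 1 J * R)) (at (snd t J))"
    and monic: "\<And>t n. t \<in> T \<Longrightarrow> degree (\<pi> t n) = n \<and> lead_coeff (\<pi> t n) = 1 \<and> degree (\<sigma> t n) = n \<and> lead_coeff (\<sigma> t n) = 1"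
    and orth: "\<And>t n m. t \<in> T \<Longrightarrow> B t (\<pi> t n) (\<sigma> t m) = (if n = m then h t n else 0)"
    and h_nz: "\<And>t n. t \<in> T \<Longrightarrow> h t n \<noteq> 0"
    and r_sq: "\<And>t n. t \<in> T \<Longrightarrow> (r t n)\<^sup>2 = h t n"
    and r_cont: "\<And>n. continuous_on T (\<lambda>t. r t n)"
    and rec_co: "\<And>t. t \<in> T \<Longrightarrow> recursion_coeffs d1 d2 (wave_fun d1 t (\<pi> t) (r t)) (r t) (\<alpha> t) (\<beta> t)"
begin

abbreviation "I \<equiv> coords d1 d2"
abbreviation "\<Omega> \<equiv> dom_of T"

lemma dom: "hdom I \<Omega>" by (rule hdom_dom_of[OF opT])

lemma \<Omega>D: "p \<in> \<Omega> \<Longrightarrow> par p \<in> T" by (simp add: dom_of_def)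

lemma B_0: "t \<in> T \<Longrightarrow> B t 0 R = 0" "t \<in> T \<Longrightarrow> B t P 0 = 0"
  using B_smult1[of t 0 0 R] B_smult2[of t P 0 0] by auto

lemma B_sum1: "t \<in> T \<Longrightarrow> B t (\<Sum>x\<in>S. f x) R = (\<Sum>x\<in>S. B t (f x) R)"
  by (induction S rule: infinite_finite_induct) (auto simp: B_0 B_add1)

lemma B_sum2: "t \<in> T \<Longrightarrow> B t P (\<Sum>x\<in>S. f x) = (\<Sum>x\<in>S. B t P (f x))"
  by (induction S rule: infinite_finite_induct) (auto simp: B_0 B_add2)

lemma r_nz: "t \<in> T \<Longrightarrow> r t n \<noteq> 0" using r_sq[of t n] h_nz[of t n] by auto

lemma h_r: "t \<in> T \<Longrightarrow> h t n = r t n * r t n" using r_sq[of t n] by (simp add: power2_eq_square)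

lemma coeff_\<pi>: "t \<in> T \<Longrightarrow> coeff (\<pi> t n) n = 1" "t \<in> T \<Longrightarrow> k > n \<Longrightarrow> coeff (\<pi> t n) k = 0"
  using monic[of t n] by (auto intro: coeff_eq_0)

lemma coeff_\<sigma>: "t \<in> T \<Longrightarrow> coeff (\<sigma> t n) n = 1" "t \<in> T \<Longrightarrow> k > n \<Longrightarrow> coeff (\<sigma> t n) k = 0"
  using monic[of t n] by (auto intro: coeff_eq_0)

lemma expand_\<pi>:
  assumes t: "t \<in> T" and P: "\<And>k. k \<ge> n \<Longrightarrow> coeff P k = 0"
  shows "P = (\<Sum>m<n. Polynomial.smult (B t P (\<sigma> t m) / h t m) (\<pi> t m))"
proof -
  obtain c where c: "P = (\<Sum>m<n. Polynomial.smult (c m) (\<pi> t m))"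
    using monic_basis_expand[of "\<pi> t" n P] monic[OF t] P by blast
  have "B t P (\<sigma> t k) / h t k = c k" if "k < n" for k
  proof -
    have "B t P (\<sigma> t k) = (\<Sum>m<n. c m * (if m = k then h t m else 0))"
      by (subst c, subst B_sum1[OF t]) (simp only: B_smult1[OF t] orth[OF t])
    also have "\<dots> = (\<Sum>m<n. if m = k then c m * h t m else 0)" by (intro sum.cong refl) simp
    finally show ?thesis using that h_nz[OF t, of k] by simp
  qed
  then show ?thesis using c by simp
qed

lemma expand_\<sigma>:
  assumes t: "t \<in> T" and P: "\<And>k. k \<ge> n \<Longrightarrow> coeff P k = 0"
  shows "P = (\<Sum>m<n. Polynomial.smult (B t (\<pi> t m) P / h t m) (\<sigma> t m))"
proof -
  obtain c where c: "P = (\<Sum>m<n. Polynomial.smult (c m) (\<sigma> t m))"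
    using monic_basis_expand[of "\<sigma> t" n P] monic[OF t] P by blast
  have "B t (\<pi> t k) P / h t k = c k" if "k < n" for k
  proof -
    have "B t (\<pi> t k) P = (\<Sum>m<n. c m * (if k = m then h t k else 0))"
      by (subst c, subst B_sum2[OF t]) (simp only: B_smult2[OF t] orth[OF t])
    also have "\<dots> = (\<Sum>m<n. if m = k then c m * h t m else 0)" by (intro sum.cong refl) simp
    finally show ?thesis using that h_nz[OF t, of k] by simp
  qed
  then show ?thesis using c by simp
qed

lemma orth_low1: "t \<in> T \<Longrightarrow> (\<And>k. k \<ge> n \<Longrightarrow> coeff P k = 0) \<Longrightarrow> B t P (\<sigma> t n) = 0"
  by (subst expand_\<pi>[of t n P]) (auto simp: B_sum1 B_smult1 orth)

lemma orth_low2: "t \<in> T \<Longrightarrow> (\<And>k. k \<ge> n \<Longrightarrow> coeff P k = 0) \<Longrightarrow> B t (\<pi> t n) P = 0"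
  by (subst expand_\<sigma>[of t n P]) (auto simp: B_sum2 B_smult2 orth)

text \<open>The contribution of the weight to a parameter derivative of \<open>B\<close>:
  differentiating the weight in the coordinate \<open>U K\<close> multiplies the integrand by
  \<open>- x^K / K\<close>, in \<open>V J\<close> by \<open>- y^J / J\<close>.\<close>

definition D :: "coord \<Rightarrow> params \<Rightarrow> complex poly \<Rightarrow> complex poly \<Rightarrow> complex" where
  "D i t P R = (case i of X \<Rightarrow> 0 | U K \<Rightarrow> - (1 / of_nat K) * B t (monom 1 K * P) R | V J \<Rightarrow> - (1 / of_nat J) * B t P (monom 1 J * R))"

lemma B_deriv: "p \<in> \<Omega> \<Longrightarrow> i \<in> I \<Longrightarrow> ((\<lambda>s. B (par (p(i := s))) P R) has_field_derivative D i (par p) P R) (at (p i))"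
  using B_deriv_u[OF \<Omega>D, of p _ P R] B_deriv_v[OF \<Omega>D, of p _ P R]
  by (auto simp: coords_def D_def) (simp_all add: par_def)

lemma cont_par: "continuous_on T f \<Longrightarrow> continuous_on \<Omega> (\<lambda>p. f (par p))"
  by (rule continuous_on_compose2[of T f \<Omega> par]) (auto intro: continuous_on_subset[OF continuous_par] simp: dom_of_def)

lemma hol_B0: "hol I \<Omega> (\<lambda>p. B (par p) P R)"
  by (rule holI[OF cont_par[OF B_cont] B_deriv])

lemma pd_B0: "p \<in> \<Omega> \<Longrightarrow> i \<in> I \<Longrightarrow> pd i (\<lambda>p. B (par p) P R) p = D i (par p) P R"
  by (rule pd_eqI[OF B_deriv])

lemma poly_monom_sum: "(\<And>k. k > N \<Longrightarrow> coeff P k = 0) \<Longrightarrow> P = (\<Sum>k\<le>N. Polynomial.smult (coeff P k) (monom 1 k))" for P :: "complex poly"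
  by (rule poly_eqI) (auto simp: coeff_sum if_distrib[of "(*) _"] cong: if_cong)

lemma B_expand:
  assumes t: "t \<in> T" and "\<And>k. k > N \<Longrightarrow> coeff P k = 0" "\<And>k. k > N \<Longrightarrow> coeff R k = 0"
  shows "B t P R = (\<Sum>i\<le>N. \<Sum>j\<le>N. coeff P i * coeff R j * B t (monom 1 i) (monom 1 j))"
proof -
  have "B t P R = B t (\<Sum>k\<le>N. Polynomial.smult (coeff P k) (monom 1 k)) (\<Sum>k\<le>N. Polynomial.smult (coeff R k) (monom 1 k))"
    using poly_monom_sum[of N P] poly_monom_sum[of N R] assms by simp
  also have "\<dots> = (\<Sum>i\<le>N. \<Sum>j\<le>N. B t (Polynomial.smult (coeff P i) (monom 1 i)) (Polynomial.smult (coeff R j) (monom 1 j)))"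
    by (subst B_sum1[OF t], subst B_sum2[OF t]) (rule refl)
  also have "\<dots> = (\<Sum>i\<le>N. \<Sum>j\<le>N. coeff P i * coeff R j * B t (monom 1 i) (monom 1 j))"
    by (simp only: B_smult1[OF t] B_smult2[OF t] mult.assoc mult.left_commute)
  finally show ?thesis .
qed

lemma D_smult1: "t \<in> T \<Longrightarrow> D l t (Polynomial.smult c P) R = c * D l t P R"
  by (cases l) (simp_all add: D_def B_smult1)
lemma D_smult2: "t \<in> T \<Longrightarrow> D l t P (Polynomial.smult c R) = c * D l t P R"
  by (cases l) (simp_all add: D_def B_smult2)
lemma D_sum1: "t \<in> T \<Longrightarrow> D l t (\<Sum>x\<in>S. f x) R = (\<Sum>x\<in>S. D l t (f x) R)"
  by (cases l) (simp_all add: D_def sum_distrib_left[where f = f] B_sum1 sum_negf sum_divide_distrib)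
lemma D_sum2: "t \<in> T \<Longrightarrow> D l t P (\<Sum>x\<in>S. f x) = (\<Sum>x\<in>S. D l t P (f x))"
  by (cases l) (simp_all add: D_def sum_distrib_left[where f = f] B_sum2 sum_negf sum_divide_distrib)

lemma D_expand:
  assumes t: "t \<in> T" and "\<And>k. k > N \<Longrightarrow> coeff P k = 0" "\<And>k. k > N \<Longrightarrow> coeff R k = 0"
  shows "D l t P R = (\<Sum>i\<le>N. \<Sum>j\<le>N. coeff P i * coeff R j * D l t (monom 1 i) (monom 1 j))"
proof -
  have eq: "P = (\<Sum>k\<le>N. Polynomial.smult (coeff P k) (monom 1 k))" "R = (\<Sum>k\<le>N. Polynomial.smult (coeff R k) (monom 1 k))"
    using poly_monom_sum[of N P] poly_monom_sum[of N R] assms by auto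
  have lin: "D l t (\<Sum>k\<le>N. Polynomial.smult (a k) (f k)) (\<Sum>k\<le>N. Polynomial.smult (c k) (g k)) = (\<Sum>i\<le>N. \<Sum>j\<le>N. a i * c j * D l t (f i) (g j))" for a c f g
  proof -
    have "D l t (\<Sum>k\<le>N. Polynomial.smult (a k) (f k)) (\<Sum>k\<le>N. Polynomial.smult (c k) (g k))
      = (\<Sum>i\<le>N. \<Sum>j\<le>N. D l t (Polynomial.smult (a i) (f i)) (Polynomial.smult (c j) (g j)))"
      by (subst D_sum1[OF t], subst D_sum2[OF t]) (rule refl)
    then show ?thesis by (simp only: D_smult1[OF t] D_smult2[OF t] mult.assoc mult.left_commute)
  qed
  show ?thesis by (subst eq(1), subst eq(2)) (rule lin)
qed

section \<open>Parameter derivatives of the biorthogonal polynomials and their norms\<close>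

definition dpoly :: "coord \<Rightarrow> nat \<Rightarrow> ((coord \<Rightarrow> complex) \<Rightarrow> complex poly) \<Rightarrow> (coord \<Rightarrow> complex) \<Rightarrow> complex poly" where
  "dpoly i N P p = (\<Sum>k\<le>N. monom (pd i (\<lambda>p. coeff (P p) k) p) k)"

lemma coeff_dpoly: "coeff (dpoly i N P p) k = (if k \<le> N then pd i (\<lambda>p. coeff (P p) k) p else 0)"
  by (simp add: dpoly_def coeff_sum)

text \<open>At bounded degree \<open>B\<close> is a finite sum of coefficients times moments of
  monomials, and the product rule has these three terms. The degree bound has to be uniform in the
  point.\<close>

lemma hol_B:
  assumes P: "\<And>k. hol I \<Omega> (\<lambda>p. coeff (P p) k)" "\<And>p k. p \<in> \<Omega> \<Longrightarrow> k > N \<Longrightarrow> coeff (P p) k = 0"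
    and R: "\<And>k. hol I \<Omega> (\<lambda>p. coeff (R p) k)" "\<And>p k. p \<in> \<Omega> \<Longrightarrow> k > N \<Longrightarrow> coeff (R p) k = 0"
  shows "hol I \<Omega> (\<lambda>p. B (par p) (P p) (R p))"
    and "\<And>p i. p \<in> \<Omega> \<Longrightarrow> i \<in> I \<Longrightarrow> pd i (\<lambda>p. B (par p) (P p) (R p)) p =
      B (par p) (dpoly i N P p) (R p) + B (par p) (P p) (dpoly i N R p) + D i (par p) (P p) (R p)"
proof -
  let ?S = "\<lambda>p. \<Sum>a\<le>N. \<Sum>b\<le>N. coeff (P p) a * coeff (R p) b * B (par p) (monom 1 a) (monom 1 b)"
  have S: "B (par p) (P p) (R p) = ?S p" if "p \<in> \<Omega>" for p
    by (rule B_expand[OF \<Omega>D[OF that] P(2)[OF that] R(2)[OF that]])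
  have hS: "hol I \<Omega> ?S" by (intro hol_sum hol_mult P R hol_B0)
  show "hol I \<Omega> (\<lambda>p. B (par p) (P p) (R p))" by (rule hol_cong[OF dom _ hS]) (rule S[symmetric])
  fix p i assume p: "p \<in> \<Omega>" and i: "i \<in> I"
  have pT: "par p \<in> T" by (rule \<Omega>D[OF p])
  have "pd i (\<lambda>p. B (par p) (P p) (R p)) p = pd i ?S p" by (rule pd_cong[OF dom p i S])
  also have "\<dots> = (\<Sum>a\<le>N. \<Sum>b\<le>N. pd i (\<lambda>p. coeff (P p) a * coeff (R p) b * B (par p) (monom 1 a) (monom 1 b)) p)"
    by (subst pd_sum[OF _ p i], intro hol_sum hol_mult P R hol_B0)
      (intro sum.cong refl pd_sum[OF _ p i] hol_mult P R hol_B0)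
  also have "\<dots> = (\<Sum>a\<le>N. \<Sum>b\<le>N. pd i (\<lambda>p. coeff (P p) a) p * coeff (R p) b * B (par p) (monom 1 a) (monom 1 b)
      + coeff (P p) a * pd i (\<lambda>p. coeff (R p) b) p * B (par p) (monom 1 a) (monom 1 b)
      + coeff (P p) a * coeff (R p) b * D i (par p) (monom 1 a) (monom 1 b))"
  proof (intro sum.cong refl)
    fix a b
    show "pd i (\<lambda>p. coeff (P p) a * coeff (R p) b * B (par p) (monom 1 a) (monom 1 b)) p =
      pd i (\<lambda>p. coeff (P p) a) p * coeff (R p) b * B (par p) (monom 1 a) (monom 1 b)
      + coeff (P p) a * pd i (\<lambda>p. coeff (R p) b) p * B (par p) (monom 1 a) (monom 1 b)
      + coeff (P p) a * coeff (R p) b * D i (par p) (monom 1 a) (monom 1 b)"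
      unfolding pd_mult[OF hol_mult[OF P(1) R(1)] hol_B0 p i] pd_mult[OF P(1) R(1) p i] pd_B0[OF p i]
      by (simp add: distrib_right)
  qed
  also have "\<dots> = (\<Sum>a\<le>N. \<Sum>b\<le>N. pd i (\<lambda>p. coeff (P p) a) p * coeff (R p) b * B (par p) (monom 1 a) (monom 1 b))
      + (\<Sum>a\<le>N. \<Sum>b\<le>N. coeff (P p) a * pd i (\<lambda>p. coeff (R p) b) p * B (par p) (monom 1 a) (monom 1 b))
      + (\<Sum>a\<le>N. \<Sum>b\<le>N. coeff (P p) a * coeff (R p) b * D i (par p) (monom 1 a) (monom 1 b))"
    by (simp only: sum.distrib)
  also have "(\<Sum>a\<le>N. \<Sum>b\<le>N. pd i (\<lambda>p. coeff (P p) a) p * coeff (R p) b * B (par p) (monom 1 a) (monom 1 b))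
     = B (par p) (dpoly i N P p) (R p)"
    by (subst B_expand[OF pT, of N]) (use R(2)[OF p] in \<open>auto simp: coeff_dpoly intro!: sum.cong\<close>)
  also have "(\<Sum>a\<le>N. \<Sum>b\<le>N. coeff (P p) a * pd i (\<lambda>p. coeff (R p) b) p * B (par p) (monom 1 a) (monom 1 b))
     = B (par p) (P p) (dpoly i N R p)"
    by (subst B_expand[OF pT, of N]) (use P(2)[OF p] in \<open>auto simp: coeff_dpoly intro!: sum.cong\<close>)
  also have "(\<Sum>a\<le>N. \<Sum>b\<le>N. coeff (P p) a * coeff (R p) b * D i (par p) (monom 1 a) (monom 1 b)) = D i (par p) (P p) (R p)"
    by (rule D_expand[symmetric, OF pT P(2)[OF p] R(2)[OF p]])
  finally show "pd i (\<lambda>p. B (par p) (P p) (R p)) p =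
      B (par p) (dpoly i N P p) (R p) + B (par p) (P p) (dpoly i N R p) + D i (par p) (P p) (R p)" .
qed

text \<open>Gram-Schmidt as an induction: \<open>\<pi> n\<close> is orthogonal to the lower
  \<open>\<sigma> m\<close>, so \<open>x^n - \<pi> n\<close> has the coefficients
  \<open>B (x^n) (\<sigma> m) / h m\<close> in the lower \<open>\<pi> m\<close>; likewise for
  \<open>\<sigma> n\<close>, after which \<open>h n\<close> is a pairing of holomorphic
  families.\<close>

lemma hol_coeffs:
  "(\<forall>k. hol I \<Omega> (\<lambda>p. coeff (\<pi> (par p) n) k)) \<and> (\<forall>k. hol I \<Omega> (\<lambda>p. coeff (\<sigma> (par p) n) k)) \<and> hol I \<Omega> (\<lambda>p. h (par p) n)"
proof (induction n rule: less_induct)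
  case (less n)
  have IH: "hol I \<Omega> (\<lambda>p. coeff (\<pi> (par p) m) k)" "hol I \<Omega> (\<lambda>p. coeff (\<sigma> (par p) m) k)" "hol I \<Omega> (\<lambda>p. h (par p) m)" if "m < n" for m k
    using less[OF that] by auto
  have h1: "hol I \<Omega> (\<lambda>p. B (par p) (monom 1 n) (\<sigma> (par p) m))" if "m < n" for m
    by (rule hol_B(1)[where N = n]) (use IH[OF that] that coeff_\<sigma>(2)[OF \<Omega>D] in auto)
  have h2: "hol I \<Omega> (\<lambda>p. B (par p) (\<pi> (par p) m) (monom 1 n))" if "m < n" for m
    by (rule hol_B(1)[where N = n]) (use IH[OF that] that coeff_\<pi>(2)[OF \<Omega>D] in auto)
  have e1: "coeff (\<pi> (par p) n) k = coeff (monom 1 n) k - (\<Sum>m<n. B (par p) (monom 1 n) (\<sigma> (par p) m) / h (par p) m * coeff (\<pi> (par p) m) k)"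
    if p: "p \<in> \<Omega>" for p k
  proof -
    note t = \<Omega>D[OF p]
    have co: "coeff (monom 1 n - \<pi> (par p) n) k = 0" if "k \<ge> n" for k
      using that coeff_\<pi>[OF t, of n] by (cases "k = n") auto
    have "B (par p) (monom 1 n - \<pi> (par p) n) (\<sigma> (par p) m) = B (par p) (monom 1 n) (\<sigma> (par p) m)" if "m < n" for m
      using B_add1[OF t, of "monom 1 n - \<pi> (par p) n" "\<pi> (par p) n" "\<sigma> (par p) m"] orth[OF t, of n m] that by simp
    note BB = this
    have "monom 1 n - \<pi> (par p) n = (\<Sum>m<n. Polynomial.smult (B (par p) (monom 1 n - \<pi> (par p) n) (\<sigma> (par p) m) / h (par p) m) (\<pi> (par p) m))"
      by (rule expand_\<pi>[OF t, of n, OF co])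
    also have "\<dots> = (\<Sum>m<n. Polynomial.smult (B (par p) (monom 1 n) (\<sigma> (par p) m) / h (par p) m) (\<pi> (par p) m))"
      by (rule sum.cong[OF refl]) (use BB in auto)
    finally have "monom 1 n - \<pi> (par p) n = (\<Sum>m<n. Polynomial.smult (B (par p) (monom 1 n) (\<sigma> (par p) m) / h (par p) m) (\<pi> (par p) m))" .
    then have "coeff (monom 1 n - \<pi> (par p) n) k = coeff (\<Sum>m<n. Polynomial.smult (B (par p) (monom 1 n) (\<sigma> (par p) m) / h (par p) m) (\<pi> (par p) m)) k" by simp
    then show ?thesis by (simp only: coeff_diff coeff_sum coeff_smult) (simp add: algebra_simps)
  qed
  have e2: "coeff (\<sigma> (par p) n) k = coeff (monom 1 n) k - (\<Sum>m<n. B (par p) (\<pi> (par p) m) (monom 1 n) / h (par p) m * coeff (\<sigma> (par p) m) k)"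
    if p: "p \<in> \<Omega>" for p k
  proof -
    note t = \<Omega>D[OF p]
    have co: "coeff (monom 1 n - \<sigma> (par p) n) k = 0" if "k \<ge> n" for k
      using that coeff_\<sigma>[OF t, of n] by (cases "k = n") auto
    have "B (par p) (\<pi> (par p) m) (monom 1 n - \<sigma> (par p) n) = B (par p) (\<pi> (par p) m) (monom 1 n)" if "m < n" for m
      using B_add2[OF t, of "\<pi> (par p) m" "monom 1 n - \<sigma> (par p) n" "\<sigma> (par p) n"] orth[OF t, of m n] that by simp
    note BB = this
    have "monom 1 n - \<sigma> (par p) n = (\<Sum>m<n. Polynomial.smult (B (par p) (\<pi> (par p) m) (monom 1 n - \<sigma> (par p) n) / h (par p) m) (\<sigma> (par p) m))"
      by (rule expand_\<sigma>[OF t, of n, OF co])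
    also have "\<dots> = (\<Sum>m<n. Polynomial.smult (B (par p) (\<pi> (par p) m) (monom 1 n) / h (par p) m) (\<sigma> (par p) m))"
      by (rule sum.cong[OF refl]) (use BB in auto)
    finally have "monom 1 n - \<sigma> (par p) n = (\<Sum>m<n. Polynomial.smult (B (par p) (\<pi> (par p) m) (monom 1 n) / h (par p) m) (\<sigma> (par p) m))" .
    then have "coeff (monom 1 n - \<sigma> (par p) n) k = coeff (\<Sum>m<n. Polynomial.smult (B (par p) (\<pi> (par p) m) (monom 1 n) / h (par p) m) (\<sigma> (par p) m)) k" by simp
    then show ?thesis by (simp only: coeff_diff coeff_sum coeff_smult) (simp add: algebra_simps)
  qed
  have c1: "hol I \<Omega> (\<lambda>p. coeff (\<pi> (par p) n) k)" for k
  proof (rule hol_cong[OF dom e1[symmetric]])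
    show "hol I \<Omega> (\<lambda>p. coeff (monom 1 n) k - (\<Sum>m<n. B (par p) (monom 1 n) (\<sigma> (par p) m) / h (par p) m * coeff (\<pi> (par p) m) k))"
      by (intro hol_diff hol_const hol_sum hol_mult hol_divide h1 IH h_nz \<Omega>D) auto
  qed
  have c2: "hol I \<Omega> (\<lambda>p. coeff (\<sigma> (par p) n) k)" for k
  proof (rule hol_cong[OF dom e2[symmetric]])
    show "hol I \<Omega> (\<lambda>p. coeff (monom 1 n) k - (\<Sum>m<n. B (par p) (\<pi> (par p) m) (monom 1 n) / h (par p) m * coeff (\<sigma> (par p) m) k))"
      by (intro hol_diff hol_const hol_sum hol_mult hol_divide h2 IH h_nz \<Omega>D) auto
  qed
  have "hol I \<Omega> (\<lambda>p. B (par p) (\<pi> (par p) n) (\<sigma> (par p) n))"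
    by (rule hol_B(1)[where N = n]) (use c1 c2 coeff_\<pi>(2)[OF \<Omega>D] coeff_\<sigma>(2)[OF \<Omega>D] in auto)
  then have "hol I \<Omega> (\<lambda>p. h (par p) n)"
    by (rule hol_cong[OF dom, rotated]) (simp add: orth[OF \<Omega>D])
  then show ?case using c1 c2 by blast
qed

lemma hol_\<pi>: "hol I \<Omega> (\<lambda>p. coeff (\<pi> (par p) n) k)" and hol_\<sigma>: "hol I \<Omega> (\<lambda>p. coeff (\<sigma> (par p) n) k)"
  and hol_h: "hol I \<Omega> (\<lambda>p. h (par p) n)"
  using hol_coeffs[of n] by auto

lemma hol_r: "hol I \<Omega> (\<lambda>p. r (par p) n)"
  and pd_r: "p \<in> \<Omega> \<Longrightarrow> i \<in> I \<Longrightarrow> 2 * r (par p) n * pd i (\<lambda>p. r (par p) n) p = pd i (\<lambda>p. h (par p) n) p"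
  by (rule hol_sqrt[OF dom hol_h[of n] cont_par[OF r_cont[of n]]]; simp add: r_sq[OF \<Omega>D] h_nz[OF \<Omega>D])+

abbreviation "d\<pi> i n p \<equiv> dpoly i n (\<lambda>p. \<pi> (par p) n) p"

text \<open>The leading coefficient is the constant \<open>1\<close>, so differentiation in a
  parameter lowers the degree.\<close>

lemma dmonic_low:
  assumes p: "p \<in> \<Omega>" and i: "i \<in> I" and k: "k \<ge> n"
  shows "coeff (dpoly i N (\<lambda>p. \<pi> (par p) n) p) k = 0" "coeff (dpoly i N (\<lambda>p. \<sigma> (par p) n) p) k = 0"
proof -
  have "pd i (\<lambda>p. coeff (\<pi> (par p) n) k) p = pd i (\<lambda>p. if k = n then 1 else 0) p"
    by (rule pd_cong[OF dom p i]) (use k coeff_\<pi>[OF \<Omega>D] in auto)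
  moreover have "pd i (\<lambda>p. coeff (\<sigma> (par p) n) k) p = pd i (\<lambda>p. if k = n then 1 else 0) p"
    by (rule pd_cong[OF dom p i]) (use k coeff_\<sigma>[OF \<Omega>D] in auto)
  ultimately show "coeff (dpoly i N (\<lambda>p. \<pi> (par p) n) p) k = 0" "coeff (dpoly i N (\<lambda>p. \<sigma> (par p) n) p) k = 0"
    by (auto simp: coeff_dpoly)
qed

text \<open>Derivative of the orthogonality relation; the term with the derivative of
  \<open>\<sigma> m\<close>, of degree below \<open>m < n\<close>, is again orthogonal to
  \<open>\<pi> n\<close>.\<close>

lemma B_d\<pi>:
  assumes p: "p \<in> \<Omega>" and i: "i \<in> I" and m: "m < n"
  shows "B (par p) (d\<pi> i n p) (\<sigma> (par p) m) = - D i (par p) (\<pi> (par p) n) (\<sigma> (par p) m)"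
proof -
  have "pd i (\<lambda>p. B (par p) (\<pi> (par p) n) (\<sigma> (par p) m)) p = pd i (\<lambda>p. 0) p"
    by (rule pd_cong[OF dom p i]) (use orth[OF \<Omega>D] m in auto)
  moreover have "pd i (\<lambda>p. B (par p) (\<pi> (par p) n) (\<sigma> (par p) m)) p =
      B (par p) (dpoly i n (\<lambda>p. \<pi> (par p) n) p) (\<sigma> (par p) m) + B (par p) (\<pi> (par p) n) (dpoly i n (\<lambda>p. \<sigma> (par p) m) p)
      + D i (par p) (\<pi> (par p) n) (\<sigma> (par p) m)"
    by (rule hol_B(2)[OF hol_\<pi> _ hol_\<sigma> _ p i]) (use m coeff_\<pi>(2)[OF \<Omega>D] coeff_\<sigma>(2)[OF \<Omega>D] in auto)
  moreover have "B (par p) (\<pi> (par p) n) (dpoly i n (\<lambda>p. \<sigma> (par p) m) p) = 0"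
    by (rule orth_low2[OF \<Omega>D[OF p]]) (use dmonic_low(2)[OF p i] m in auto)
  ultimately show ?thesis by (simp add: eq_neg_iff_add_eq_0)
qed

lemma pd_h:
  assumes p: "p \<in> \<Omega>" and i: "i \<in> I"
  shows "pd i (\<lambda>p. h (par p) n) p = D i (par p) (\<pi> (par p) n) (\<sigma> (par p) n)"
proof -
  have "pd i (\<lambda>p. h (par p) n) p = pd i (\<lambda>p. B (par p) (\<pi> (par p) n) (\<sigma> (par p) n)) p"
    by (rule pd_cong[OF dom p i]) (use orth[OF \<Omega>D] in auto)
  also have "\<dots> = B (par p) (dpoly i n (\<lambda>p. \<pi> (par p) n) p) (\<sigma> (par p) n) + B (par p) (\<pi> (par p) n) (dpoly i n (\<lambda>p. \<sigma> (par p) n) p)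
      + D i (par p) (\<pi> (par p) n) (\<sigma> (par p) n)"
    by (rule hol_B(2)[OF hol_\<pi> _ hol_\<sigma> _ p i]) (use coeff_\<pi>(2)[OF \<Omega>D] coeff_\<sigma>(2)[OF \<Omega>D] in auto)
  also have "B (par p) (\<pi> (par p) n) (dpoly i n (\<lambda>p. \<sigma> (par p) n) p) = 0"
    by (rule orth_low2[OF \<Omega>D[OF p]]) (use dmonic_low(2)[OF p i] in auto)
  also have "B (par p) (dpoly i n (\<lambda>p. \<pi> (par p) n) p) (\<sigma> (par p) n) = 0"
    by (rule orth_low1[OF \<Omega>D[OF p]]) (use dmonic_low(1)[OF p i] in auto)
  finally show ?thesis by simp
qed

end

text \<open>The transpose of \<open>- P\<close> has the shape of \<open>Q\<close> with
  \<open>\<beta>\<close> in place of \<open>\<alpha>\<close>. Through this identity the band facts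
  about \<open>Q_mat\<close> apply to both variables, and the exchange of variables becomes
  literal.\<close>

lemma P_mat_Q_mat: "P_mat d c n m = - Q_mat d c m n"
  by (simp add: P_mat_def Q_mat_def)

lemma Q_mat_sum:
  "(\<Sum>j | j \<in> {-1..int d} \<and> 0 \<le> int n - j. c j n * f (nat (int n - j))) = (\<Sum>m<n+2. Q_mat d c n m * f m)"
proof -
  have "(\<Sum>m<n+2. Q_mat d c n m * f m) = (\<Sum>m | m < n + 2 \<and> int n - int m \<in> {-1..int d}. Q_mat d c n m * f m)"
    by (rule sum.mono_neutral_right) (auto simp: Q_mat_def)
  also have "\<dots> = (\<Sum>j | j \<in> {-1..int d} \<and> 0 \<le> int n - j. c j n * f (nat (int n - j)))"
    by (rule sum.reindex_bij_witness[where i = "\<lambda>j. nat (int n - j)" and j = "\<lambda>m. int n - int m"]) (auto simp: Q_mat_def)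
  finally show ?thesis ..
qed

lemma P_mat_sum:
  "- (\<Sum>j | j \<in> {-1..int d} \<and> 0 \<le> int n + j. c j (nat (int n + j)) * f (nat (int n + j))) = (\<Sum>m<n+d+1. P_mat d c n m * f m)"
proof -
  have "(\<Sum>m<n+d+1. P_mat d c n m * f m) = (\<Sum>m | m < n + d + 1 \<and> int m - int n \<in> {-1..int d}. P_mat d c n m * f m)"
    by (rule sum.mono_neutral_right) (auto simp: P_mat_def)
  also have "\<dots> = (\<Sum>j | j \<in> {-1..int d} \<and> 0 \<le> int n + j. - (c j (nat (int n + j)) * f (nat (int n + j))))"
    by (rule sum.reindex_bij_witness[where i = "\<lambda>j. nat (int n + j)" and j = "\<lambda>m. int m - int n"]) (auto simp: P_mat_def)
  finally show ?thesis by (simp add: sum_negf)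
qed

lemma Q_mat_band: "m > n + 1 \<or> n > m + d \<Longrightarrow> Q_mat d c n m = 0"
  by (auto simp: Q_mat_def)

lemma inf_mult_sum:
  assumes "\<And>l. l \<ge> N \<Longrightarrow> A n l = 0"
  shows "inf_mult A B n m = (\<Sum>l<N. A n l * B l m)"
  unfolding inf_mult_def
  by (rule sum.mono_neutral_left) (use assms in \<open>auto simp: not_less[symmetric]\<close>)

lemma inf_power_band:
  assumes "\<And>n m. m > n + 1 \<Longrightarrow> A n m = 0" "m > n + K"
  shows "inf_power A K n m = 0"
  using assms(2)
proof (induction K arbitrary: n)
  case (Suc K)
  have "A n l * inf_power A K l m = 0" for l
    using assms(1)[of n l] Suc.IH[of l] Suc.prems by (cases "l > n + 1") auto
  then show ?case unfolding inf_power.simps inf_mult_def by (intro sum.neutral) blast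
qed simp

lemma deform_upper: "m < n \<Longrightarrow> deform A k n m = 0" by (simp add: deform_def)

lemma deform_band:
  assumes "\<And>n m. m > n + 1 \<Longrightarrow> A n m = 0" "m > n + K"
  shows "deform A K n m = 0"
  using inf_power_band[OF assms] assms(2) by (simp add: deform_def)

section \<open>Recursion matrices as matrix elements of the moment functional\<close>

context bimoment begin

abbreviation "Qm t \<equiv> Q_mat d2 (\<alpha> t)"
abbreviation "Rm t \<equiv> Q_mat d1 (\<beta> t)"

lemma gamma: "t \<in> T \<Longrightarrow> \<alpha> t (-1) n = r t (n+1) / r t n" "t \<in> T \<Longrightarrow> \<beta> t (-1) n = r t (n+1) / r t n"
  using rec_co[of t] by (auto simp: recursion_coeffs_def)

lemma x_\<pi>:
  assumes t: "t \<in> T"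
  shows "Polynomial.smult (1 / r t n) (monom 1 1 * \<pi> t n) = (\<Sum>m<n+2. Polynomial.smult (Qm t n m / r t m) (\<pi> t m))"
proof -
  have "poly (Polynomial.smult (1 / r t n) (monom 1 1 * \<pi> t n)) x = poly (\<Sum>m<n+2. Polynomial.smult (Qm t n m / r t m) (\<pi> t m)) x" for x
  proof -
    let ?E = "exp (- potential d1 (fst t) x)"
    have "x * wave_fun d1 t (\<pi> t) (r t) n x = (\<Sum>m<n+2. Qm t n m * wave_fun d1 t (\<pi> t) (r t) m x)"
      using rec_co[OF t] by (simp add: recursion_coeffs_def Q_mat_sum[where f = "\<lambda>m. wave_fun d1 t (\<pi> t) (r t) m x", symmetric] del: add_2_eq_Suc')
    moreover have "(\<Sum>m<n+2. Qm t n m * wave_fun d1 t (\<pi> t) (r t) m x) = (\<Sum>m<n+2. Qm t n m / r t m * poly (\<pi> t m) x) * ?E"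
      unfolding sum_distrib_right by (intro sum.cong refl) (simp add: wave_fun_def)
    moreover have "x * wave_fun d1 t (\<pi> t) (r t) n x = (1 / r t n * (x * poly (\<pi> t n) x)) * ?E" by (simp add: wave_fun_def)
    ultimately have "(1 / r t n * (x * poly (\<pi> t n) x)) * ?E = (\<Sum>m<n+2. Qm t n m / r t m * poly (\<pi> t m) x) * ?E" by (simp only:)
    then have "1 / r t n * (x * poly (\<pi> t n) x) = (\<Sum>m<n+2. Qm t n m / r t m * poly (\<pi> t m) x)"
      by (subst (asm) mult_right_cancel) auto
    then show ?thesis by (simp add: poly_sum poly_monom mult.assoc del: sum.lessThan_Suc add_2_eq_Suc')
  qed
  then show ?thesis by (simp add: poly_eq_poly_eq_iff[symmetric] fun_eq_iff)
qed

lemma Q_B: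
  assumes t: "t \<in> T"
  shows "B t (monom 1 1 * \<pi> t n) (\<sigma> t k) = Qm t n k * r t n * r t k"
proof (cases "k < n + 2")
  case True
  have "B t (Polynomial.smult (1 / r t n) (monom 1 1 * \<pi> t n)) (\<sigma> t k) = (\<Sum>m<n+2. Qm t n m / r t m * B t (\<pi> t m) (\<sigma> t k))"
    unfolding x_\<pi>[OF t] by (simp only: B_sum1[OF t] B_smult1[OF t])
  also have "\<dots> = (\<Sum>m<n+2. if m = k then Qm t n m / r t m * h t m else 0)" by (intro sum.cong refl) (simp add: orth[OF t])
  also have "\<dots> = Qm t n k * r t k" using True r_nz[OF t, of k] by (simp add: h_r[OF t])
  finally show ?thesis using r_nz[OF t, of n] by (simp add: B_smult1[OF t] field_simps)
next
  case False
  have "B t (monom 1 1 * \<pi> t n) (\<sigma> t k) = 0"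
    by (rule orth_low1[OF t]) (use False coeff_\<pi>(2)[OF t, of n] in \<open>auto simp: coeff_monom_mult\<close>)
  then show ?thesis using False Q_mat_band[of n k d2 "\<alpha> t"] by simp
qed

lemma coeff_low_dpot_mult:
  assumes "\<And>k. k > n \<Longrightarrow> coeff P k = 0" "k > n + d"
  shows "coeff (dpot d c * P) k = 0"
  unfolding coeff_mult
proof (rule sum.neutral, intro ballI)
  fix i assume "i \<in> {..k}"
  show "coeff (dpot d c) i * coeff P (k - i) = 0"
    using assms by (cases "i \<le> d") (auto simp: coeff_dpot)
qed

lemma dx_\<pi>:
  assumes t: "t \<in> T"
  shows "Polynomial.smult (1 / r t n) (pderiv (\<pi> t n) - dpot d1 (fst t) * \<pi> t n) = (\<Sum>m<n+d1+1. Polynomial.smult (P_mat d1 (\<beta> t) n m / r t m) (\<pi> t m))"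
proof -
  have "poly (Polynomial.smult (1 / r t n) (pderiv (\<pi> t n) - dpot d1 (fst t) * \<pi> t n)) x = poly (\<Sum>m<n+d1+1. Polynomial.smult (P_mat d1 (\<beta> t) n m / r t m) (\<pi> t m)) x" for x
  proof -
    let ?E = "exp (- potential d1 (fst t) x)"
    have "((\<lambda>x. poly (\<pi> t n) x * exp (- potential d1 (fst t) x) / r t n) has_field_derivative
        (poly (pderiv (\<pi> t n)) x * ?E + (?E * - poly (dpot d1 (fst t)) x) * poly (\<pi> t n) x) / r t n) (at x)"
      by (intro DERIV_cdivide DERIV_mult poly_DERIV DERIV_fun_exp DERIV_minus poly_dpot)
    moreover have "(wave_fun d1 t (\<pi> t) (r t) n has_field_derivative (\<Sum>m<n+d1+1. P_mat d1 (\<beta> t) n m * wave_fun d1 t (\<pi> t) (r t) m x)) (at x)"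
      using rec_co[OF t] unfolding recursion_coeffs_def P_mat_sum[where f = "\<lambda>m. wave_fun d1 t (\<pi> t) (r t) m x", symmetric] by blast
    ultimately have "(poly (pderiv (\<pi> t n)) x * ?E + (?E * - poly (dpot d1 (fst t)) x) * poly (\<pi> t n) x) / r t n =
        (\<Sum>m<n+d1+1. P_mat d1 (\<beta> t) n m * wave_fun d1 t (\<pi> t) (r t) m x)"
      unfolding wave_fun_def[abs_def] by (rule DERIV_unique)
    moreover have "(\<Sum>m<n+d1+1. P_mat d1 (\<beta> t) n m * wave_fun d1 t (\<pi> t) (r t) m x) = (\<Sum>m<n+d1+1. P_mat d1 (\<beta> t) n m / r t m * poly (\<pi> t m) x) * ?E"
      unfolding sum_distrib_right by (intro sum.cong refl) (simp add: wave_fun_def)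
    moreover have "(poly (pderiv (\<pi> t n)) x * ?E + (?E * - poly (dpot d1 (fst t)) x) * poly (\<pi> t n) x) / r t n =
        (1 / r t n * (poly (pderiv (\<pi> t n)) x - poly (dpot d1 (fst t)) x * poly (\<pi> t n) x)) * ?E"
      by (simp add: left_diff_distrib diff_divide_distrib)
    ultimately have "(1 / r t n * (poly (pderiv (\<pi> t n)) x - poly (dpot d1 (fst t)) x * poly (\<pi> t n) x)) * ?E
        = (\<Sum>m<n+d1+1. P_mat d1 (\<beta> t) n m / r t m * poly (\<pi> t m) x) * ?E" by (simp only:)
    then have "1 / r t n * (poly (pderiv (\<pi> t n)) x - poly (dpot d1 (fst t)) x * poly (\<pi> t n) x)
        = (\<Sum>m<n+d1+1. P_mat d1 (\<beta> t) n m / r t m * poly (\<pi> t m) x)"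
      by (subst (asm) mult_right_cancel) auto
    then show ?thesis by (simp add: poly_sum mult.assoc del: sum.lessThan_Suc)
  qed
  then show ?thesis by (simp add: poly_eq_poly_eq_iff[symmetric] fun_eq_iff)
qed

text \<open>Integration by parts in \<open>x\<close> replaces multiplication of
  \<open>\<sigma>\<close> by \<open>y\<close> with minus the derivative acting on
  \<open>\<pi>\<close> times its exponential, and that derivative is expanded by
  \<open>P\<close>.\<close>

lemma R_B:
  assumes t: "t \<in> T"
  shows "B t (\<pi> t n) (monom 1 1 * \<sigma> t k) = Rm t k n * r t n * r t k"
proof -
  let ?P = "pderiv (\<pi> t n) - dpot d1 (fst t) * \<pi> t n"
  have B: "B t (\<pi> t n) (monom 1 1 * \<sigma> t k) = - B t ?P (\<sigma> t k)"
    using parts1[OF t, of "\<pi> t n" "\<sigma> t k"] by (simp add: eq_neg_iff_add_eq_0 add.commute)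
  show ?thesis
  proof (cases "k < n + d1 + 1")
    case True
    have "B t (Polynomial.smult (1 / r t n) ?P) (\<sigma> t k) = (\<Sum>m<n+d1+1. P_mat d1 (\<beta> t) n m / r t m * B t (\<pi> t m) (\<sigma> t k))"
      unfolding dx_\<pi>[OF t] by (simp only: B_sum1[OF t] B_smult1[OF t])
    also have "\<dots> = (\<Sum>m<n+d1+1. if m = k then P_mat d1 (\<beta> t) n m / r t m * h t m else 0)" by (intro sum.cong refl) (simp add: orth[OF t])
    also have "\<dots> = P_mat d1 (\<beta> t) n k * r t k" using True r_nz[OF t, of k] by (simp add: h_r[OF t])
    finally show ?thesis using r_nz[OF t, of n] unfolding B by (simp add: B_smult1[OF t] field_simps P_mat_Q_mat)
  next
    case False
    have "B t ?P (\<sigma> t k) = 0"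
    proof (rule orth_low1[OF t])
      fix j assume "j \<ge> k"
      then have "j > n + d1" using False by simp
      then show "coeff ?P j = 0"
        using coeff_low_dpot_mult[of n "\<pi> t n" d1 j "fst t"] coeff_\<pi>(2)[OF t, of n] by (simp add: coeff_pderiv)
    qed
    then show ?thesis using False B Q_mat_band[of k n d1 "\<beta> t"] by simp
  qed
qed

lemma y_\<sigma>:
  assumes t: "t \<in> T"
  shows "monom 1 1 * \<sigma> t n = (\<Sum>m<n+2. Polynomial.smult (Rm t n m * r t n / r t m) (\<sigma> t m))"
proof -
  have "monom 1 1 * \<sigma> t n = (\<Sum>m<n+2. Polynomial.smult (B t (\<pi> t m) (monom 1 1 * \<sigma> t n) / h t m) (\<sigma> t m))"
    by (rule expand_\<sigma>[OF t]) (use coeff_\<sigma>(2)[OF t, of n] in \<open>auto simp: coeff_monom_mult\<close>)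
  also have "\<dots> = (\<Sum>m<n+2. Polynomial.smult (Rm t n m * r t n / r t m) (\<sigma> t m))"
    unfolding R_B[OF t] h_r[OF t] by (intro sum.cong refl arg_cong2[where f = Polynomial.smult]) (use r_nz[OF t] in auto)
  finally show ?thesis .
qed

lemma x_\<pi>':
  assumes t: "t \<in> T"
  shows "monom 1 1 * \<pi> t n = (\<Sum>m<n+2. Polynomial.smult (Qm t n m * r t n / r t m) (\<pi> t m))"
proof -
  have "monom 1 1 * \<pi> t n = (\<Sum>m<n+2. Polynomial.smult (B t (monom 1 1 * \<pi> t n) (\<sigma> t m) / h t m) (\<pi> t m))"
    by (rule expand_\<pi>[OF t]) (use coeff_\<pi>(2)[OF t, of n] in \<open>auto simp: coeff_monom_mult\<close>)
  also have "\<dots> = (\<Sum>m<n+2. Polynomial.smult (Qm t n m * r t n / r t m) (\<pi> t m))"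
    unfolding Q_B[OF t] h_r[OF t] by (intro sum.cong refl arg_cong2[where f = Polynomial.smult]) (use r_nz[OF t] in auto)
  finally show ?thesis .
qed

lemma Qpow_B:
  assumes t: "t \<in> T"
  shows "B t (monom 1 K * \<pi> t n) (\<sigma> t m) = inf_power (Qm t) K n m * r t n * r t m"
proof (induction K arbitrary: n)
  case 0 then show ?case by (simp add: orth[OF t] h_r[OF t] monom_0 flip: one_pCons)
next
  case (Suc K)
  have "monom 1 (Suc K) * \<pi> t n = monom 1 K * (monom 1 1 * \<pi> t n)" by (simp add: mult_monom flip: mult.assoc)
  also have "\<dots> = (\<Sum>l<n+2. Polynomial.smult (Qm t n l * r t n / r t l) (monom 1 K * \<pi> t l))"
    unfolding x_\<pi>'[OF t] by (simp only: sum_distrib_left mult_smult_right)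
  finally have "B t (monom 1 (Suc K) * \<pi> t n) (\<sigma> t m) = (\<Sum>l<n+2. Qm t n l * r t n / r t l * (inf_power (Qm t) K l m * r t l * r t m))"
    by (simp only: B_sum1[OF t] B_smult1[OF t] Suc.IH)
  also have "\<dots> = (\<Sum>l<n+2. Qm t n l * inf_power (Qm t) K l m * (r t n * r t m))"
    by (intro sum.cong refl) (use r_nz[OF t] in auto)
  also have "\<dots> = (\<Sum>l<n+2. Qm t n l * inf_power (Qm t) K l m) * (r t n * r t m)" by (simp only: sum_distrib_right)
  also have "(\<Sum>l<n+2. Qm t n l * inf_power (Qm t) K l m) = inf_power (Qm t) (Suc K) n m"
    by (simp only: inf_power.simps, rule inf_mult_sum[symmetric]) (auto intro: Q_mat_band)
  finally show ?case by simp
qed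

lemma Rpow_B:
  assumes t: "t \<in> T"
  shows "B t (\<pi> t m) (monom 1 K * \<sigma> t n) = inf_power (Rm t) K n m * r t n * r t m"
proof (induction K arbitrary: n)
  case 0 then show ?case by (simp add: orth[OF t] h_r[OF t] monom_0 flip: one_pCons)
next
  case (Suc K)
  have "monom 1 (Suc K) * \<sigma> t n = monom 1 K * (monom 1 1 * \<sigma> t n)" by (simp add: mult_monom flip: mult.assoc)
  also have "\<dots> = (\<Sum>l<n+2. Polynomial.smult (Rm t n l * r t n / r t l) (monom 1 K * \<sigma> t l))"
    unfolding y_\<sigma>[OF t] by (simp only: sum_distrib_left mult_smult_right)
  finally have "B t (\<pi> t m) (monom 1 (Suc K) * \<sigma> t n) = (\<Sum>l<n+2. Rm t n l * r t n / r t l * (inf_power (Rm t) K l m * r t l * r t m))"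
    by (simp only: B_sum2[OF t] B_smult2[OF t] Suc.IH)
  also have "\<dots> = (\<Sum>l<n+2. Rm t n l * inf_power (Rm t) K l m * (r t n * r t m))"
    by (intro sum.cong refl) (use r_nz[OF t] in auto)
  also have "\<dots> = (\<Sum>l<n+2. Rm t n l * inf_power (Rm t) K l m) * (r t n * r t m)" by (simp only: sum_distrib_right)
  also have "(\<Sum>l<n+2. Rm t n l * inf_power (Rm t) K l m) = inf_power (Rm t) (Suc K) n m"
    by (simp only: inf_power.simps, rule inf_mult_sum[symmetric]) (auto intro: Q_mat_band)
  finally show ?case by simp
qed

text \<open>Subtracting the multiple of \<open>\<sigma> t N\<close> with the same leading
  coefficient leaves degree below \<open>N\<close>.\<close>

lemma B_lead:
  assumes t: "t \<in> T" and R: "\<And>k. k > N \<Longrightarrow> coeff R k = 0"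
  shows "B t (\<pi> t N) R = coeff R N * h t N"
proof -
  have "B t (\<pi> t N) (R - Polynomial.smult (coeff R N) (\<sigma> t N)) = 0"
  proof (rule orth_low2[OF t])
    fix k assume "k \<ge> N"
    then show "coeff (R - Polynomial.smult (coeff R N) (\<sigma> t N)) k = 0"
      using R[of k] coeff_\<sigma>[OF t, of N] coeff_\<sigma>(2)[OF t, of N k] by (cases "k = N") auto
  qed
  then show ?thesis
    using B_add2[OF t, of "\<pi> t N" "R - Polynomial.smult (coeff R N) (\<sigma> t N)" "Polynomial.smult (coeff R N) (\<sigma> t N)"]
    by (simp add: B_smult2[OF t] orth[OF t])
qed

text \<open>Integration by parts in \<open>y\<close> rewrites the corner entry with the derivative
  of the second potential acting on \<open>\<sigma> t n\<close>; by orthogonality only its leading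
  coefficient \<open>snd t (d2 + 1)\<close> counts.\<close>

lemma Q_low:
  assumes t: "t \<in> T"
  shows "Qm t (n + d2) n \<noteq> 0"
proof -
  let ?R = "pderiv (\<sigma> t n) - dpot d2 (snd t) * \<sigma> t n"
  have lead2: "coeff (dpot d2 (snd t) * \<sigma> t n) (n + d2) = snd t (Suc d2)"
  proof -
    have "coeff (dpot d2 (snd t) * \<sigma> t n) (n + d2) = (\<Sum>i\<le>n+d2. if i = d2 then snd t (Suc d2) else 0)"
      unfolding coeff_mult
    proof (rule sum.cong[OF refl])
      fix i assume "i \<in> {..n+d2}"
      consider "i < d2" | "i = d2" | "i > d2" by linarith
      then show "coeff (dpot d2 (snd t)) i * coeff (\<sigma> t n) (n + d2 - i) = (if i = d2 then snd t (Suc d2) else 0)"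
      proof cases
        case 1 then show ?thesis using coeff_\<sigma>(2)[OF t, of n "n + d2 - i"] by simp
      next
        case 2 then show ?thesis using coeff_\<sigma>(1)[OF t, of n] by (simp add: coeff_dpot)
      next
        case 3 then show ?thesis by (simp add: coeff_dpot)
      qed
    qed
    then show ?thesis by simp
  qed
  have pd0: "coeff (pderiv (\<sigma> t n)) k = 0" if "k \<ge> n" for k
    using coeff_\<sigma>(2)[OF t, of n "Suc k"] that by (simp add: coeff_pderiv)
  have "Qm t (n + d2) n * r t (n + d2) * r t n = - B t (\<pi> t (n + d2)) ?R"
    using parts2[OF t, of "\<pi> t (n + d2)" "\<sigma> t n"] Q_B[OF t, of "n + d2" n] by (simp add: eq_neg_iff_add_eq_0)
  also have "B t (\<pi> t (n + d2)) ?R = coeff ?R (n + d2) * h t (n + d2)"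
  proof (rule B_lead[OF t])
    fix k assume "k > n + d2"
    then show "coeff ?R k = 0"
      using coeff_low_dpot_mult[of n "\<sigma> t n" d2 k "snd t"] coeff_\<sigma>(2)[OF t, of n] pd0[of k] by simp
  qed
  also have "coeff ?R (n + d2) = - snd t (Suc d2)" using lead2 pd0[of "n + d2"] by simp
  finally show ?thesis using lead[OF t] h_nz[OF t, of "n + d2"] by auto
qed

lemma Q_up: "t \<in> T \<Longrightarrow> Qm t n (Suc n) \<noteq> 0"
  using gamma(1)[of t n] r_nz[of t] by (simp add: Q_mat_def)

lemma hol_coeff_mult:
  assumes "\<And>k. hol I \<Omega> (\<lambda>p. coeff (P p) k)"
  shows "hol I \<Omega> (\<lambda>p. coeff (monom 1 K * P p) k)"
  by (cases "K \<le> k") (auto simp: coeff_monom_mult assms)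

text \<open>By \<open>Qpow_B\<close> the entry is a moment divided by
  \<open>r n * r m\<close>.\<close>

lemma hol_Qpow: "hol I \<Omega> (\<lambda>p. inf_power (Qm (par p)) K n m)"
proof (rule hol_cong[OF dom])
  fix p assume p: "p \<in> \<Omega>"
  show "B (par p) (monom 1 K * \<pi> (par p) n) (\<sigma> (par p) m) / (r (par p) n * r (par p) m) = inf_power (Qm (par p)) K n m"
    using r_nz[OF \<Omega>D[OF p]] by (simp add: Qpow_B[OF \<Omega>D[OF p]])
next
  have "hol I \<Omega> (\<lambda>p. B (par p) (monom 1 K * \<pi> (par p) n) (\<sigma> (par p) m))"
    by (rule hol_B(1)[where N = "n + m + K"])
      (use hol_coeff_mult hol_\<pi> hol_\<sigma> coeff_\<pi>(2)[OF \<Omega>D] coeff_\<sigma>(2)[OF \<Omega>D] in \<open>auto simp: coeff_monom_mult\<close>)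
  then show "hol I \<Omega> (\<lambda>p. B (par p) (monom 1 K * \<pi> (par p) n) (\<sigma> (par p) m) / (r (par p) n * r (par p) m))"
    by (intro hol_divide hol_mult hol_r) (auto simp: r_nz[OF \<Omega>D])
qed

lemma hol_Rpow: "hol I \<Omega> (\<lambda>p. inf_power (Rm (par p)) K n m)"
proof (rule hol_cong[OF dom])
  fix p assume p: "p \<in> \<Omega>"
  show "B (par p) (\<pi> (par p) m) (monom 1 K * \<sigma> (par p) n) / (r (par p) n * r (par p) m) = inf_power (Rm (par p)) K n m"
    using r_nz[OF \<Omega>D[OF p]] by (simp add: Rpow_B[OF \<Omega>D[OF p]])
next
  have "hol I \<Omega> (\<lambda>p. B (par p) (\<pi> (par p) m) (monom 1 K * \<sigma> (par p) n))"
    by (rule hol_B(1)[where N = "n + m + K"])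
      (use hol_coeff_mult hol_\<pi> hol_\<sigma> coeff_\<pi>(2)[OF \<Omega>D] coeff_\<sigma>(2)[OF \<Omega>D] in \<open>auto simp: coeff_monom_mult\<close>)
  then show "hol I \<Omega> (\<lambda>p. B (par p) (\<pi> (par p) m) (monom 1 K * \<sigma> (par p) n) / (r (par p) n * r (par p) m))"
    by (intro hol_divide hol_mult hol_r) (auto simp: r_nz[OF \<Omega>D])
qed

lemma inf_power_1: "inf_power A 1 n m = A n m" if "\<And>l. l \<ge> N \<Longrightarrow> A n l = 0"
proof -
  have "inf_power A 1 n m = (\<Sum>l<N. A n l * (if l = m then 1 else 0))"
    using inf_mult_sum[of N A n "\<lambda>n m. if n = m then 1 else 0" m] that by simp
  also have "\<dots> = (\<Sum>l<N. if l = m then A n l else 0)" by (intro sum.cong refl) simp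
  also have "\<dots> = A n m" using that[of m] by (auto simp: not_less)
  finally show ?thesis .
qed

lemma hol_Q: "hol I \<Omega> (\<lambda>p. Qm (par p) n m)" and hol_R: "hol I \<Omega> (\<lambda>p. Rm (par p) n m)"
proof -
  have "inf_power (Qm t) 1 n m = Qm t n m" "inf_power (Rm t) 1 n m = Rm t n m" for t
    by (rule inf_power_1[where N = "n + 2"]; rule Q_mat_band; simp)+
  then show "hol I \<Omega> (\<lambda>p. Qm (par p) n m)" "hol I \<Omega> (\<lambda>p. Rm (par p) n m)"
    using hol_Qpow[of 1 n m] hol_Rpow[of 1 n m] by simp_all
qed

text \<open>\<open>V J\<close> enters transposed and with a sign: multiplication by
  \<open>y^J\<close> acts on the index of \<open>\<sigma>\<close>, hence by the transposed matrix on
  that of the wave functions.\<close>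

definition Mm :: "coord \<Rightarrow> params \<Rightarrow> nat \<Rightarrow> nat \<Rightarrow> complex" where
  "Mm i t n m = (case i of X \<Rightarrow> P_mat d1 (\<beta> t) n m | U K \<Rightarrow> U_mat d2 (\<alpha> t) K n m | V J \<Rightarrow> - V_mat d1 (\<beta> t) J m n)"

lemma V_mat_deform: "V_mat d1 (\<beta> t) J = deform (Rm t) J"
  by (simp add: V_mat_def P_mat_Q_mat)

lemma hol_deform:
  assumes "hol I \<Omega> (\<lambda>p. inf_power (A p) K n m)"
  shows "hol I \<Omega> (\<lambda>p. deform (A p) K n m)"
proof -
  define c :: complex where "c = (if n < m then - (1 / of_nat K) else if n = m then - (1 / of_nat K) / 2 else 0)"
  have "deform (A p) K n m = c * inf_power (A p) K n m" for p
    by (simp add: deform_def c_def)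
  then show ?thesis using hol_mult[OF hol_const[of I \<Omega> c] assms] by simp
qed

lemma hol_Mm: "hol I \<Omega> (\<lambda>p. Mm i (par p) n m)"
proof (cases i)
  case X then show ?thesis using hol_minus[OF hol_R] by (simp add: Mm_def P_mat_Q_mat)
next
  case (U K) then show ?thesis using hol_deform[where A = "\<lambda>p. Qm (par p)", OF hol_Qpow] by (simp add: Mm_def U_mat_def)
next
  case (V J) then show ?thesis using hol_minus[OF hol_deform[where A = "\<lambda>p. Rm (par p)", OF hol_Rpow]] by (simp add: Mm_def V_mat_deform)
qed

definition low :: "coord \<Rightarrow> nat" where "low i = (case i of X \<Rightarrow> 1 | U K \<Rightarrow> 0 | V J \<Rightarrow> J)"
definition upp :: "coord \<Rightarrow> nat" where "upp i = (case i of X \<Rightarrow> d1 | U K \<Rightarrow> K | V J \<Rightarrow> 0)"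
text \<open>A common bound for the bandwidths \<open>1\<close>, \<open>d1\<close>,
  \<open>K \<le> d1 + 1\<close> and \<open>J \<le> d2 + 1\<close>.\<close>

definition bw :: nat where "bw = d1 + d2 + 2"

lemma low_bw: "i \<in> I \<Longrightarrow> low i \<le> bw" and upp_bw: "i \<in> I \<Longrightarrow> upp i \<le> bw"
  by (auto simp: coords_def low_def upp_def bw_def)

lemma Mm_band: "m > n + upp i \<or> n > m + low i \<Longrightarrow> Mm i t n m = 0"
proof -
  have dQ: "deform (Qm t) K n m = 0" "deform (Rm t) K n m = 0" if "m > n + K" for K n m
    by (rule deform_band[OF _ that]; rule Q_mat_band; simp)+
  assume "m > n + upp i \<or> n > m + low i"
  then show ?thesis
    by (cases i) (auto simp: Mm_def low_def upp_def P_mat_Q_mat U_mat_def V_mat_deform deform_upper dQ intro: Q_mat_band)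
qed

section \<open>Derivatives of the wave functions in all coordinates\<close>

definition \<Psi> :: "nat \<Rightarrow> (coord \<Rightarrow> complex) \<Rightarrow> complex" where
  "\<Psi> n p = wave_fun d1 (par p) (\<pi> (par p)) (r (par p)) n (p X)"

text \<open>The wave function is split into polynomial, exponential and norm, which are
  differentiated separately. The polynomial is written with a fixed number of terms, so that its
  holomorphy in all coordinates reduces to that of the coefficients.\<close>

definition pv :: "nat \<Rightarrow> (coord \<Rightarrow> complex) \<Rightarrow> complex" where "pv n p = (\<Sum>k\<le>n. coeff (\<pi> (par p) n) k * p X ^ k)"
definition ef :: "(coord \<Rightarrow> complex) \<Rightarrow> complex" where "ef p = exp (- (\<Sum>k=1..d1+1. p (U k) / of_nat k * p X ^ k))"

lemma pv_poly: "p \<in> \<Omega> \<Longrightarrow> pv n p = poly (\<pi> (par p) n) (p X)"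
  using monic[OF \<Omega>D, of p n] by (simp add: pv_def poly_altdef)

lemma ef_exp: "ef p = exp (- potential d1 (fst (par p)) (p X))"
  by (simp add: ef_def potential_def par_def)

lemma \<Psi>_eq: "p \<in> \<Omega> \<Longrightarrow> \<Psi> n p = pv n p * ef p / r (par p) n"
  by (simp add: \<Psi>_def wave_fun_def pv_poly ef_exp)

lemma hol_pv: "hol I \<Omega> (pv n)"
  unfolding pv_def by (intro hol_sum hol_mult hol_\<pi> hol_power hol_coord)

lemma hol_pot: "hol I \<Omega> (\<lambda>p. - (\<Sum>k=1..d1+1. p (U k) / of_nat k * p X ^ k))"
  unfolding divide_inverse by (intro hol_minus hol_sum hol_mult hol_power hol_coord hol_const)

lemma hol_ef: "hol I \<Omega> ef"
  unfolding ef_def by (rule hol_exp[OF hol_pot])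

lemma hol_\<Psi>: "hol I \<Omega> (\<Psi> n)"
proof (rule hol_cong[OF dom])
  show "hol I \<Omega> (\<lambda>p. pv n p * ef p / r (par p) n)"
    by (intro hol_divide hol_mult hol_pv hol_ef hol_r r_nz \<Omega>D)
qed (simp add: \<Psi>_eq)

lemma x_\<Psi>:
  assumes p: "p \<in> \<Omega>" and S: "S \<ge> n + 2"
  shows "p X * \<Psi> n p = (\<Sum>m<S. Qm (par p) n m * \<Psi> m p)"
proof -
  have "p X * \<Psi> n p = (\<Sum>m<n+2. Qm (par p) n m * \<Psi> m p)"
    using rec_co[OF \<Omega>D[OF p]] unfolding recursion_coeffs_def \<Psi>_def Q_mat_sum[where f = "\<lambda>m. wave_fun d1 (par p) (\<pi> (par p)) (r (par p)) m (p X)", symmetric] by blast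
  also have "\<dots> = (\<Sum>m<S. Qm (par p) n m * \<Psi> m p)"
    by (rule sum.mono_neutral_left) (use S Q_mat_band[of n _ d2 "\<alpha> (par p)"] in auto)
  finally show ?thesis .
qed

lemma pd_\<Psi>_X:
  assumes p: "p \<in> \<Omega>"
  shows "pd X (\<Psi> n) p = (\<Sum>m<n+d1+1. Mm X (par p) n m * \<Psi> m p)"
proof (rule pd_eqI)
  have "(wave_fun d1 (par p) (\<pi> (par p)) (r (par p)) n has_field_derivative
      (\<Sum>m<n+d1+1. P_mat d1 (\<beta> (par p)) n m * wave_fun d1 (par p) (\<pi> (par p)) (r (par p)) m (p X))) (at (p X))"
    using rec_co[OF \<Omega>D[OF p]] unfolding recursion_coeffs_def P_mat_sum[where f = "\<lambda>m. wave_fun d1 (par p) (\<pi> (par p)) (r (par p)) m (p X)", symmetric] by blast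
  then show "((\<lambda>s. \<Psi> n (p(X := s))) has_field_derivative (\<Sum>m<n+d1+1. Mm X (par p) n m * \<Psi> m p)) (at (p X))"
    by (simp add: \<Psi>_def Mm_def)
qed

text \<open>Normalised matrix element of the parameter derivative of the weight:
  \<open>- Q^K / K\<close> for \<open>U K\<close>, and for \<open>V J\<close> the transpose of the
  analogous matrix built from \<open>Rm\<close>.\<close>

definition W :: "coord \<Rightarrow> params \<Rightarrow> nat \<Rightarrow> nat \<Rightarrow> complex" where
  "W i t n m = D i t (\<pi> t n) (\<sigma> t m) / (r t n * r t m)"

lemma W_U: "t \<in> T \<Longrightarrow> W (U K) t n m = - (1 / of_nat K) * inf_power (Qm t) K n m"
  using r_nz[of t] by (simp add: W_def D_def Qpow_B)

lemma W_V: "t \<in> T \<Longrightarrow> W (V J) t n m = - (1 / of_nat J) * inf_power (Rm t) J m n"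
  using r_nz[of t] by (simp add: W_def D_def Rpow_B)

text \<open>The derivative of \<open>\<pi> n\<close> has degree below \<open>n\<close>, and
  \<open>B_d\<pi>\<close> gives its coefficients in the lower \<open>\<pi> m\<close>.\<close>

lemma pd_pv:
  assumes p: "p \<in> \<Omega>" and i: "i \<in> I" "i \<noteq> X"
  shows "pd i (pv n) p = - (\<Sum>m<n. W i (par p) n m * pv m p / r (par p) m) * r (par p) n"
proof -
  note t = \<Omega>D[OF p]
  have "pd i (pv n) p = (\<Sum>k\<le>n. pd i (\<lambda>p. coeff (\<pi> (par p) n) k * p X ^ k) p)"
    unfolding pv_def[abs_def] by (rule pd_sum[OF hol_mult[OF hol_\<pi> hol_power[OF hol_coord]] p i(1)])
  also have "\<dots> = (\<Sum>k\<le>n. pd i (\<lambda>p. coeff (\<pi> (par p) n) k) p * p X ^ k)"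
  proof (intro sum.cong refl)
    fix k
    have "pd i (\<lambda>p. p X ^ k) p = 0" using i(2) by (intro pd_eqI) simp
    then show "pd i (\<lambda>p. coeff (\<pi> (par p) n) k * p X ^ k) p = pd i (\<lambda>p. coeff (\<pi> (par p) n) k) p * p X ^ k"
      by (simp add: pd_mult[OF hol_\<pi> hol_power[OF hol_coord] p i(1)])
  qed
  also have "\<dots> = poly (d\<pi> i n p) (p X)"
    by (simp add: dpoly_def poly_sum poly_monom)
  also have "d\<pi> i n p = (\<Sum>m<n. Polynomial.smult (B (par p) (d\<pi> i n p) (\<sigma> (par p) m) / h (par p) m) (\<pi> (par p) m))"
    by (rule expand_\<pi>[OF t]) (rule dmonic_low(1)[OF p i(1)])
  also have "\<dots> = (\<Sum>m<n. Polynomial.smult (- (W i (par p) n m / r (par p) m * r (par p) n)) (\<pi> (par p) m))"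
    by (intro sum.cong refl arg_cong2[where f = Polynomial.smult])
      (use r_nz[OF t] in \<open>auto simp: B_d\<pi>[OF p i(1)] h_r[OF t] W_def\<close>)
  also have "poly \<dots> (p X) = - (\<Sum>m<n. W i (par p) n m * pv m p / r (par p) m) * r (par p) n"
    unfolding poly_sum sum_negf[symmetric] sum_distrib_right by (intro sum.cong refl) (simp add: pv_poly[OF p])
  finally show ?thesis .
qed

text \<open>Origin of the half diagonal in \<open>deform\<close>: the logarithmic derivative of
  \<open>h n\<close> is the diagonal entry of \<open>W\<close>, and \<open>r\<close> is a square
  root of \<open>h\<close>.\<close>

lemma pd_r_W:
  assumes p: "p \<in> \<Omega>" and i: "i \<in> I"
  shows "pd i (\<lambda>p. r (par p) n) p = W i (par p) n n / 2 * r (par p) n"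
  using pd_r[OF p i, of n] pd_h[OF p i, of n] r_nz[OF \<Omega>D[OF p], of n] by (simp add: W_def field_simps)

text \<open>Minus the logarithmic derivative of \<open>ef\<close> in the coordinate
  \<open>i\<close>, for \<open>i \<noteq> X\<close>.\<close>

definition ev :: "coord \<Rightarrow> (coord \<Rightarrow> complex) \<Rightarrow> complex" where
  "ev i p = (case i of U K \<Rightarrow> p X ^ K / of_nat K | _ \<Rightarrow> 0)"

lemma pd_ef:
  assumes p: "p \<in> \<Omega>" and i: "i \<in> I" "i \<noteq> X"
  shows "pd i ef p = - ev i p * ef p"
proof -
  have "pd i (\<lambda>p. - (\<Sum>k=1..d1+1. p (U k) / of_nat k * p X ^ k)) p = - ev i p"
  proof (rule pd_eqI)
    have "((\<lambda>s. \<Sum>k=1..d1+1. (p(i := s)) (U k) / of_nat k * (p(i := s)) X ^ k) has_field_derivative (\<Sum>k=1..d1+1. if U k = i then p X ^ k / of_nat k else 0)) (at (p i))"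
    proof (rule DERIV_sum)
      fix k assume "k \<in> {1..d1+1}"
      then show "((\<lambda>s. (p(i := s)) (U k) / of_nat k * (p(i := s)) X ^ k) has_field_derivative (if U k = i then p X ^ k / of_nat k else 0)) (at (p i))"
        using i(2) by (cases "U k = i") (auto intro!: derivative_eq_intros)
    qed
    moreover have "(\<Sum>k=1..d1+1. if U k = i then p X ^ k / of_nat k else 0) = ev i p"
      using i by (cases i) (auto simp: ev_def coords_def)
    ultimately have "((\<lambda>s. \<Sum>k=1..d1+1. (p(i := s)) (U k) / of_nat k * (p(i := s)) X ^ k) has_field_derivative ev i p) (at (p i))"
      by (simp only:)
    then show "((\<lambda>s. - (\<Sum>k=1..d1+1. (p(i := s)) (U k) / of_nat k * (p(i := s)) X ^ k)) has_field_derivative - ev i p) (at (p i))"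
      by (rule DERIV_minus)
  qed
  then show ?thesis unfolding ef_def[abs_def] pd_exp[OF hol_pot p i(1)] by simp
qed

lemma pd_\<Psi>_W:
  assumes p: "p \<in> \<Omega>" and i: "i \<in> I" "i \<noteq> X"
  shows "pd i (\<Psi> n) p = - (\<Sum>m<n. W i (par p) n m * \<Psi> m p) - W i (par p) n n / 2 * \<Psi> n p - ev i p * \<Psi> n p"
proof -
  note t = \<Omega>D[OF p]
  have rn: "r (par p) m \<noteq> 0" for m by (rule r_nz[OF t])
  have "pd i (\<lambda>p. pv n p * ef p) p = pd i (\<lambda>p. \<Psi> n p * r (par p) n) p"
    by (rule pd_cong[OF dom p i(1)]) (simp add: \<Psi>_eq r_nz[OF \<Omega>D])
  then have "pd i (pv n) p * ef p + pv n p * pd i ef p = pd i (\<Psi> n) p * r (par p) n + \<Psi> n p * pd i (\<lambda>p. r (par p) n) p"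
    by (simp only: pd_mult[OF hol_pv hol_ef p i(1)] pd_mult[OF hol_\<Psi> hol_r p i(1)])
  then have "pd i (\<Psi> n) p * r (par p) n = pd i (pv n) p * ef p + pv n p * pd i ef p - \<Psi> n p * pd i (\<lambda>p. r (par p) n) p"
    by (simp add: algebra_simps)
  also have "pd i (pv n) p * ef p = - (\<Sum>m<n. W i (par p) n m * \<Psi> m p) * r (par p) n"
    unfolding pd_pv[OF p i] minus_mult_left[symmetric] sum_distrib_right neg_equal_iff_equal
    by (intro sum.cong refl) (simp add: \<Psi>_eq[OF p])
  also have "pv n p * pd i ef p = - ev i p * \<Psi> n p * r (par p) n"
    using rn by (simp add: pd_ef[OF p i] \<Psi>_eq[OF p])
  also have "\<Psi> n p * pd i (\<lambda>p. r (par p) n) p = W i (par p) n n / 2 * \<Psi> n p * r (par p) n"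
    by (simp add: pd_r_W[OF p i(1)])
  finally have "pd i (\<Psi> n) p * r (par p) n = (- (\<Sum>m<n. W i (par p) n m * \<Psi> m p) - W i (par p) n n / 2 * \<Psi> n p - ev i p * \<Psi> n p) * r (par p) n"
    by (simp only: left_diff_distrib) simp
  then show ?thesis using rn[of n] by simp
qed

lemma pow_\<Psi>:
  assumes p: "p \<in> \<Omega>"
  shows "p X ^ K * \<Psi> n p = (\<Sum>m<n+K+1. inf_power (Qm (par p)) K n m * \<Psi> m p)"
proof -
  note t = \<Omega>D[OF p]
  have rn: "r (par p) m \<noteq> 0" for m by (rule r_nz[OF t])
  have "monom 1 K * \<pi> (par p) n = (\<Sum>m<n+K+1. Polynomial.smult (B (par p) (monom 1 K * \<pi> (par p) n) (\<sigma> (par p) m) / h (par p) m) (\<pi> (par p) m))"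
    by (rule expand_\<pi>[OF t]) (use coeff_\<pi>(2)[OF t, of n] in \<open>auto simp: coeff_monom_mult\<close>)
  also have "\<dots> = (\<Sum>m<n+K+1. Polynomial.smult (inf_power (Qm (par p)) K n m * r (par p) n / r (par p) m) (\<pi> (par p) m))"
    unfolding Qpow_B[OF t] h_r[OF t] by (intro sum.cong refl arg_cong2[where f = Polynomial.smult]) (use rn in auto)
  finally have "poly (monom 1 K * \<pi> (par p) n) (p X) = poly (\<Sum>m<n+K+1. Polynomial.smult (inf_power (Qm (par p)) K n m * r (par p) n / r (par p) m) (\<pi> (par p) m)) (p X)"
    by simp
  then have e: "p X ^ K * pv n p = (\<Sum>m<n+K+1. inf_power (Qm (par p)) K n m * r (par p) n / r (par p) m * pv m p)"
    by (simp add: poly_sum poly_monom pv_poly[OF p] del: sum.lessThan_Suc)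
  have "p X ^ K * \<Psi> n p = (p X ^ K * pv n p) * (ef p / r (par p) n)" by (simp add: \<Psi>_eq[OF p])
  also have "\<dots> = (\<Sum>m<n+K+1. inf_power (Qm (par p)) K n m * \<Psi> m p)"
    unfolding e sum_distrib_right by (intro sum.cong refl) (use rn in \<open>simp add: \<Psi>_eq[OF p]\<close>)
  finally show ?thesis .
qed

lemma sum_split3: "n < N \<Longrightarrow> (\<Sum>m<N. f m) = (\<Sum>m<n. f m) + f n + (\<Sum>m\<in>{n<..<N}. f m)" for f :: "nat \<Rightarrow> complex"
proof -
  assume n: "n < N"
  have e: "{..<N} = {..<Suc n} \<union> {n<..<N}" using n by auto
  have "(\<Sum>m<N. f m) = (\<Sum>m<Suc n. f m) + (\<Sum>m\<in>{n<..<N}. f m)" unfolding e by (rule sum.union_disjoint) auto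
  then show ?thesis by simp
qed

text \<open>By \<open>pd_\<Psi>_W\<close>, polynomial and norm contribute minus the strictly lower
  part of \<open>W\<close> and minus half its diagonal. For \<open>V J\<close> this is all. For
  \<open>U K\<close> the exponential contributes the whole of \<open>W\<close>, since multiplication
  by \<open>x^K\<close> acts as \<open>Q^K\<close>: the lower part cancels and the half diagonal
  changes sign, leaving the upper part.\<close>

lemma pd_\<Psi>:
  assumes p: "p \<in> \<Omega>" and i: "i \<in> I" and S: "S \<ge> n + bw + 2"
  shows "pd i (\<Psi> n) p = (\<Sum>m<S. Mm i (par p) n m * \<Psi> m p)"
proof (cases i)
  case X
  have "pd i (\<Psi> n) p = (\<Sum>m<n+d1+1. Mm X (par p) n m * \<Psi> m p)" using pd_\<Psi>_X[OF p] X by simp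
  also have "\<dots> = (\<Sum>m<S. Mm i (par p) n m * \<Psi> m p)"
    unfolding X by (rule sum.mono_neutral_left) (use S Mm_band[of n X _ "par p"] in \<open>auto simp: upp_def bw_def\<close>)
  finally show ?thesis .
next
  case (U K)
  note t = \<Omega>D[OF p]
  have K: "K \<le> d1 + 1" "K \<ge> 1" using i U by (auto simp: coords_def)
  let ?W = "\<lambda>m. W i (par p) n m * \<Psi> m p"
  have "ev i p * \<Psi> n p = - (\<Sum>m<n+K+1. ?W m)"
    using pow_\<Psi>[OF p, of K n] unfolding U W_U[OF t]
    by (simp add: ev_def sum_negf sum_divide_distrib[symmetric] del: sum.lessThan_Suc)
  then have "pd i (\<Psi> n) p = - (\<Sum>m<n. ?W m) - W i (par p) n n / 2 * \<Psi> n p + (\<Sum>m<n+K+1. ?W m)"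
    using pd_\<Psi>_W[OF p i, of n] U by simp
  also have "(\<Sum>m<n+K+1. ?W m) = (\<Sum>m<n. ?W m) + ?W n + (\<Sum>m\<in>{n<..<n+K+1}. ?W m)" by (rule sum_split3) simp
  finally have 1: "pd i (\<Psi> n) p = W i (par p) n n / 2 * \<Psi> n p + (\<Sum>m\<in>{n<..<n+K+1}. ?W m)" by simp
  have "(\<Sum>m<S. Mm i (par p) n m * \<Psi> m p) = (\<Sum>m<n+K+1. Mm i (par p) n m * \<Psi> m p)"
    unfolding U by (rule sum.mono_neutral_right) (use S K Mm_band[of n "U K" _ "par p"] in \<open>auto simp: upp_def bw_def\<close>)
  also have "\<dots> = (\<Sum>m<n. Mm i (par p) n m * \<Psi> m p) + Mm i (par p) n n * \<Psi> n p + (\<Sum>m\<in>{n<..<n+K+1}. Mm i (par p) n m * \<Psi> m p)"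
    by (rule sum_split3) simp
  also have "(\<Sum>m<n. Mm i (par p) n m * \<Psi> m p) = 0"
    by (rule sum.neutral) (auto simp: U Mm_def U_mat_def deform_upper)
  also have "Mm i (par p) n n * \<Psi> n p = W i (par p) n n / 2 * \<Psi> n p"
    by (simp add: U Mm_def U_mat_def deform_def W_U[OF t])
  also have "(\<Sum>m\<in>{n<..<n+K+1}. Mm i (par p) n m * \<Psi> m p) = (\<Sum>m\<in>{n<..<n+K+1}. ?W m)"
    by (intro sum.cong refl) (simp add: U Mm_def U_mat_def deform_def W_U[OF t])
  finally show ?thesis using 1 by simp
next
  case (V J)
  note t = \<Omega>D[OF p]
  have "pd i (\<Psi> n) p = - (\<Sum>m<n. W i (par p) n m * \<Psi> m p) - W i (par p) n n / 2 * \<Psi> n p"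
    using pd_\<Psi>_W[OF p i, of n] V by (simp add: ev_def)
  also have "\<dots> = (\<Sum>m<Suc n. Mm i (par p) n m * \<Psi> m p)"
    by (simp add: V Mm_def V_mat_deform deform_def W_V[OF t] sum_negf)
  also have "\<dots> = (\<Sum>m<S. Mm i (par p) n m * \<Psi> m p)"
    unfolding V by (rule sum.mono_neutral_left) (use S Mm_band[of n "V J" _ "par p"] in \<open>auto simp: upp_def bw_def\<close>)
  finally show ?thesis .
qed

text \<open>With the parameters fixed \<open>x\<close> still varies freely, so after division by the
  exponential the relation is one between polynomials, and pairing with \<open>\<sigma> m\<close>
  isolates \<open>c m\<close>.\<close>

lemma \<Psi>_indep:
  assumes p: "p \<in> \<Omega>" and z: "\<And>s. (\<Sum>m<N. c m * \<Psi> m (p(X := s))) = 0" and m: "m < N"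
  shows "c m = 0"
proof -
  note t = \<Omega>D[OF p]
  have "poly (\<Sum>m<N. Polynomial.smult (c m / r (par p) m) (\<pi> (par p) m)) s = poly 0 s" for s
  proof -
    have "(\<Sum>m<N. c m * \<Psi> m (p(X := s))) = (\<Sum>m<N. c m / r (par p) m * poly (\<pi> (par p) m) s) * exp (- potential d1 (fst (par p)) s)"
      unfolding sum_distrib_right by (intro sum.cong refl) (simp add: \<Psi>_def wave_fun_def)
    then show ?thesis using z[of s] by (simp add: poly_sum)
  qed
  then have P: "(\<Sum>m<N. Polynomial.smult (c m / r (par p) m) (\<pi> (par p) m)) = 0"
    using poly_eq_poly_eq_iff[THEN iffD1, OF ext] by blast
  have "0 = B (par p) (\<Sum>m<N. Polynomial.smult (c m / r (par p) m) (\<pi> (par p) m)) (\<sigma> (par p) m)"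
    unfolding P by (simp add: B_0[OF t])
  also have "\<dots> = (\<Sum>k<N. c k / r (par p) k * (if k = m then h (par p) k else 0))"
    by (simp only: B_sum1[OF t] B_smult1[OF t] orth[OF t])
  also have "\<dots> = (\<Sum>k<N. if k = m then c k / r (par p) k * h (par p) k else 0)" by (intro sum.cong refl) simp
  finally have "0 = c m / r (par p) m * h (par p) m" using m by simp
  then show ?thesis using h_nz[OF t, of m] r_nz[OF t, of m] by simp
qed

section \<open>Lax and zero curvature equations by comparison of coefficients\<close>

lemma pd_par_X: "pd i (\<lambda>p. g (par p)) (p(X := s)) = pd i (\<lambda>p. g (par p)) p"
proof (cases i)
  case X then show ?thesis by (simp add: pd_def)
next
  case (U K)
  have "par ((p(X := s))(U K := s')) = par (p(U K := s'))" for s' by (auto simp: par_def fun_eq_iff)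
  then show ?thesis unfolding U pd_def by (simp del: par_upd_U)
next
  case (V K)
  have "par ((p(X := s))(V K := s')) = par (p(V K := s'))" for s' by (auto simp: par_def fun_eq_iff)
  then show ?thesis unfolding V pd_def by (simp del: par_upd_V)
qed

lemma \<Omega>_upd_X: "p \<in> \<Omega> \<Longrightarrow> p(X := s) \<in> \<Omega>" by (simp add: dom_of_def)

text \<open>\<open>x\<close> times a wave function is differentiated before and after its expansion
  by \<open>Q\<close>; the coefficients are independent of \<open>x\<close>, so
  \<open>\<Psi>_indep\<close> compares them. In the direction \<open>X\<close> the derivative of the
  factor \<open>x\<close> leaves the identity matrix.\<close>

lemma compat_Q:
  assumes p: "p \<in> \<Omega>" and i: "i \<in> I"
  shows "pd i (\<lambda>p. Qm (par p) n m) p = (if i = X \<and> n = m then 1 else 0) +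
    (\<Sum>l<n+bw+2. Mm i (par p) n l * Qm (par p) l m) - (\<Sum>l<n+bw+2. Qm (par p) n l * Mm i (par p) l m)"
proof -
  \<comment> \<open>\<open>S\<close> exhausts row \<open>n\<close> of the factors, \<open>S'\<close>
    also every row met after a second multiplication.\<close>
  define S where "S = n + m + bw + 4"
  define S' where "S' = S + bw + 4"
  define \<epsilon> :: complex where "\<epsilon> = (if i = X then 1 else 0)"
  define c where "c l = pd i (\<lambda>p. Qm (par p) n l) p + (\<Sum>k<S. Qm (par p) n k * Mm i (par p) k l) - (if l = n then \<epsilon> else 0)
     - (\<Sum>k<S. Mm i (par p) n k * Qm (par p) k l)" for l
  have "(\<Sum>l<S'. c l * \<Psi> l (p(X := s))) = 0" for s
  proof -
    define q where "q = p(X := s)"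
    have q: "q \<in> \<Omega>" unfolding q_def by (rule \<Omega>_upd_X[OF p])
    have pq: "par q = par p" by (simp add: q_def)
    have dq: "pd i (\<lambda>p. Qm (par p) n l) q = pd i (\<lambda>p. Qm (par p) n l) p" for l
      unfolding q_def by (rule pd_par_X[where g = "\<lambda>t. Qm t n l"])
    have "pd i (\<lambda>q. q X * \<Psi> n q) q = pd i (\<lambda>q. \<Sum>m<S'. Qm (par q) n m * \<Psi> m q) q"
      by (rule pd_cong[OF dom q i]) (rule x_\<Psi>, auto simp: S'_def S_def)
    also have "\<dots> = (\<Sum>m<S'. pd i (\<lambda>q. Qm (par q) n m * \<Psi> m q) q)"
      by (rule pd_sum[OF hol_mult[OF hol_Q hol_\<Psi>] q i])
    also have "\<dots> = (\<Sum>m<S'. pd i (\<lambda>q. Qm (par q) n m) q * \<Psi> m q + Qm (par q) n m * pd i (\<Psi> m) q)"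
      by (intro sum.cong refl pd_mult[OF hol_Q hol_\<Psi> q i])
    also have "\<dots> = (\<Sum>m<S'. pd i (\<lambda>p. Qm (par p) n m) p * \<Psi> m q) + (\<Sum>m<S'. Qm (par p) n m * pd i (\<Psi> m) q)"
      by (simp only: sum.distrib pq dq)
    also have "(\<Sum>m<S'. Qm (par p) n m * pd i (\<Psi> m) q) = (\<Sum>m<S. Qm (par p) n m * (\<Sum>l<S'. Mm i (par p) m l * \<Psi> l q))"
    proof -
      have "(\<Sum>m<S'. Qm (par p) n m * pd i (\<Psi> m) q) = (\<Sum>m<S. Qm (par p) n m * pd i (\<Psi> m) q)"
        by (rule sum.mono_neutral_right) (use Q_mat_band[of n _ d2 "\<alpha> (par p)"] in \<open>auto simp: S_def S'_def\<close>)
      also have "\<dots> = (\<Sum>m<S. Qm (par p) n m * (\<Sum>l<S'. Mm i (par p) m l * \<Psi> l q))"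
        by (intro sum.cong refl arg_cong2[where f = "(*)"]) (use pd_\<Psi>[OF q i] pq in \<open>auto simp: S'_def\<close>)
      finally show ?thesis .
    qed
    also have "\<dots> = (\<Sum>l<S'. (\<Sum>m<S. Qm (par p) n m * Mm i (par p) m l) * \<Psi> l q)"
      unfolding sum_distrib_left sum_distrib_right by (subst sum.swap) (simp only: mult.assoc)
    finally have 1: "pd i (\<lambda>q. q X * \<Psi> n q) q = (\<Sum>l<S'. pd i (\<lambda>p. Qm (par p) n l) p * \<Psi> l q) + (\<Sum>l<S'. (\<Sum>m<S. Qm (par p) n m * Mm i (par p) m l) * \<Psi> l q)" .
    have "pd i (\<lambda>q. q X * \<Psi> n q) q = \<epsilon> * \<Psi> n q + q X * pd i (\<Psi> n) q"
      by (subst pd_mult[OF hol_coord hol_\<Psi> q i]) (auto simp: pd_coord \<epsilon>_def)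
    also have "q X * pd i (\<Psi> n) q = (\<Sum>m<S. Mm i (par p) n m * (q X * \<Psi> m q))"
      using pd_\<Psi>[OF q i, of n S] by (simp add: S_def pq sum_distrib_left mult.left_commute)
    also have "\<dots> = (\<Sum>m<S. Mm i (par p) n m * (\<Sum>l<S'. Qm (par p) m l * \<Psi> l q))"
      by (intro sum.cong refl arg_cong2[where f = "(*)"]) (use x_\<Psi>[OF q] pq in \<open>auto simp: S'_def\<close>)
    also have "\<dots> = (\<Sum>l<S'. (\<Sum>m<S. Mm i (par p) n m * Qm (par p) m l) * \<Psi> l q)"
      unfolding sum_distrib_left sum_distrib_right by (subst sum.swap) (simp only: mult.assoc)
    finally have 2: "pd i (\<lambda>q. q X * \<Psi> n q) q = \<epsilon> * \<Psi> n q + (\<Sum>l<S'. (\<Sum>m<S. Mm i (par p) n m * Qm (par p) m l) * \<Psi> l q)" .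
    have 3: "\<epsilon> * \<Psi> n q = (\<Sum>l<S'. (if l = n then \<epsilon> else 0) * \<Psi> l q)"
      by (simp add: S'_def S_def if_distrib[of "\<lambda>x. x * _"] cong: if_cong)
    have "(\<Sum>l<S'. c l * \<Psi> l q) = pd i (\<lambda>q. q X * \<Psi> n q) q - pd i (\<lambda>q. q X * \<Psi> n q) q"
      by (subst (1) 1, subst 2, subst 3) (simp only: c_def left_diff_distrib distrib_right sum.distrib sum_subtractf diff_diff_add)
    then show ?thesis by (simp add: q_def)
  qed
  then have "c m = 0" by (rule \<Psi>_indep[OF p]) (simp add: S'_def S_def)
  moreover have "(\<Sum>k<S. Qm (par p) n k * Mm i (par p) k m) = (\<Sum>k<n+bw+2. Qm (par p) n k * Mm i (par p) k m)"
    by (rule sum.mono_neutral_right) (use Q_mat_band[of n _ d2 "\<alpha> (par p)"] in \<open>auto simp: S_def\<close>)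
  moreover have "(\<Sum>k<S. Mm i (par p) n k * Qm (par p) k m) = (\<Sum>k<n+bw+2. Mm i (par p) n k * Qm (par p) k m)"
    by (rule sum.mono_neutral_right) (use Mm_band[of n i _ "par p"] upp_bw[OF i] in \<open>auto simp: S_def\<close>)
  ultimately show ?thesis unfolding c_def \<epsilon>_def by (auto simp: algebra_simps split: if_splits)
qed

text \<open>The two mixed derivatives of one wave function have the same coefficients.\<close>

lemma curv_M:
  assumes p: "p \<in> \<Omega>" and i: "i \<in> I" and j: "j \<in> I"
  shows "pd j (\<lambda>p. Mm i (par p) n m) p + (\<Sum>l<n+bw+2. Mm i (par p) n l * Mm j (par p) l m) =
    pd i (\<lambda>p. Mm j (par p) n m) p + (\<Sum>l<n+bw+2. Mm j (par p) n l * Mm i (par p) l m)"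
proof -
  define S where "S = n + bw + 2"
  define S' where "S' = S + m + bw + 4"
  define c where "c i j l = pd j (\<lambda>p. Mm i (par p) n l) p + (\<Sum>k<S. Mm i (par p) n k * Mm j (par p) k l)" for i j l
  have dd: "pd j (pd i (\<Psi> n)) (p(X := s)) = (\<Sum>l<S'. c i j l * \<Psi> l (p(X := s)))" if i: "i \<in> I" and j: "j \<in> I" for i j s
  proof -
    define q where "q = p(X := s)"
    have q: "q \<in> \<Omega>" unfolding q_def by (rule \<Omega>_upd_X[OF p])
    have pq: "par q = par p" by (simp add: q_def)
    have dq: "pd j (\<lambda>p. Mm i (par p) n l) q = pd j (\<lambda>p. Mm i (par p) n l) p" for l
      unfolding q_def by (rule pd_par_X[where g = "\<lambda>t. Mm i t n l"])
    have "pd j (pd i (\<Psi> n)) q = pd j (\<lambda>q. \<Sum>m<S'. Mm i (par q) n m * \<Psi> m q) q"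
      by (rule pd_cong[OF dom q j]) (rule pd_\<Psi>[OF _ i], auto simp: S'_def S_def)
    also have "\<dots> = (\<Sum>m<S'. pd j (\<lambda>q. Mm i (par q) n m * \<Psi> m q) q)"
      by (rule pd_sum[OF hol_mult[OF hol_Mm hol_\<Psi>] q j])
    also have "\<dots> = (\<Sum>m<S'. pd j (\<lambda>q. Mm i (par q) n m) q * \<Psi> m q + Mm i (par q) n m * pd j (\<Psi> m) q)"
      by (intro sum.cong refl pd_mult[OF hol_Mm hol_\<Psi> q j])
    also have "\<dots> = (\<Sum>m<S'. pd j (\<lambda>p. Mm i (par p) n m) p * \<Psi> m q) + (\<Sum>m<S'. Mm i (par p) n m * pd j (\<Psi> m) q)"
      by (simp only: sum.distrib pq dq)
    also have "(\<Sum>m<S'. Mm i (par p) n m * pd j (\<Psi> m) q) = (\<Sum>m<S. Mm i (par p) n m * pd j (\<Psi> m) q)"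
      by (rule sum.mono_neutral_right) (use Mm_band[of n i _ "par p"] upp_bw[OF i] in \<open>auto simp: S_def S'_def\<close>)
    also have "\<dots> = (\<Sum>m<S. Mm i (par p) n m * (\<Sum>l<S'. Mm j (par p) m l * \<Psi> l q))"
      by (intro sum.cong refl arg_cong2[where f = "(*)"]) (use pd_\<Psi>[OF q j] pq in \<open>auto simp: S'_def\<close>)
    also have "\<dots> = (\<Sum>l<S'. (\<Sum>m<S. Mm i (par p) n m * Mm j (par p) m l) * \<Psi> l q)"
      unfolding sum_distrib_left sum_distrib_right by (subst sum.swap) (simp only: mult.assoc)
    finally show ?thesis unfolding c_def distrib_right sum.distrib q_def .
  qed
  have "(\<Sum>l<S'. (c i j l - c j i l) * \<Psi> l (p(X := s))) = 0" for s
    unfolding left_diff_distrib sum_subtractf dd[OF i j, symmetric] dd[OF j i, symmetric]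
    using pd_comm[OF dom hol_\<Psi> i j \<Omega>_upd_X[OF p]] by simp
  then have "c i j m - c j i m = 0" by (rule \<Psi>_indep[OF p]) (simp add: S'_def)
  then show ?thesis by (simp add: c_def S_def)
qed

definition Lm :: "nat \<Rightarrow> nat \<Rightarrow> (coord \<Rightarrow> complex) \<Rightarrow> complex" where
  "Lm n m p = Qm (par p) n m - (if n = m then p X else 0)"

definition Mp :: "coord \<Rightarrow> nat \<Rightarrow> nat \<Rightarrow> (coord \<Rightarrow> complex) \<Rightarrow> complex" where
  "Mp i n m p = Mm i (par p) n m"

text \<open>Subtracting \<open>x\<close> on the diagonal absorbs the identity matrix in
  \<open>compat_Q\<close> and leaves a pure commutator.\<close>

sublocale lax I \<Omega> d2 bw Lm Mp low upp
proof unfold_locales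
  show "hdom I \<Omega>" by (rule dom)
  show "simply_connected \<Omega>" by (rule simply_connected_dom_of[OF scT])
  obtain t where "t \<in> T" using neT by blast
  then have "pt 0 t \<in> \<Omega>" by (simp add: dom_of_def)
  then show "\<Omega> \<noteq> {}" by blast
  show "1 \<le> bw" by (simp add: bw_def)
  show "1 \<le> d2" by (rule d2)
  show "Lm n m p = 0" if "m > n + 1 \<or> n > m + d2" for n m p
    using that Q_mat_band[OF that] by (auto simp: Lm_def)
  show "Mp i n m p = 0" if "i \<in> I" "m > n + upp i \<or> n > m + low i" for i n m p
    using Mm_band[OF that(2)] by (simp add: Mp_def)
  show "low i \<le> bw" "upp i \<le> bw" if "i \<in> I" for i using low_bw[OF that] upp_bw[OF that] by auto
  show "hol I \<Omega> (Lm n m)" for n m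
    unfolding Lm_def by (cases "n = m") (auto intro: hol_diff hol_Q hol_coord)
  show "hol I \<Omega> (Mp i n m)" for i n m unfolding Mp_def by (rule hol_Mm)
  show "Lm n (Suc n) p \<noteq> 0" if "p \<in> \<Omega>" for n p using Q_up[OF \<Omega>D[OF that]] by (simp add: Lm_def)
  show "Lm (n + d2) n p \<noteq> 0" if "p \<in> \<Omega>" for n p using Q_low[OF \<Omega>D[OF that]] d2 by (simp add: Lm_def)
  show "pd i (Lm n m) p = (\<Sum>l<n+bw+2. Mp i n l p * Lm l m p) - (\<Sum>l<n+bw+2. Lm n l p * Mp i l m p)"
    if i: "i \<in> I" and p: "p \<in> \<Omega>" for i n m p
  proof -
    have "hol I \<Omega> (\<lambda>p. if n = m then p X else 0)" by (cases "n = m") (auto intro: hol_coord)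
    from pd_diff[OF hol_Q this p i]
    have "pd i (Lm n m) p = pd i (\<lambda>p. Qm (par p) n m) p - pd i (\<lambda>p. if n = m then p X else 0) p"
      by (simp add: Lm_def[abs_def])
    also have "pd i (\<lambda>p. if n = m then p X else 0) p = (if i = X \<and> n = m then 1 else 0)"
      using pd_coord[of i X p] by (cases "n = m") auto
    finally have 1: "pd i (Lm n m) p = (\<Sum>l<n+bw+2. Mm i (par p) n l * Qm (par p) l m) - (\<Sum>l<n+bw+2. Qm (par p) n l * Mm i (par p) l m)"
      using compat_Q[OF p i, of n m] by simp
    have "(\<Sum>l<n+bw+2. Mp i n l p * Lm l m p) = (\<Sum>l<n+bw+2. Mm i (par p) n l * Qm (par p) l m) - (\<Sum>l<n+bw+2. if l = m then Mm i (par p) n l * p X else 0)"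
      unfolding sum_subtractf[symmetric] by (intro sum.cong refl) (simp add: Mp_def Lm_def right_diff_distrib)
    moreover have "(\<Sum>l<n+bw+2. if l = m then Mm i (par p) n l * p X else 0) = Mm i (par p) n m * p X"
      using Mm_band[of n i m "par p"] upp_bw[OF i] by auto
    moreover have "(\<Sum>l<n+bw+2. Lm n l p * Mp i l m p) = (\<Sum>l<n+bw+2. Qm (par p) n l * Mm i (par p) l m) - (\<Sum>l<n+bw+2. if l = n then p X * Mm i (par p) l m else 0)"
      unfolding sum_subtractf[symmetric] by (intro sum.cong refl) (auto simp: Mp_def Lm_def left_diff_distrib)
    moreover have "(\<Sum>l<n+bw+2. if l = n then p X * Mm i (par p) l m else 0) = p X * Mm i (par p) n m"
      by (simp add: sum.delta)
    ultimately show ?thesis unfolding 1 by simp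
  qed
  show "pd j (Mp i n m) p + (\<Sum>l<n+bw+2. Mp i n l p * Mp j l m p) = pd i (Mp j n m) p + (\<Sum>l<n+bw+2. Mp j n l p * Mp i l m p)"
    if "i \<in> I" "j \<in> I" "p \<in> \<Omega>" for i j n m p
    using curv_M[OF that(3,1,2)] unfolding Mp_def[abs_def] .
qed

end

section \<open>Windows\<close>

lemma trivial_kernel_inverse:
  assumes A: "A \<in> carrier_mat n n"
    and ns: "\<And>v j. (\<And>i. i < n \<Longrightarrow> (\<Sum>j<n. A $$ (i, j) * v j) = (0::complex)) \<Longrightarrow> j < n \<Longrightarrow> v j = 0"
  obtains B where "B \<in> carrier_mat n n" "A * B = 1\<^sub>m n" "B * A = 1\<^sub>m n"
proof -
  have "Determinant.det A \<noteq> 0"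
  proof
    assume "Determinant.det A = 0"
    then obtain v where v: "v \<in> carrier_vec n" "v \<noteq> 0\<^sub>v n" "A *\<^sub>v v = 0\<^sub>v n"
      using det_0_iff_vec_prod_zero_field[OF A] by blast
    have "v $ j = 0" if "j < n" for j
    proof (rule ns[OF _ that, of "\<lambda>j. v $ j"])
      fix i assume i: "i < n"
      have "(A *\<^sub>v v) $ i = (\<Sum>j<n. A $$ (i, j) * v $ j)"
        using i v(1) A by (simp add: mult_mat_vec_def scalar_prod_def atLeast0LessThan)
      then show "(\<Sum>j<n. A $$ (i, j) * v $ j) = 0" using v(3) i by simp
    qed
    then have "v = 0\<^sub>v n" using v(1) by (intro eq_vecI) auto
    then show False using v(2) by simp
  qed
  from det_non_zero_imp_unit[OF A this, of "()"] show ?thesis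
    using that by (auto simp: Units_def ring_mat_def)
qed

lemma invertible_matI:
  "A \<in> carrier_mat n n \<Longrightarrow> B \<in> carrier_mat n n \<Longrightarrow> A * B = 1\<^sub>m n \<Longrightarrow> B * A = 1\<^sub>m n \<Longrightarrow> invertible_mat A"
  by (auto simp: invertible_mat_def inverts_mat_def)

lemma the_mat_inverse:
  fixes A :: "complex mat"
  assumes "A \<in> carrier_mat n n" "B \<in> carrier_mat n n" "A * B = 1\<^sub>m n"
  shows "the (mat_inverse A) \<in> carrier_mat n n" "the (mat_inverse A) * A = 1\<^sub>m n" "A * the (mat_inverse A) = 1\<^sub>m n"
proof -
  have "B * A = 1\<^sub>m n" using mat_mult_left_right_inverse assms by blast
  then have "A \<in> Units (ring_mat TYPE(complex) n ())" using assms by (auto simp: Units_def ring_mat_def)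
  then obtain C where "mat_inverse A = Some C" using mat_inverse(1)[OF assms(1), where b = "()"] by (cases "mat_inverse A") auto
  then show "the (mat_inverse A) \<in> carrier_mat n n" "the (mat_inverse A) * A = 1\<^sub>m n" "A * the (mat_inverse A) = 1\<^sub>m n"
    using mat_inverse(2)[OF assms(1)] by auto
qed

lemma mat_sum_carrier: "mat_sum n S F \<in> carrier_mat n n"
  by (simp add: mat_sum_def)

lemma mat_sum_mult:
  assumes W: "W \<in> carrier_mat n n" and F: "\<And>j. j \<in> S \<Longrightarrow> F j \<in> carrier_mat n n" and ik: "i < n" "k < n"
  shows "(mat_sum n S F * W) $$ (i, k) = (\<Sum>j\<in>S. (F j * W) $$ (i, k))"
proof -
  have "(mat_sum n S F * W) $$ (i, k) = (\<Sum>l<n. (\<Sum>j\<in>S. F j $$ (i, l)) * W $$ (l, k))"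
    using W ik by (simp add: mat_sum_def scalar_prod_def atLeast0LessThan)
  also have "\<dots> = (\<Sum>j\<in>S. \<Sum>l<n. F j $$ (i, l) * W $$ (l, k))"
    unfolding sum_distrib_right by (rule sum.swap)
  also have "\<dots> = (\<Sum>j\<in>S. (F j * W) $$ (i, k))"
    using W ik carrier_matD[OF F] by (intro sum.cong refl) (simp add: scalar_prod_def atLeast0LessThan)
  finally show ?thesis .
qed

lemma mult_mat_sum:
  assumes W: "W \<in> carrier_mat n n" and F: "\<And>j. j \<in> S \<Longrightarrow> F j \<in> carrier_mat n n" and ik: "i < n" "k < n"
  shows "(W * mat_sum n S F) $$ (i, k) = (\<Sum>j\<in>S. (W * F j) $$ (i, k))"
proof -
  have "(W * mat_sum n S F) $$ (i, k) = (\<Sum>l<n. W $$ (i, l) * (\<Sum>j\<in>S. F j $$ (l, k)))"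
    using W ik by (simp add: mat_sum_def scalar_prod_def atLeast0LessThan)
  also have "\<dots> = (\<Sum>j\<in>S. \<Sum>l<n. W $$ (i, l) * F j $$ (l, k))"
    unfolding sum_distrib_left by (rule sum.swap)
  also have "\<dots> = (\<Sum>j\<in>S. (W * F j) $$ (i, k))"
    using W ik carrier_matD[OF F] by (intro sum.cong refl) (simp add: scalar_prod_def atLeast0LessThan)
  finally show ?thesis .
qed

lemma lprod_carrier: "(\<And>i. i < j \<Longrightarrow> F i \<in> carrier_mat n n) \<Longrightarrow> lprod n F j \<in> carrier_mat n n"
  by (induction j) (auto intro: mult_carrier_mat)

lemma rprod_carrier: "(\<And>i. i < j \<Longrightarrow> F i \<in> carrier_mat n n) \<Longrightarrow> rprod n F j \<in> carrier_mat n n"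
  by (induction j) (auto intro: mult_carrier_mat)

lemma lprod_shift:
  assumes "\<And>i. i \<le> j \<Longrightarrow> Y i \<in> carrier_mat n n"
    and "\<And>i. i < j \<Longrightarrow> F i \<in> carrier_mat n n" "\<And>i. i < j \<Longrightarrow> F i * Y i = Y (Suc i)"
  shows "lprod n F j * Y 0 = Y j"
  using assms
proof (induction j)
  case 0 then show ?case using left_mult_one_mat by fastforce
next
  case (Suc j)
  have "F j \<in> carrier_mat n n" "lprod n F j \<in> carrier_mat n n" "Y 0 \<in> carrier_mat n n"
    using Suc.prems by (auto intro: lprod_carrier)
  then have "lprod n F (Suc j) * Y 0 = F j * (lprod n F j * Y 0)" by (simp add: assoc_mult_mat)
  then show ?case using Suc by simp
qed

lemma rprod_shift:
  assumes "\<And>i. i \<le> j \<Longrightarrow> Y i \<in> carrier_mat n n"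
    and "\<And>i. i < j \<Longrightarrow> F i \<in> carrier_mat n n" "\<And>i. i < j \<Longrightarrow> Y i * F i = Y (Suc i)"
  shows "Y 0 * rprod n F j = Y j"
  using assms
proof (induction j)
  case 0 then show ?case using right_mult_one_mat by fastforce
next
  case (Suc j)
  have "F j \<in> carrier_mat n n" "rprod n F j \<in> carrier_mat n n" "Y 0 \<in> carrier_mat n n"
    using Suc.prems by (auto intro: rprod_carrier)
  then have "Y 0 * rprod n F (Suc j) = (Y 0 * rprod n F j) * F j" by (simp add: assoc_mult_mat)
  then show ?case using Suc by simp
qed

text \<open>Everything is evaluated at one point; \<open>F k\<close> is the solution number
  \<open>k\<close>. Matrix identities are tested on the invertible \<open>win N\<close>, where a
  ladder factor is a shift of the window by one.\<close>

locale wave_window =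
  fixes d :: nat and c :: rec_coeffs and z :: complex and F :: "nat \<Rightarrow> nat \<Rightarrow> complex"
  assumes d: "d \<ge> 1" and c_up: "\<And>n. c (-1) n \<noteq> 0"
    and rec_F: "\<And>k n. k \<le> d \<Longrightarrow> n \<ge> d \<Longrightarrow> z * F k n = (\<Sum>m<n+2. Q_mat d c n m * F k m)"
    and ns_F: "\<And>N v k. (\<And>l. l \<le> d \<Longrightarrow> (\<Sum>k\<le>d. v k * F k (N + l)) = 0) \<Longrightarrow> k \<le> d \<Longrightarrow> v k = 0"
begin

definition win :: "nat \<Rightarrow> complex mat" where "win N = Matrix.mat (d+1) (d+1) (\<lambda>(i, k). F k (N - d + i))"

lemma win_carrier [simp]: "win N \<in> carrier_mat (d+1) (d+1)" by (simp add: win_def)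
lemma ladder_carrier [simp]: "ladder d c z N \<in> carrier_mat (d+1) (d+1)" by (simp add: ladder_def)
lemma carrier_Suc [simp]: "win N \<in> carrier_mat (Suc d) (Suc d)" "ladder d c z N \<in> carrier_mat (Suc d) (Suc d)"
  "window w p d \<in> carrier_mat (Suc d) (Suc d)" by (simp_all add: win_def ladder_def window_def)

lemma win_inverse:
  obtains B where "B \<in> carrier_mat (d+1) (d+1)" "win N * B = 1\<^sub>m (d+1)" "B * win N = 1\<^sub>m (d+1)"
proof (rule trivial_kernel_inverse[OF win_carrier])
  fix v j assume v: "\<And>i. i < d+1 \<Longrightarrow> (\<Sum>j<d+1. win N $$ (i, j) * v j) = (0::complex)" and j: "j < d+1"
  show "v j = 0"
  proof (rule ns_F[where N = "N - d"])
    fix l assume "l \<le> d"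
    then show "(\<Sum>k\<le>d. v k * F k (N - d + l)) = 0"
      using v[of l] by (simp add: win_def mult.commute lessThan_Suc_atMost del: sum.lessThan_Suc)
  qed (use j in simp)
qed

lemma rec_window:
  assumes k: "k \<le> d" and N: "N \<ge> d"
  shows "z * F k N = c (-1) N * F k (N+1) + (\<Sum>l\<le>d. c (int d - int l) N * F k (N - d + l))"
proof -
  have "z * F k N = (\<Sum>m<N+2. Q_mat d c N m * F k m)" by (rule rec_F[OF k N])
  also have "\<dots> = Q_mat d c N (N+1) * F k (N+1) + (\<Sum>m<N+1. Q_mat d c N m * F k m)" by simp
  also have "(\<Sum>m<N+1. Q_mat d c N m * F k m) = (\<Sum>m\<in>{N-d..N}. Q_mat d c N m * F k m)"
    by (rule sum.mono_neutral_right) (auto simp: Q_mat_def)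
  also have "\<dots> = (\<Sum>l\<le>d. Q_mat d c N (N - d + l) * F k (N - d + l))"
    by (rule sum.reindex_bij_witness[where i = "\<lambda>l. N - d + l" and j = "\<lambda>m. m - (N - d)"]) (use N in auto)
  also have "\<dots> = (\<Sum>l\<le>d. c (int d - int l) N * F k (N - d + l))"
  proof (intro sum.cong refl)
    fix l assume "l \<in> {..d}"
    then have "int N - int (N - d + l) = int d - int l" using N by simp
    then show "Q_mat d c N (N - d + l) * F k (N - d + l) = c (int d - int l) N * F k (N - d + l)"
      using \<open>l \<in> {..d}\<close> by (simp add: Q_mat_def)
  qed
  also have "Q_mat d c N (N+1) = c (-1) N" by (simp add: Q_mat_def)
  finally show ?thesis .
qed

text \<open>The ladder is a companion matrix: all rows but the last shift the window, and the last
  row is the recurrence solved for the next entry.\<close>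

lemma win_step:
  assumes N: "N \<ge> d"
  shows "ladder d c z N * win N = win (N+1)"
proof (rule eq_matI)
  fix i k assume "i < dim_row (win (N+1))" "k < dim_col (win (N+1))"
  then have ik: "i \<le> d" "k \<le> d" by (auto simp: win_def)
  have e: "(ladder d c z N * win N) $$ (i, k) = (\<Sum>l<d+1. ladder d c z N $$ (i, l) * F k (N - d + l))"
    using ik by (simp add: ladder_def win_def scalar_prod_def atLeast0LessThan del: sum.lessThan_Suc)
  show "(ladder d c z N * win N) $$ (i, k) = win (N+1) $$ (i, k)"
  proof (cases "i < d")
    case True
    have "(\<Sum>l<d+1. ladder d c z N $$ (i, l) * F k (N - d + l)) = (\<Sum>l<d+1. if l = i + 1 then F k (N - d + l) else 0)"
      by (intro sum.cong refl) (use True in \<open>auto simp: ladder_def\<close>)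
    also have "\<dots> = F k (N - d + (i + 1))" using True by (simp del: sum.lessThan_Suc)
    finally show ?thesis using e ik N by (simp add: win_def Suc_diff_le)
  next
    case False
    then have i: "i = d" using ik by simp
    have "(\<Sum>l<d+1. ladder d c z N $$ (i, l) * F k (N - d + l)) =
       (\<Sum>l<d. - (c (int d - int l) N / c (-1) N * F k (N - d + l))) + (z - c 0 N) / c (-1) N * F k N"
      using N unfolding i by (simp add: ladder_def)
    also have "\<dots> = (z * F k N - (\<Sum>l\<le>d. c (int d - int l) N * F k (N - d + l))) / c (-1) N"
      using N by (simp add: sum_negf lessThan_Suc_atMost[symmetric] diff_divide_distrib add_divide_distrib sum_divide_distrib left_diff_distrib)
    also have "\<dots> = F k (N+1)" using rec_window[OF ik(2) N] c_up[of N] by simp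
    finally show ?thesis using e ik N unfolding i by (simp add: win_def Suc_diff_le)
  qed
qed (auto simp: ladder_def win_def)

text \<open>The windows at \<open>N\<close> and \<open>N + 1\<close> are both invertible, which
  exhibits \<open>win N * B\<close> as a right inverse of the ladder; so the option in
  \<open>ladder_inv\<close> is not empty.\<close>

lemma ladder_inv:
  assumes N: "N \<ge> d"
  shows "ladder_inv d c z N \<in> carrier_mat (d+1) (d+1)" "ladder_inv d c z N * win (N+1) = win N"
proof -
  obtain B where B: "B \<in> carrier_mat (d+1) (d+1)" "win (N+1) * B = 1\<^sub>m (d+1)" "B * win (N+1) = 1\<^sub>m (d+1)"
    by (rule win_inverse)
  have "ladder d c z N * (win N * B) = (ladder d c z N * win N) * B"
    by (rule assoc_mult_mat[of _ "d+1" "d+1" _ "d+1" _ "d+1", symmetric]) (use B in auto)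
  also have "\<dots> = 1\<^sub>m (d+1)" unfolding win_step[OF N] by (rule B)
  finally have e: "ladder d c z N * (win N * B) = 1\<^sub>m (d+1)" .
  note inv = the_mat_inverse[OF ladder_carrier mult_carrier_mat[OF win_carrier B(1)] e, folded ladder_inv_def]
  show "ladder_inv d c z N \<in> carrier_mat (d+1) (d+1)" by (rule inv)
  have "ladder_inv d c z N * win (N+1) = (ladder_inv d c z N * ladder d c z N) * win N"
    unfolding win_step[OF N, symmetric] by (rule assoc_mult_mat[of _ "d+1" "d+1" _ "d+1" _ "d+1", symmetric]) (use inv in auto)
  then show "ladder_inv d c z N * win (N+1) = win N" using inv left_mult_one_mat[OF win_carrier[of N]] by simp
qed

lemma lprod_ladder:
  assumes "N \<ge> d"
  shows "lprod (d+1) (\<lambda>i. ladder d c z (N+i)) j * win N = win (N+j)"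
  using lprod_shift[of j "\<lambda>i. win (N+i)" "d+1" "\<lambda>i. ladder d c z (N+i)"] win_step assms by simp

lemma lprod_ladder_inv:
  assumes "N \<ge> d + j"
  shows "lprod (d+1) (\<lambda>i. ladder_inv d c z (N-1-i)) j * win N = win (N-j)"
proof -
  have "ladder_inv d c z (N-1-i) * win (N-i) = win (N - Suc i)" if "i < j" for i
    using ladder_inv(2)[of "N-1-i"] that assms by (simp add: Suc_diff_Suc)
  then show ?thesis
    using lprod_shift[of j "\<lambda>i. win (N-i)" "d+1" "\<lambda>i. ladder_inv d c z (N-1-i)"] ladder_inv(1) assms by simp
qed

lemma window_mult_win:
  assumes "i \<le> d" "k \<le> d"
  shows "(window w p d * win N) $$ (i, k) = w (p + i) * F k (N - d + i)"
  using assms unfolding window_def by (subst mat_diag_mult_left[OF win_carrier]) (simp add: win_def)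

lemma window_lprod:
  assumes "i \<le> d" "k \<le> d" and L: "L \<in> carrier_mat (d+1) (d+1)" "L * win N = win M"
  shows "(window w p d * L * win N) $$ (i, k) = w (p + i) * F k (M - d + i)"
proof -
  have "window w p d * L * win N = window w p d * win M"
    unfolding L(2)[symmetric] by (rule assoc_mult_mat[of _ "d+1" "d+1" _ "d+1" _ "d+1"]) (use L(1) in auto)
  then show ?thesis using window_mult_win[OF assms(1,2)] by simp
qed

lemma window_carrier: "window w p d \<in> carrier_mat (d+1) (d+1)" by (simp add: window_def)

text \<open>Ladder products turn into shifted windows, so on solutions \<open>fold_up\<close> acts
  as the diagonal and the first \<open>K\<close> superdiagonals of the semi-infinite matrix
  \<open>W\<close>, row \<open>i\<close> of the window being row \<open>N - d + i\<close> of
  \<open>W\<close>.\<close>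

lemma fold_up_win:
  assumes ik: "i \<le> d" "k \<le> d" and N: "N \<ge> d"
  shows "(fold_up d c z W K N * win N) $$ (i, k) = (\<Sum>j=0..K. W (N - d + i) (N - d + i + j) * F k (N - d + i + j))"
proof -
  have L: "lprod (d+1) (\<lambda>i. ladder d c z (N+i)) j \<in> carrier_mat (d+1) (d+1)" for j by (rule lprod_carrier) simp
  have "(fold_up d c z W K N * win N) $$ (i, k) = (\<Sum>j=0..K. (window (\<lambda>n. W n (n+j)) (N-d) d * lprod (d+1) (\<lambda>i. ladder d c z (N+i)) j * win N) $$ (i, k))"
    unfolding fold_up_def by (rule mat_sum_mult[OF win_carrier mult_carrier_mat[OF window_carrier L]]) (use ik in auto)
  also have "\<dots> = (\<Sum>j=0..K. W (N - d + i) (N - d + i + j) * F k (N - d + i + j))"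
  proof (intro sum.cong refl)
    fix j
    have e: "N + j - d + i = N - d + i + j" using N by simp
    show "(window (\<lambda>n. W n (n+j)) (N-d) d * lprod (d+1) (\<lambda>i. ladder d c z (N+i)) j * win N) $$ (i, k) =
       W (N - d + i) (N - d + i + j) * F k (N - d + i + j)"
      unfolding window_lprod[OF ik L lprod_ladder[OF N]] e ..
  qed
  finally show ?thesis .
qed

text \<open>Downward shifts meet the entries of a column of \<open>W\<close>, so the transpose of
  \<open>W\<close> acts. The bound on \<open>N\<close> keeps all inverse ladder matrices in the
  range where they exist.\<close>

lemma fold_down_win:
  assumes ik: "i \<le> d" "k \<le> d" and N: "N \<ge> d + K"
  shows "(fold_down d c z W K N * win N) $$ (i, k) = (\<Sum>j=0..K. W (N - d + i - j) (N - d + i) * F k (N - d + i - j))"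
proof -
  have L: "lprod (d+1) (\<lambda>i. ladder_inv d c z (N-1-i)) j \<in> carrier_mat (d+1) (d+1)" if "j \<le> K" for j
    by (rule lprod_carrier, rule ladder_inv) (use N that in auto)
  have "(fold_down d c z W K N * win N) $$ (i, k) = (\<Sum>j=0..K. (window (\<lambda>n. W n (n+j)) (N-d-j) d * lprod (d+1) (\<lambda>i. ladder_inv d c z (N-1-i)) j * win N) $$ (i, k))"
    unfolding fold_down_def by (rule mat_sum_mult[OF win_carrier mult_carrier_mat[OF window_carrier L]]) (use ik in auto)
  also have "\<dots> = (\<Sum>j=0..K. W (N - d + i - j) (N - d + i) * F k (N - d + i - j))"
  proof (intro sum.cong refl)
    fix j assume "j \<in> {0..K}"
    then have j: "j \<le> K" by simp
    have e: "N - j - d + i = N - d + i - j" "N - d - j + i = N - d + i - j" "N - d + i - j + j = N - d + i" using N j by auto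
    have "N \<ge> d + j" using N j by simp
    then show "(window (\<lambda>n. W n (n+j)) (N-d-j) d * lprod (d+1) (\<lambda>i. ladder_inv d c z (N-1-i)) j * win N) $$ (i, k) =
       W (N - d + i - j) (N - d + i) * F k (N - d + i - j)"
      using window_lprod[OF ik L[OF j] lprod_ladder_inv, of "\<lambda>n. W n (n+j)" "N-d-j"] unfolding e by blast
  qed
  finally show ?thesis .
qed

text \<open>The coefficients \<open>b\<close> enter \<open>P_mat\<close> with a minus sign, so the
  folded matrix is \<open>- P\<close>; this is the sign in front of \<open>D\<close> in the
  systems.\<close>

lemma diff_mat_win:
  assumes ik: "i \<le> d" "k \<le> d" and N: "N \<ge> d + 1"
  shows "(diff_mat d e c b z N * win N) $$ (i, k) = - (\<Sum>m<N - d + i + e + 1. P_mat e b (N - d + i) m * F k m)"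
proof -
  let ?n = "N - d + i"
  have L: "lprod (d+1) (\<lambda>i. ladder d c z (N+i)) j \<in> carrier_mat (d+1) (d+1)" for j by (rule lprod_carrier) simp
  have N': "N - 1 \<ge> d" "N \<ge> d" "N - 1 + 1 = N" using N by auto
  let ?A = "window (b (-1)) (N-1-d) d * ladder_inv d c z (N-1)"
  let ?S = "mat_sum (d+1) {1..e} (\<lambda>j. window (b (int j)) (N+j-d) d * lprod (d+1) (\<lambda>i. ladder d c z (N+i)) j)"
  have A: "?A \<in> carrier_mat (d+1) (d+1)" by (rule mult_carrier_mat[OF window_carrier ladder_inv(1)[OF N'(1)]])
  have "(diff_mat d e c b z N * win N) $$ (i, k) = (?A * win N + window (b 0) (N-d) d * win N + ?S * win N) $$ (i, k)"
    unfolding diff_mat_def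
    by (simp only: add_mult_distrib_mat[OF add_carrier_mat[OF window_carrier] mat_sum_carrier win_carrier]
      add_mult_distrib_mat[OF A window_carrier win_carrier])
  also have "\<dots> = (?A * win N) $$ (i, k) + (window (b 0) (N-d) d * win N) $$ (i, k) + (?S * win N) $$ (i, k)"
    using ik by (simp add: carrier_matD[OF mat_sum_carrier] carrier_matD[OF win_carrier] carrier_matD[OF window_carrier])
  also have "(?A * win N) $$ (i, k) = b (-1) (N-1-d+i) * F k (N-1-d+i)"
    by (rule window_lprod[OF ik ladder_inv(1)[OF N'(1)]]) (use ladder_inv(2)[OF N'(1)] N' in simp)
  also have "(window (b 0) (N-d) d * win N) $$ (i, k) = b 0 ?n * F k ?n" by (rule window_mult_win[OF ik])
  also have "(?S * win N) $$ (i, k) = (\<Sum>j=1..e. b (int j) (?n + j) * F k (?n + j))"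
  proof -
    have "(?S * win N) $$ (i, k) = (\<Sum>j=1..e. (window (b (int j)) (N+j-d) d * lprod (d+1) (\<lambda>i. ladder d c z (N+i)) j * win N) $$ (i, k))"
      by (rule mat_sum_mult[OF win_carrier mult_carrier_mat[OF window_carrier L]]) (use ik in auto)
    also have "\<dots> = (\<Sum>j=1..e. b (int j) (?n + j) * F k (?n + j))"
    proof (intro sum.cong refl)
      fix j
      have "N + j - d + i = ?n + j" using N by simp
      with window_lprod[OF ik L lprod_ladder[OF N'(2)], of "b (int j)" "N+j-d" j]
      show "(window (b (int j)) (N+j-d) d * lprod (d+1) (\<lambda>i. ladder d c z (N+i)) j * win N) $$ (i, k) = b (int j) (?n + j) * F k (?n + j)"
        by simp
    qed
    finally show ?thesis .
  qed
  also have "b (-1) (N-1-d+i) * F k (N-1-d+i) + b 0 ?n * F k ?n + (\<Sum>j=1..e. b (int j) (?n + j) * F k (?n + j)) =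
      (\<Sum>j | j \<in> {-1..int e} \<and> 0 \<le> int ?n + j. b j (nat (int ?n + j)) * F k (nat (int ?n + j)))"
  proof -
    \<comment> \<open>\<open>N \<ge> d + 1\<close> makes the row index positive, so the term
      \<open>j = -1\<close> is always present.\<close>
    have set: "{j. j \<in> {-1..int e} \<and> 0 \<le> int ?n + j} = insert (-1) (insert 0 {1..int e})" using N by auto
    have "(\<Sum>j=1..e. b (int j) (?n + j) * F k (?n + j)) = (\<Sum>j\<in>{1..int e}. b j (nat (int ?n + j)) * F k (nat (int ?n + j)))"
      by (rule sum.reindex_bij_witness[where i = nat and j = int]) (auto simp: nat_add_distrib nat_diff_distrib simp flip: of_nat_add)
    moreover have "nat (int ?n - 1) = N - 1 - d + i" using N by auto
    ultimately show ?thesis unfolding set by (simp del: of_nat_add)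
  qed
  also have "\<dots> = - (\<Sum>m<?n + e + 1. P_mat e b ?n m * F k m)"
    using P_mat_sum[where d = e and n = ?n and c = b and f = "F k", symmetric] by (simp only: minus_minus)
  finally show ?thesis .
qed

end

text \<open>Mirror image of \<open>wave_window\<close>: solutions are rows, matrices act from the
  right, and the window with index \<open>N\<close> begins at \<open>N\<close> instead of ending
  there.\<close>

locale dual_window =
  fixes d :: nat and c :: rec_coeffs and z :: complex and G :: "nat \<Rightarrow> nat \<Rightarrow> complex"
  assumes d: "d \<ge> 1" and c_up: "\<And>n. c (-1) n \<noteq> 0"
    and rec_G: "\<And>k n. k \<le> d \<Longrightarrow> n \<ge> 1 \<Longrightarrow> z * G k n = (\<Sum>m<n+d+1. G k m * Q_mat d c m n)"
    and ns_G: "\<And>N v k. (\<And>l. l \<le> d \<Longrightarrow> (\<Sum>k\<le>d. v k * G k (N + l)) = 0) \<Longrightarrow> k \<le> d \<Longrightarrow> v k = 0"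
begin

definition win :: "nat \<Rightarrow> complex mat" where "win N = Matrix.mat (d+1) (d+1) (\<lambda>(k, i). G k (N + i))"

lemma win_carrier [simp]: "win N \<in> carrier_mat (d+1) (d+1)" by (simp add: win_def)
lemma dual_ladder_carrier [simp]: "dual_ladder d c z N \<in> carrier_mat (d+1) (d+1)" by (simp add: dual_ladder_def)
lemma carrier_Suc [simp]: "win N \<in> carrier_mat (Suc d) (Suc d)" "dual_ladder d c z N \<in> carrier_mat (Suc d) (Suc d)"
  "window w p d \<in> carrier_mat (Suc d) (Suc d)" by (simp_all add: win_def dual_ladder_def window_def)

lemma win_inverse:
  obtains B where "B \<in> carrier_mat (d+1) (d+1)" "win N * B = 1\<^sub>m (d+1)" "B * win N = 1\<^sub>m (d+1)"
proof -
  have "transpose_mat (win N) \<in> carrier_mat (d+1) (d+1)" by simp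
  then obtain B where B: "B \<in> carrier_mat (d+1) (d+1)" "transpose_mat (win N) * B = 1\<^sub>m (d+1)" "B * transpose_mat (win N) = 1\<^sub>m (d+1)"
  proof (rule trivial_kernel_inverse)
    fix v j assume v: "\<And>i. i < d+1 \<Longrightarrow> (\<Sum>j<d+1. transpose_mat (win N) $$ (i, j) * v j) = (0::complex)" and j: "j < d+1"
    show "v j = 0"
    proof (rule ns_G[where N = N])
      fix l assume "l \<le> d"
      then show "(\<Sum>k\<le>d. v k * G k (N + l)) = 0"
        using v[of l] by (simp add: win_def mult.commute lessThan_Suc_atMost del: sum.lessThan_Suc)
    qed (use j in simp)
  qed
  show ?thesis
  proof (rule that[of "transpose_mat B"])
    show "transpose_mat B \<in> carrier_mat (d+1) (d+1)" using B by simp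
    show "win N * transpose_mat B = 1\<^sub>m (d+1)"
      using arg_cong[OF B(3), of transpose_mat] by (subst (asm) transpose_mult[of _ "d+1" "d+1" _ "d+1"]) (use B in auto)
    show "transpose_mat B * win N = 1\<^sub>m (d+1)"
      using arg_cong[OF B(2), of transpose_mat] by (subst (asm) transpose_mult[of _ "d+1" "d+1" _ "d+1"]) (use B in auto)
  qed
qed

lemma rec_window:
  assumes k: "k \<le> d" and N: "N \<ge> 1"
  shows "z * G k N = c (-1) (N-1) * G k (N-1) + (\<Sum>l\<le>d. c (int l) (N + l) * G k (N + l))"
proof -
  have "z * G k N = (\<Sum>m<N+d+1. G k m * Q_mat d c m N)" by (rule rec_G[OF k N])
  also have "\<dots> = (\<Sum>m\<in>insert (N-1) {N..N+d}. G k m * Q_mat d c m N)"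
    by (rule sum.mono_neutral_right) (use N in \<open>auto simp: Q_mat_def\<close>)
  also have "\<dots> = G k (N-1) * Q_mat d c (N-1) N + (\<Sum>m\<in>{N..N+d}. G k m * Q_mat d c m N)"
    by (rule sum.insert) (use N in auto)
  also have "(\<Sum>m\<in>{N..N+d}. G k m * Q_mat d c m N) = (\<Sum>l\<le>d. c (int l) (N + l) * G k (N + l))"
    by (rule sum.reindex_bij_witness[where i = "\<lambda>l. N + l" and j = "\<lambda>m. m - N"]) (auto simp: Q_mat_def of_nat_diff)
  also have "Q_mat d c (N-1) N = c (-1) (N-1)" using N by (simp add: Q_mat_def of_nat_diff)
  finally show ?thesis by (simp add: mult.commute)
qed

lemma win_step:
  assumes N: "N \<ge> 1"
  shows "win N * dual_ladder d c z N = win (N-1)"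
proof (rule eq_matI)
  fix k i assume "k < dim_row (win (N-1))" "i < dim_col (win (N-1))"
  then have ik: "i \<le> d" "k \<le> d" by (auto simp: win_def)
  have e: "(win N * dual_ladder d c z N) $$ (k, i) = (\<Sum>l<d+1. G k (N + l) * dual_ladder d c z N $$ (l, i))"
    using ik by (simp add: dual_ladder_def win_def scalar_prod_def atLeast0LessThan del: sum.lessThan_Suc)
  show "(win N * dual_ladder d c z N) $$ (k, i) = win (N-1) $$ (k, i)"
  proof (cases "i = 0")
    case False
    have "(\<Sum>l<d+1. G k (N + l) * dual_ladder d c z N $$ (l, i)) = (\<Sum>l<d+1. if l = i - 1 then G k (N + l) else 0)"
      by (intro sum.cong refl) (use False ik in \<open>auto simp: dual_ladder_def\<close>)
    also have "\<dots> = G k (N + (i - 1))" using False ik by (simp del: sum.lessThan_Suc)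
    finally show ?thesis using e ik N False by (simp add: win_def)
  next
    case i: True
    have "(\<Sum>l<d+1. G k (N + l) * dual_ladder d c z N $$ (l, i)) =
       (\<Sum>l<d+1. (if l = 0 then z * G k N / c (-1) (N-1) else 0) - c (int l) (N + l) * G k (N + l) / c (-1) (N-1))"
      unfolding i by (intro sum.cong refl) (auto simp: dual_ladder_def algebra_simps diff_divide_distrib)
    also have "\<dots> = (z * G k N - (\<Sum>l\<le>d. c (int l) (N + l) * G k (N + l))) / c (-1) (N-1)"
      unfolding sum_subtractf by (simp add: diff_divide_distrib sum_divide_distrib lessThan_Suc_atMost del: sum.lessThan_Suc)
    also have "\<dots> = G k (N-1)" using rec_window[OF ik(2) N] c_up[of "N-1"] by simp
    finally show ?thesis using e ik unfolding i by (simp add: win_def)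
  qed
qed (auto simp: dual_ladder_def win_def)

lemma dual_ladder_inv:
  assumes N: "N \<ge> 1"
  shows "dual_ladder_inv d c z N \<in> carrier_mat (d+1) (d+1)" "win (N-1) * dual_ladder_inv d c z N = win N"
proof -
  obtain B where B: "B \<in> carrier_mat (d+1) (d+1)" "win (N-1) * B = 1\<^sub>m (d+1)" "B * win (N-1) = 1\<^sub>m (d+1)"
    by (rule win_inverse)
  have "(B * win N) * dual_ladder d c z N = B * (win N * dual_ladder d c z N)"
    by (rule assoc_mult_mat[of _ "d+1" "d+1" _ "d+1" _ "d+1"]) (use B in auto)
  also have "\<dots> = 1\<^sub>m (d+1)" unfolding win_step[OF N] by (rule B)
  finally have "dual_ladder d c z N * (B * win N) = 1\<^sub>m (d+1)"
    using mat_mult_left_right_inverse[OF mult_carrier_mat[OF B(1) win_carrier] dual_ladder_carrier] by blast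
  note inv = the_mat_inverse[OF dual_ladder_carrier mult_carrier_mat[OF B(1) win_carrier] this, folded dual_ladder_inv_def]
  show "dual_ladder_inv d c z N \<in> carrier_mat (d+1) (d+1)" by (rule inv)
  have "win (N-1) * dual_ladder_inv d c z N = win N * (dual_ladder d c z N * dual_ladder_inv d c z N)"
    unfolding win_step[OF N, symmetric] by (rule assoc_mult_mat[of _ "d+1" "d+1" _ "d+1" _ "d+1"]) (use inv in auto)
  then show "win (N-1) * dual_ladder_inv d c z N = win N" using inv right_mult_one_mat[OF win_carrier[of N]] by simp
qed

lemma rprod_dual_ladder_inv:
  assumes "N \<ge> 1"
  shows "win (N-1) * rprod (d+1) (\<lambda>i. dual_ladder_inv d c z (N+i)) j = win (N-1+j)"
proof -
  have "win (N-1+i) * dual_ladder_inv d c z (N+i) = win (N-1 + Suc i)" for i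
    using dual_ladder_inv(2)[of "N+i"] assms by simp
  then show ?thesis
    using rprod_shift[of j "\<lambda>i. win (N-1+i)" "d+1" "\<lambda>i. dual_ladder_inv d c z (N+i)"] dual_ladder_inv(1) assms by simp
qed

lemma rprod_dual_ladder:
  assumes "N \<ge> j + 1"
  shows "win (N-1) * rprod (d+1) (\<lambda>i. dual_ladder d c z (N-1-i)) j = win (N-1-j)"
proof -
  have "win (N-1-i) * dual_ladder d c z (N-1-i) = win (N-1 - Suc i)" if "i < j" for i
    using win_step[of "N-1-i"] that assms by simp
  then show ?thesis
    using rprod_shift[of j "\<lambda>i. win (N-1-i)" "d+1" "\<lambda>i. dual_ladder d c z (N-1-i)"] by simp
qed

lemma win_mult_window:
  assumes "i \<le> d" "k \<le> d"
  shows "(win N * window w p d) $$ (k, i) = G k (N + i) * w (p + i)"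
  using assms unfolding window_def by (subst mat_diag_mult_right[OF win_carrier]) (simp add: win_def)

lemma rprod_window:
  assumes "i \<le> d" "k \<le> d" and L: "L \<in> carrier_mat (d+1) (d+1)" "win N * L = win M"
  shows "(win N * (L * window w p d)) $$ (k, i) = G k (M + i) * w (p + i)"
proof -
  have "win N * (L * window w p d) = win M * window w p d"
    unfolding L(2)[symmetric] by (rule assoc_mult_mat[of _ "d+1" "d+1" _ "d+1" _ "d+1", symmetric]) (use L(1) in auto)
  then show ?thesis using win_mult_window[OF assms(1,2)] by simp
qed

lemma window_carrier: "window w p d \<in> carrier_mat (d+1) (d+1)" by (simp add: window_def)

lemma win_fold_up:
  assumes ik: "i \<le> d" "k \<le> d" and N: "N \<ge> 1"
  shows "(win (N-1) * dual_fold_up d c z W K N) $$ (k, i) = (\<Sum>j=0..K. G k (N - 1 + i + j) * W (N - 1 + i) (N - 1 + i + j))"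
proof -
  have L: "rprod (d+1) (\<lambda>i. dual_ladder_inv d c z (N+i)) j \<in> carrier_mat (d+1) (d+1)" for j
    by (rule rprod_carrier, rule dual_ladder_inv) (use N in auto)
  have "(win (N-1) * dual_fold_up d c z W K N) $$ (k, i) = (\<Sum>j=0..K. (win (N-1) * (rprod (d+1) (\<lambda>i. dual_ladder_inv d c z (N+i)) j * window (\<lambda>n. W n (n+j)) (N-1) d)) $$ (k, i))"
    unfolding dual_fold_up_def by (rule mult_mat_sum[OF win_carrier mult_carrier_mat[OF L window_carrier]]) (use ik in auto)
  also have "\<dots> = (\<Sum>j=0..K. G k (N - 1 + i + j) * W (N - 1 + i) (N - 1 + i + j))"
    unfolding rprod_window[OF ik L rprod_dual_ladder_inv[OF N]] by (simp add: add_ac)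
  finally show ?thesis .
qed

lemma win_fold_down:
  assumes ik: "i \<le> d" "k \<le> d" and N: "N \<ge> K + 1"
  shows "(win (N-1) * dual_fold_down d c z W K N) $$ (k, i) = (\<Sum>j=0..K. G k (N - 1 + i - j) * W (N - 1 + i - j) (N - 1 + i))"
proof -
  have L: "rprod (d+1) (\<lambda>i. dual_ladder d c z (N-1-i)) j \<in> carrier_mat (d+1) (d+1)" for j
    by (rule rprod_carrier) simp
  have "(win (N-1) * dual_fold_down d c z W K N) $$ (k, i) = (\<Sum>j=0..K. (win (N-1) * (rprod (d+1) (\<lambda>i. dual_ladder d c z (N-1-i)) j * window (\<lambda>n. W n (n+j)) (N-1-j) d)) $$ (k, i))"
    unfolding dual_fold_down_def by (rule mult_mat_sum[OF win_carrier mult_carrier_mat[OF L window_carrier]]) (use ik in auto)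
  also have "\<dots> = (\<Sum>j=0..K. G k (N - 1 + i - j) * W (N - 1 + i - j) (N - 1 + i))"
  proof (intro sum.cong refl)
    fix j assume "j \<in> {0..K}"
    then have e: "N \<ge> j + 1" "N - 1 - j + i = N - 1 + i - j" "N - 1 + i - j + j = N - 1 + i" using N by auto
    show "(win (N-1) * (rprod (d+1) (\<lambda>i. dual_ladder d c z (N-1-i)) j * window (\<lambda>n. W n (n+j)) (N-1-j) d)) $$ (k, i) =
       G k (N - 1 + i - j) * W (N - 1 + i - j) (N - 1 + i)"
      unfolding rprod_window[OF ik L rprod_dual_ladder[OF e(1)]] e ..
  qed
  finally show ?thesis .
qed

lemma win_diff_mat:
  assumes ik: "i \<le> d" "k \<le> d" and N: "N \<ge> e + 1"
  shows "(win (N-1) * dual_diff_mat d e c b z N) $$ (k, i) = - (\<Sum>m<N + i + 1. G k m * P_mat e b m (N - 1 + i))"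
proof -
  let ?n = "N - 1 + i"
  have N': "N \<ge> 1" using N by auto
  have L: "rprod (d+1) (\<lambda>i. dual_ladder d c z (N-1-i)) j \<in> carrier_mat (d+1) (d+1)" for j by (rule rprod_carrier) simp
  let ?A = "dual_ladder_inv d c z N * window (b (-1)) (N-1) d"
  let ?S = "mat_sum (d+1) {1..e} (\<lambda>j. rprod (d+1) (\<lambda>i. dual_ladder d c z (N-1-i)) j * window (b (int j)) (N-1) d)"
  have A: "?A \<in> carrier_mat (d+1) (d+1)" by (rule mult_carrier_mat[OF dual_ladder_inv(1)[OF N'] window_carrier])
  have "win (N-1) * dual_diff_mat d e c b z N = win (N-1) * ?A + win (N-1) * window (b 0) (N-1) d + win (N-1) * ?S"
    unfolding dual_diff_mat_def
    by (simp only: mult_add_distrib_mat[OF win_carrier add_carrier_mat[OF window_carrier] mat_sum_carrier]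
      mult_add_distrib_mat[OF win_carrier A window_carrier])
  then have "(win (N-1) * dual_diff_mat d e c b z N) $$ (k, i) = (win (N-1) * ?A) $$ (k, i) + (win (N-1) * window (b 0) (N-1) d) $$ (k, i) + (win (N-1) * ?S) $$ (k, i)"
    using ik by (simp add: carrier_matD[OF mat_sum_carrier] carrier_matD[OF win_carrier] carrier_matD[OF window_carrier])
  also have "(win (N-1) * ?A) $$ (k, i) = G k (N + i) * b (-1) ?n"
    by (rule rprod_window[OF ik dual_ladder_inv[OF N']])
  also have "(win (N-1) * window (b 0) (N-1) d) $$ (k, i) = G k ?n * b 0 ?n" by (rule win_mult_window[OF ik])
  also have "(win (N-1) * ?S) $$ (k, i) = (\<Sum>j=1..e. G k (?n - j) * b (int j) ?n)"
  proof -
    have "(win (N-1) * ?S) $$ (k, i) = (\<Sum>j=1..e. (win (N-1) * (rprod (d+1) (\<lambda>i. dual_ladder d c z (N-1-i)) j * window (b (int j)) (N-1) d)) $$ (k, i))"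
      by (rule mult_mat_sum[OF win_carrier mult_carrier_mat[OF L window_carrier]]) (use ik in auto)
    also have "\<dots> = (\<Sum>j=1..e. G k (?n - j) * b (int j) ?n)"
    proof (intro sum.cong refl)
      fix j assume "j \<in> {1..e}"
      then have e: "N \<ge> j + 1" "N - 1 - j + i = ?n - j" using N by auto
      show "(win (N-1) * (rprod (d+1) (\<lambda>i. dual_ladder d c z (N-1-i)) j * window (b (int j)) (N-1) d)) $$ (k, i) = G k (?n - j) * b (int j) ?n"
        unfolding rprod_window[OF ik L rprod_dual_ladder[OF e(1)]] e ..
    qed
    finally show ?thesis .
  qed
  also have "G k (N + i) * b (-1) ?n + G k ?n * b 0 ?n + (\<Sum>j=1..e. G k (?n - j) * b (int j) ?n) = - (\<Sum>m<N + i + 1. G k m * P_mat e b m ?n)"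
  proof -
    \<comment> \<open>By \<open>N \<ge> e + 1\<close> the subtraction \<open>?n - e\<close> is
      exact, so none of the \<open>e\<close> lower terms is lost at the edge.\<close>
    have "(\<Sum>m<N + i + 1. G k m * P_mat e b m ?n) = (\<Sum>m\<in>insert (N+i) (insert ?n {?n - e..<?n}). G k m * P_mat e b m ?n)"
      by (rule sum.mono_neutral_right) (use N in \<open>auto simp: P_mat_def of_nat_diff\<close>)
    also have "\<dots> = G k (N+i) * P_mat e b (N+i) ?n + (G k ?n * P_mat e b ?n ?n + (\<Sum>m\<in>{?n - e..<?n}. G k m * P_mat e b m ?n))"
      by (subst sum.insert, simp, use N in force, subst sum.insert) (use N in auto)
    also have "(\<Sum>m\<in>{?n - e..<?n}. G k m * P_mat e b m ?n) = (\<Sum>j=1..e. - (G k (?n - j) * b (int j) ?n))"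
      by (rule sum.reindex_bij_witness[where i = "\<lambda>j. ?n - j" and j = "\<lambda>m. ?n - m"]) (use N in \<open>auto simp: P_mat_def of_nat_diff algebra_simps\<close>)
    also have "P_mat e b (N+i) ?n = - b (-1) ?n" using N by (simp add: P_mat_def of_nat_diff)
    also have "P_mat e b ?n ?n = - b 0 ?n" by (simp add: P_mat_def)
    finally show ?thesis by (simp add: sum_negf)
  qed
  finally show ?thesis .
qed

end

section \<open>The first pair of systems and its normalisation\<close>

lemma sum_up:
  fixes h :: "nat \<Rightarrow> complex"
  assumes "\<And>m. m < n \<or> m > n + K \<Longrightarrow> h m = 0" "S \<ge> n + K + 1"
  shows "(\<Sum>m<S. h m) = (\<Sum>j=0..K. h (n + j))"
proof -
  have "(\<Sum>m<S. h m) = (\<Sum>m\<in>{n..n+K}. h m)"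
    by (rule sum.mono_neutral_right) (use assms in auto)
  also have "\<dots> = (\<Sum>j=0..K. h (n + j))"
    by (rule sum.reindex_bij_witness[where i = "\<lambda>j. n + j" and j = "\<lambda>m. m - n"]) auto
  finally show ?thesis .
qed

lemma sum_down:
  fixes h :: "nat \<Rightarrow> complex"
  assumes "\<And>m. m > n \<or> n > m + K \<Longrightarrow> h m = 0" "K \<le> n" "S \<ge> n + 1"
  shows "(\<Sum>m<S. h m) = (\<Sum>j=0..K. h (n - j))"
proof -
  have "(\<Sum>m<S. h m) = (\<Sum>m\<in>{n-K..n}. h m)"
    by (rule sum.mono_neutral_right) (use assms(2,3) in \<open>auto intro!: assms(1)\<close>)
  also have "\<dots> = (\<Sum>j=0..K. h (n - j))"
    by (rule sum.reindex_bij_witness[where i = "\<lambda>j. n - j" and j = "\<lambda>m. n - m"]) (use assms in auto)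
  finally show ?thesis .
qed

lemma uminus_entry: "A \<in> carrier_mat n n \<Longrightarrow> i < n \<Longrightarrow> k < n \<Longrightarrow> (- A) $$ (i, k) = - (A $$ (i, k) :: complex)"
  by auto

context bimoment begin

lemma pt_dom: "t \<in> T \<Longrightarrow> pt x t \<in> \<Omega>" by (simp add: dom_of_def)

lemma X_I: "X \<in> I" and U_I: "K \<in> {1..d1+1} \<Longrightarrow> U K \<in> I" and V_I: "J \<in> {1..d2+1} \<Longrightarrow> V J \<in> I"
  by (auto simp: coords_def)

lemma mat_deriv:
  assumes t: "t \<in> T" and c: "c \<in> I" and Y: "\<And>i k. i < n \<Longrightarrow> k < n \<Longrightarrow> hol I \<Omega> (Y i k)"
    and E: "E \<in> carrier_mat n n" "\<And>i k. i < n \<Longrightarrow> k < n \<Longrightarrow> E $$ (i, k) = pd c (Y i k) (pt x t)"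
  shows "has_mat_deriv n (\<lambda>s. Matrix.mat n n (\<lambda>(i, k). Y i k ((pt x t)(c := s)))) E (pt x t c)"
  unfolding has_mat_deriv_def using hol_deriv[OF Y pt_dom[OF t] c] E by simp

context
  fixes f :: "nat \<Rightarrow> nat \<Rightarrow> (coord \<Rightarrow> complex) \<Rightarrow> complex"
  assumes hf: "\<And>k n. hol I \<Omega> (f k n)"
    and kf: "\<And>p k n. p \<in> \<Omega> \<Longrightarrow> n \<ge> d2 \<Longrightarrow> app Lm (f k) n p = 0"
    and df: "\<And>p i k n. p \<in> \<Omega> \<Longrightarrow> i \<in> I \<Longrightarrow> n \<ge> low i \<Longrightarrow> pd i (f k n) p = app (Mp i) (f k) n p"
    and ns: "\<And>p N c k. p \<in> \<Omega> \<Longrightarrow> (\<And>l. l \<le> d2 \<Longrightarrow> (\<Sum>k\<le>d2. c k * f k (N + l) p) = 0) \<Longrightarrow> k \<le> d2 \<Longrightarrow> c k = 0"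
begin

lemma wave_window:
  assumes t: "t \<in> T"
  shows "wave_window d2 (\<alpha> t) x (\<lambda>k n. f k n (pt x t))"
proof
  show "1 \<le> d2" by (rule d2)
  show "\<alpha> t (- 1) n \<noteq> 0" for n using gamma(1)[OF t] r_nz[OF t] by simp
  show "x * f k n (pt x t) = (\<Sum>m<n+2. Qm t n m * f k m (pt x t))" if "n \<ge> d2" for k n
  proof -
    have "0 = (\<Sum>m<n+bw+2. Lm n m (pt x t) * f k m (pt x t))"
      using kf[OF pt_dom[OF t] that, of k x] unfolding app_def by simp
    also have "\<dots> = (\<Sum>m<n+bw+2. Qm t n m * f k m (pt x t) - (if m = n then x * f k m (pt x t) else 0))"
      by (intro sum.cong refl) (auto simp: Lm_def left_diff_distrib)
    also have "\<dots> = (\<Sum>m<n+bw+2. Qm t n m * f k m (pt x t)) - x * f k n (pt x t)"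
      unfolding sum_subtractf by (simp del: sum.lessThan_Suc add_2_eq_Suc')
    also have "(\<Sum>m<n+bw+2. Qm t n m * f k m (pt x t)) = (\<Sum>m<n+2. Qm t n m * f k m (pt x t))"
      by (rule sum.mono_neutral_right) (use Q_mat_band[of n _ d2 "\<alpha> t"] in auto)
    finally show ?thesis by simp
  qed
  show "v k = 0" if "\<And>l. l \<le> d2 \<Longrightarrow> (\<Sum>k\<le>d2. v k * f k (N + l) (pt x t)) = 0" "k \<le> d2" for N v k
    using ns[OF pt_dom[OF t] that] .
qed

lemma Psi_system:
  "Psi_system d1 d2 T \<alpha> \<beta> (\<lambda>N x t. Matrix.mat (d2+1) (d2+1) (\<lambda>(i, k). f k (N - d2 + i) (pt x t)))" (is "Psi_system _ _ _ _ _ ?F")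
  unfolding Psi_system_def
proof (intro ballI allI impI conjI)
  fix t x N assume t: "t \<in> T" and N: "d2 + 1 \<le> N"
  interpret w: wave_window d2 "\<alpha> t" x "\<lambda>k n. f k n (pt x t)" by (rule wave_window[OF t])
  note p = pt_dom[OF t, of x]
  have F: "?F N x t = w.win N" "?F (N+1) x t = w.win (N+1)" by (simp_all add: w.win_def)
  show "?F N x t \<in> carrier_mat (d2+1) (d2+1)" by simp
  show "invertible_mat (?F N x t)" unfolding F using w.win_inverse[of N] invertible_matI[OF w.win_carrier] by blast
  show "?F (N+1) x t = ladder d2 (\<alpha> t) x N * ?F N x t" unfolding F using w.win_step[of N] N by simp
  have c: "A * w.win N \<in> carrier_mat (d2+1) (d2+1)" if "A \<in> carrier_mat (d2+1) (d2+1)" for A using that w.win_carrier by (rule mult_carrier_mat)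
  have fc: "fold_up d2 c z W K N \<in> carrier_mat (d2+1) (d2+1)" "fold_down d2 c z W K N \<in> carrier_mat (d2+1) (d2+1)"
    "diff_mat d2 e c b z N \<in> carrier_mat (d2+1) (d2+1)" for c z W K e b
    by (auto simp: fold_up_def fold_down_def diff_mat_def mat_sum_def)
  have e: "(- (A * w.win N)) $$ (i, k) = - (A * w.win N) $$ (i, k)" if "i < d2+1" "k < d2+1" "A \<in> carrier_mat (d2+1) (d2+1)" for A i k
    using that(1,2) carrier_matD[OF c[OF that(3)]] by (intro index_uminus_mat) simp_all
  have "has_mat_deriv (d2+1) (\<lambda>s. Matrix.mat (d2+1) (d2+1) (\<lambda>(i, k). f k (N - d2 + i) ((pt x t)(X := s))))
      (- (diff_mat d2 d1 (\<alpha> t) (\<beta> t) x N * w.win N)) (pt x t X)"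
  proof (rule mat_deriv[OF t X_I hf uminus_carrier_mat[OF c[OF fc(3)]]])
    fix i k assume ik: "i < d2+1" "k < d2+1"
    let ?n = "N - d2 + i"
    have "pd X (f k ?n) (pt x t) = (\<Sum>m<?n+bw+2. P_mat d1 (\<beta> t) ?n m * f k m (pt x t))"
      using df[OF p X_I, of ?n k] N by (simp add: low_def app_def Mp_def Mm_def)
    also have "\<dots> = (\<Sum>m<?n+d1+1. P_mat d1 (\<beta> t) ?n m * f k m (pt x t))"
      by (rule sum.mono_neutral_right) (auto simp: bw_def P_mat_def)
    finally show "(- (diff_mat d2 d1 (\<alpha> t) (\<beta> t) x N * w.win N)) $$ (i, k) = pd X (f k ?n) (pt x t)"
      using ik N by (simp add: e[OF ik fc(3)] w.diff_mat_win del: sum.lessThan_Suc)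
  qed
  then show "has_mat_deriv (d2+1) (\<lambda>z. ?F N z t) (- (diff_mat d2 d1 (\<alpha> t) (\<beta> t) x N * ?F N x t)) x"
    unfolding F pt_upd_X pt_X .
  fix K assume K: "K \<in> {1..d1+1}"
  have "has_mat_deriv (d2+1) (\<lambda>s. Matrix.mat (d2+1) (d2+1) (\<lambda>(i, k). f k (N - d2 + i) ((pt x t)(U K := s))))
      (fold_up d2 (\<alpha> t) x (U_mat d2 (\<alpha> t) K) K N * w.win N) (pt x t (U K))"
  proof (rule mat_deriv[OF t U_I[OF K] hf c[OF fc(1)]])
    fix i k assume ik: "i < d2+1" "k < d2+1"
    let ?n = "N - d2 + i"
    have "pd (U K) (f k ?n) (pt x t) = (\<Sum>m<?n+bw+2. U_mat d2 (\<alpha> t) K ?n m * f k m (pt x t))"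
      using df[OF p U_I[OF K], of ?n k] by (simp add: low_def app_def Mp_def Mm_def)
    also have "\<dots> = (\<Sum>j=0..K. U_mat d2 (\<alpha> t) K ?n (?n + j) * f k (?n + j) (pt x t))"
      by (rule sum_up) (use K Mm_band[of ?n "U K" _ t] in \<open>auto simp: bw_def Mm_def low_def upp_def\<close>)
    finally show "(fold_up d2 (\<alpha> t) x (U_mat d2 (\<alpha> t) K) K N * w.win N) $$ (i, k) = pd (U K) (f k ?n) (pt x t)"
      using ik N by (simp only: w.fold_up_win)
  qed
  then show "has_u_deriv (d2+1) (?F N x) K (fold_up d2 (\<alpha> t) x (U_mat d2 (\<alpha> t) K) K N * ?F N x t) t"
    unfolding F has_u_deriv_def pt_upd_U pt_U .
next
  fix t x N J assume t: "t \<in> T" and N: "d2 + 1 \<le> N" and J: "J \<in> {1..d2+1}" "d2 + J \<le> N"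
  interpret w: wave_window d2 "\<alpha> t" x "\<lambda>k n. f k n (pt x t)" by (rule wave_window[OF t])
  note p = pt_dom[OF t, of x]
  have F: "?F N x t = w.win N" by (simp add: w.win_def)
  let ?A = "fold_down d2 (\<alpha> t) x (V_mat d1 (\<beta> t) J) J N * w.win N"
  have A: "?A \<in> carrier_mat (d2+1) (d2+1)"
    by (rule mult_carrier_mat[OF _ w.win_carrier]) (simp add: fold_down_def mat_sum_def)
  have "has_mat_deriv (d2+1) (\<lambda>s. Matrix.mat (d2+1) (d2+1) (\<lambda>(i, k). f k (N - d2 + i) ((pt x t)(V J := s)))) (- ?A) (pt x t (V J))"
  proof (rule mat_deriv[OF t V_I[OF J(1)] hf uminus_carrier_mat[OF A]])
    fix i k assume ik: "i < d2+1" "k < d2+1"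
    let ?n = "N - d2 + i"
    \<comment> \<open>\<open>d2 + J \<le> N\<close> gives \<open>?n \<ge> low (V J)\<close>: the
      rows on which the derivative is known are those for which \<open>fold_down\<close> makes
      sense.\<close>
    have "pd (V J) (f k ?n) (pt x t) = (\<Sum>m<?n+bw+2. Mm (V J) t ?n m * f k m (pt x t))"
      using df[OF p V_I[OF J(1)], of ?n k] J by (simp add: low_def app_def Mp_def)
    also have "\<dots> = (\<Sum>j=0..J. Mm (V J) t ?n (?n - j) * f k (?n - j) (pt x t))"
      by (rule sum_down) (use J Mm_band[of ?n "V J" _ t] in \<open>auto simp: low_def upp_def\<close>)
    also have "\<dots> = - (\<Sum>j=0..J. V_mat d1 (\<beta> t) J (?n - j) ?n * f k (?n - j) (pt x t))"
      by (simp add: Mm_def sum_negf)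
    finally show "(- ?A) $$ (i, k) = pd (V J) (f k ?n) (pt x t)"
      unfolding uminus_entry[OF A ik] using ik J by (simp add: w.fold_down_win)
  qed
  then show "has_v_deriv (d2+1) (?F N x) J (- (fold_down d2 (\<alpha> t) x (V_mat d1 (\<beta> t) J) J N * ?F N x t)) t"
    unfolding F has_v_deriv_def pt_upd_V pt_V .
qed

end

context
  fixes g :: "nat \<Rightarrow> nat \<Rightarrow> (coord \<Rightarrow> complex) \<Rightarrow> complex"
  assumes hg: "\<And>k n. k \<le> d2 \<Longrightarrow> hol I \<Omega> (g k n)"
    and kg: "\<And>p k n. p \<in> \<Omega> \<Longrightarrow> k \<le> d2 \<Longrightarrow> n \<ge> 1 \<Longrightarrow> dapp Lm (g k) n p = 0"
    and dg: "\<And>p i k n. p \<in> \<Omega> \<Longrightarrow> i \<in> I \<Longrightarrow> k \<le> d2 \<Longrightarrow> n \<ge> upp i \<Longrightarrow> pd i (g k n) p = - dapp (Mp i) (g k) n p"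
    and nsg: "\<And>p N c k. p \<in> \<Omega> \<Longrightarrow> (\<And>l. l \<le> d2 \<Longrightarrow> (\<Sum>k\<le>d2. c k * g k (N + l) p) = 0) \<Longrightarrow> k \<le> d2 \<Longrightarrow> c k = 0"
begin

lemma dual_window:
  assumes t: "t \<in> T"
  shows "dual_window d2 (\<alpha> t) x (\<lambda>k n. g k n (pt x t))"
proof
  show "1 \<le> d2" by (rule d2)
  show "\<alpha> t (- 1) n \<noteq> 0" for n using gamma(1)[OF t] r_nz[OF t] by simp
  show "x * g k n (pt x t) = (\<Sum>m<n+d2+1. g k m (pt x t) * Qm t m n)" if "k \<le> d2" "n \<ge> 1" for k n
  proof -
    have "0 = (\<Sum>m<n+bw+d2+2. g k m (pt x t) * Lm m n (pt x t))"
      using kg[OF pt_dom[OF t] that, of x] unfolding dapp_def by simp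
    also have "\<dots> = (\<Sum>m<n+bw+d2+2. g k m (pt x t) * Qm t m n - (if m = n then x * g k m (pt x t) else 0))"
      by (intro sum.cong refl) (auto simp: Lm_def right_diff_distrib)
    also have "\<dots> = (\<Sum>m<n+bw+d2+2. g k m (pt x t) * Qm t m n) - x * g k n (pt x t)"
      unfolding sum_subtractf by (simp del: sum.lessThan_Suc add_2_eq_Suc')
    also have "(\<Sum>m<n+bw+d2+2. g k m (pt x t) * Qm t m n) = (\<Sum>m<n+d2+1. g k m (pt x t) * Qm t m n)"
      by (rule sum.mono_neutral_right) (use Q_mat_band[of _ n d2 "\<alpha> t"] in auto)
    finally show ?thesis by simp
  qed
  show "v k = 0" if "\<And>l. l \<le> d2 \<Longrightarrow> (\<Sum>k\<le>d2. v k * g k (N + l) (pt x t)) = 0" "k \<le> d2" for N v k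
    using nsg[OF pt_dom[OF t] that] .
qed

lemma dual_Phi_system:
  "dual_Phi_system d1 d2 T \<alpha> \<beta> (\<lambda>N x t. Matrix.mat (d2+1) (d2+1) (\<lambda>(k, i). g k (N + i) (pt x t)))" (is "dual_Phi_system _ _ _ _ _ ?G")
  unfolding dual_Phi_system_def
proof (intro ballI allI impI conjI)
  fix t x N assume t: "t \<in> T" and N: "1 \<le> (N::nat)"
  interpret w: dual_window d2 "\<alpha> t" x "\<lambda>k n. g k n (pt x t)" by (rule dual_window[OF t])
  note p = pt_dom[OF t, of x]
  have G: "?G (N-1) x t = w.win (N-1)" "?G N x t = w.win N" by (simp_all add: w.win_def)
  have hg': "hol I \<Omega> (g k (N - 1 + i))" if "k < d2+1" for k i by (rule hg) (use that in simp)
  show "?G (N-1) x t \<in> carrier_mat (d2+1) (d2+1)" by simp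
  show "invertible_mat (?G (N-1) x t)" unfolding G using w.win_inverse[of "N-1"] invertible_matI[OF w.win_carrier] by blast
  show "?G (N-1) x t = ?G N x t * dual_ladder d2 (\<alpha> t) x N" unfolding G using w.win_step[of N] N by simp
  {
    assume N': "d2 + 1 \<le> N \<and> d1 + 1 \<le> N"
    let ?A = "w.win (N-1) * dual_diff_mat d2 d1 (\<alpha> t) (\<beta> t) x N"
    have "has_mat_deriv (d2+1) (\<lambda>s. Matrix.mat (d2+1) (d2+1) (\<lambda>(k, i). g k (N - 1 + i) ((pt x t)(X := s)))) ?A (pt x t X)"
    proof (rule mat_deriv[OF t X_I hg'])
      show "?A \<in> carrier_mat (d2+1) (d2+1)"
        by (rule mult_carrier_mat[OF w.win_carrier]) (simp add: dual_diff_mat_def mat_sum_def)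
      fix k i assume ik: "k < d2+1" "i < d2+1"
      let ?n = "N - 1 + i"
      have "pd X (g k ?n) (pt x t) = - (\<Sum>m<?n+bw+d2+2. g k m (pt x t) * P_mat d1 (\<beta> t) m ?n)"
      proof -
        \<comment> \<open>\<open>d1 + 1 \<le> N\<close> places the index \<open>?n\<close> at or
          above \<open>upp X = d1\<close>, where the dual derivative is known.\<close>
        have "k \<le> d2" "upp X \<le> ?n" using ik N' by (auto simp: upp_def)
        from dg[OF p X_I this] show ?thesis by (simp add: dapp_def Mp_def Mm_def del: sum.lessThan_Suc add_2_eq_Suc')
      qed
      also have "(\<Sum>m<?n+bw+d2+2. g k m (pt x t) * P_mat d1 (\<beta> t) m ?n) = (\<Sum>m<N+i+1. g k m (pt x t) * P_mat d1 (\<beta> t) m ?n)"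
        by (rule sum.mono_neutral_right) (use N in \<open>auto simp: P_mat_def\<close>)
      finally show "?A $$ (k, i) = pd X (g k ?n) (pt x t)"
        using w.win_diff_mat[of i k d1 N "\<beta> t"] ik N' by simp
    qed
    then show "has_mat_deriv (d2+1) (\<lambda>z. ?G (N-1) z t) (?G (N-1) x t * dual_diff_mat d2 d1 (\<alpha> t) (\<beta> t) x N) x"
      unfolding G pt_upd_X pt_X .
  }
  {
    fix K assume K: "K \<in> {1..d1+1}" "K + 1 \<le> N"
    let ?A = "w.win (N-1) * dual_fold_down d2 (\<alpha> t) x (U_mat d2 (\<alpha> t) K) K N"
    have A: "?A \<in> carrier_mat (d2+1) (d2+1)"
      by (rule mult_carrier_mat[OF w.win_carrier]) (simp add: dual_fold_down_def mat_sum_def)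
    have "has_mat_deriv (d2+1) (\<lambda>s. Matrix.mat (d2+1) (d2+1) (\<lambda>(k, i). g k (N - 1 + i) ((pt x t)(U K := s)))) (- ?A) (pt x t (U K))"
    proof (rule mat_deriv[OF t U_I[OF K(1)] hg' uminus_carrier_mat[OF A]])
      fix k i assume ik: "k < d2+1" "i < d2+1"
      let ?n = "N - 1 + i"
      have "pd (U K) (g k ?n) (pt x t) = - (\<Sum>m<?n+bw+d2+2. g k m (pt x t) * U_mat d2 (\<alpha> t) K m ?n)"
        using dg[OF p U_I[OF K(1)], of k ?n] K ik by (simp add: upp_def dapp_def Mp_def Mm_def del: sum.lessThan_Suc add_2_eq_Suc')
      also have "(\<Sum>m<?n+bw+d2+2. g k m (pt x t) * U_mat d2 (\<alpha> t) K m ?n) = (\<Sum>j=0..K. g k (?n - j) (pt x t) * U_mat d2 (\<alpha> t) K (?n - j) ?n)"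
        by (rule sum_down) (use K Mm_band[of _ "U K" ?n t] in \<open>auto simp: Mm_def low_def upp_def\<close>)
      finally show "(- ?A) $$ (k, i) = pd (U K) (g k ?n) (pt x t)"
        unfolding uminus_entry[OF A ik] using w.win_fold_down[of i k K N "U_mat d2 (\<alpha> t) K"] ik K by simp
    qed
    then show "has_u_deriv (d2+1) (?G (N-1) x) K (- (?G (N-1) x t * dual_fold_down d2 (\<alpha> t) x (U_mat d2 (\<alpha> t) K) K N)) t"
      unfolding G has_u_deriv_def pt_upd_U pt_U .
  }
  fix J assume J: "J \<in> {1..d2+1}"
  let ?A = "w.win (N-1) * dual_fold_up d2 (\<alpha> t) x (V_mat d1 (\<beta> t) J) J N"
  have "has_mat_deriv (d2+1) (\<lambda>s. Matrix.mat (d2+1) (d2+1) (\<lambda>(k, i). g k (N - 1 + i) ((pt x t)(V J := s)))) ?A (pt x t (V J))"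
  proof (rule mat_deriv[OF t V_I[OF J] hg'])
    show "?A \<in> carrier_mat (d2+1) (d2+1)"
      by (rule mult_carrier_mat[OF w.win_carrier]) (simp add: dual_fold_up_def mat_sum_def)
    fix k i assume ik: "k < d2+1" "i < d2+1"
    let ?n = "N - 1 + i"
    have "pd (V J) (g k ?n) (pt x t) = (\<Sum>m<?n+bw+d2+2. g k m (pt x t) * V_mat d1 (\<beta> t) J ?n m)"
      using dg[OF p V_I[OF J], of k ?n] ik by (simp add: upp_def dapp_def Mp_def Mm_def sum_negf del: sum.lessThan_Suc add_2_eq_Suc')
    also have "(\<Sum>m<?n+bw+d2+2. g k m (pt x t) * V_mat d1 (\<beta> t) J ?n m) = (\<Sum>j=0..J. g k (?n + j) (pt x t) * V_mat d1 (\<beta> t) J ?n (?n + j))"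
      by (rule sum_up) (use J Mm_band[of _ "V J" ?n t] in \<open>auto simp: bw_def Mm_def low_def upp_def\<close>)
    finally show "?A $$ (k, i) = pd (V J) (g k ?n) (pt x t)"
      using w.win_fold_up[of i k N "V_mat d1 (\<beta> t) J" J] ik N by simp
  qed
  then show "has_v_deriv (d2+1) (?G (N-1) x) J (?G (N-1) x t * dual_fold_up d2 (\<alpha> t) x (V_mat d1 (\<beta> t) J) J N) t"
    unfolding G has_v_deriv_def pt_upd_V pt_V .
qed

end

text \<open>The Christoffel-Darboux matrix is the surviving corner of the commutator, with row
  \<open>a\<close> standing for the index \<open>N - 1 + a\<close> and column \<open>b\<close> for
  \<open>N - d2 + b\<close>. Diagonal entries of \<open>Lm\<close> are always cut off, so
  \<open>x\<close> does not appear in it.\<close>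

lemma christoffel_darboux_cut:
  assumes N: "N \<ge> d2 + 1" and ab: "a \<le> d2" "b \<le> d2"
  shows "Lm (N - 1 + a) (N - d2 + b) (pt x t) * (of_bool (N - d2 + b < N) - of_bool (N - 1 + a < N)) = christoffel_darboux d2 (\<alpha> t) N $$ (a, b)"
proof (cases "a = 0")
  case True
  then show ?thesis
    using N ab d2 by (cases "b = d2") (auto simp: christoffel_darboux_def Lm_def Q_mat_def of_nat_diff)
next
  case False
  then have e: "int (N - 1 + a) - int (N - d2 + b) = int d2 + int (a - 1) - int b" "N - 1 + a = N + (a - 1)" "N - 1 + a \<ge> N"
    using N by auto
  show ?thesis
  proof (cases "b = d2")
    case True then show ?thesis using False N ab d2 by (auto simp: christoffel_darboux_def)
  next
    case b: False
    then have "N - d2 + b < N" using N ab by simp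
    then show ?thesis
      using False b N ab e(3) unfolding Lm_def Q_mat_def e(1) unfolding e(2) by (auto simp: christoffel_darboux_def)
  qed
qed

lemma pair_mat:
  assumes N: "N \<ge> d2 + 1" and ik: "k \<le> d2" "k' \<le> d2"
  shows "(Matrix.mat (d2+1) (d2+1) (\<lambda>(k, i). g k (N - 1 + i) (pt x t)) * christoffel_darboux d2 (\<alpha> t) N
     * Matrix.mat (d2+1) (d2+1) (\<lambda>(i, k). f k (N - d2 + i) (pt x t))) $$ (k, k') = pair N (g k) (f k') (pt x t)"
proof -
  let ?h = "\<lambda>m l. g k m (pt x t) * Lm m l (pt x t) * (of_bool (l < N) - of_bool (m < N)) * f k' l (pt x t)"
  have z: "?h m l = 0" if "m < N - 1 \<or> m > N - 1 + d2 \<or> l < N - d2 \<or> l > N" for m l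
  proof -
    have "Lm m l (pt x t) * (of_bool (l < N) - of_bool (m < N)) = 0" by (rule cut_zero) (use that N in auto)
    then show ?thesis by simp
  qed
  have "pair N (g k) (f k') (pt x t) = (\<Sum>m<N+d2+1. \<Sum>l<N+d2+1. ?h m l)" unfolding pair_def ..
  also have "\<dots> = (\<Sum>a=0..d2. \<Sum>l<N+d2+1. ?h (N-1+a) l)"
    by (rule sum_up, rule sum.neutral, rule ballI, rule z) (use N in auto)
  also have "\<dots> = (\<Sum>a=0..d2. \<Sum>b=0..d2. ?h (N-1+a) (N-d2+b))"
    by (rule sum.cong[OF refl], rule sum_up, rule z) (use N in auto)
  also have "\<dots> = (\<Sum>b=0..d2. \<Sum>a=0..d2. ?h (N-1+a) (N-d2+b))" by (rule sum.swap)
  also have "\<dots> = (\<Sum>b=0..d2. (\<Sum>a=0..d2. g k (N - 1 + a) (pt x t) * christoffel_darboux d2 (\<alpha> t) N $$ (a, b)) * f k' (N - d2 + b) (pt x t))"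
    unfolding sum_distrib_right
  proof (intro sum.cong refl)
    fix b a assume "b \<in> {0..d2}" "a \<in> {0..d2}"
    then have ab: "a \<le> d2" "b \<le> d2" by auto
    show "?h (N-1+a) (N-d2+b) = g k (N - 1 + a) (pt x t) * christoffel_darboux d2 (\<alpha> t) N $$ (a, b) * f k' (N - d2 + b) (pt x t)"
      unfolding christoffel_darboux_cut[OF N ab, of x t, symmetric] by (simp only: mult.assoc)
  qed
  finally show ?thesis
    using ik by (simp add: scalar_prod_def christoffel_darboux_def atLeast0LessThan lessThan_Suc_atMost atLeast0AtMost del: sum.lessThan_Suc sum.atMost_Suc)
qed

theorem fundamental_pair:
  "\<exists>F G. Psi_system d1 d2 T \<alpha> \<beta> F \<and> dual_Phi_system d1 d2 T \<alpha> \<beta> G \<and>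
     (\<forall>t\<in>T. \<forall>x. \<forall>N\<ge>d2+1. G (N-1) x t * christoffel_darboux d2 (\<alpha> t) N * F N x t = 1\<^sub>m (d2+1))"
proof -
  obtain f where f0: "(\<forall>k n. hol I \<Omega> (f k n)) \<and> (\<forall>p\<in>\<Omega>. (\<forall>k. \<forall>n\<ge>d2. app Lm (f k) n p = 0) \<and>
     (\<forall>i\<in>I. \<forall>k. \<forall>n\<ge>low i. pd i (f k n) p = app (Mp i) (f k) n p) \<and>
     (\<forall>N c. (\<forall>l\<le>d2. (\<Sum>k\<le>d2. c k * f k (N + l) p) = 0) \<longrightarrow> (\<forall>k\<le>d2. c k = 0)))"
    by (rule exE[OF solution])
  have hf: "hol I \<Omega> (f k n)" for k n using f0 by blast
  note f = bspec[OF conjunct2[OF f0]]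
  have kf: "app Lm (f k) n p = 0" if "p \<in> \<Omega>" "n \<ge> d2" for p k n using f[OF that(1)] that(2) by blast
  have df: "pd i (f k n) p = app (Mp i) (f k) n p" if "p \<in> \<Omega>" "i \<in> I" "n \<ge> low i" for p i k n
    using f[OF that(1)] that(2,3) by blast
  have ns: "c k = 0" if "p \<in> \<Omega>" "\<And>l. l \<le> d2 \<Longrightarrow> (\<Sum>k\<le>d2. c k * f k (N + l) p) = 0" "k \<le> d2" for p N c k
    using f[OF that(1)] that(2,3) by blast
  obtain g where g0: "(\<forall>k\<le>d2. \<forall>n. hol I \<Omega> (g k n)) \<and> (\<forall>p\<in>\<Omega>. (\<forall>k\<le>d2. \<forall>n\<ge>1. dapp Lm (g k) n p = 0) \<and>
     (\<forall>i\<in>I. \<forall>k\<le>d2. \<forall>n\<ge>upp i. pd i (g k n) p = - dapp (Mp i) (g k) n p) \<and>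
     (\<forall>N\<ge>d2. \<forall>k\<le>d2. \<forall>k'\<le>d2. pair N (g k) (f k') p = (if k = k' then 1 else 0)) \<and>
     (\<forall>N c. (\<forall>l\<le>d2. (\<Sum>k\<le>d2. c k * g k (N + l) p) = 0) \<longrightarrow> (\<forall>k\<le>d2. c k = 0)))"
  proof (rule exE[OF dual_solution[where f = f, OF hf kf df]])
    show "c k = 0" if "p \<in> \<Omega>" "\<And>l. l \<le> d2 \<Longrightarrow> (\<Sum>k\<le>d2. c k * f k (N + l) p) = 0" "k \<le> d2" for p N c k
      by (rule ns[OF that])
  qed (assumption | rule that)+
  note hg = conjunct1[OF g0] and g = bspec[OF conjunct2[OF g0]]
  \<comment> \<open>The window of \<open>?F\<close> with index \<open>N\<close> ends at
    \<open>N\<close>, that of \<open>?G\<close> with upper index \<open>N - 1\<close> begins at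
    \<open>N - 1\<close>; these are the two windows on which the concomitant at \<open>N\<close> is
    supported.\<close>
  let ?F = "\<lambda>N x t. Matrix.mat (d2+1) (d2+1) (\<lambda>(i, k). f k (N - d2 + i) (pt x t))"
  let ?G = "\<lambda>N x t. Matrix.mat (d2+1) (d2+1) (\<lambda>(k, i). g k (N + i) (pt x t))"
  have "Psi_system d1 d2 T \<alpha> \<beta> ?F"
  proof (rule Psi_system[where f = f, OF hf kf df])
    show "c k = 0" if "p \<in> \<Omega>" "\<And>l. l \<le> d2 \<Longrightarrow> (\<Sum>k\<le>d2. c k * f k (N + l) p) = 0" "k \<le> d2" for p N c k
      by (rule ns[OF that])
  qed
  moreover have "dual_Phi_system d1 d2 T \<alpha> \<beta> ?G"
  proof (rule dual_Phi_system[where g = g])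
    show "hol I \<Omega> (g k n)" if "k \<le> d2" for k n using hg that by blast
    show "dapp Lm (g k) n p = 0" if "p \<in> \<Omega>" "k \<le> d2" "n \<ge> 1" for p k n using g[OF that(1)] that(2,3) by blast
    show "pd i (g k n) p = - dapp (Mp i) (g k) n p" if "p \<in> \<Omega>" "i \<in> I" "k \<le> d2" "n \<ge> upp i" for p i k n
      using g[OF that(1)] that(2-4) by blast
    show "c k = 0" if "p \<in> \<Omega>" "\<And>l. l \<le> d2 \<Longrightarrow> (\<Sum>k\<le>d2. c k * g k (N + l) p) = 0" "k \<le> d2" for p N c k
      using g[OF that(1)] that(2,3) by blast
  qed
  moreover have "?G (N-1) x t * christoffel_darboux d2 (\<alpha> t) N * ?F N x t = 1\<^sub>m (d2+1)" if t: "t \<in> T" and N: "N \<ge> d2+1" for t x N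
  proof (rule eq_matI)
    fix k k' assume "k < dim_row (1\<^sub>m (d2+1))" "k' < dim_col (1\<^sub>m (d2+1))"
    then have k: "k \<le> d2" "k' \<le> d2" by auto
    then have "pair N (g k) (f k') (pt x t) = (if k = k' then 1 else 0)" using g[OF pt_dom[OF t]] N by simp
    then show "(?G (N-1) x t * christoffel_darboux d2 (\<alpha> t) N * ?F N x t) $$ (k, k') = 1\<^sub>m (d2+1) $$ (k, k')"
      unfolding pair_mat[OF N k] using k by simp
  qed auto
  ultimately show ?thesis by blast
qed

end

section \<open>Moments\<close>

text \<open>On the disc of radius \<open>e\<close> the real part of \<open>d * m\<close> is at most
  \<open>e * (\<bar>Re m\<bar> + \<bar>Im m\<bar>)\<close>, hence at most \<open>2 * e\<close> times
  the larger summand, and this is the real part of \<open>c * m\<close> for one of the four points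
  \<open>c\<close>. A whole disc is thus dominated by four exponentials.\<close>

lemma norm_exp_le_corners:
  fixes m d :: complex
  assumes "norm d \<le> e" "e > 0"
  shows "norm (exp (d * m)) \<le> (\<Sum>c\<in>{2*e, -2*e, 2*e*\<i>, -2*e*\<i>}. norm (exp (c * m)))"
proof -
  let ?C = "{complex_of_real (2*e), complex_of_real (-2*e), 2*e*\<i>, -2*e*\<i>}"
  have "Re (d * m) \<le> norm d * norm m" using complex_Re_le_cmod[of "d * m"] by (simp add: norm_mult)
  also have "\<dots> \<le> e * (\<bar>Re m\<bar> + \<bar>Im m\<bar>)" using assms cmod_le[of m] by (intro mult_mono) auto
  also have "\<dots> \<le> 2 * e * max \<bar>Re m\<bar> \<bar>Im m\<bar>" using assms(2) mult_left_mono[of "\<bar>Re m\<bar> + \<bar>Im m\<bar>" "2 * max \<bar>Re m\<bar> \<bar>Im m\<bar>" e] by (simp add: mult_ac)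
  finally have le: "Re (d * m) \<le> 2 * e * max \<bar>Re m\<bar> \<bar>Im m\<bar>" .
  have ex: "\<exists>c\<in>?C. Re (c * m) = 2 * e * max \<bar>Re m\<bar> \<bar>Im m\<bar>"
    by (cases "\<bar>Re m\<bar> \<le> \<bar>Im m\<bar>"; cases "Re m \<ge> 0"; cases "Im m \<ge> 0") (auto simp: max_def)
  then obtain c where c: "c \<in> ?C" "Re (c * m) = 2 * e * max \<bar>Re m\<bar> \<bar>Im m\<bar>" by (rule bexE)
  have "norm (exp (d * m)) \<le> norm (exp (c * m))" using c(2) le by simp
  also have "\<dots> \<le> (\<Sum>c\<in>?C. norm (exp (c * m)))" using c(1) by (intro member_le_sum) auto
  finally show ?thesis by simp
qed

text \<open>The exponent of the weight is affine in the parameters with these coefficients.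
  \<open>X\<close> gets \<open>0\<close> because the spectral variable is not the integration
  variable.\<close>

definition coord_fun :: "complex \<Rightarrow> complex \<Rightarrow> coord \<Rightarrow> complex" where
  "coord_fun x y i = (case i of X \<Rightarrow> 0 | U K \<Rightarrow> - (x ^ K / of_nat K) | V J \<Rightarrow> - (y ^ J / of_nat J))"

lemma weight_coords: "weight d1 d2 (par p) x y = exp (x * y + (\<Sum>i\<in>coords d1 d2. p i * coord_fun x y i))"
proof -
  have "(\<Sum>i\<in>coords d1 d2. p i * coord_fun x y i) = (\<Sum>i\<in>U ` {1..d1+1}. p i * coord_fun x y i) + (\<Sum>i\<in>V ` {1..d2+1}. p i * coord_fun x y i)"
    unfolding coords_def by (subst sum.insert, simp, force, subst sum.union_disjoint) (auto simp: coord_fun_def)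
  also have "\<dots> = (\<Sum>k=1..d1+1. p (U k) * coord_fun x y (U k)) + (\<Sum>k=1..d2+1. p (V k) * coord_fun x y (V k))"
    by (subst (1 2) sum.reindex) (auto simp: inj_on_def)
  also have "\<dots> = - potential d1 (fst (par p)) x - potential d2 (snd (par p)) y"
    by (simp add: coord_fun_def potential_def par_def sum_negf)
  finally show ?thesis unfolding weight_def by (simp only: add.commute)
qed

text \<open>The integrable majorants for differentiation under the integral come from the convergence
  hypothesis itself, at finitely many other parameter points.\<close>

lemma weight_dominated:
  assumes T: "openin (top_of_set (param_space d1 d2)) T" and p: "p \<in> dom_of T"
  shows "\<exists>e \<Gamma> (s :: (coord \<Rightarrow> complex) \<Rightarrow> params). e > 0 \<and> finite \<Gamma> \<and> (\<forall>c\<in>\<Gamma>. s c \<in> T) \<and>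
    (\<forall>q x y. (\<forall>i\<in>coords d1 d2. norm (q i - p i) \<le> e) \<longrightarrow>
       norm (weight d1 d2 (par q) x y) \<le> (\<Sum>c\<in>\<Gamma>. norm (weight d1 d2 (s c) x y)))"
proof -
  let ?I = "coords d1 d2"
  obtain e0 where e0: "e0 > 0" "polybox ?I p e0 \<subseteq> dom_of T" using hdom_dom_of[OF T] p by (auto simp: hdom_def)
  \<comment> \<open>The shifts in \<open>?C\<close> have norm \<open>2 * e\<close>, which has to
    stay below \<open>e0\<close>.\<close>
  define e where "e = e0 / 3"
  have e: "e > 0" using e0 by (simp add: e_def)
  let ?C = "{complex_of_real (2*e), complex_of_real (-2*e), 2*e*\<i>, -2*e*\<i>}"
  \<comment> \<open>One of the four shifts is chosen independently in each coordinate; expanding the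
    product of the four-term sums gives a sum over \<open>\<Gamma>\<close>.\<close>
  define \<Gamma> where "\<Gamma> = PiE ?I (\<lambda>_. ?C)"
  define sh where "sh c = (\<lambda>i. p i + (if i \<in> ?I then c i else 0))" for c
  show ?thesis
  proof (intro exI[of _ e] exI[of _ \<Gamma>] exI[of _ "\<lambda>c. par (sh c)"] conjI ballI allI impI)
    show "finite \<Gamma>" unfolding \<Gamma>_def by (rule finite_PiE) (auto simp: finite_coords)
    show "par (sh c) \<in> T" if c: "c \<in> \<Gamma>" for c
    proof -
      have "norm (c i) < e0" if "i \<in> ?I" for i
      proof -
        have "c i \<in> ?C" using c that unfolding \<Gamma>_def by (rule PiE_mem)
        moreover have "\<forall>z\<in>?C. norm z = 2 * e" using e by (simp add: norm_mult)
        ultimately have "norm (c i) = 2 * e" by blast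
        then show ?thesis using e0(1) by (simp add: e_def)
      qed
      then have "sh c \<in> polybox ?I p e0" by (auto simp: polybox_def sh_def dist_norm)
      then show ?thesis using e0(2) by (auto simp: dom_of_def)
    qed
    fix q x y assume q: "\<forall>i\<in>?I. norm (q i - p i) \<le> e"
    let ?m = "coord_fun x y"
    \<comment> \<open>The quotient of two weights is a product of exponentials, one per coordinate,
      so the bound can be taken coordinatewise.\<close>
    have sp: "weight d1 d2 (par q') x y = weight d1 d2 (par p) x y * (\<Prod>i\<in>?I. exp ((q' i - p i) * ?m i))" for q'
      unfolding weight_coords exp_sum[OF finite_coords, symmetric] exp_add[symmetric]
      by (simp add: left_diff_distrib sum_subtractf add.assoc)
    have "norm (weight d1 d2 (par q) x y) = norm (weight d1 d2 (par p) x y) * (\<Prod>i\<in>?I. norm (exp ((q i - p i) * ?m i)))"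
      unfolding sp[of q] by (simp only: norm_mult prod_norm)
    also have "\<dots> \<le> norm (weight d1 d2 (par p) x y) * (\<Prod>i\<in>?I. \<Sum>c\<in>?C. norm (exp (c * ?m i)))"
      by (intro mult_left_mono prod_mono conjI norm_ge_zero) (use norm_exp_le_corners[OF q[rule_format] e] in auto)
    also have "(\<Prod>i\<in>?I. \<Sum>c\<in>?C. norm (exp (c * ?m i))) = (\<Sum>c\<in>\<Gamma>. \<Prod>i\<in>?I. norm (exp (c i * ?m i)))"
      unfolding \<Gamma>_def by (rule prod_sum_PiE) (auto simp: finite_coords)
    also have "norm (weight d1 d2 (par p) x y) * \<dots> = (\<Sum>c\<in>\<Gamma>. norm (weight d1 d2 (par (sh c)) x y))"
      unfolding sum_distrib_left sp[of "sh _"] norm_mult prod_norm[symmetric]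
      by (intro sum.cong refl arg_cong2[where f = "(*)"] prod.cong) (simp add: sh_def)
    finally show "norm (weight d1 d2 (par q) x y) \<le> (\<Sum>c\<in>\<Gamma>. norm (weight d1 d2 (par (sh c)) x y))" .
  qed (rule e)
qed

section \<open>The moment functional, integration by parts and parameter derivatives\<close>

definition moment :: "nat \<Rightarrow> nat \<Rightarrow> contour \<Rightarrow> contour \<Rightarrow> params \<Rightarrow> complex poly \<Rightarrow> complex poly \<Rightarrow> complex" where
  "moment d1 d2 Gx Gy t P R = dbl_integral Gx Gy (\<lambda>x y. poly P x * poly R y * weight d1 d2 t x y)"

lemma dbl_integral_add:
  assumes "dbl_integrable Gx Gy F" "dbl_integrable Gx Gy G"
  shows "dbl_integral Gx Gy (\<lambda>x y. F x y + G x y) = dbl_integral Gx Gy F + dbl_integral Gx Gy G"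
proof -
  have "integral\<^sup>L lborel (pullback g k (\<lambda>x y. F x y + G x y)) = integral\<^sup>L lborel (pullback g k F) + integral\<^sup>L lborel (pullback g k G)"
    if "g \<in> set Gx" "k \<in> set Gy" for g k
  proof -
    have "pullback g k (\<lambda>x y. F x y + G x y) = (\<lambda>z. pullback g k F z + pullback g k G z)"
      by (auto simp: pullback_def fun_eq_iff distrib_right)
    then show ?thesis using assms that by (simp add: dbl_integrable_def)
  qed
  then have "dbl_integral Gx Gy (\<lambda>x y. F x y + G x y) = (\<Sum>g\<leftarrow>Gx. \<Sum>k\<leftarrow>Gy. integral\<^sup>L lborel (pullback g k F) + integral\<^sup>L lborel (pullback g k G))"
    unfolding dbl_integral_def by (intro arg_cong[where f = sum_list] map_cong refl) auto
  then show ?thesis by (simp add: dbl_integral_def sum_list_addf)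
qed

lemma dbl_integral_cmult: "dbl_integral Gx Gy (\<lambda>x y. c * F x y) = c * dbl_integral Gx Gy F"
proof -
  have "pullback g k (\<lambda>x y. c * F x y) = (\<lambda>z. c * pullback g k F z)" for g k
    by (auto simp: pullback_def fun_eq_iff)
  then show ?thesis by (simp add: dbl_integral_def sum_list_const_mult)
qed

lemma continuous_on_sum_list:
  fixes f :: "'a \<Rightarrow> 'b::topological_space \<Rightarrow> complex"
  shows "(\<And>x. x \<in> set xs \<Longrightarrow> continuous_on S (f x)) \<Longrightarrow> continuous_on S (\<lambda>t. \<Sum>x\<leftarrow>xs. f x t)"
  by (induction xs) (auto intro!: continuous_intros)

lemma DERIV_sum_list:
  fixes f :: "'a \<Rightarrow> complex \<Rightarrow> complex"
  shows "(\<And>x. x \<in> set xs \<Longrightarrow> (f x has_field_derivative f' x) (at z)) \<Longrightarrow> ((\<lambda>t. \<Sum>x\<leftarrow>xs. f x t) has_field_derivative (\<Sum>x\<leftarrow>xs. f' x)) (at z)"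
  by (induction xs) (auto intro!: DERIV_add)

lemma LIMSEQ_integral_eventually:
  fixes F :: "nat \<Rightarrow> 'a \<Rightarrow> complex"
  assumes F: "\<And>n. n \<ge> N \<Longrightarrow> F n \<in> borel_measurable M" and f: "f \<in> borel_measurable M" and w: "integrable M w"
    and lim: "\<And>z. (\<lambda>n. F n z) \<longlonglongrightarrow> f z" and bd: "\<And>n z. n \<ge> N \<Longrightarrow> norm (F n z) \<le> w z"
  shows "(\<lambda>n. integral\<^sup>L M (F n)) \<longlonglongrightarrow> integral\<^sup>L M f"
proof -
  have "(\<lambda>n. integral\<^sup>L M (F (n + N))) \<longlonglongrightarrow> integral\<^sup>L M f"
    by (rule integral_dominated_convergence[OF f _ w]) (use F bd LIMSEQ_ignore_initial_segment[OF lim] in auto)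
  then show ?thesis by (rule LIMSEQ_offset)
qed

lemma continuous_weight: "continuous_on UNIV (\<lambda>t. weight d1 d2 t x y)"
proof -
  have "continuous_on UNIV (\<lambda>t :: params. fst t k)" "continuous_on UNIV (\<lambda>t :: params. snd t k)" for k
    by (rule continuous_on_product_then_coordinatewise; intro continuous_intros)+
  then show ?thesis unfolding weight_def potential_def by (intro continuous_intros) auto
qed

locale moment_space =
  fixes d1 d2 :: nat and Gx Gy :: contour and T :: "params set"
  assumes opT: "openin (top_of_set (param_space d1 d2)) T"
    and conv: "\<And>t. t \<in> T \<Longrightarrow> integrals_converge d1 d2 Gx Gy t"
    and nbt: "\<And>t. t \<in> T \<Longrightarrow> no_boundary_terms d1 d2 Gx Gy t"
begin

abbreviation "w \<equiv> weight d1 d2"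
abbreviation "Mo \<equiv> moment d1 d2 Gx Gy"

lemma int_poly: "t \<in> T \<Longrightarrow> dbl_integrable Gx Gy (\<lambda>x y. poly P x * poly R y * w t x y)"
  using conv[of t] by (simp add: integrals_converge_def)

lemma Mo_add: "t \<in> T \<Longrightarrow> Mo t (P + P') R = Mo t P R + Mo t P' R" "t \<in> T \<Longrightarrow> Mo t P (R + R') = Mo t P R + Mo t P R'"
  unfolding moment_def by (subst dbl_integral_add[symmetric], rule int_poly, assumption, rule int_poly, assumption, simp add: algebra_simps)+

lemma Mo_smult: "Mo t (Polynomial.smult c P) R = c * Mo t P R" "Mo t P (Polynomial.smult c R) = c * Mo t P R"
  unfolding moment_def dbl_integral_cmult[symmetric] by (simp_all add: mult_ac)

text \<open>\<open>b\<close> stands for the potential of the other variable, so one computation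
  serves both.\<close>

lemma pot_exp_deriv:
  "((\<lambda>z. exp (- potential d c z - b + z * y)) has_field_derivative exp (- potential d c x - b + x * y) * (- poly (dpot d c) x + y)) (at x)"
  using poly_dpot[of d c x] by (auto intro!: derivative_eq_intros)

lemma weight_deriv_x: "((\<lambda>z. w t z y) has_field_derivative w t x y * (- poly (dpot d1 (fst t)) x + y)) (at x)"
  using pot_exp_deriv[of d1 "fst t" "potential d2 (snd t) y" y x] by (simp add: weight_def)

lemma weight_deriv_y: "((\<lambda>z. w t x z) has_field_derivative w t x y * (- poly (dpot d2 (snd t)) y + x)) (at y)"
  using pot_exp_deriv[of d2 "snd t" "potential d1 (fst t) x" x y] by (simp add: weight_def algebra_simps)

lemma Mo_parts1:
  assumes t: "t \<in> T"
  shows "Mo t (pderiv P - dpot d1 (fst t) * P) R + Mo t P (monom 1 1 * R) = 0"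
proof -
  have "deriv (\<lambda>z. poly P z * poly R y * w t z y) x =
     poly (pderiv P - dpot d1 (fst t) * P) x * poly R y * w t x y + poly P x * poly (monom 1 1 * R) y * w t x y" for x y
    by (rule DERIV_imp_deriv) (auto intro!: derivative_eq_intros weight_deriv_x simp: poly_monom algebra_simps)
  moreover have "dbl_integral Gx Gy (\<lambda>x y. deriv (\<lambda>z. poly P z * poly R y * w t z y) x) = 0"
    using nbt[OF t] unfolding no_boundary_terms_def by blast
  ultimately show ?thesis
    unfolding moment_def dbl_integral_add[OF int_poly[OF t] int_poly[OF t], symmetric] by (simp only:)
qed

lemma Mo_parts2:
  assumes t: "t \<in> T"
  shows "Mo t (monom 1 1 * P) R + Mo t P (pderiv R - dpot d2 (snd t) * R) = 0"
proof -
  have "deriv (\<lambda>z. poly P x * poly R z * w t x z) y =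
     poly (monom 1 1 * P) x * poly R y * w t x y + poly P x * poly (pderiv R - dpot d2 (snd t) * R) y * w t x y" for x y
    by (rule DERIV_imp_deriv) (auto intro!: derivative_eq_intros weight_deriv_y simp: poly_monom algebra_simps)
  moreover have "dbl_integral Gx Gy (\<lambda>x y. deriv (\<lambda>z. poly P x * poly R z * w t x z) y) = 0"
    using nbt[OF t] unfolding no_boundary_terms_def by blast
  ultimately show ?thesis
    unfolding moment_def dbl_integral_add[OF int_poly[OF t] int_poly[OF t], symmetric] by (simp only:)
qed

abbreviation "pb g k t P R \<equiv> pullback g k (\<lambda>x y. poly P x * poly R y * w t x y)"

lemma int_pb: "t \<in> T \<Longrightarrow> g \<in> set Gx \<Longrightarrow> k \<in> set Gy \<Longrightarrow> integrable lborel (pb g k t P R)"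
  using int_poly[of t P R] by (simp add: dbl_integrable_def)

lemma pb_eq: "pb g k t P R z = w t (g (fst z)) (k (snd z)) *
    (poly P (g (fst z)) * poly R (k (snd z)) * vector_derivative g (at (fst z)) * vector_derivative k (at (snd z)))"
  by (simp add: pullback_def case_prod_unfold)

lemma pb_dominated:
  assumes bd: "\<And>x y. norm (w t x y) \<le> (\<Sum>c\<in>\<Gamma>. norm (w (s c) x y))"
  shows "norm (pb g k t P R z) \<le> (\<Sum>c\<in>\<Gamma>. norm (pb g k (s c) P R z))"
  unfolding pb_eq norm_mult[of "w _ _ _"] sum_distrib_right[symmetric] by (intro mult_right_mono bd norm_ge_zero)

text \<open>Dominated convergence along sequences in \<open>T\<close>; the majorant from
  \<open>weight_dominated\<close> is integrable because its finitely many parameter points lie in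
  \<open>T\<close>.\<close>

lemma Mo_cont: "continuous_on T (\<lambda>t. Mo t P R)"
  unfolding moment_def dbl_integral_def
proof (intro continuous_on_sum_list)
  fix g k assume gk: "g \<in> set Gx" "k \<in> set Gy"
  show "continuous_on T (\<lambda>t. integral\<^sup>L lborel (pb g k t P R))"
    unfolding continuous_on_sequentially comp_def
  proof (intro allI ballI impI, elim conjE)
    fix X t assume t: "t \<in> T" and X: "\<forall>n. X n \<in> T" "X \<longlonglongrightarrow> t"
    \<comment> \<open>The spectral coordinate does not enter the weight and is set to
      \<open>0\<close>.\<close>
    have p: "pt 0 t \<in> dom_of T" using t by (simp add: dom_of_def)
    obtain e \<Gamma> and s :: "(coord \<Rightarrow> complex) \<Rightarrow> params" where D: "e > 0 \<and> finite \<Gamma> \<and> (\<forall>c\<in>\<Gamma>. s c \<in> T) \<and>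
      (\<forall>q x y. (\<forall>i\<in>coords d1 d2. norm (q i - pt 0 t i) \<le> e) \<longrightarrow> norm (w (par q) x y) \<le> (\<Sum>c\<in>\<Gamma>. norm (w (s c) x y)))"
      using weight_dominated[OF opT p] by (elim exE) (rule that)
    have e: "e > 0" and \<Gamma>: "finite \<Gamma>" "\<And>c. c \<in> \<Gamma> \<Longrightarrow> s c \<in> T" using D by auto
    have bd: "norm (w (par q) x y) \<le> (\<Sum>c\<in>\<Gamma>. norm (w (s c) x y))" if "\<And>i. i \<in> coords d1 d2 \<Longrightarrow> norm (q i - pt 0 t i) \<le> e" for q x y
      using D that by simp
    have "eventually (\<lambda>n. norm (pt 0 (X n) i - pt 0 t i) < e) sequentially" for i
    proof -
      have "continuous_on UNIV (\<lambda>t. pt 0 t i)"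
        by (rule continuous_on_product_then_coordinatewise[OF continuous_pt]) (auto intro: continuous_intros)
      then have "(\<lambda>n. pt 0 (X n) i) \<longlonglongrightarrow> pt 0 t i" using X(2) by (rule continuous_on_tendsto_compose) auto
      then show ?thesis using e by (auto simp: tendsto_iff dist_norm)
    qed
    then have "eventually (\<lambda>n. \<forall>i\<in>coords d1 d2. norm (pt 0 (X n) i - pt 0 t i) < e) sequentially"
      using finite_coords by (intro eventually_ball_finite) auto
    then obtain N where N: "\<And>n i. n \<ge> N \<Longrightarrow> i \<in> coords d1 d2 \<Longrightarrow> norm (pt 0 (X n) i - pt 0 t i) < e"
      unfolding eventually_sequentially by blast
    show "(\<lambda>n. integral\<^sup>L lborel (pb g k (X n) P R)) \<longlonglongrightarrow> integral\<^sup>L lborel (pb g k t P R)"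
    proof (rule LIMSEQ_integral_eventually)
      show "pb g k (X n) P R \<in> borel_measurable lborel" for n using int_pb[OF X(1)[rule_format] gk] by simp
      show "pb g k t P R \<in> borel_measurable lborel" using int_pb[OF t gk] by simp
      show "integrable lborel (\<lambda>z. \<Sum>c\<in>\<Gamma>. norm (pb g k (s c) P R z))"
        by (intro Bochner_Integration.integrable_sum integrable_norm int_pb \<Gamma> gk)
      show "(\<lambda>n. pb g k (X n) P R z) \<longlonglongrightarrow> pb g k t P R z" for z
        unfolding pb_eq by (intro tendsto_mult tendsto_const continuous_on_tendsto_compose[OF continuous_weight X(2)]) auto
      show "norm (pb g k (X n) P R z) \<le> (\<Sum>c\<in>\<Gamma>. norm (pb g k (s c) P R z))" if "n \<ge> N" for n z
        by (rule pb_dominated) (use bd[of "pt 0 (X n)"] N[OF that] in \<open>force intro: less_imp_le\<close>)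
    qed
  qed
qed

lemma weight_deriv_coord:
  assumes i: "i \<in> coords d1 d2"
  shows "((\<lambda>s. w (par (p(i := s))) x y) has_field_derivative coord_fun x y i * w (par (p(i := s))) x y) (at s within S)"
proof -
  have "(\<Sum>j\<in>coords d1 d2. (p(i := s)) j * coord_fun x y j) = s * coord_fun x y i + (\<Sum>j\<in>coords d1 d2 - {i}. p j * coord_fun x y j)" for s
    by (subst sum.remove[OF finite_coords i]) simp
  then show ?thesis unfolding weight_coords by (auto intro!: derivative_eq_intros)
qed

text \<open>The derivative multiplies the integrand by \<open>coord_fun\<close>, a multiple of a
  power of \<open>x\<close> or of \<open>y\<close>, which \<open>P'\<close> or \<open>R'\<close>
  absorbs; so both families of parameters share one proof. The mean value inequality on the disc of
  radius \<open>e\<close> bounds the difference quotients by the majorant of the derivative.\<close>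

lemma Mo_deriv:
  assumes p: "p \<in> dom_of T" and i: "i \<in> coords d1 d2"
    and PR: "\<And>x y. coord_fun x y i * (poly P x * poly R y) = poly P' x * poly R' y"
  shows "((\<lambda>s. Mo (par (p(i := s))) P R) has_field_derivative Mo (par p) P' R') (at (p i))"
  unfolding moment_def dbl_integral_def
proof (intro DERIV_sum_list)
  fix g k assume gk: "g \<in> set Gx" "k \<in> set Gy"
  obtain e \<Gamma> and s :: "(coord \<Rightarrow> complex) \<Rightarrow> params" where D: "e > 0 \<and> finite \<Gamma> \<and> (\<forall>c\<in>\<Gamma>. s c \<in> T) \<and>
    (\<forall>q x y. (\<forall>i\<in>coords d1 d2. norm (q i - p i) \<le> e) \<longrightarrow> norm (w (par q) x y) \<le> (\<Sum>c\<in>\<Gamma>. norm (w (s c) x y)))"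
    using weight_dominated[OF opT p] by (elim exE) (rule that)
  have e: "e > 0" and \<Gamma>: "finite \<Gamma>" "\<And>c. c \<in> \<Gamma> \<Longrightarrow> s c \<in> T" using D by auto
  have bd: "norm (w (par q) x y) \<le> (\<Sum>c\<in>\<Gamma>. norm (w (s c) x y))" if "\<And>i. i \<in> coords d1 d2 \<Longrightarrow> norm (q i - p i) \<le> e" for q x y
    using D that by simp
  let ?f = "\<lambda>s. pb g k (par (p(i := s))) P R"
  have pbd: "norm (pb g k (par (p(i := u))) P' R' z) \<le> (\<Sum>c\<in>\<Gamma>. norm (pb g k (s c) P' R' z))" if "u \<in> cball (p i) e" for u z
    by (rule pb_dominated, rule bd) (use that e in \<open>auto simp: dist_norm norm_minus_commute\<close>)
  have fd: "((\<lambda>u. ?f u z) has_field_derivative pb g k (par (p(i := u))) P' R' z) (at u within S)" for u z S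
  proof -
    have "((\<lambda>u. ?f u z) has_field_derivative coord_fun (g (fst z)) (k (snd z)) i * w (par (p(i := u))) (g (fst z)) (k (snd z)) *
       (poly P (g (fst z)) * poly R (k (snd z)) * vector_derivative g (at (fst z)) * vector_derivative k (at (snd z)))) (at u within S)"
      unfolding pb_eq by (rule DERIV_cmult_right[OF weight_deriv_coord[OF i]])
    moreover have "coord_fun (g (fst z)) (k (snd z)) i * w (par (p(i := u))) (g (fst z)) (k (snd z)) *
       (poly P (g (fst z)) * poly R (k (snd z)) * vector_derivative g (at (fst z)) * vector_derivative k (at (snd z))) = pb g k (par (p(i := u))) P' R' z"
      unfolding pb_eq PR[of "g (fst z)" "k (snd z)", symmetric] by (simp only: mult_ac)
    ultimately show ?thesis by (simp only:)
  qed
  obtain e' where e': "e' > 0" "\<And>u. u \<in> ball (p i) e' \<Longrightarrow> p(i := u) \<in> dom_of T" using hdom_upd[OF hdom_dom_of[OF opT] p i] by auto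
  show "((\<lambda>u. integral\<^sup>L lborel (?f u)) has_field_derivative integral\<^sup>L lborel (pb g k (par p) P' R')) (at (p i))"
    unfolding has_field_derivative_iff tendsto_at_iff_sequentially comp_def
  proof (intro allI impI)
    fix Y assume Y: "\<forall>n. Y n \<in> UNIV - {p i}" "Y \<longlonglongrightarrow> p i"
    have "eventually (\<lambda>n. dist (Y n) (p i) < min e e') sequentially" using tendstoD[OF Y(2), of "min e e'"] e e'(1) by simp
    then obtain N where N: "\<And>n. n \<ge> N \<Longrightarrow> dist (Y n) (p i) < min e e'" unfolding eventually_sequentially by blast
    have parT: "par p \<in> T" using p by (simp add: dom_of_def)
    have YT: "par (p(i := Y n)) \<in> T" if "n \<ge> N" for n
      using e'(2)[of "Y n"] N[OF that] by (simp add: dom_of_def dist_commute)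
    have I: "integrable lborel (?f (Y n))" if "n \<ge> N" for n by (rule int_pb[OF YT[OF that] gk])
    have I0: "integrable lborel (?f (p i))" using int_pb[OF parT gk] by simp
    have lim: "(\<lambda>n. integral\<^sup>L lborel (\<lambda>z. (?f (Y n) z - ?f (p i) z) / (Y n - p i))) \<longlonglongrightarrow> integral\<^sup>L lborel (pb g k (par p) P' R')"
    proof (rule LIMSEQ_integral_eventually)
      show "(\<lambda>z. (?f (Y n) z - ?f (p i) z) / (Y n - p i)) \<in> borel_measurable lborel" if "n \<ge> N" for n
        using I[OF that] I0 by (intro borel_measurable_divide borel_measurable_diff borel_measurable_const) auto
      show "pb g k (par p) P' R' \<in> borel_measurable lborel" using int_pb[OF parT gk] by simp
      show "integrable lborel (\<lambda>z. \<Sum>c\<in>\<Gamma>. norm (pb g k (s c) P' R' z))"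
        by (intro Bochner_Integration.integrable_sum integrable_norm int_pb \<Gamma> gk)
      show "(\<lambda>n. (?f (Y n) z - ?f (p i) z) / (Y n - p i)) \<longlonglongrightarrow> pb g k (par p) P' R' z" for z
        using fd[of z "p i" UNIV] Y unfolding has_field_derivative_iff tendsto_at_iff_sequentially comp_def by simp
      show "norm ((?f (Y n) z - ?f (p i) z) / (Y n - p i)) \<le> (\<Sum>c\<in>\<Gamma>. norm (pb g k (s c) P' R' z))" if n: "n \<ge> N" for n z
      proof -
        have "norm (?f (Y n) z - ?f (p i) z) \<le> (\<Sum>c\<in>\<Gamma>. norm (pb g k (s c) P' R' z)) * norm (Y n - p i)"
          by (rule field_differentiable_bound[OF convex_cball[of "p i" e] fd pbd]) (use N[OF n] e in \<open>auto simp: dist_commute\<close>)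
        moreover have "norm (Y n - p i) > 0" using Y(1) by simp
        ultimately show ?thesis by (simp add: norm_divide divide_le_eq)
      qed
    qed
    have "eventually (\<lambda>n. integral\<^sup>L lborel (\<lambda>z. (?f (Y n) z - ?f (p i) z) / (Y n - p i)) =
       (integral\<^sup>L lborel (?f (Y n)) - integral\<^sup>L lborel (?f (p i))) / (Y n - p i)) sequentially"
      by (rule eventually_sequentiallyI[of N]) (use I I0 in simp)
    then show "(\<lambda>n. (integral\<^sup>L lborel (?f (Y n)) - integral\<^sup>L lborel (?f (p i))) / (Y n - p i)) \<longlonglongrightarrow> integral\<^sup>L lborel (pb g k (par p) P' R')"
      by (rule Lim_transform_eventually[OF lim])
  qed
qed

lemma Mo_deriv_u:
  assumes t: "t \<in> T" and K: "K \<in> {1..d1+1}"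
  shows "((\<lambda>s. Mo ((fst t)(K := s), snd t) P R) has_field_derivative - (1 / of_nat K) * Mo t (monom 1 K * P) R) (at (fst t K))"
proof -
  have "((\<lambda>s. Mo (par ((pt 0 t)(U K := s))) P R) has_field_derivative Mo (par (pt 0 t)) (Polynomial.smult (- (1 / of_nat K)) (monom 1 K * P)) R) (at (pt 0 t (U K)))"
    by (rule Mo_deriv) (use t K in \<open>auto simp: dom_of_def coords_def coord_fun_def poly_monom\<close>)
  then show ?thesis by (simp only: pt_upd_U par_pt pt_U Mo_smult)
qed

lemma Mo_deriv_v:
  assumes t: "t \<in> T" and J: "J \<in> {1..d2+1}"
  shows "((\<lambda>s. Mo (fst t, (snd t)(J := s)) P R) has_field_derivative - (1 / of_nat J) * Mo t P (monom 1 J * R)) (at (snd t J))"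
proof -
  have "((\<lambda>s. Mo (par ((pt 0 t)(V J := s))) P R) has_field_derivative Mo (par (pt 0 t)) P (Polynomial.smult (- (1 / of_nat J)) (monom 1 J * R))) (at (pt 0 t (V J)))"
    by (rule Mo_deriv) (use t J in \<open>auto simp: dom_of_def coords_def coord_fun_def poly_monom\<close>)
  then show ?thesis by (simp only: pt_upd_V par_pt pt_V Mo_smult)
qed

end

section \<open>Exchange of the two variables\<close>

lemma V_mat_eq_U_mat: "V_mat d b J = U_mat d b J"
  by (simp add: V_mat_def U_mat_def P_mat_Q_mat)

lemma swap_T: "t \<in> prod.swap ` T \<longleftrightarrow> prod.swap t \<in> T"
  by (metis image_iff swap_swap)

lemma continuous_swap: "continuous_on S (prod.swap :: 'a::topological_space \<times> 'b::topological_space \<Rightarrow> _)"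
  unfolding prod.swap_def[abs_def] by (intro continuous_intros)

context bimoment begin

text \<open>The recursion is assumed for the wave functions in \<open>x\<close> only. For those in
  \<open>y\<close> it follows from \<open>y_\<sigma>\<close>, with \<open>\<beta>\<close> in the
  role of \<open>\<alpha>\<close>.\<close>

lemma y_wave:
  assumes t: "t \<in> T"
  shows "y * wave_fun d2 (prod.swap t) (\<sigma> t) (r t) n y = (\<Sum>m<n+2. Rm t n m * wave_fun d2 (prod.swap t) (\<sigma> t) (r t) m y)"
proof -
  have "poly (monom 1 1 * \<sigma> t n) y = poly (\<Sum>m<n+2. Polynomial.smult (Rm t n m * r t n / r t m) (\<sigma> t m)) y"
    by (simp only: y_\<sigma>[OF t])
  then have "y * poly (\<sigma> t n) y = (\<Sum>m<n+2. Rm t n m * r t n / r t m * poly (\<sigma> t m) y)"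
    by (simp add: poly_sum poly_monom del: sum.lessThan_Suc add_2_eq_Suc')
  then have "y * wave_fun d2 (prod.swap t) (\<sigma> t) (r t) n y = (\<Sum>m<n+2. Rm t n m * r t n / r t m * poly (\<sigma> t m) y) * (exp (- potential d2 (snd t) y) / r t n)"
    by (simp add: wave_fun_def)
  also have "\<dots> = (\<Sum>m<n+2. Rm t n m * wave_fun d2 (prod.swap t) (\<sigma> t) (r t) m y)"
    unfolding sum_distrib_right by (intro sum.cong refl) (use r_nz[OF t] in \<open>simp add: wave_fun_def\<close>)
  finally show ?thesis .
qed

text \<open>Integration by parts in \<open>y\<close> expresses the expansion coefficients of the
  derivative by those of multiplication by \<open>x\<close> in the first argument, that is by the
  transpose of \<open>- Q\<close>.\<close>

lemma dy_wave:
  assumes t: "t \<in> T"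
  shows "(wave_fun d2 (prod.swap t) (\<sigma> t) (r t) n has_field_derivative
     (\<Sum>m<n+d2+1. P_mat d2 (\<alpha> t) n m * wave_fun d2 (prod.swap t) (\<sigma> t) (r t) m y)) (at y)"
proof -
  let ?R = "pderiv (\<sigma> t n) - dpot d2 (snd t) * \<sigma> t n"
  have "?R = (\<Sum>m<n+d2+1. Polynomial.smult (B t (\<pi> t m) ?R / h t m) (\<sigma> t m))"
  proof (rule expand_\<sigma>[OF t])
    fix j assume "j \<ge> n + d2 + 1"
    then show "coeff ?R j = 0"
      using coeff_low_dpot_mult[of n "\<sigma> t n" d2 j "snd t"] coeff_\<sigma>(2)[OF t, of n] by (simp add: coeff_pderiv)
  qed
  also have "\<dots> = (\<Sum>m<n+d2+1. Polynomial.smult (P_mat d2 (\<alpha> t) n m * r t n / r t m) (\<sigma> t m))"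
  proof (intro sum.cong refl arg_cong2[where f = Polynomial.smult])
    fix m
    have "B t (\<pi> t m) ?R = - B t (monom 1 1 * \<pi> t m) (\<sigma> t n)"
      using parts2[OF t, of "\<pi> t m" "\<sigma> t n"] by (simp add: eq_neg_iff_add_eq_0 add.commute)
    then show "B t (\<pi> t m) ?R / h t m = P_mat d2 (\<alpha> t) n m * r t n / r t m"
      using r_nz[OF t, of m] unfolding Q_B[OF t] h_r[OF t] P_mat_Q_mat by simp
  qed
  finally have "poly ?R y = (\<Sum>m<n+d2+1. P_mat d2 (\<alpha> t) n m * r t n / r t m * poly (\<sigma> t m) y)"
    by (simp add: poly_sum del: sum.lessThan_Suc)
  then have e: "poly (pderiv (\<sigma> t n)) y - poly (dpot d2 (snd t)) y * poly (\<sigma> t n) y = (\<Sum>m<n+d2+1. P_mat d2 (\<alpha> t) n m * r t n / r t m * poly (\<sigma> t m) y)"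
    by simp
  let ?E = "exp (- potential d2 (snd t) y)"
  have "((\<lambda>y. poly (\<sigma> t n) y * exp (- potential d2 (snd t) y) / r t n) has_field_derivative
      (poly (pderiv (\<sigma> t n)) y * ?E + (?E * - poly (dpot d2 (snd t)) y) * poly (\<sigma> t n) y) / r t n) (at y)"
    by (intro DERIV_cdivide DERIV_mult poly_DERIV DERIV_fun_exp DERIV_minus poly_dpot)
  moreover have "(poly (pderiv (\<sigma> t n)) y * ?E + (?E * - poly (dpot d2 (snd t)) y) * poly (\<sigma> t n) y) / r t n =
      (poly (pderiv (\<sigma> t n)) y - poly (dpot d2 (snd t)) y * poly (\<sigma> t n) y) * (?E / r t n)"
    by (simp add: left_diff_distrib diff_divide_distrib)
  moreover have "\<dots> = (\<Sum>m<n+d2+1. P_mat d2 (\<alpha> t) n m * wave_fun d2 (prod.swap t) (\<sigma> t) (r t) m y)"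
    unfolding e sum_distrib_right by (intro sum.cong refl) (use r_nz[OF t] in \<open>simp add: wave_fun_def\<close>)
  ultimately show ?thesis by (simp only: wave_fun_def[abs_def] fst_swap)
qed

text \<open>All clauses are symmetric apart from the recursion relations, which
  \<open>y_wave\<close> and \<open>dy_wave\<close> provide for the exchanged variables.\<close>

lemma swapped:
  "bimoment d2 d1 (prod.swap ` T) (\<lambda>t P R. B (prod.swap t) R P) (\<lambda>t. \<sigma> (prod.swap t)) (\<lambda>t. \<pi> (prod.swap t))
     (\<lambda>t. h (prod.swap t)) (\<lambda>t. r (prod.swap t)) (\<lambda>t. \<beta> (prod.swap t)) (\<lambda>t. \<alpha> (prod.swap t))"
proof (unfold_locales, unfold swap_T)
  show "1 \<le> d2" "1 \<le> d1" by (rule d2 d1)+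
  show "openin (top_of_set (param_space d2 d1)) (prod.swap ` T)"
  proof -
    obtain W where W: "open W" "T = param_space d1 d2 \<inter> W" using opT by (auto simp: openin_open)
    have "open (prod.swap -` W)" by (rule open_vimage[OF W(1) continuous_swap])
    moreover have "prod.swap ` T = param_space d2 d1 \<inter> prod.swap -` W"
      unfolding set_eq_iff swap_T unfolding W(2) by (auto simp: param_space_def)
    ultimately show ?thesis by (auto simp: openin_open)
  qed
  have "homeomorphism T (prod.swap ` T) prod.swap prod.swap"
    by (auto simp: homeomorphism_def continuous_swap image_comp)
  then show "simply_connected (prod.swap ` T)"
    using homeomorphic_simply_connected[OF _ scT] by (auto simp: homeomorphic_def)
  show "prod.swap ` T \<noteq> {}" using neT by simp
  fix t :: params
  {
    fix P R :: "complex poly" and s assume t: "prod.swap t \<in> T"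
    show "fst t (d2 + 1) \<noteq> 0 \<and> snd t (d1 + 1) \<noteq> 0" using lead[OF t] by simp
    show "B (prod.swap t) R (P + P') = B (prod.swap t) R P + B (prod.swap t) R P'" for P' by (rule B_add2[OF t])
    show "B (prod.swap t) (R + R') P = B (prod.swap t) R P + B (prod.swap t) R' P" for R' by (rule B_add1[OF t])
    show "B (prod.swap t) R (Polynomial.smult c P) = c * B (prod.swap t) R P" for c by (rule B_smult2[OF t])
    show "B (prod.swap t) (Polynomial.smult c R) P = c * B (prod.swap t) R P" for c by (rule B_smult1[OF t])
    show "B (prod.swap t) R (pderiv P - dpot d2 (fst t) * P) + B (prod.swap t) (monom 1 1 * R) P = 0"
      using parts2[OF t, of R P] by (simp add: add.commute)
    show "B (prod.swap t) R (monom 1 1 * P) + B (prod.swap t) (pderiv R - dpot d1 (snd t) * R) P = 0"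
      using parts1[OF t, of R P] by (simp add: add.commute)
    show "((\<lambda>s. B (prod.swap ((fst t)(K := s), snd t)) R P) has_field_derivative - (1 / of_nat K) * B (prod.swap t) R (monom 1 K * P)) (at (fst t K))"
      if "K \<in> {1..d2+1}" for K using B_deriv_v[OF t that, of R P] by (simp add: prod.swap_def)
    show "((\<lambda>s. B (prod.swap (fst t, (snd t)(J := s))) R P) has_field_derivative - (1 / of_nat J) * B (prod.swap t) (monom 1 J * R) P) (at (snd t J))"
      if "J \<in> {1..d1+1}" for J using B_deriv_u[OF t that, of R P] by (simp add: prod.swap_def)
    show "degree (\<sigma> (prod.swap t) n) = n \<and> lead_coeff (\<sigma> (prod.swap t) n) = 1 \<and>
        degree (\<pi> (prod.swap t) n) = n \<and> lead_coeff (\<pi> (prod.swap t) n) = 1" for n using monic[OF t, of n] by blast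
    show "B (prod.swap t) (\<pi> (prod.swap t) m) (\<sigma> (prod.swap t) n) = (if n = m then h (prod.swap t) n else 0)" for n m
      using orth[OF t, of m n] by simp
    show "h (prod.swap t) n \<noteq> 0" "(r (prod.swap t) n)\<^sup>2 = h (prod.swap t) n" for n by (rule h_nz[OF t] r_sq[OF t])+
    show "recursion_coeffs d2 d1 (wave_fun d2 t (\<sigma> (prod.swap t)) (r (prod.swap t))) (r (prod.swap t)) (\<beta> (prod.swap t)) (\<alpha> (prod.swap t))"
      unfolding recursion_coeffs_def
    proof (intro conjI allI impI)
      let ?w = "wave_fun d2 t (\<sigma> (prod.swap t)) (r (prod.swap t))"
      show "\<beta> (prod.swap t) (-1) n = r (prod.swap t) (n+1) / r (prod.swap t) n" "\<alpha> (prod.swap t) (-1) n = r (prod.swap t) (n+1) / r (prod.swap t) n" for n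
        by (rule gamma[OF t])+
      show "\<beta> (prod.swap t) j n = 0" "\<alpha> (prod.swap t) j n = 0" if "int n < j" for j n
        using rec_co[OF t] that by (simp_all add: recursion_coeffs_def)
      show "x * ?w n x = (\<Sum>j | j \<in> {-1..int d1} \<and> 0 \<le> int n - j. \<beta> (prod.swap t) j n * ?w (nat (int n - j)) x)" for n x
        using y_wave[OF t, of x n] unfolding Q_mat_sum[where f = "\<lambda>m. ?w m x"] by (simp only: swap_swap)
      show "(?w n has_field_derivative - (\<Sum>j | j \<in> {-1..int d2} \<and> 0 \<le> int n + j. \<alpha> (prod.swap t) j (nat (int n + j)) * ?w (nat (int n + j)) x)) (at x)" for n x
        using dy_wave[OF t, of n x] unfolding P_mat_sum[where f = "\<lambda>m. ?w m x"] by (simp only: swap_swap)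
    qed
  }
  show "continuous_on (prod.swap ` T) (\<lambda>t. B (prod.swap t) R P)" for P R
    by (rule continuous_on_compose2[OF B_cont continuous_swap]) auto
  show "continuous_on (prod.swap ` T) (\<lambda>t. r (prod.swap t) n)" for n
    by (rule continuous_on_compose2[OF r_cont continuous_swap]) auto
qed

text \<open>The first pair for the exchanged data, pulled back along \<open>prod.swap\<close>; the
  exchange turns derivatives in \<open>u\<close> into derivatives in \<open>v\<close> and
  conversely, and \<open>V_mat_eq_U_mat\<close> matches the deformation matrices.\<close>

theorem dual_fundamental_pair:
  "\<exists>F G. Phi_system d1 d2 T \<alpha> \<beta> F \<and> dual_Psi_system d1 d2 T \<alpha> \<beta> G \<and>
     (\<forall>t\<in>T. \<forall>y. \<forall>N\<ge>d1+1. G (N-1) y t * christoffel_darboux d1 (\<beta> t) N * F N y t = 1\<^sub>m (d1+1))"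
proof -
  obtain F G where FG: "Psi_system d2 d1 (prod.swap ` T) (\<lambda>t. \<beta> (prod.swap t)) (\<lambda>t. \<alpha> (prod.swap t)) F \<and>
      dual_Phi_system d2 d1 (prod.swap ` T) (\<lambda>t. \<beta> (prod.swap t)) (\<lambda>t. \<alpha> (prod.swap t)) G \<and>
      (\<forall>t\<in>prod.swap ` T. \<forall>y. \<forall>N\<ge>d1+1. G (N-1) y t * christoffel_darboux d1 (\<beta> (prod.swap t)) N * F N y t = 1\<^sub>m (d1+1))"
    using bimoment.fundamental_pair[OF swapped] by (elim exE) (rule that)
  then have F: "Psi_system d2 d1 (prod.swap ` T) (\<lambda>t. \<beta> (prod.swap t)) (\<lambda>t. \<alpha> (prod.swap t)) F"
    and G: "dual_Phi_system d2 d1 (prod.swap ` T) (\<lambda>t. \<beta> (prod.swap t)) (\<lambda>t. \<alpha> (prod.swap t)) G" by blast+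
  have cd: "\<forall>t\<in>T. \<forall>y. \<forall>N\<ge>d1+1. G (N-1) y (prod.swap t) * christoffel_darboux d1 (\<beta> t) N * F N y (prod.swap t) = 1\<^sub>m (d1+1)"
    using FG by simp
  have u: "has_u_deriv n (\<lambda>t. H N y (prod.swap t)) K E t = has_v_deriv n (H N y) K E (prod.swap t)"
    "has_v_deriv n (\<lambda>t. H N y (prod.swap t)) K E t = has_u_deriv n (H N y) K E (prod.swap t)"
    for n K E t N y and H :: "nat \<Rightarrow> complex \<Rightarrow> params \<Rightarrow> complex mat"
    by (simp_all add: has_u_deriv_def has_v_deriv_def)
  have "Phi_system d1 d2 T \<alpha> \<beta> (\<lambda>N y t. F N y (prod.swap t))"
    using F by (simp add: Phi_system_def Psi_system_def u[where H = F] V_mat_eq_U_mat)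
  moreover have "dual_Psi_system d1 d2 T \<alpha> \<beta> (\<lambda>N y t. G N y (prod.swap t))"
    unfolding dual_Psi_system_def u[where H = G]
  proof (intro ballI allI impI)
    fix t y and N :: nat assume "t \<in> T" "N \<ge> 1"
    then have "prod.swap t \<in> prod.swap ` T" "1 \<le> N" by auto
    note g = G[unfolded dual_Phi_system_def, THEN bspec, OF this(1), THEN spec, THEN spec, THEN mp, OF this(2), of y]
    show "G (N-1) y (prod.swap t) \<in> carrier_mat (d1+1) (d1+1) \<and> invertible_mat (G (N-1) y (prod.swap t)) \<and>
      G (N-1) y (prod.swap t) = G N y (prod.swap t) * dual_ladder d1 (\<beta> t) y N \<and>
      (N \<ge> d1+1 \<and> N \<ge> d2+1 \<longrightarrow> has_mat_deriv (d1+1) (\<lambda>z. G (N-1) z (prod.swap t))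
        (G (N-1) y (prod.swap t) * dual_diff_mat d1 d2 (\<beta> t) (\<alpha> t) y N) y) \<and>
      (\<forall>K\<in>{1..d1+1}. has_v_deriv (d1+1) (G (N-1) y) K
        (G (N-1) y (prod.swap t) * dual_fold_up d1 (\<beta> t) y (U_mat d2 (\<alpha> t) K) K N) (prod.swap t)) \<and>
      (\<forall>J\<in>{1..d2+1}. N \<ge> J+1 \<longrightarrow> has_u_deriv (d1+1) (G (N-1) y) J
        (- (G (N-1) y (prod.swap t) * dual_fold_down d1 (\<beta> t) y (V_mat d1 (\<beta> t) J) J N)) (prod.swap t))"
      using g unfolding V_mat_eq_U_mat swap_swap by (elim conjE) (intro conjI; assumption)
  qed
  ultimately show ?thesis using cd by blast
qed

end

theorem corollary4p1:
  fixes d1 d2 :: nat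
    and Gx Gy :: contour
    and T :: "params set"
    and \<pi> \<sigma> :: "params \<Rightarrow> nat \<Rightarrow> complex poly"
    and h r :: "params \<Rightarrow> nat \<Rightarrow> complex"
    and \<alpha> \<beta> :: "params \<Rightarrow> rec_coeffs"
  assumes "d1 \<ge> 1" and "d2 \<ge> 1"
    and "is_contour Gx" and "is_contour Gy"
    and "openin (top_of_set (param_space d1 d2)) T" and "simply_connected T"
    and "\<And>u v. (u, v) \<in> T \<Longrightarrow> u (d1+1) \<noteq> 0 \<and> v (d2+1) \<noteq> 0"
    and "\<And>t. t \<in> T \<Longrightarrow> integrals_converge d1 d2 Gx Gy t"
    and "\<And>t. t \<in> T \<Longrightarrow> no_boundary_terms d1 d2 Gx Gy t"
    and "\<And>t. t \<in> T \<Longrightarrow> biorthogonal d1 d2 Gx Gy t (\<pi> t) (\<sigma> t) (h t)"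
    and "\<And>t n. t \<in> T \<Longrightarrow> (r t n)\<^sup>2 = h t n"
    and "\<And>n. continuous_on T (\<lambda>t. r t n)"
    and "\<And>t. t \<in> T \<Longrightarrow> recursion_coeffs d1 d2 (wave_fun d1 t (\<pi> t) (r t)) (r t) (\<alpha> t) (\<beta> t)"
  shows "\<exists>\<Psi> \<Phi>u \<Phi> \<Psi>u :: nat \<Rightarrow> complex \<Rightarrow> params \<Rightarrow> complex mat.
     Psi_system d1 d2 T \<alpha> \<beta> \<Psi> \<and> dual_Phi_system d1 d2 T \<alpha> \<beta> \<Phi>u \<and>
     Phi_system d1 d2 T \<alpha> \<beta> \<Phi> \<and> dual_Psi_system d1 d2 T \<alpha> \<beta> \<Psi>u \<and>
     (\<forall>t\<in>T. \<forall>x. \<forall>N\<ge>d2+1.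
        \<Phi>u (N-1) x t * christoffel_darboux d2 (\<alpha> t) N * \<Psi> N x t = 1\<^sub>m (d2+1)) \<and>
     (\<forall>t\<in>T. \<forall>y. \<forall>N\<ge>d1+1.
        \<Psi>u (N-1) y t * christoffel_darboux d1 (\<beta> t) N * \<Phi> N y t = 1\<^sub>m (d1+1))"
proof (cases "T = {}")
  \<comment> \<open>The frames need a base point in \<open>T\<close>; for empty \<open>T\<close> all
    conditions are vacuous.\<close>
  case True
  then show ?thesis by (simp add: Psi_system_def Phi_system_def dual_Psi_system_def dual_Phi_system_def)
next
  case False
  interpret ms: moment_space d1 d2 Gx Gy T by unfold_locales (use assms in auto)
  interpret bimoment d1 d2 T "moment d1 d2 Gx Gy" \<pi> \<sigma> h r \<alpha> \<beta>
  proof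
    show "1 \<le> d1" "1 \<le> d2" "openin (top_of_set (param_space d1 d2)) T" "simply_connected T" "T \<noteq> {}"
      by (rule assms False)+
    fix t
    show "fst t (d1+1) \<noteq> 0 \<and> snd t (d2+1) \<noteq> 0" if "t \<in> T" using assms(7)[of "fst t" "snd t"] that by simp
    assume t: "t \<in> T"
    show "degree (\<pi> t n) = n \<and> lead_coeff (\<pi> t n) = 1 \<and> degree (\<sigma> t n) = n \<and> lead_coeff (\<sigma> t n) = 1"
      "moment d1 d2 Gx Gy t (\<pi> t n) (\<sigma> t m) = (if n = m then h t n else 0)" "h t n \<noteq> 0" for n m
      using assms(10)[OF t] unfolding biorthogonal_def moment_def by blast+
  qed (rule assms ms.Mo_add ms.Mo_smult ms.Mo_parts1 ms.Mo_parts2 ms.Mo_cont ms.Mo_deriv_u ms.Mo_deriv_v; assumption)+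
  show ?thesis using fundamental_pair dual_fundamental_pair by blast
qed

end
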